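(* Let $\frac12<H<1$ and let $B^H$ be a fractional Brownian motion with Hurst index $H$. For every $t\ge 0$ and $a\in\mathbb R$, $$ \mathcal C^H_t(a)=\lim_{\varepsilon\downarrow 0}\int_0^t 1_{\{|B^H_s-a|\ge\varepsilon\}}\frac{2Hs^{2H-1}}{B^H_s-a}\,ds\qquad\text{in }L^2(\Omega), $$ where $$ \mathcal C^H_t(a)=2\Big(F(B^H_t-a)-F(-a)-\int_0^t\log|B^H_s-a|\,\delta B^H_s\Big),\qquad F(x)=x\log|x|-x\ \ (F(0)=0). $$
   Context: $B^H=\{B^H_t\}$ is a centered Gaussian process with $E[B^H_tB^H_s]=\frac12(t^{2H}+s^{2H}-|t-s|^{2H})$; $T>0$ is an arbitrary time horizon and all times lie in $[0,T]$. $\mathcal H$ is the completion of the linear span of the indicators $1_{[0,t]}$, $t\in[0,T]$, for the inner product $\langle 1_{[0,s]},1_{[0,t]}\rangle_{\mathcal H}=E[B^H_sB^H_t]$, and $\varphi\mapsto B^H(\varphi)$ is the isometric extension of $1_{[0,t]}\mapsto B^H_t$. For smooth functionals $G=f(B^H(\varphi_1),\dots,B^H(\varphi_n))$ with $f\in C_b^\infty(\mathbb R^n)$, $\varphi_i\in\mathcal H$, the Malliavin derivative is $D^HG=\sum_j\partial_jf(B^H(\varphi_1),\dots,B^H(\varphi_n))\varphi_j$. The divergence $\delta^H$ is its adjoint: $u\in L^2(\Omega;\mathcal H)$ is in $\mathrm{Dom}(\delta^H)$ if $E|\langle D^HG,u\rangle_{\mathcal H}|\le c\|G\|_{L^2(\Omega)}$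 for all smooth $G$, and then $E[G\delta^H(u)]=E\langle D^HG,u\rangle_{\mathcal H}$. The Skorohod integral is $\int_0^tu_s\,\delta B^H_s=\delta^H(u1_{[0,t]})$. For $\frac12<H<1$ the integral $\int_0^t\log|B^H_s-a|\,\delta B^H_s$ exists in $L^2(\Omega)$ for all $t\geq 0$ and $a\in\mathbb R$, so $\mathcal C^H_t(a)$ is well defined.
   Formalization: The domain condition E|⟨DG,u⟩| ≤ c‖G‖, which as printed admits only u = 0 (take G = sin(N B(φ))), is read as the standard |E⟨DG,u⟩| ≤ c‖G‖, with L²(Ω) over the sigma-algebra generated by B; B has continuous paths. *)

theory Defs
  imports "HOL-Probability.Probability"
begin

section \<open>Fractional Brownian motion\<close>

definition fbm_cov :: "real \<Rightarrow> real \<Rightarrow> real \<Rightarrow> real" where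
  "fbm_cov H s t = (s powr (2*H) + t powr (2*H) - \<bar>t - s\<bar> powr (2*H)) / 2"

text \<open>The library's normal densities have positive variance; the degenerate law is added here.\<close>

definition centered_gaussian :: "'a measure \<Rightarrow> ('a \<Rightarrow> real) \<Rightarrow> bool" where
  "centered_gaussian M X \<longleftrightarrow>
     X \<in> borel_measurable M \<and>
     ((AE \<omega> in M. X \<omega> = 0) \<or>
      (\<exists>\<sigma>>0. distributed M lborel X (\<lambda>x. ennreal (normal_density 0 \<sigma> x))))"

definition centered_gaussian_process ::
    "'a measure \<Rightarrow> real set \<Rightarrow> (real \<Rightarrow> 'a \<Rightarrow> real) \<Rightarrow> bool" where
  "centered_gaussian_process M I B \<longleftrightarrow>
     (\<forall>J c. finite J \<and> J \<subseteq> I \<longrightarrow> centered_gaussian M (\<lambda>\<omega>. \<Sum>s\<in>J. c s * B s \<omega>))"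

text \<open>As usual, the process is the version with continuous paths; some such regularity is needed
  for the pathwise time integrals to make sense.\<close>

definition fractional_brownian_motion ::
    "'a measure \<Rightarrow> real \<Rightarrow> real \<Rightarrow> (real \<Rightarrow> 'a \<Rightarrow> real) \<Rightarrow> bool" where
  "fractional_brownian_motion M H T B \<longleftrightarrow>
     prob_space M \<and>
     centered_gaussian_process M {0..T} B \<and>
     (\<forall>s\<in>{0..T}. \<forall>t\<in>{0..T}. (\<integral>\<omega>. B s \<omega> * B t \<omega> \<partial>M) = fbm_cov H s t) \<and>
     (\<forall>\<omega>\<in>space M. continuous_on {0..T} (\<lambda>s. B s \<omega>))"

definition generated_sigma :: "'a measure \<Rightarrow> real \<Rightarrow> (real \<Rightarrow> 'a \<Rightarrow> real) \<Rightarrow> 'a measure" where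
  "generated_sigma M T B =
     sigma (space M) {B s -` A \<inter> space M | s A. s \<in> {0..T} \<and> A \<in> sets borel}"

definition square_integrable :: "'a measure \<Rightarrow> ('a \<Rightarrow> real) \<Rightarrow> bool" where
  "square_integrable M X \<longleftrightarrow> X \<in> borel_measurable M \<and> integrable M (\<lambda>\<omega>. (X \<omega>)\<^sup>2)"

definition L2_tendsto ::
    "'a measure \<Rightarrow> ('i \<Rightarrow> 'a \<Rightarrow> real) \<Rightarrow> ('a \<Rightarrow> real) \<Rightarrow> 'i filter \<Rightarrow> bool" where
  "L2_tendsto M X Y F \<longleftrightarrow>
     (\<forall>\<^sub>F i in F. square_integrable M (X i)) \<and> square_integrable M Y \<and>
     ((\<lambda>i. \<integral>\<omega>. (X i \<omega> - Y \<omega>)\<^sup>2 \<partial>M) \<longlongrightarrow> 0) F"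


section \<open>The Hilbert space of the process and its Wiener integral\<close>

text \<open>A realisation of the completion of the linear span of the indicators: a Hilbert space with
  a vector \<open>e t\<close> for each \<open>1\<^bsub>[0,t]\<^esub>\<close>, having the prescribed inner products and dense linear span.
  The indicators are linearly independent, so \<open>e\<close> extends linearly to all step functions, and the
  realisation is unique up to isometric isomorphism. The space is separable because
  \<^const>\<open>fbm_cov\<close> is continuous, so the sort \<open>second_countable_topology\<close> is no restriction.\<close>

definition fbm_hilbert_space ::
    "real \<Rightarrow> real \<Rightarrow> (real \<Rightarrow> 'h::{real_inner,banach,second_countable_topology}) \<Rightarrow> bool" where
  "fbm_hilbert_space H T e \<longleftrightarrow>
     (\<forall>s\<in>{0..T}. \<forall>t\<in>{0..T}. e s \<bullet> e t = fbm_cov H s t) \<and>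
     closure (span (e ` {0..T})) = UNIV"

text \<open>\<open>W h\<close> is a version of the random variable attached to \<open>h\<close>; linearity therefore holds only
  almost surely for each fixed choice of vectors.\<close>

definition wiener_map ::
    "'a measure \<Rightarrow> real \<Rightarrow> (real \<Rightarrow> 'a \<Rightarrow> real) \<Rightarrow>
     (real \<Rightarrow> 'h::{real_inner,banach,second_countable_topology}) \<Rightarrow> ('h \<Rightarrow> 'a \<Rightarrow> real) \<Rightarrow> bool" where
  "wiener_map M T B e W \<longleftrightarrow>
     (\<forall>h. square_integrable M (W h)) \<and>
     (\<forall>b c h k. AE \<omega> in M. W (b *\<^sub>R h + c *\<^sub>R k) \<omega> = b * W h \<omega> + c * W k \<omega>) \<and>
     (\<forall>h. (\<integral>\<omega>. (W h \<omega>)\<^sup>2 \<partial>M) = (norm h)\<^sup>2) \<and>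
     (\<forall>t\<in>{0..T}. AE \<omega> in M. W (e t) \<omega> = B t \<omega>)"

text \<open>Which functions on \<open>[0,T]\<close> are elements of the Hilbert space. For \<open>1/2 < H < 1\<close> one has
  \[ \langle \varphi, \psi \rangle = H(2H-1) \int_0^T \int_0^T \varphi(s) \psi(v) |s-v|^{2H-2} dv ds \]
  for step functions, and every \<open>\<phi>\<close> for which this double integral of \<open>\<bar>\<phi>\<bar>\<close> against itself is
  finite is identified with the element \<open>h\<close> for which the formula persists. As the indicators are
  total, it suffices to test against \<open>\<psi> = 1\<^bsub>[0,r]\<^esub>\<close>, and \<open>h\<close> is unique.\<close>

definition represents ::
    "real \<Rightarrow> real \<Rightarrow> (real \<Rightarrow> 'h::{real_inner,banach,second_countable_topology}) \<Rightarrow>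
     (real \<Rightarrow> real) \<Rightarrow> 'h \<Rightarrow> bool" where
  "represents H T e \<phi> h \<longleftrightarrow>
     set_borel_measurable lborel {0..T} \<phi> \<and>
     (\<integral>\<^sup>+s\<in>{0..T}. (\<integral>\<^sup>+v\<in>{0..T}.
        ennreal (\<bar>\<phi> s\<bar> * \<bar>\<phi> v\<bar> * \<bar>s - v\<bar> powr (2*H - 2)) \<partial>lborel) \<partial>lborel) < \<infinity> \<and>
     (\<forall>r\<in>{0..T}. h \<bullet> e r =
        H * (2*H - 1) *
        (LINT s:{0..T}|lborel. (LINT v:{0..r}|lborel. \<phi> s * \<bar>s - v\<bar> powr (2*H - 2))))"


section \<open>Malliavin derivative and divergence\<close>

text \<open>Functions on \<open>\<real>\<^sup>n\<close> are encoded as functions of a sequence that depend only on its first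
  \<open>n\<close> entries; for these, continuity in the product topology is continuity on \<open>\<real>\<^sup>n\<close>.\<close>

definition partial_deriv :: "nat \<Rightarrow> ((nat \<Rightarrow> real) \<Rightarrow> real) \<Rightarrow> (nat \<Rightarrow> real) \<Rightarrow> real" where
  "partial_deriv i f x = deriv (\<lambda>y. f (x(i := y))) (x i)"

definition Cb_infinity :: "nat \<Rightarrow> ((nat \<Rightarrow> real) \<Rightarrow> real) \<Rightarrow> bool" where
  "Cb_infinity n f \<longleftrightarrow>
     (\<forall>x y. (\<forall>i<n. x i = y i) \<longrightarrow> f x = f y) \<and>
     (\<forall>is. set is \<subseteq> {..<n} \<longrightarrow>
        (let g = foldr partial_deriv is f in
           continuous_on UNIV g \<and> bounded (range g) \<and>
           (\<forall>x. \<forall>i<n. (\<lambda>y. g (x(i := y))) differentiable (at (x i)))))"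

definition smooth_functional ::
    "('h \<Rightarrow> 'a \<Rightarrow> real) \<Rightarrow> ((nat \<Rightarrow> real) \<Rightarrow> real) \<Rightarrow> (nat \<Rightarrow> 'h) \<Rightarrow> 'a \<Rightarrow> real" where
  "smooth_functional W f \<phi> \<omega> = f (\<lambda>i. W (\<phi> i) \<omega>)"

definition malliavin_derivative ::
    "('h::real_vector \<Rightarrow> 'a \<Rightarrow> real) \<Rightarrow> nat \<Rightarrow> ((nat \<Rightarrow> real) \<Rightarrow> real) \<Rightarrow> (nat \<Rightarrow> 'h) \<Rightarrow> 'a \<Rightarrow> 'h" where
  "malliavin_derivative W n f \<phi> \<omega> =
     (\<Sum>j<n. partial_deriv j f (\<lambda>i. W (\<phi> i) \<omega>) *\<^sub>R \<phi> j)"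

text \<open>\<open>L\<^sup>2(\<Omega>)\<close> and \<open>L\<^sup>2(\<Omega>;\<H>)\<close> are taken over the sigma-algebra generated by the process (each class
  has a representative measurable for the uncompleted one): the smooth functionals are dense
  only there, so that otherwise the divergence would not be determined by duality. In the domain
  condition the absolute value is outside the expectation, as for any adjoint operator; with
  \<open>E\<bar>\<langle>DG,u\<rangle>\<bar>\<close> instead, no nonzero deterministic \<open>u\<close> would be in the domain
  (take \<open>G = sin (N * W u)\<close> with \<open>N\<close> large).\<close>

definition div_domain ::
    "'a measure \<Rightarrow> real \<Rightarrow> (real \<Rightarrow> 'a \<Rightarrow> real) \<Rightarrow>
     ('h::{real_inner,banach,second_countable_topology} \<Rightarrow> 'a \<Rightarrow> real) \<Rightarrow> ('a \<Rightarrow> 'h) \<Rightarrow> bool" where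
  "div_domain M T B W U \<longleftrightarrow>
     U \<in> borel_measurable (generated_sigma M T B) \<and>
     integrable M (\<lambda>\<omega>. (norm (U \<omega>))\<^sup>2) \<and>
     (\<exists>c. \<forall>n f \<phi>. Cb_infinity n f \<longrightarrow>
        \<bar>\<integral>\<omega>. malliavin_derivative W n f \<phi> \<omega> \<bullet> U \<omega> \<partial>M\<bar>
          \<le> c * sqrt (\<integral>\<omega>. (smooth_functional W f \<phi> \<omega>)\<^sup>2 \<partial>M))"

definition has_divergence ::
    "'a measure \<Rightarrow> real \<Rightarrow> (real \<Rightarrow> 'a \<Rightarrow> real) \<Rightarrow>
     ('h::{real_inner,banach,second_countable_topology} \<Rightarrow> 'a \<Rightarrow> real) \<Rightarrow>
     ('a \<Rightarrow> 'h) \<Rightarrow> ('a \<Rightarrow> real) \<Rightarrow> bool" where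
  "has_divergence M T B W U Z \<longleftrightarrow>
     div_domain M T B W U \<and>
     Z \<in> borel_measurable (generated_sigma M T B) \<and> square_integrable M Z \<and>
     (\<forall>n f \<phi>. Cb_infinity n f \<longrightarrow>
        (\<integral>\<omega>. smooth_functional W f \<phi> \<omega> * Z \<omega> \<partial>M) =
        (\<integral>\<omega>. malliavin_derivative W n f \<phi> \<omega> \<bullet> U \<omega> \<partial>M))"

definition has_skorohod_integral ::
    "'a measure \<Rightarrow> real \<Rightarrow> real \<Rightarrow> (real \<Rightarrow> 'a \<Rightarrow> real) \<Rightarrow>
     (real \<Rightarrow> 'h::{real_inner,banach,second_countable_topology}) \<Rightarrow> ('h \<Rightarrow> 'a \<Rightarrow> real) \<Rightarrow>
     (real \<Rightarrow> 'a \<Rightarrow> real) \<Rightarrow> real \<Rightarrow> ('a \<Rightarrow> real) \<Rightarrow> bool" where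
  "has_skorohod_integral M H T B e W u t Z \<longleftrightarrow>
     (\<exists>U. (AE \<omega> in M. represents H T e (\<lambda>s. u s \<omega> * indicator {0..t} s) (U \<omega>)) \<and>
          has_divergence M T B W U Z)"

definition skorohod_integrable ::
    "'a measure \<Rightarrow> real \<Rightarrow> real \<Rightarrow> (real \<Rightarrow> 'a \<Rightarrow> real) \<Rightarrow>
     (real \<Rightarrow> 'h::{real_inner,banach,second_countable_topology}) \<Rightarrow> ('h \<Rightarrow> 'a \<Rightarrow> real) \<Rightarrow>
     (real \<Rightarrow> 'a \<Rightarrow> real) \<Rightarrow> real \<Rightarrow> bool" where
  "skorohod_integrable M H T B e W u t \<longleftrightarrow> (\<exists>Z. has_skorohod_integral M H T B e W u t Z)"

text \<open>The integral is determined up to almost sure equality; a version is chosen.\<close>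

definition skorohod_integral ::
    "'a measure \<Rightarrow> real \<Rightarrow> real \<Rightarrow> (real \<Rightarrow> 'a \<Rightarrow> real) \<Rightarrow>
     (real \<Rightarrow> 'h::{real_inner,banach,second_countable_topology}) \<Rightarrow> ('h \<Rightarrow> 'a \<Rightarrow> real) \<Rightarrow>
     (real \<Rightarrow> 'a \<Rightarrow> real) \<Rightarrow> real \<Rightarrow> 'a \<Rightarrow> real" where
  "skorohod_integral M H T B e W u t = (SOME Z. has_skorohod_integral M H T B e W u t Z)"


section \<open>The process defined through the Skorohod integral of the logarithm\<close>

text \<open>\<open>log_primitive 0 = 0\<close> because of the factor \<open>x\<close>.\<close>

definition log_primitive :: "real \<Rightarrow> real" where
  "log_primitive x = x * ln \<bar>x\<bar> - x"

definition C_process ::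
    "'a measure \<Rightarrow> real \<Rightarrow> real \<Rightarrow> (real \<Rightarrow> 'a \<Rightarrow> real) \<Rightarrow>
     (real \<Rightarrow> 'h::{real_inner,banach,second_countable_topology}) \<Rightarrow> ('h \<Rightarrow> 'a \<Rightarrow> real) \<Rightarrow>
     real \<Rightarrow> real \<Rightarrow> 'a \<Rightarrow> real" where
  "C_process M H T B e W t a \<omega> =
     2 * (log_primitive (B t \<omega> - a) - log_primitive (- a)
          - skorohod_integral M H T B e W (\<lambda>s \<omega>. ln \<bar>B s \<omega> - a\<bar>) t \<omega>)"

end

theory Submission
  imports Defs
begin

text \<open>Let \<open>F\<^sub>\<epsilon>\<close> be the primitive of \<open>ln (max \<bar>x\<bar> \<epsilon>)\<close> that vanishes at \<open>0\<close>. Its second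
  derivative is the truncated reciprocal \<open>1 / x\<close> on \<open>\<bar>x\<bar> \<ge> \<epsilon>\<close>, so half of the truncated integral is
  the Ito correction of \<open>F\<^sub>\<epsilon> (B t - a)\<close>. Gaussian integration by parts over small time increments,
  tested against smooth functionals, shows that \<open>F\<^sub>\<epsilon> (B t - a) - F\<^sub>\<epsilon> (- a)\<close> minus this correction
  is the divergence of \<open>ln (max \<bar>B s - a\<bar> \<epsilon>)\<close>.

  Let \<open>\<epsilon>\<close> tend to \<open>0\<close>. The integrands converge in the Hilbert space, because the Schur test embeds
  \<open>L\<^sup>2[0,T]\<close> in it and the squared logarithm has a finite expected time integral. The corrections are
  Cauchy in \<open>L\<^sup>2(\<Omega>)\<close>: the difference \<open>g\<close> of two truncated reciprocals is odd with a Fourier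
  transform that at frequency \<open>\<kappa>\<close> is bounded by a constant and by \<open>2 * \<delta> * \<bar>\<kappa>\<bar>\<close>, and the
  conditional variance of \<open>B r\<close> given \<open>B s\<close> is at least of order \<open>\<bar>r - s\<bar>\<close> to the power \<open>2H\<close>;
  together these bound the expectation of \<open>g (B s - a) * g (B r - a)\<close> by a power of \<open>\<delta>\<close> times an
  integrable singularity. Passing to the limit in the duality identifies the divergence, and it is
  unique because a function measurable for the process and orthogonal to all its trigonometric
  functionals vanishes.\<close>

section \<open>Uniqueness by characteristic functions\<close>

text \<open>The positive and the negative part of \<open>D\<close> are densities for which \<open>X\<close> has the same characteristic
  function.\<close>

lemma (in prob_space) char_density_unique:
  fixes D X :: "'a \<Rightarrow> real"
  assumes D: "integrable M D" and X[measurable]: "X \<in> borel_measurable M"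
    and c: "\<And>l. (\<integral>x. D x * cos (l * X x) \<partial>M) = 0" and s: "\<And>l. (\<integral>x. D x * sin (l * X x) \<partial>M) = 0"
    and A[measurable]: "A \<in> sets borel"
  shows "(\<integral>x. D x * indicator A (X x) \<partial>M) = 0"
proof -
  have Dm[measurable]: "D \<in> borel_measurable M" using D by auto
  define P N where "P x = max (D x) 0" and "N x = max (- D x) 0" for x
  have PN: "D x = P x - N x" "P x \<ge> 0" "N x \<ge> 0" for x by (auto simp: P_def N_def max_def)
  have [measurable]: "P \<in> borel_measurable M" "N \<in> borel_measurable M"
    unfolding P_def[abs_def] N_def[abs_def] by measurable
  have iP: "integrable M P" "integrable M N"
    by (rule Bochner_Integration.integrable_bound[OF D]; auto simp: P_def N_def max_def)+
  have split: "(\<integral>x. D x * f x \<partial>M) = (\<integral>x. P x * f x \<partial>M) - (\<integral>x. N x * f x \<partial>M)"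
    and iPf: "integrable M (\<lambda>x. P x * f x)" "integrable M (\<lambda>x. N x * f x)"
    if [measurable]: "f \<in> borel_measurable M" and b: "\<And>x. \<bar>f x\<bar> \<le> 1" for f
  proof -
    have *: "integrable M (\<lambda>x. Q x * f x)" if "integrable M Q" "\<And>x. Q x \<ge> 0" for Q
      using that b by (intro Bochner_Integration.integrable_bound[OF that(1)])
         (auto simp: abs_mult intro!: mult_left_le)
    show "integrable M (\<lambda>x. P x * f x)" "integrable M (\<lambda>x. N x * f x)"
      using * iP PN by auto
    then show "(\<integral>x. D x * f x \<partial>M) = (\<integral>x. P x * f x \<partial>M) - (\<integral>x. N x * f x \<partial>M)"
      by (subst Bochner_Integration.integral_diff[symmetric]) (auto simp: PN(1) algebra_simps)
  qed
  define m where "m = (\<integral>x. P x \<partial>M)"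
  have mN: "m = (\<integral>x. N x \<partial>M)"
    using c[of 0] split[of "\<lambda>_. 1"] by (simp add: m_def)
  show ?thesis
  proof (cases "m = 0")
    case True
    have "AE x in M. P x = 0" "AE x in M. N x = 0"
      using integral_nonneg_eq_0_iff_AE[OF iP(1)] integral_nonneg_eq_0_iff_AE[OF iP(2)] PN True mN
      by (auto simp: m_def)
    then have "AE x in M. D x * indicator A (X x) = 0" by eventually_elim (simp add: PN(1))
    then show ?thesis by (simp add: integral_eq_zero_AE)
  next
    case False
    moreover have "m \<ge> 0" unfolding m_def using PN by (intro integral_nonneg_AE) auto
    ultimately have m: "m > 0" by simp
    define MM where "MM Q = distr (density M (\<lambda>x. ennreal (Q x / m))) borel X" for Q
    have MM: "real_distribution (MM Q)"
         "\<And>g::real\<Rightarrow>complex. g \<in> borel_measurable borel \<Longrightarrow> (\<integral>x. g x \<partial>MM Q) = (\<integral>x. (Q x / m) *\<^sub>R g (X x) \<partial>M)"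
         "\<And>g::real\<Rightarrow>real. g \<in> borel_measurable borel \<Longrightarrow> (\<integral>x. g x \<partial>MM Q) = (\<integral>x. (Q x / m) *\<^sub>R g (X x) \<partial>M)"
      if [measurable]: "Q \<in> borel_measurable M" and "integrable M Q" "\<And>x. Q x \<ge> 0" "(\<integral>x. Q x \<partial>M) = m" for Q
    proof -
      have "prob_space (density M (\<lambda>x. ennreal (Q x / m)))"
      proof (rule prob_spaceI)
        have "emeasure (density M (\<lambda>x. ennreal (Q x / m))) (space M) = (\<integral>\<^sup>+x. ennreal (Q x / m) \<partial>M)"
          by (subst emeasure_density) (auto intro!: nn_integral_cong)
        also have "\<dots> = ennreal (\<integral>x. Q x / m \<partial>M)"
          using that m by (intro nn_integral_eq_integral) auto
        also have "\<dots> = 1" using that m by simp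
        finally show "emeasure (density M (\<lambda>x. ennreal (Q x / m))) (space (density M (\<lambda>x. ennreal (Q x / m)))) = 1"
          by simp
      qed
      then show "real_distribution (MM Q)" unfolding MM_def
        by (rule prob_space.real_distribution_distr) simp
      fix g :: "real \<Rightarrow> complex" assume [measurable]: "g \<in> borel_measurable borel"
      show "(\<integral>x. g x \<partial>MM Q) = (\<integral>x. (Q x / m) *\<^sub>R g (X x) \<partial>M)"
        unfolding MM_def using that(3) m by (subst integral_distr, simp, simp) (subst integral_density, auto)
    next
      fix g :: "real \<Rightarrow> real" assume [measurable]: "g \<in> borel_measurable borel"
      show "(\<integral>x. g x \<partial>MM Q) = (\<integral>x. (Q x / m) *\<^sub>R g (X x) \<partial>M)"
        unfolding MM_def using that(3) m by (subst integral_distr, simp, simp) (subst integral_density, auto)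
    qed
    have ch: "char (MM Q) t = Complex ((\<integral>x. Q x * cos (t * X x) \<partial>M) / m) ((\<integral>x. Q x * sin (t * X x) \<partial>M) / m)"
      if Q: "Q \<in> borel_measurable M" "integrable M Q" "\<And>x. Q x \<ge> 0" "(\<integral>x. Q x \<partial>M) = m"
       and i: "\<And>f. f \<in> borel_measurable M \<Longrightarrow> (\<And>x. \<bar>f x\<bar> \<le> 1) \<Longrightarrow> integrable M (\<lambda>x. Q x * f x)" for Q t
    proof -
      note [measurable] = Q(1)
      have "char (MM Q) t = (\<integral>x. (Q x / m) *\<^sub>R iexp (t * X x) \<partial>M)"
        unfolding char_def using MM(2)[OF Q] by simp
      also have "\<dots> = (\<integral>x. complex_of_real (Q x * cos (t * X x) / m) +
          \<i> * complex_of_real (Q x * sin (t * X x) / m) \<partial>M)"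
        by (intro Bochner_Integration.integral_cong refl) (simp add: complex_eq_iff Re_exp Im_exp)
      also have "\<dots> = complex_of_real (\<integral>x. Q x * cos (t * X x) / m \<partial>M) +
          \<i> * complex_of_real (\<integral>x. Q x * sin (t * X x) / m \<partial>M)"
        using i by (subst Bochner_Integration.integral_add) (auto simp del: of_real_mult of_real_divide)
      finally show ?thesis by (simp add: complex_eq_iff)
    qed
    note P = \<open>P \<in> borel_measurable M\<close> iP(1) PN(2) m_def[symmetric]
    note N = \<open>N \<in> borel_measurable M\<close> iP(2) PN(3) mN[symmetric]
    have "char (MM P) = char (MM N)"
    proof
      fix t show "char (MM P) t = char (MM N) t"
        using c[of t] s[of t] split[of "\<lambda>x. cos (t * X x)"] split[of "\<lambda>x. sin (t * X x)"]
        by (subst ch[OF P iPf(1)], simp, simp) (subst ch[OF N iPf(2)], simp_all)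
    qed
    from Levy_uniqueness[OF MM(1)[OF P] MM(1)[OF N] this] have "MM P = MM N" .
    then have "(\<integral>x. (P x / m) *\<^sub>R indicator A (X x) \<partial>M) = (\<integral>x. (N x / m) *\<^sub>R (indicator A (X x)::real) \<partial>M)"
      using MM(3)[OF P, of "indicator A"] MM(3)[OF N, of "indicator A"] by simp
    then have "(\<integral>x. P x * indicator A (X x) \<partial>M) = (\<integral>x. N x * (indicator A (X x)::real) \<partial>M)"
      using m by simp
    then show ?thesis by (subst split) (auto simp: indicator_def)
  qed
qed

lemma (in prob_space) char_density_unique_cylinder:
  fixes D :: "'a \<Rightarrow> real" and X :: "'i \<Rightarrow> 'a \<Rightarrow> real"
  assumes J: "finite J" and X: "\<And>i. i \<in> J \<Longrightarrow> X i \<in> borel_measurable M"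
    and D: "integrable M D"
    and "\<And>c. (\<integral>x. D x * cos (\<Sum>i\<in>J. c i * X i x) \<partial>M) = 0"
    and "\<And>c. (\<integral>x. D x * sin (\<Sum>i\<in>J. c i * X i x) \<partial>M) = 0"
    and A: "\<And>i. i \<in> J \<Longrightarrow> A i \<in> sets borel"
  shows "(\<integral>x. D x * (\<Prod>i\<in>J. indicator (A i) (X i x)) \<partial>M) = 0"
  using J X D assms(4,5) A
proof (induction J arbitrary: D rule: finite_induct)
  case empty
  from empty.prems(3) show ?case by simp
next
  case (insert j J)
  note [measurable] = insert.prems(1)[of j, simplified] insert.prems(5)[of j, simplified]
  have [measurable]: "X i \<in> borel_measurable M" if "i \<in> J" for i using insert.prems that by auto
  have DX[measurable]: "D \<in> borel_measurable M" using insert.prems(2) by auto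
  have iD: "integrable M (\<lambda>x. D x * f x)"
    if [measurable]: "f \<in> borel_measurable M" and b: "\<And>x. \<bar>f x\<bar> \<le> 1" for f
    by (rule Bochner_Integration.integrable_bound[OF insert.prems(2)]) (auto simp: abs_mult intro!: mult_left_le b)
  let ?S = "\<lambda>c x. \<Sum>i\<in>J. c i * X i x"
  have Sm[measurable]: "?S c \<in> borel_measurable M" for c by measurable
  have upd: "(\<Sum>i\<in>insert j J. (c(j := l)) i * X i x) = l * X j x + ?S c x" for c l x
    using insert.hyps by (auto intro!: sum.cong)
  have C: "(\<integral>x. D x * cos (l * X j x + ?S c x) \<partial>M) = 0"
    and S: "(\<integral>x. D x * sin (l * X j x + ?S c x) \<partial>M) = 0" for c l
    using insert.prems(3,4)[of "c(j := l)"] unfolding upd by auto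
  have C': "(\<integral>x. D x * cos (l * X j x - ?S c x) \<partial>M) = 0"
    and S': "(\<integral>x. D x * sin (l * X j x - ?S c x) \<partial>M) = 0" for c l
    using C[of l "\<lambda>i. - c i"] S[of l "\<lambda>i. - c i"] by (simp_all add: sum_negf)
  have half: "(\<integral>x. D x * f x \<partial>M) = 0"
    if f: "\<And>x. f x = (g x + k * h x) / 2" and m: "g \<in> borel_measurable M" "h \<in> borel_measurable M"
      and "\<And>x. \<bar>g x\<bar> \<le> 1" "\<And>x. \<bar>h x\<bar> \<le> 1"
      and "(\<integral>x. D x * g x \<partial>M) = 0" "(\<integral>x. D x * h x \<partial>M) = 0" for f g h :: "'a \<Rightarrow> real" and k :: real
  proof -
    have "(\<integral>x. D x * f x \<partial>M) = (\<integral>x. (1/2) * (D x * g x) + (k/2) * (D x * h x) \<partial>M)"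
      unfolding f by (intro Bochner_Integration.integral_cong) (auto simp: field_simps)
    also have "\<dots> = (1/2) * (\<integral>x. (D x * g x) \<partial>M) + (k/2) * (\<integral>x. (D x * h x) \<partial>M)"
      using iD[of g] iD[of h] that by (subst Bochner_Integration.integral_add) auto
    finally show ?thesis unfolding that(6,7) by simp
  qed
  have m: "(\<lambda>x. cos (l * X j x + ?S c x)) \<in> borel_measurable M"
      "(\<lambda>x. cos (l * X j x - ?S c x)) \<in> borel_measurable M"
    "(\<lambda>x. sin (l * X j x + ?S c x)) \<in> borel_measurable M" "(\<lambda>x. sin (l * X j x - ?S c x)) \<in> borel_measurable M"
        for c l
    by measurable
  have t: "cos v * cos u = (cos (u + v) + 1 * cos (u - v)) / 2"
      "cos v * sin u = (sin (u + v) + 1 * sin (u - v)) / 2"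
    "sin v * cos u = (sin (u + v) + -1 * sin (u - v)) / 2" "sin v * sin u = (cos (u - v) + -1 * cos (u + v)) / 2"
        for u v :: real
    by (simp_all add: cos_add cos_diff sin_add sin_diff mult.commute)
  have 1: "(\<integral>x. (D x * cos (?S c x)) * cos (l * X j x) \<partial>M) = 0" for c l
    unfolding mult.assoc by (rule half[OF t(1) m(1,2) abs_cos_le_one abs_cos_le_one C C'])
  have 2: "(\<integral>x. (D x * cos (?S c x)) * sin (l * X j x) \<partial>M) = 0" for c l
    unfolding mult.assoc by (rule half[OF t(2) m(3,4) abs_sin_le_one abs_sin_le_one S S'])
  have 3: "(\<integral>x. (D x * sin (?S c x)) * cos (l * X j x) \<partial>M) = 0" for c l
    unfolding mult.assoc by (rule half[OF t(3) m(3,4) abs_sin_le_one abs_sin_le_one S S'])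
  have 4: "(\<integral>x. (D x * sin (?S c x)) * sin (l * X j x) \<partial>M) = 0" for c l
    unfolding mult.assoc by (rule half[OF t(4) m(2,1) abs_cos_le_one abs_cos_le_one C' C])
  have "(\<integral>x. (D x * indicator (A j) (X j x)) * (\<Prod>i\<in>J. indicator (A i) (X i x)) \<partial>M) = 0"
  proof (rule insert.IH)
    show "integrable M (\<lambda>x. D x * indicator (A j) (X j x))" by (rule iD) (auto simp: indicator_def)
    fix c
    have "(\<integral>x. (D x * cos (?S c x)) * indicator (A j) (X j x) \<partial>M) = 0"
      by (rule char_density_unique[OF _ _ 1 2]) (auto intro: iD)
    then show "(\<integral>x. D x * indicator (A j) (X j x) * cos (?S c x) \<partial>M) = 0"
      by (simp add: mult_ac)
    have "(\<integral>x. (D x * sin (?S c x)) * indicator (A j) (X j x) \<partial>M) = 0"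
      by (rule char_density_unique[OF _ _ 3 4]) (auto intro: iD)
    then show "(\<integral>x. D x * indicator (A j) (X j x) * sin (?S c x) \<partial>M) = 0"
      by (simp add: mult_ac)
  qed (use insert.prems in auto)
  then show ?case using insert.hyps by (simp add: mult_ac)
qed

lemma (in prob_space) char_density_unique_sigma:
  fixes D :: "'a \<Rightarrow> real" and X :: "'i \<Rightarrow> 'a \<Rightarrow> real"
  assumes X: "\<And>i. i \<in> I \<Longrightarrow> X i \<in> borel_measurable M"
    and D: "integrable M D"
    and c: "\<And>J c. finite J \<Longrightarrow> J \<subseteq> I \<Longrightarrow> (\<integral>x. D x * cos (\<Sum>i\<in>J. c i * X i x) \<partial>M) = 0"
    and s: "\<And>J c. finite J \<Longrightarrow> J \<subseteq> I \<Longrightarrow> (\<integral>x. D x * sin (\<Sum>i\<in>J. c i * X i x) \<partial>M) = 0"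
    and S: "S \<in> sigma_sets (space M) {X i -` A \<inter> space M | i A. i \<in> I \<and> A \<in> sets borel}"
  shows "(\<integral>x. D x * indicator S x \<partial>M) = 0"
proof -
  have Dm[measurable]: "D \<in> borel_measurable M" using D by auto
  define E where "E = {{x\<in>space M. \<forall>i\<in>J. X i x \<in> A i} | J A. finite J \<and> J \<subseteq> I \<and>
      (\<forall>i. A i \<in> sets (borel::real measure))}"
  have gen: "{X i -` A \<inter> space M | i A. i \<in> I \<and> A \<in> sets borel} \<subseteq> E"
  proof safe
    fix i and A :: "real set" assume "i \<in> I" "A \<in> sets borel"
    then show "X i -` A \<inter> space M \<in> E"
      unfolding E_def by (intro CollectI exI[of _ "{i}"] exI[of _ "\<lambda>_. A"]) auto
  qed
  have SE: "S \<in> sigma_sets (space M) E" using S sigma_sets_mono'[OF gen] by auto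
  have Esub: "E \<subseteq> sets M"
  proof
    fix Q assume "Q \<in> E"
    then obtain J A where Q: "Q = {x\<in>space M. \<forall>i\<in>J. X i x \<in> A i}" "finite J" "J \<subseteq> I" "\<And>i. A i \<in> sets borel"
      unfolding E_def by auto
    have "{x\<in>space M. X i x \<in> A i} \<in> sets M" if "i \<in> J" for i
      using measurable_sets[OF X[of i] Q(4)[of i]] Q(3) that by (auto simp: vimage_def Int_def conj_commute)
    then show "Q \<in> sets M" unfolding Q(1) using Q(2) by (intro sets.sets_Collect_finite_All) auto
  qed
  have sM: "sigma_sets (space M) E \<subseteq> sets M" using Esub by (rule sets.sigma_sets_subset)
  have int: "Int_stable E"
  proof (rule Int_stableI)
    fix P Q assume "P \<in> E" "Q \<in> E"
    then obtain J A K C where PQ: "P = {x\<in>space M. \<forall>i\<in>J. X i x \<in> A i}" "finite J" "J \<subseteq> I" "\<And>i. A i \<in> sets borel"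
       "Q = {x\<in>space M. \<forall>i\<in>K. X i x \<in> C i}" "finite K" "K \<subseteq> I" "\<And>i. C i \<in> sets borel"
      unfolding E_def by auto
    define F where "F i = (if i \<in> J then A i else UNIV) \<inter> (if i \<in> K then C i else UNIV)" for i
    have "P \<inter> Q = {x\<in>space M. \<forall>i\<in>J \<union> K. X i x \<in> F i}"
      unfolding PQ F_def by auto
    moreover have "F i \<in> sets borel" for i unfolding F_def using PQ by auto
    ultimately show "P \<inter> Q \<in> E" unfolding E_def using PQ
      by (intro CollectI exI[of _ "J \<union> K"] exI[of _ F]) simp
  qed
  have iD: "integrable M (\<lambda>x. D x * indicator Q x)" if "Q \<in> sets M" for Q
    using integrable_mult_indicator[OF that D] by (simp add: mult.commute)
  show ?thesis using int _ SE
  proof (rule sigma_sets_induct_disjoint)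
    show "E \<subseteq> Pow (space M)" using Esub sets.sets_into_space by auto
  next
    fix Q assume "Q \<in> E"
    then obtain J A where Q: "Q = {x\<in>space M. \<forall>i\<in>J. X i x \<in> A i}" "finite J" "J \<subseteq> I" "\<And>i. A i \<in> sets borel"
      unfolding E_def by auto
    have "(\<integral>x. D x * indicator Q x \<partial>M) = (\<integral>x. D x * (\<Prod>i\<in>J. indicator (A i) (X i x)) \<partial>M)"
      using Q(2) by (intro Bochner_Integration.integral_cong) (auto simp: Q(1) indicator_def prod_zero_iff)
    also have "\<dots> = 0" using Q X c s D by (intro char_density_unique_cylinder) auto
    finally show "(\<integral>x. D x * indicator Q x \<partial>M) = 0" .
  next
    show "(\<integral>x. D x * indicator {} x \<partial>M) = 0" by simp
  next
    fix Q assume Q: "Q \<in> sigma_sets (space M) E" "(\<integral>x. D x * indicator Q x \<partial>M) = 0"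
    have "(\<integral>x. D x * indicator (space M - Q) x \<partial>M) = (\<integral>x. D x - D x * indicator Q x \<partial>M)"
      by (intro Bochner_Integration.integral_cong) (auto simp: indicator_def)
    also have "\<dots> = (\<integral>x. D x \<partial>M) - 0" using iD[of Q] Q sM D by (subst Bochner_Integration.integral_diff) auto
    also have "\<dots> = 0" using c[of "{}"] by simp
    finally show "(\<integral>x. D x * indicator (space M - Q) x \<partial>M) = 0" .
  next
    fix Q :: "nat \<Rightarrow> 'a set" assume d: "disjoint_family Q" and Q: "range Q \<subseteq> sigma_sets (space M) E"
      and 0: "\<And>i. (\<integral>x. D x * indicator (Q i) x \<partial>M) = 0"
    have Qm[measurable]: "Q i \<in> sets M" for i using Q sM by auto
    have "set_integrable M (\<Union>i. Q i) D" using iD unfolding set_integrable_def by (simp add: mult.commute)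
    from lebesgue_integral_countable_add[OF _ _ this] d
    have "(LINT x:(\<Union>i. Q i)|M. D x) = (\<Sum>i. (LINT x:(Q i)|M. D x))"
      by (auto simp: disjoint_family_on_def)
    then show "(\<integral>x. D x * indicator (\<Union>i. Q i) x \<partial>M) = 0"
      using 0 by (simp add: set_lebesgue_integral_def mult.commute)
  qed
qed

section \<open>Square integrable functions\<close>

lemma square_integrable_mult:
  fixes f g :: "'a \<Rightarrow> real"
  assumes "square_integrable M f" "square_integrable M g"
  shows "integrable M (\<lambda>x. f x * g x)"
proof -
  have [measurable]: "f \<in> borel_measurable M" "g \<in> borel_measurable M"
    and i: "integrable M (\<lambda>x. (f x)\<^sup>2 + (g x)\<^sup>2)"
    using assms by (auto simp: square_integrable_def)
  have "\<bar>f x * g x\<bar> \<le> \<bar>(f x)\<^sup>2 + (g x)\<^sup>2\<bar>" for x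
  proof -
    have "0 \<le> \<bar>f x\<bar> * \<bar>g x\<bar>" by simp
    with sum_squares_bound[of "\<bar>f x\<bar>" "\<bar>g x\<bar>"] have "\<bar>f x\<bar> * \<bar>g x\<bar> \<le> (f x)\<^sup>2 + (g x)\<^sup>2"
      unfolding power2_abs by linarith
    then show ?thesis by (simp add: abs_mult)
  qed
  then show ?thesis by (intro Bochner_Integration.integrable_bound[OF i]) auto
qed

lemma square_integrable_cmult: "square_integrable M f \<Longrightarrow> square_integrable M (\<lambda>x. c * f x)"
  by (auto simp: square_integrable_def power_mult_distrib)

lemma square_integrable_add:
  fixes f g :: "'a \<Rightarrow> real"
  assumes "square_integrable M f" "square_integrable M g"
  shows "square_integrable M (\<lambda>x. f x + g x)"
  using assms square_integrable_mult[OF assms] unfolding square_integrable_def power2_sum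
  by (auto simp: mult.assoc)

lemma square_integrable_diff:
  fixes f g :: "'a \<Rightarrow> real"
  assumes "square_integrable M f" "square_integrable M g"
  shows "square_integrable M (\<lambda>x. f x - g x)"
  using square_integrable_add[OF assms(1) square_integrable_cmult[OF assms(2), of "-1"]] by simp

lemma (in finite_measure) square_integrable_const: "square_integrable M (\<lambda>x. c)"
  by (auto simp: square_integrable_def)

lemma (in finite_measure) square_integrable_bounded:
  fixes f :: "'a \<Rightarrow> real"
  assumes [measurable]: "f \<in> borel_measurable M" and b: "\<And>x. x \<in> space M \<Longrightarrow> \<bar>f x\<bar> \<le> C"
  shows "square_integrable M f"
  unfolding square_integrable_def
proof
  show "integrable M (\<lambda>x. (f x)\<^sup>2)"
    by (rule integrable_const_bound[where B="C\<^sup>2"]) (auto intro!: AE_I2 abs_le_square_iff[THEN iffD1] dest!: b)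
qed simp

lemma (in finite_measure) square_integrable_integrable:
  "square_integrable M f \<Longrightarrow> integrable M f"
  using square_integrable_mult[OF _ square_integrable_const, of f 1] by simp

lemma square_integrable_abs: "square_integrable M f \<Longrightarrow> square_integrable M (\<lambda>x. \<bar>f x\<bar>)"
  by (auto simp: square_integrable_def)

lemma square_integrable_AE_cong:
  assumes "square_integrable M f" "g \<in> borel_measurable M" "AE x in M. f x = g x"
  shows "square_integrable M g"
proof -
  have "integrable M (\<lambda>x. (f x)\<^sup>2) = integrable M (\<lambda>x. (g x)\<^sup>2)"
    using assms by (intro integrable_cong_AE) (auto simp: square_integrable_def elim!: eventually_mono)
  then show ?thesis using assms by (auto simp: square_integrable_def)
qed

lemma L2_Cauchy_Schwarz:
  fixes f g :: "'a \<Rightarrow> real"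
  assumes "square_integrable M f" "square_integrable M g"
  shows "\<bar>\<integral>x. f x * g x \<partial>M\<bar> \<le> sqrt (\<integral>x. (f x)\<^sup>2 \<partial>M) * sqrt (\<integral>x. (g x)\<^sup>2 \<partial>M)"
proof -
  have [measurable]: "f \<in> borel_measurable M" "g \<in> borel_measurable M"
    and i: "integrable M (\<lambda>x. (f x)\<^sup>2)" "integrable M (\<lambda>x. (g x)\<^sup>2)"
    using assms by (auto simp: square_integrable_def)
  note fg = square_integrable_mult[OF assms]
  define A B C where "A = (\<integral>x. (f x)\<^sup>2 \<partial>M)" and "B = (\<integral>x. (g x)\<^sup>2 \<partial>M)" and "C = (\<integral>x. f x * g x \<partial>M)"
  have AB: "A \<ge> 0" "B \<ge> 0" by (auto simp: A_def B_def)
  have q: "0 \<le> t\<^sup>2 * A - 2 * t * C + B" for t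
  proof -
    have "0 \<le> (\<integral>x. (t * f x - g x)\<^sup>2 \<partial>M)" by simp
    also have "\<dots> = (\<integral>x. t\<^sup>2 * (f x)\<^sup>2 - 2 * t * (f x * g x) + (g x)\<^sup>2 \<partial>M)"
      by (intro Bochner_Integration.integral_cong) (auto simp: power2_eq_square algebra_simps)
    also have "\<dots> = t\<^sup>2 * A - 2 * t * C + B"
      unfolding A_def B_def C_def using i fg by simp
    finally show ?thesis .
  qed
  have "C\<^sup>2 \<le> A * B"
  proof (cases "A = 0")
    case True
    then have "AE x in M. (f x)\<^sup>2 = 0"
      unfolding A_def using i by (subst (asm) integral_nonneg_eq_0_iff_AE) auto
    then have "C = 0" unfolding C_def by (intro integral_eq_zero_AE) (auto elim: eventually_mono)
    then show ?thesis using True by simp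
  next
    case False
    then have "A > 0" using AB by simp
    then show ?thesis using q[of "C / A"] by (simp add: field_simps power2_eq_square)
  qed
  then have "\<bar>C\<bar> \<le> sqrt (A * B)" by (rule real_le_rsqrt[of "\<bar>C\<bar>", simplified])
  then show ?thesis by (simp add: real_sqrt_mult A_def B_def C_def)
qed

lemma (in prob_space) L1_le_L2:
  fixes f :: "'a \<Rightarrow> real"
  assumes "square_integrable M f"
  shows "(\<integral>x. \<bar>f x\<bar> \<partial>M) \<le> sqrt (\<integral>x. (f x)\<^sup>2 \<partial>M)"
  using L2_Cauchy_Schwarz[OF square_integrable_abs[OF assms] square_integrable_const[of 1]]
  by (simp add: prob_space)

lemma (in prob_space) AE_tendsto_of_summable_L1:
  fixes D :: "nat \<Rightarrow> 'a \<Rightarrow> real"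
  assumes D: "\<And>k. integrable M (D k)" and b: "\<And>k. (\<integral>x. \<bar>D k x\<bar> \<partial>M) \<le> (1/2)^k"
  shows "AE x in M. summable (\<lambda>k. \<bar>D k x\<bar>)"
proof -
  have [measurable]: "D k \<in> borel_measurable M" for k using D by auto
  have "(\<integral>\<^sup>+x. (\<Sum>k. ennreal \<bar>D k x\<bar>) \<partial>M) = (\<Sum>k. \<integral>\<^sup>+x. ennreal \<bar>D k x\<bar> \<partial>M)"
    by (intro nn_integral_suminf) auto
  also have "\<dots> = (\<Sum>k. ennreal (\<integral>x. \<bar>D k x\<bar> \<partial>M))"
    using D by (intro arg_cong[where f=suminf] ext nn_integral_eq_integral) auto
  also have "\<dots> \<le> (\<Sum>k. ennreal ((1/2)^k))"
    using b by (intro suminf_le ennreal_leI) auto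
  also have "\<dots> = ennreal 2"
    using geometric_sums[of "1/2::real"] by (intro suminf_ennreal_eq) auto
  finally have "(\<integral>\<^sup>+x. (\<Sum>k. ennreal \<bar>D k x\<bar>) \<partial>M) \<noteq> \<infinity>" by (auto simp: top_unique)
  then have "AE x in M. (\<Sum>k. ennreal \<bar>D k x\<bar>) \<noteq> \<infinity>"
    by (intro nn_integral_noteq_infinite) auto
  then show ?thesis
    by eventually_elim (rule summable_suminf_not_top, auto)
qed

text \<open>The sub-sigma-algebra \<open>N\<close> keeps the limit measurable with respect to the process.\<close>

lemma (in prob_space) L2_complete:
  fixes X :: "nat \<Rightarrow> 'a \<Rightarrow> real"
  assumes N: "sets N \<subseteq> sets M" "space N = space M"
    and X: "\<And>n. X n \<in> borel_measurable N" "\<And>n. square_integrable M (X n)"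
    and C: "\<And>e. e > 0 \<Longrightarrow> \<exists>n0. \<forall>m\<ge>n0. \<forall>n\<ge>n0. (\<integral>x. (X m x - X n x)\<^sup>2 \<partial>M) < e"
  shows "\<exists>Y\<in>borel_measurable N. square_integrable M Y \<and> (\<lambda>n. \<integral>x. (X n x - Y x)\<^sup>2 \<partial>M) \<longlonglongrightarrow> 0"
proof -
  have sub: "f \<in> borel_measurable M" if "f \<in> borel_measurable N" for f :: "'a \<Rightarrow> real"
    using that N by (auto simp: measurable_def)
  note [measurable] = X(1)
  have XM[measurable]: "X n \<in> borel_measurable M" for n by (rule sub[OF X(1)])
  have "\<forall>k. \<exists>n0. \<forall>m\<ge>n0. \<forall>n\<ge>n0. (\<integral>x. (X m x - X n x)\<^sup>2 \<partial>M) < (1/4)^k"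
    using C by auto
  then obtain r where r: "\<And>k m n. m \<ge> r k \<Longrightarrow> n \<ge> r k \<Longrightarrow> (\<integral>x. (X m x - X n x)\<^sup>2 \<partial>M) < (1/4)^k" by metis
  define s where "s k = (\<Sum>j\<le>k. r j)" for k
  have rs: "r k \<le> s j" if "k \<le> j" for k j
    unfolding s_def using that by (intro member_le_sum) auto
  have sm: "AE x in M. summable (\<lambda>k. \<bar>X (s (Suc k)) x - X (s k) x\<bar>)"
  proof (rule AE_tendsto_of_summable_L1)
    fix k
    note si = square_integrable_diff[OF X(2)[of "s (Suc k)"] X(2)[of "s k"]]
    show "integrable M (\<lambda>x. X (s (Suc k)) x - X (s k) x)" by (rule square_integrable_integrable[OF si])
    have "(\<integral>x. \<bar>X (s (Suc k)) x - X (s k) x\<bar> \<partial>M) \<le> sqrt (\<integral>x. (X (s (Suc k)) x - X (s k) x)\<^sup>2 \<partial>M)"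
      by (rule L1_le_L2[OF si])
    also have "\<dots> \<le> sqrt ((1/4)^k)"
      using r[of k "s (Suc k)" "s k"] rs[of k "Suc k"] rs[of k k] by (intro real_sqrt_le_mono) auto
    also have "\<dots> = (1/2)^k" by (simp add: real_sqrt_power real_sqrt_divide)
    finally show "(\<integral>x. \<bar>X (s (Suc k)) x - X (s k) x\<bar> \<partial>M) \<le> (1/2)^k" .
  qed
  have conv: "AE x in M. convergent (\<lambda>k. X (s k) x)"
    using sm
  proof eventually_elim
    case (elim x)
    then have "summable (\<lambda>k. X (s (Suc k)) x - X (s k) x)" by (rule summable_rabs_cancel)
    then show ?case
      using sum_lessThan_telescope[of "\<lambda>k. X (s k) x"]
      by (simp add: summable_iff_convergent convergent_diff_const_right_iff)
  qed
  define Y where "Y x = lim (\<lambda>k. X (s k) x)" for x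
  have YN[measurable]: "Y \<in> borel_measurable N" unfolding Y_def by measurable
  have YM[measurable]: "Y \<in> borel_measurable M" by (rule sub[OF YN])
  have lim: "AE x in M. (\<lambda>k. X (s k) x) \<longlonglongrightarrow> Y x"
    using conv by eventually_elim (simp add: Y_def convergent_LIMSEQ_iff)
  have F: "integrable M (\<lambda>x. (X n x - Y x)\<^sup>2) \<and> (\<integral>x. (X n x - Y x)\<^sup>2 \<partial>M) \<le> (1/4)^k" if n: "n \<ge> r k" for n k
  proof -
    have "(\<integral>\<^sup>+x. ennreal ((X n x - Y x)\<^sup>2) \<partial>M) = (\<integral>\<^sup>+x. liminf (\<lambda>j. ennreal ((X n x - X (s j) x)\<^sup>2)) \<partial>M)"
    proof (intro nn_integral_cong_AE, use lim in eventually_elim)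
      case (elim x)
      then have "(\<lambda>j. ennreal ((X n x - X (s j) x)\<^sup>2)) \<longlonglongrightarrow> ennreal ((X n x - Y x)\<^sup>2)"
        by (intro tendsto_intros)
      then show ?case by (rule lim_imp_Liminf[symmetric, rotated]) simp
    qed
    also have "\<dots> \<le> liminf (\<lambda>j. \<integral>\<^sup>+x. ennreal ((X n x - X (s j) x)\<^sup>2) \<partial>M)"
      by (intro nn_integral_liminf) auto
    also have "\<dots> \<le> ennreal ((1/4)^k)"
    proof (rule Liminf_le)
      show "\<forall>\<^sub>F j in sequentially. (\<integral>\<^sup>+x. ennreal ((X n x - X (s j) x)\<^sup>2) \<partial>M) \<le> ennreal ((1/4)^k)"
        using eventually_ge_at_top[of k]
      proof eventually_elim
        case (elim j)
        have "(\<integral>\<^sup>+x. ennreal ((X n x - X (s j) x)\<^sup>2) \<partial>M) = ennreal (\<integral>x. (X n x - X (s j) x)\<^sup>2 \<partial>M)"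
          using square_integrable_diff[OF X(2)[of n] X(2)[of "s j"]]
          by (intro nn_integral_eq_integral) (auto simp: square_integrable_def)
        also have "\<dots> \<le> ennreal ((1/4)^k)"
          using r[OF n rs[OF elim]] by (intro ennreal_leI) auto
        finally show ?case .
      qed
    qed simp
    finally have *: "(\<integral>\<^sup>+x. ennreal ((X n x - Y x)\<^sup>2) \<partial>M) \<le> ennreal ((1/4)^k)" .
    then have i: "integrable M (\<lambda>x. (X n x - Y x)\<^sup>2)"
      by (intro integrableI_bounded) (auto simp: top_unique less_top[symmetric])
    then show ?thesis using * by (subst (asm) nn_integral_eq_integral) auto
  qed
  have sY: "square_integrable M Y"
  proof -
    have "square_integrable M (\<lambda>x. X (r 0) x - Y x)"
      using F[of 0 "r 0"] by (auto simp: square_integrable_def)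
    from square_integrable_diff[OF X(2)[of "r 0"] this] show ?thesis by simp
  qed
  have "(\<lambda>n. \<integral>x. (X n x - Y x)\<^sup>2 \<partial>M) \<longlonglongrightarrow> 0"
  proof (rule LIMSEQ_I)
    fix e :: real assume "e > 0"
    then obtain k where k: "(1/4)^k < e" using real_arch_pow_inv[of e "1/4"] by auto
    have "norm ((\<integral>x. (X n x - Y x)\<^sup>2 \<partial>M) - 0) < e" if "n \<ge> r k" for n
      using F[OF that] k by simp
    then show "\<exists>no. \<forall>n\<ge>no. norm ((\<integral>x. (X n x - Y x)\<^sup>2 \<partial>M) - 0) < e" by blast
  qed
  with YN sY show ?thesis by blast
qed

lemma has_real_derivative_abs_powr:
  fixes p :: real
  assumes "p > 1"
  shows "((\<lambda>x. \<bar>x\<bar> powr p) has_real_derivative p * sgn x * \<bar>x\<bar> powr (p - 1)) (at x)"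
proof -
  consider "x > 0" | "x < 0" | "x = 0" by linarith
  then show ?thesis
  proof cases
    case 1
    have "((\<lambda>x. x powr p) has_real_derivative p * x powr (p - 1)) (at x)"
      using 1 by (rule has_real_derivative_powr)
    then have "((\<lambda>x. \<bar>x\<bar> powr p) has_real_derivative p * x powr (p - 1)) (at x)"
      by (rule has_field_derivative_transform_within_open[where S="{0<..}"]) (use 1 in auto)
    then show ?thesis using 1 by simp
  next
    case 2
    have "((\<lambda>x. (-x) powr p) has_real_derivative p * (-x) powr (p - 1) * (-1)) (at x)"
      by (rule DERIV_chain2[OF has_real_derivative_powr]) (use 2 in \<open>auto intro!: derivative_eq_intros\<close>)
    then have "((\<lambda>x. \<bar>x\<bar> powr p) has_real_derivative p * (-x) powr (p - 1) * (-1)) (at x)"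
      by (rule has_field_derivative_transform_within_open[where S="{..<0}"]) (use 2 in auto)
    then show ?thesis using 2 by simp
  next
    case 3
    have "(\<lambda>h. \<bar>h\<bar> powr (p - 1)) \<midarrow>0\<rightarrow> \<bar>0\<bar> powr (p - 1)"
      by (intro tendsto_powr' tendsto_intros) (use assms in auto)
    then have "(\<lambda>h. \<bar>\<bar>h\<bar> powr p / h\<bar>) \<midarrow>0\<rightarrow> 0"
      unfolding abs_zero powr_0
      by (rule Lim_transform_eventually) (auto simp: powr_diff eventually_at_filter)
    then have "(\<lambda>h. \<bar>h\<bar> powr p / h) \<midarrow>0\<rightarrow> 0" by (rule tendsto_rabs_zero_cancel)
    then show ?thesis using 3 by (simp add: has_field_derivative_iff)
  qed
qed

lemma nn_integral_abs_powr_Icc: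
  fixes p s c d :: real
  assumes p: "p > 0" and cd: "c \<le> d"
  shows "(\<integral>\<^sup>+v\<in>{c..d}. ennreal (\<bar>s - v\<bar> powr (p - 1)) \<partial>lborel) =
     ennreal ((sgn (d - s) * \<bar>d - s\<bar> powr p - sgn (c - s) * \<bar>c - s\<bar> powr p) / p)"
proof -
  define G where "G v = sgn (v - s) * \<bar>v - s\<bar> powr p / p" for v
  have "isCont (\<lambda>x::real. sgn x * \<bar>x\<bar> powr p) x" for x
  proof (cases "x = 0")
    case True
    have "(\<lambda>h::real. \<bar>h\<bar> powr p) \<midarrow>0\<rightarrow> \<bar>0\<bar> powr p"
      by (intro tendsto_powr' tendsto_intros) (use p in auto)
    then have "(\<lambda>h::real. sgn h * \<bar>h\<bar> powr p) \<midarrow>0\<rightarrow> 0"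
      by (subst tendsto_rabs_zero_iff[symmetric], rule_tac Lim_transform_eventually)
         (auto simp: abs_mult abs_sgn_eq eventually_at_filter)
    then show ?thesis using True by (simp add: isCont_def)
  next
    case False
    then show ?thesis by (intro continuous_intros) auto
  qed
  then have "isCont (\<lambda>v. sgn (v - s) * \<bar>v - s\<bar> powr p) v" for v
    by (rule isCont_o2[rotated]) (intro continuous_intros)
  then have "isCont G v" for v unfolding G_def using p by (intro isCont_divide) auto
  then have cG: "continuous_on A G" for A
    by (intro continuous_at_imp_continuous_on ballI)
  have dG: "(G has_vector_derivative \<bar>s - v\<bar> powr (p - 1)) (at v)" if "v \<noteq> s" for v
  proof -
    consider "v > s" | "v < s" using \<open>v \<noteq> s\<close> by linarith
    then show ?thesis
    proof cases
      case 1
      have "((\<lambda>v. (v - s) powr p / p) has_real_derivative (v - s) powr (p - 1)) (at v)"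
        using 1 p by (auto intro!: derivative_eq_intros)
      then have "(G has_real_derivative (v - s) powr (p - 1)) (at v)"
        by (rule has_field_derivative_transform_within_open[where S="{s<..}"]) (use 1 in \<open>auto simp: G_def\<close>)
      then show ?thesis using 1 by (simp add: has_real_derivative_iff_has_vector_derivative)
    next
      case 2
      have "((\<lambda>v. - ((s - v) powr p / p)) has_real_derivative (s - v) powr (p - 1)) (at v)"
        using 2 p by (auto intro!: derivative_eq_intros)
      then have "(G has_real_derivative (s - v) powr (p - 1)) (at v)"
        by (rule has_field_derivative_transform_within_open[where S="{..<s}"]) (use 2 in \<open>auto simp: G_def\<close>)
      then show ?thesis using 2 by (simp add: has_real_derivative_iff_has_vector_derivative)
    qed
  qed
  have "((\<lambda>v. \<bar>s - v\<bar> powr (p - 1)) has_integral (G d - G c)) {c..d}"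
    by (rule fundamental_theorem_of_calculus_interior_strong[of "{s}"]) (use cd dG cG in auto)
  then have "integral\<^sup>N lborel (\<lambda>x. indicator {c..d} x * \<bar>s - x\<bar> powr (p - 1)) = ennreal (G d - G c)"
    by (intro nn_integral_has_integral_lebesgue) auto
  then show ?thesis
    by (simp add: G_def diff_divide_distrib mult.commute ennreal_mult' ennreal_indicator)
qed

section \<open>Smooth functions of finitely many variables\<close>

lemma tendsto_fun_coordinatewise:
  fixes x :: "'b \<Rightarrow> 'i \<Rightarrow> real"
  assumes "\<And>i. ((\<lambda>k. x k i) \<longlongrightarrow> l i) F"
  shows "(x \<longlongrightarrow> l) F"
proof -
  have "limitin (product_topology (\<lambda>i. euclidean) UNIV) x l F"
    unfolding limitin_componentwise using assms by auto
  then show ?thesis by (simp add: euclidean_product_topology)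
qed

lemma continuous_fun_tendsto:
  fixes g :: "(nat \<Rightarrow> real) \<Rightarrow> real"
  assumes "continuous_on UNIV g" "\<And>i. ((\<lambda>k. x k i) \<longlongrightarrow> l i) F"
  shows "((\<lambda>k. g (x k)) \<longlongrightarrow> g l) F"
  using continuous_on_tendsto_compose[OF assms(1) tendsto_fun_coordinatewise[OF assms(2)]] by simp

lemma Cb_infinity_D:
  assumes "Cb_infinity n f"
  shows "continuous_on UNIV f" "bounded (range f)"
    "\<And>x y. (\<And>i. i < n \<Longrightarrow> x i = y i) \<Longrightarrow> f x = f y"
    "\<And>j. j < n \<Longrightarrow> continuous_on UNIV (partial_deriv j f)"
    "\<And>j. j < n \<Longrightarrow> bounded (range (partial_deriv j f))"
    "\<And>j x y. j < n \<Longrightarrow> ((\<lambda>z. f (x(j := z))) has_real_derivative partial_deriv j f (x(j := y))) (at y)"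
proof -
  have C: "continuous_on UNIV (foldr partial_deriv is f)" "bounded (range (foldr partial_deriv is f))"
       "\<And>x i. i < n \<Longrightarrow> (\<lambda>y. foldr partial_deriv is f (x(i := y))) differentiable (at (x i))"
    if "set is \<subseteq> {..<n}" for "is"
    using assms that unfolding Cb_infinity_def Let_def by blast+
  show "continuous_on UNIV f" "bounded (range f)" using C(1,2)[of "[]"] by auto
  show "\<And>x y. (\<And>i. i < n \<Longrightarrow> x i = y i) \<Longrightarrow> f x = f y" using assms unfolding Cb_infinity_def by blast
  fix j assume j: "j < n"
  show "continuous_on UNIV (partial_deriv j f)" "bounded (range (partial_deriv j f))"
    using C(1,2)[of "[j]"] j by auto
  fix x :: "nat \<Rightarrow> real" and y
  have "(\<lambda>z. f ((x(j := y))(j := z))) differentiable (at ((x(j := y)) j))"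
    using C(3)[of "[]" j "x(j := y)"] j by simp
  then show "((\<lambda>z. f (x(j := z))) has_real_derivative partial_deriv j f (x(j := y))) (at y)"
    unfolding partial_deriv_def by (simp add: real_differentiable_def) (metis DERIV_imp_deriv)
qed

lemma Cb_infinity_line_derivative:
  assumes f: "Cb_infinity n f"
  shows "((\<lambda>y. f (\<lambda>i. v i + y * c i)) has_real_derivative
           (\<Sum>j<n. c j * partial_deriv j f (\<lambda>i. v i + y * c i))) (at y)"
proof -
  note Cb = Cb_infinity_D[OF f]
  define u where "u m v y i = (if i < m then v i + y * c i else v i)" for m v y and i :: nat
  have u0: "u m v 0 = v" for m v by (auto simp: u_def fun_eq_iff)
  have step: "((\<lambda>y. f (u m v y)) has_real_derivative (\<Sum>j<m. c j * partial_deriv j f v)) (at 0)" if "m \<le> n" for m v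
    using that
  proof (induction m)
    case 0
    then show ?case by (simp add: u_def)
  next
    case (Suc m)
    then have m: "m < n" by simp
    have "\<exists>\<theta>. 0 < \<theta> \<and> \<theta> < 1 \<and> f (u (Suc m) v y) - f (u m v y) =
       y * c m * partial_deriv m f ((u m v y)(m := v m + \<theta> * (y * c m)))" for y
    proof -
      have "((\<lambda>z. f ((u m v y)(m := v m + z * (y * c m)))) has_real_derivative
          partial_deriv m f ((u m v y)(m := v m + z * (y * c m))) * (y * c m)) (at z)" for z
        by (rule DERIV_chain2[OF Cb(6)[OF m]]) (auto intro!: derivative_eq_intros)
      from MVT2[of 0 1 "\<lambda>z. f ((u m v y)(m := v m + z * (y * c m)))", OF _ this]
      obtain \<theta> where "0 < \<theta>" "\<theta> < 1" "f ((u m v y)(m := v m + 1 * (y * c m))) -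
          f ((u m v y)(m := v m + 0 * (y * c m)))
         = (1 - 0) * (partial_deriv m f ((u m v y)(m := v m + \<theta> * (y * c m))) * (y * c m))" by auto
      moreover have "(u m v y)(m := v m + 1 * (y * c m)) = u (Suc m) v y"
          "(u m v y)(m := v m + 0 * (y * c m)) = u m v y"
        by (auto simp: u_def fun_eq_iff)
      ultimately show ?thesis by (auto simp: mult_ac)
    qed
    then obtain \<theta> where \<theta>: "\<And>y. 0 < \<theta> y" "\<And>y. \<theta> y < 1" "\<And>y. f (u (Suc m) v y) - f (u m v y) =
       y * c m * partial_deriv m f ((u m v y)(m := v m + \<theta> y * (y * c m)))" by metis
    have "((\<lambda>y. partial_deriv m f ((u m v y)(m := v m + \<theta> y * (y * c m)))) \<longlongrightarrow> partial_deriv m f v) (at 0)"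
    proof (rule continuous_fun_tendsto[OF Cb(4)[OF m]])
      fix i
      have "((\<lambda>y. \<theta> y * (y * c m)) \<longlongrightarrow> 0) (at 0)"
      proof (rule Lim_null_comparison)
        show "\<forall>\<^sub>F y in at 0. norm (\<theta> y * (y * c m)) \<le> \<bar>y * c m\<bar>"
          using \<theta>(1,2) by (auto simp: abs_mult less_imp_le mult_right_le_one_le intro!: always_eventually
              mult_left_le_one_le)
        show "((\<lambda>y. \<bar>y * c m\<bar>) \<longlongrightarrow> 0) (at 0)" by (auto intro!: tendsto_eq_intros)
      qed
      from tendsto_add[OF tendsto_const[of "v m"] this]
      have 1: "((\<lambda>y. v m + \<theta> y * (y * c m)) \<longlongrightarrow> v m) (at 0)" by simp
      have 2: "((\<lambda>y. u m v y i) \<longlongrightarrow> v i) (at 0)"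
        unfolding u_def by (cases "i < m") (auto intro!: tendsto_eq_intros)
      show "((\<lambda>y. ((u m v y)(m := v m + \<theta> y * (y * c m))) i) \<longlongrightarrow> v i) (at 0)"
        using 1 2 by (cases "i = m") auto
    qed
    then have "((\<lambda>y. c m * partial_deriv m f ((u m v y)(m := v m + \<theta> y * (y * c m))) + (f (u m v y) - f v) / y)
       \<longlongrightarrow> c m * partial_deriv m f v + (\<Sum>j<m. c j * partial_deriv j f v)) (at 0)"
      using Suc.IH m by (intro tendsto_intros) (auto simp: has_field_derivative_iff u0)
    then have "((\<lambda>y. (f (u (Suc m) v y) - f v) / y) \<longlongrightarrow> c m * partial_deriv m f v +
        (\<Sum>j<m. c j * partial_deriv j f v)) (at 0)"
    proof (rule Lim_transform_eventually)
      show "\<forall>\<^sub>F y in at 0. c m * partial_deriv m f ((u m v y)(m := v m + \<theta> y * (y * c m))) +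
          (f (u m v y) - f v) / y
           = (f (u (Suc m) v y) - f v) / y"
        unfolding eventually_at_filter
      proof (intro always_eventually allI impI)
        fix y :: real assume y: "y \<noteq> 0"
        have "(f (u (Suc m) v y) - f v) / y = (f (u (Suc m) v y) - f (u m v y)) / y + (f (u m v y) - f v) / y"
          by (simp add: diff_divide_distrib)
        then show "c m * partial_deriv m f ((u m v y)(m := v m + \<theta> y * (y * c m))) + (f (u m v y) - f v) / y
           = (f (u (Suc m) v y) - f v) / y" using y by (simp add: \<theta>(3))
      qed
    qed
    then show ?case by (simp add: has_field_derivative_iff u0 add.commute)
  qed
  have "((\<lambda>h. f (u n (\<lambda>i. v i + y * c i) h)) has_real_derivative
      (\<Sum>j<n. c j * partial_deriv j f (\<lambda>i. v i + y * c i))) (at 0)"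
    by (rule step) simp
  moreover have "f (u n (\<lambda>i. v i + y * c i) h) = f (\<lambda>i. v i + (y + h) * c i)" for h
    by (rule Cb(3)) (simp add: u_def algebra_simps)
  ultimately have "((\<lambda>h. f (\<lambda>i. v i + (y + h) * c i)) has_real_derivative
      (\<Sum>j<n. c j * partial_deriv j f (\<lambda>i. v i + y * c i))) (at 0)"
    by simp
  then show ?thesis using DERIV_shift[of "\<lambda>y. f (\<lambda>i. v i + y * c i)" _ 0 y] by (simp add: add.commute)
qed

lemma Cb_infinity_cos: "Cb_infinity n (\<lambda>x. K * cos (\<theta> + (\<Sum>i<n. c i * x i)))"
proof -
  have d: "((\<lambda>y. K * cos (\<theta> + (\<Sum>i<n. c i * (x(j := y)) i))) has_real_derivative
      K * c j * cos (\<theta> + pi/2 + (\<Sum>i<n. c i * (x(j := y)) i))) (at y)" if "j < n" for K \<theta> x j y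
  proof -
    have s: "(\<Sum>i<n. c i * (x(j := y)) i) = c j * y + (\<Sum>i\<in>{..<n}-{j}. c i * x i)" for y
      using that by (subst sum.remove[of _ j]) (auto intro!: sum.cong)
    show ?thesis unfolding s
      by (auto intro!: derivative_eq_intros) (auto simp: cos_add sin_add algebra_simps)
  qed
  have p: "partial_deriv j (\<lambda>x. K * cos (\<theta> + (\<Sum>i<n. c i * x i))) =
      (\<lambda>x. (K * c j) * cos ((\<theta> + pi/2) + (\<Sum>i<n. c i * x i)))"
    if "j < n" for K \<theta> j
  proof
    fix x :: "nat \<Rightarrow> real"
    show "partial_deriv j (\<lambda>x. K * cos (\<theta> + (\<Sum>i<n. c i * x i))) x =
        (K * c j) * cos ((\<theta> + pi/2) + (\<Sum>i<n. c i * x i))"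
      unfolding partial_deriv_def using DERIV_imp_deriv[OF d[OF that, of K \<theta> x "x j"]] by simp
  qed
  have ex: "\<exists>K' \<theta>'. foldr partial_deriv is (\<lambda>x. K * cos (\<theta> + (\<Sum>i<n. c i * x i))) =
      (\<lambda>x. K' * cos (\<theta>' + (\<Sum>i<n. c i * x i)))"
    if "set is \<subseteq> {..<n}" for "is"
    using that
  proof (induction "is")
    case (Cons j js)
    then obtain K' \<theta>' where "foldr partial_deriv js (\<lambda>x. K * cos (\<theta> + (\<Sum>i<n. c i * x i))) =
        (\<lambda>x. K' * cos (\<theta>' + (\<Sum>i<n. c i * x i)))"
      by auto
    then show ?case using p[of j K' \<theta>'] Cons.prems by auto
  qed auto
  have c: "continuous_on UNIV (\<lambda>x. K * cos (\<theta> + (\<Sum>i<n. c i * x i)))" for K \<theta>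
    by (intro continuous_intros continuous_on_product_coordinates)
  have b: "bounded (range (\<lambda>x. K * cos (\<theta> + (\<Sum>i<n. c i * x i))))" for K \<theta>
    by (rule boundedI[where B="\<bar>K\<bar>"]) (auto simp: abs_mult intro!: mult_left_le)
  have df: "(\<lambda>y. K * cos (\<theta> + (\<Sum>i<n. c i * (x(j := y)) i))) differentiable (at (x j))" if "j < n" for K \<theta> x j
    using d[OF that, of K \<theta> x "x j"] by (auto simp: real_differentiable_def simp del: fun_upd_apply)
  show ?thesis unfolding Cb_infinity_def Let_def
  proof (intro conjI allI impI)
    fix x y :: "nat \<Rightarrow> real" assume "\<forall>i<n. x i = y i"
    then have "(\<Sum>i<n. c i * x i) = (\<Sum>i<n. c i * y i)" by (intro sum.cong) auto
    then show "K * cos (\<theta> + (\<Sum>i<n. c i * x i)) = K * cos (\<theta> + (\<Sum>i<n. c i * y i))" by simp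
  next
    fix js assume "set js \<subseteq> {..<n}"
    from ex[OF this] obtain K' \<theta>' where
      *: "foldr partial_deriv js (\<lambda>x. K * cos (\<theta> + (\<Sum>i<n. c i * x i))) = (\<lambda>x. K' * cos (\<theta>' + (\<Sum>i<n. c i * x i)))"
      by blast
    show "continuous_on UNIV (foldr partial_deriv js (\<lambda>x. K * cos (\<theta> + (\<Sum>i<n. c i * x i))))"
      "bounded (range (foldr partial_deriv js (\<lambda>x. K * cos (\<theta> + (\<Sum>i<n. c i * x i)))))"
      unfolding * by (rule c, rule b)
    fix x i assume "i < n"
    then show "(\<lambda>y. foldr partial_deriv js (\<lambda>x. K * cos (\<theta> + (\<Sum>i<n. c i * x i))) (x(i := y))) differentiable
        (at (x i))"
      unfolding * by (rule df)
  qed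
qed

section \<open>Gaussian integration by parts\<close>

lemma fourier_normal_density:
  assumes \<sigma>: "\<sigma> > 0"
  shows "integrable lborel (\<lambda>x. normal_density 0 \<sigma> x * cos (u * x))"
    "integrable lborel (\<lambda>x. normal_density 0 \<sigma> x * sin (u * x))"
    "(\<integral>x. normal_density 0 \<sigma> x * cos (u * x) \<partial>lborel) = exp (- (u * \<sigma>)\<^sup>2 / 2)"
    "(\<integral>x. normal_density 0 \<sigma> x * sin (u * x) \<partial>lborel) = 0"
proof -
  have i: "integrable lborel (\<lambda>x. normal_density 0 \<sigma> x * f x)"
    if [measurable]: "f \<in> borel_measurable borel" and "\<And>x. \<bar>f x\<bar> \<le> 1" "\<sigma> > 0" for f and \<sigma> :: real
    using that by (intro Bochner_Integration.integrable_bound[OF integrable_normal_density[of \<sigma> 0]])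
      (auto simp: abs_mult intro!: mult_left_le)
  show ic: "integrable lborel (\<lambda>x. normal_density 0 \<sigma> x * cos (u * x))"
    and isn: "integrable lborel (\<lambda>x. normal_density 0 \<sigma> x * sin (u * x))" using \<sigma> by (auto intro!: i)
  have c: "char std_normal_distribution t = exp (- t\<^sup>2 / 2)" for t
    by (simp add: char_std_normal_distribution)
  have c2: "char std_normal_distribution t =
      Complex (\<integral>x. std_normal_density x * cos (t * x) \<partial>lborel)
      (\<integral>x. std_normal_density x * sin (t * x) \<partial>lborel)" for t
  proof -
    have "char std_normal_distribution t = (\<integral>x. std_normal_density x *\<^sub>R iexp (t * x) \<partial>lborel)"
      unfolding char_def by (subst integral_density) auto
    also have "\<dots> = (\<integral>x. complex_of_real (std_normal_density x * cos (t * x)) +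
        \<i> * complex_of_real (std_normal_density x * sin (t * x)) \<partial>lborel)"
      by (intro Bochner_Integration.integral_cong refl) (simp add: complex_eq_iff Re_exp Im_exp)
    also have "\<dots> = complex_of_real (\<integral>x. std_normal_density x * cos (t * x) \<partial>lborel) +
        \<i> * complex_of_real (\<integral>x. std_normal_density x * sin (t * x) \<partial>lborel)"
      by (subst Bochner_Integration.integral_add) (auto intro!: i integrable_mult_right simp del: of_real_mult)
    finally show ?thesis by (simp add: complex_eq_iff)
  qed
  have cs: "(\<integral>x. std_normal_density x * cos (t * x) \<partial>lborel) = exp (- t\<^sup>2 / 2)"
    "(\<integral>x. std_normal_density x * sin (t * x) \<partial>lborel) = 0" for t
    using c[of t] unfolding c2 by (auto simp: complex_eq_iff)
  have sub: "(\<integral>x. normal_density 0 \<sigma> x * f x \<partial>lborel) = (\<integral>x. std_normal_density x * f (\<sigma> * x) \<partial>lborel)" for f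
  proof -
    have "(\<integral>x. normal_density 0 \<sigma> x * f x \<partial>lborel) =
        \<bar>\<sigma>\<bar> *\<^sub>R (\<integral>x. normal_density 0 \<sigma> (0 + \<sigma> * x) * f (0 + \<sigma> * x) \<partial>lborel)"
      using \<sigma> by (subst lborel_integral_real_affine[of \<sigma> _ 0]) auto
    also have "\<dots> = (\<integral>x. \<sigma> * (normal_density 0 \<sigma> (\<sigma> * x) * f (\<sigma> * x)) \<partial>lborel)"
      using \<sigma> by simp
    also have "\<dots> = (\<integral>x. std_normal_density x * f (\<sigma> * x) \<partial>lborel)"
      using \<sigma> by (intro Bochner_Integration.integral_cong refl)
        (simp add: normal_density_def power_mult_distrib real_sqrt_mult)
    finally show ?thesis .
  qed
  show "(\<integral>x. normal_density 0 \<sigma> x * cos (u * x) \<partial>lborel) = exp (- (u * \<sigma>)\<^sup>2 / 2)"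
    "(\<integral>x. normal_density 0 \<sigma> x * sin (u * x) \<partial>lborel) = 0"
    unfolding sub[of "\<lambda>x. cos (u * x)"] sub[of "\<lambda>x. sin (u * x)"] using cs[of "u * \<sigma>"]
    by (simp_all add: mult.assoc)
qed

lemma gaussian_integration_by_parts:
  fixes h h' :: "real \<Rightarrow> real"
  assumes \<sigma>: "\<sigma> > 0" and S: "finite S" and h: "continuous_on UNIV h"
    and h': "\<And>y. y \<notin> S \<Longrightarrow> (h has_real_derivative h' y) (at y)"
    and [measurable]: "h' \<in> borel_measurable borel"
    and b: "\<And>y. \<bar>h y\<bar> \<le> C * (1 + \<bar>y\<bar>)" "\<And>y. \<bar>h' y\<bar> \<le> C * (1 + \<bar>y\<bar>)"
  shows "(\<integral>y. normal_density 0 \<sigma> y * (y * h y - \<sigma>\<^sup>2 * h' y) \<partial>lborel) = 0"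
proof -
  have [measurable]: "h \<in> borel_measurable borel" using h by (rule borel_measurable_continuous_onI)
  let ?n = "normal_density 0 \<sigma>"
  let ?g = "\<lambda>y. ?n y * (y * h y - \<sigma>\<^sup>2 * h' y)"
  have C: "C \<ge> 0" using b(1)[of 0] by simp
  have int: "integrable lborel ?g"
  proof (rule Bochner_Integration.integrable_bound)
    show "integrable lborel (\<lambda>y. C * (?n y * \<bar>y - 0\<bar> ^ 1 + ?n y * \<bar>y - 0\<bar> ^ 2 + \<sigma>\<^sup>2 * (?n y + ?n y * \<bar>y - 0\<bar>^1)))"
      using \<sigma> by (intro integrable_mult_right Bochner_Integration.integrable_add integrable_normal_moment_abs
          integrable_normal_density) auto
    show "AE y in lborel. norm (?g y) \<le>
        norm (C * (?n y * \<bar>y - 0\<bar> ^ 1 + ?n y * \<bar>y - 0\<bar> ^ 2 + \<sigma>\<^sup>2 * (?n y + ?n y * \<bar>y - 0\<bar>^1)))"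
    proof (rule AE_I2)
      fix y
      have "\<bar>y * h y - \<sigma>\<^sup>2 * h' y\<bar> \<le> \<bar>y\<bar> * \<bar>h y\<bar> + \<sigma>\<^sup>2 * \<bar>h' y\<bar>"
        by (rule order_trans[OF abs_triangle_ineq4]) (simp add: abs_mult)
      also have "\<dots> \<le> \<bar>y\<bar> * (C * (1 + \<bar>y\<bar>)) + \<sigma>\<^sup>2 * (C * (1 + \<bar>y\<bar>))"
        using b[of y] by (intro add_mono mult_left_mono) auto
      finally have "\<bar>?g y\<bar> \<le> ?n y * (\<bar>y\<bar> * (C * (1 + \<bar>y\<bar>)) + \<sigma>\<^sup>2 * (C * (1 + \<bar>y\<bar>)))"
        by (simp add: abs_mult mult_left_mono)
      also have "\<dots> = C * (?n y * \<bar>y - 0\<bar> ^ 1 + ?n y * \<bar>y - 0\<bar> ^ 2 + \<sigma>\<^sup>2 * (?n y + ?n y * \<bar>y - 0\<bar>^1))"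
        by (simp add: algebra_simps power2_eq_square)
      finally show "norm (?g y) \<le> norm
          (C * (?n y * \<bar>y - 0\<bar> ^ 1 + ?n y * \<bar>y - 0\<bar> ^ 2 + \<sigma>\<^sup>2 * (?n y + ?n y * \<bar>y - 0\<bar>^1)))"
        by simp
    qed
  qed simp
  define q where "q y = - (\<sigma>\<^sup>2 * (h y * ?n y))" for y
  have dn: "(?n has_real_derivative - (y / \<sigma>\<^sup>2) * ?n y) (at y)" for y
    unfolding normal_density_def using \<sigma> by (auto intro!: derivative_eq_intros simp: field_simps power2_eq_square)
  have dq: "(q has_real_derivative ?g y) (at y)" if "y \<notin> S" for y
    unfolding q_def using \<sigma> by (auto intro!: derivative_eq_intros h'[OF that] dn simp: field_simps
        power2_eq_square)
  have cq: "continuous_on A q" for A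
    unfolding q_def using dn
    by (intro continuous_intros continuous_on_subset[OF h] DERIV_continuous_on[of A ?n]) (auto intro: DERIV_subset)
  have fin: "(\<integral>y. indicator {-real n..real n} y * ?g y \<partial>lborel) = q (real n) - q (- real n)" for n
  proof -
    have "(?g has_integral (q (real n) - q (- real n))) {-real n..real n}"
      using S dq cq by (intro fundamental_theorem_of_calculus_interior_strong[of S])
        (auto simp flip: has_real_derivative_iff_has_vector_derivative)
    moreover have "set_integrable lborel {-real n..real n} ?g"
      unfolding set_integrable_def real_scaleR_def
          by (rule integrable_real_mult_indicator[OF _ int, simplified mult.commute[of _ "indicator _ _"]]) simp
    ultimately show ?thesis
      using set_borel_integral_eq_integral(2)[of "{-real n..real n}" ?g]
      by (simp add: set_lebesgue_integral_def integral_unique)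
  qed
  have lim1: "(\<lambda>n. \<integral>y. indicator {-real n..real n} y * ?g y \<partial>lborel) \<longlonglongrightarrow> (\<integral>y. ?g y \<partial>lborel)"
  proof (rule integral_dominated_convergence[where w="\<lambda>y. \<bar>?g y\<bar>"])
    show "integrable lborel (\<lambda>y. \<bar>?g y\<bar>)" using int by simp
    show "AE y in lborel. (\<lambda>n. indicator {-real n..real n} y * ?g y) \<longlonglongrightarrow> ?g y"
    proof (rule AE_I2)
      fix y :: real
      obtain N :: nat where "\<bar>y\<bar> \<le> real N" using real_arch_simple by blast
      have "\<forall>\<^sub>F n in sequentially. indicator {-real n..real n} y * ?g y = ?g y"
        using eventually_ge_at_top[of N]
      proof eventually_elim
        case (elim n)
        then have "y \<in> {-real n..real n}" using \<open>\<bar>y\<bar> \<le> real N\<close> by auto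
        then show ?case by simp
      qed
      then show "(\<lambda>n. indicator {-real n..real n} y * ?g y) \<longlonglongrightarrow> ?g y" by (rule tendsto_eventually)
    qed
  qed (auto simp: indicator_def)
  have nb: "?n y \<le> 1 / sqrt (2 * pi * \<sigma>\<^sup>2) * (2 * \<sigma>\<^sup>2 / y\<^sup>2)" if "y \<noteq> 0" for y
  proof -
    have "exp (- y\<^sup>2 / (2 * \<sigma>\<^sup>2)) = 1 / exp (y\<^sup>2 / (2 * \<sigma>\<^sup>2))" unfolding minus_divide_left[symmetric] exp_minus
        by (rule inverse_eq_divide)
    also have "\<dots> \<le> 1 / (y\<^sup>2 / (2 * \<sigma>\<^sup>2))"
    proof (rule divide_left_mono)
      show "y\<^sup>2 / (2 * \<sigma>\<^sup>2) \<le> exp (y\<^sup>2 / (2 * \<sigma>\<^sup>2))"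
        using exp_ge_add_one_self[of "y\<^sup>2 / (2 * \<sigma>\<^sup>2)"] by linarith
      show "0 < exp (y\<^sup>2 / (2 * \<sigma>\<^sup>2)) * (y\<^sup>2 / (2 * \<sigma>\<^sup>2))" using that \<sigma> by simp
    qed simp
    finally show ?thesis unfolding normal_density_def by (intro mult_left_mono) auto
  qed
  define K where "K = \<sigma>\<^sup>2 * C * (1 / sqrt (2 * pi * \<sigma>\<^sup>2) * (2 * \<sigma>\<^sup>2))"
  have qb: "\<bar>q y\<bar> \<le> K * 2 / \<bar>y\<bar>" if y: "\<bar>y\<bar> \<ge> 1" for y
  proof -
    have "\<bar>q y\<bar> = \<sigma>\<^sup>2 * (\<bar>h y\<bar> * ?n y)" by (simp add: q_def abs_mult)
    also have "\<dots> \<le> \<sigma>\<^sup>2 * ((C * (1 + \<bar>y\<bar>)) * (1 / sqrt (2 * pi * \<sigma>\<^sup>2) * (2 * \<sigma>\<^sup>2 / y\<^sup>2)))"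
      using b(1)[of y] nb[of y] y C by (intro mult_left_mono mult_mono) auto
    also have "\<dots> = K * ((1 + \<bar>y\<bar>) / \<bar>y\<bar>\<^sup>2)" by (simp add: K_def)
    also have "\<dots> \<le> K * (2 / \<bar>y\<bar>)"
    proof (rule mult_left_mono)
      show "(1 + \<bar>y\<bar>) / \<bar>y\<bar>\<^sup>2 \<le> 2 / \<bar>y\<bar>"
      proof -
        have "(1 + \<bar>y\<bar>) / \<bar>y\<bar>\<^sup>2 \<le> (2 * \<bar>y\<bar>) / \<bar>y\<bar>\<^sup>2" using y by (intro divide_right_mono) auto
        also have "\<dots> = 2 / \<bar>y\<bar>"
          unfolding power2_eq_square using y by (intro nonzero_mult_divide_mult_cancel_right) auto
        finally show ?thesis .
      qed
      show "0 \<le> K" unfolding K_def using C by simp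
    qed
    finally show ?thesis by simp
  qed
  have "(\<lambda>n. q (real n) - q (- real n)) \<longlonglongrightarrow> 0"
  proof (rule Lim_null_comparison)
    show "\<forall>\<^sub>F n in sequentially. norm (q (real n) - q (- real n)) \<le> 4 * K * inverse (real n)"
      using eventually_ge_at_top[of 1]
    proof eventually_elim
      case (elim n)
      have "\<bar>q (real n) - q (- real n)\<bar> \<le> \<bar>q (real n)\<bar> + \<bar>q (- real n)\<bar>" by simp
      also have "\<dots> \<le> K * 2 / \<bar>real n\<bar> + K * 2 / \<bar>- real n\<bar>"
        using elim by (intro add_mono qb) auto
      finally show ?case by (simp add: divide_inverse algebra_simps)
    qed
    have "(\<lambda>n. 4 * K * inverse (real n)) \<longlonglongrightarrow> 4 * K * 0"
      by (intro tendsto_intros lim_inverse_n)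
    then show "(\<lambda>n. 4 * K * inverse (real n)) \<longlonglongrightarrow> 0" by simp
  qed
  with lim1 show ?thesis unfolding fin using LIMSEQ_unique by blast
qed

locale fbm_setting =
  fixes M :: "'a measure" and B :: "real \<Rightarrow> 'a \<Rightarrow> real"
    and e :: "real \<Rightarrow> 'h::{real_inner,banach,second_countable_topology}"
    and W :: "'h \<Rightarrow> 'a \<Rightarrow> real"
    and H T :: real
  assumes H: "1/2 < H" "H < 1" and T: "0 < T"
    and fbm: "fractional_brownian_motion M H T B"
    and hilbert: "fbm_hilbert_space H T e"
    and wiener: "wiener_map M T B e W"
begin

sublocale prob_space M using fbm by (simp add: fractional_brownian_motion_def)

abbreviation "steps \<equiv> span (e ` {0..T})"

lemma e_inner: "s \<in> {0..T} \<Longrightarrow> r \<in> {0..T} \<Longrightarrow> e s \<bullet> e r = fbm_cov H s r"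
  using hilbert by (auto simp: fbm_hilbert_space_def)

lemma B_gaussian: "finite J \<Longrightarrow> J \<subseteq> {0..T} \<Longrightarrow> centered_gaussian M (\<lambda>\<omega>. \<Sum>s\<in>J. c s * B s \<omega>)"
  using fbm by (auto simp: fractional_brownian_motion_def centered_gaussian_process_def)

lemma B_measurable: "s \<in> {0..T} \<Longrightarrow> B s \<in> borel_measurable M"
  using B_gaussian[of "{s}" "\<lambda>_. 1"] by (simp add: centered_gaussian_def)

lemma W_square_integrable: "square_integrable M (W h)"
  and W_linear: "AE \<omega> in M. W (b *\<^sub>R h + c *\<^sub>R k) \<omega> = b * W h \<omega> + c * W k \<omega>"
  and W_norm: "(\<integral>\<omega>. (W h \<omega>)\<^sup>2 \<partial>M) = (norm h)\<^sup>2"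
  and W_e: "t \<in> {0..T} \<Longrightarrow> AE \<omega> in M. W (e t) \<omega> = B t \<omega>"
  using wiener by (auto simp: wiener_map_def)

lemma W_measurable[measurable]: "W h \<in> borel_measurable M"
  using W_square_integrable by (simp add: square_integrable_def)

lemma W_sum:
  assumes "finite J"
  shows "AE \<omega> in M. W (\<Sum>i\<in>J. c i *\<^sub>R h i) \<omega> = (\<Sum>i\<in>J. c i * W (h i) \<omega>)"
  using assms
proof (induction J)
  case empty
  show ?case using W_linear[of 0 0 0 0] by simp
next
  case (insert j J)
  show ?case using insert.IH W_linear[of "c j" "h j" 1 "\<Sum>i\<in>J. c i *\<^sub>R h i"]
    by eventually_elim (use insert.hyps in simp)
qed

lemma steps_explicit:
  assumes "h \<in> steps"
  obtains J c where "finite J" "J \<subseteq> {0..T}" "h = (\<Sum>s\<in>J. c s *\<^sub>R e s)"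
proof -
  obtain t r where t: "finite t" "t \<subseteq> e ` {0..T}" "h = (\<Sum>a\<in>t. r a *\<^sub>R a)"
    using assms unfolding span_explicit by blast
  then obtain J where J: "J \<subseteq> {0..T}" "inj_on e J" "t = e ` J"
    unfolding subset_image_inj by blast
  then have "finite J" using t(1) finite_imageD by blast
  then show ?thesis using that[of J "r \<circ> e"] J t by (simp add: sum.reindex)
qed

lemma W_gaussian: "h \<in> steps \<Longrightarrow> centered_gaussian M (W h)"
proof -
  assume "h \<in> steps"
  then obtain J c where J: "finite J" "J \<subseteq> {0..T}" "h = (\<Sum>s\<in>J. c s *\<^sub>R e s)" by (rule steps_explicit)
  let ?X = "\<lambda>\<omega>. \<Sum>s\<in>J. c s * B s \<omega>"
  have "AE \<omega> in M. \<forall>s\<in>J. W (e s) \<omega> = B s \<omega>"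
    using J by (intro AE_finite_allI W_e) auto
  with W_sum[OF J(1), of c e] have ae: "AE \<omega> in M. W h \<omega> = ?X \<omega>"
    unfolding J(3) by eventually_elim simp
  have g: "centered_gaussian M ?X" using J by (rule_tac B_gaussian)
  then have [measurable]: "?X \<in> borel_measurable M" by (simp add: centered_gaussian_def)
  have "distr M lborel (W h) = distr M lborel ?X"
    using ae by (intro distr_cong_AE) auto
  moreover have "(AE \<omega> in M. W h \<omega> = 0) \<longleftrightarrow> (AE \<omega> in M. ?X \<omega> = 0)"
    using ae by (auto elim: eventually_elim2)
  ultimately show ?thesis using g unfolding centered_gaussian_def distributed_def by auto
qed

lemma W_normal:
  assumes h: "h \<in> steps" "h \<noteq> 0"
  shows "distributed M lborel (W h) (\<lambda>x. ennreal (normal_density 0 (norm h) x))"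
proof -
  have "\<not> (AE \<omega> in M. W h \<omega> = 0)"
  proof
    assume "AE \<omega> in M. W h \<omega> = 0"
    then have "(\<integral>\<omega>. (W h \<omega>)\<^sup>2 \<partial>M) = 0" by (intro integral_eq_zero_AE) (auto elim: eventually_mono)
    then show False using h W_norm[of h] by simp
  qed
  then obtain \<sigma> where \<sigma>: "\<sigma> > 0" "distributed M lborel (W h) (\<lambda>x. ennreal (normal_density 0 \<sigma> x))"
    using W_gaussian[OF h(1)] by (auto simp: centered_gaussian_def)
  have "variance (W h) = \<sigma>\<^sup>2" "expectation (W h) = 0"
    using normal_distributed_variance[OF \<sigma>] normal_distributed_expectation[OF \<sigma>] by auto
  then have "\<sigma>\<^sup>2 = (norm h)\<^sup>2" using W_norm[of h] by simp
  then have "\<sigma> = norm h" using \<sigma> by (simp add: power2_eq_iff_nonneg)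
  then show ?thesis using \<sigma> by simp
qed

lemma W_char:
  assumes h: "h \<in> steps"
  shows "(\<integral>\<omega>. cos (W h \<omega>) \<partial>M) = exp (- (norm h)\<^sup>2 / 2)" "(\<integral>\<omega>. sin (W h \<omega>) \<partial>M) = 0"
proof -
  have "(\<integral>\<omega>. cos (W h \<omega>) \<partial>M) = exp (- (norm h)\<^sup>2 / 2) \<and> (\<integral>\<omega>. sin (W h \<omega>) \<partial>M) = 0"
  proof (cases "h = 0")
    case True
    have ae: "AE \<omega> in M. W h \<omega> = 0" using W_linear[of 0 0 0 0] True by simp
    have "(\<integral>\<omega>. cos (W h \<omega>) \<partial>M) = (\<integral>\<omega>. 1 \<partial>M)" "(\<integral>\<omega>. sin (W h \<omega>) \<partial>M) = (\<integral>\<omega>. 0 \<partial>M)"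
      by (intro integral_cong_AE; use ae in \<open>auto elim: eventually_mono\<close>)+
    then show ?thesis using True by (simp add: prob_space)
  next
    case False
    note d = W_normal[OF h False]
    have "(\<integral>\<omega>. g (W h \<omega>) \<partial>M) = (\<integral>x. normal_density 0 (norm h) x * g x \<partial>lborel)" if "g \<in> borel_measurable borel"
        for g :: "real \<Rightarrow> real"
      using distributed_integral[OF d, of g] that by simp
    then show ?thesis using fourier_normal_density(3,4)[of "norm h" 1] False by simp
  qed
  then show "(\<integral>\<omega>. cos (W h \<omega>) \<partial>M) = exp (- (norm h)\<^sup>2 / 2)" "(\<integral>\<omega>. sin (W h \<omega>) \<partial>M) = 0" by auto
qed

lemma bounded_integrable: "f \<in> borel_measurable M \<Longrightarrow> (\<And>x. \<bar>f x\<bar> \<le> C) \<Longrightarrow> integrable M (f :: 'a \<Rightarrow> real)"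
  by (rule integrable_const_bound[where B=C]) auto

lemma W_char_product:
  assumes k: "k \<in> steps" and h: "h \<in> steps" and o: "k \<bullet> h = 0"
  shows "(\<integral>\<omega>. cos (W h \<omega>) * cos (l * W k \<omega>) \<partial>M) = (\<integral>\<omega>. cos (W h \<omega>) \<partial>M) * (\<integral>\<omega>. cos (l * W k \<omega>) \<partial>M)"
    "(\<integral>\<omega>. cos (W h \<omega>) * sin (l * W k \<omega>) \<partial>M) = 0"
    "(\<integral>\<omega>. sin (W h \<omega>) * cos (l * W k \<omega>) \<partial>M) = 0"
    "(\<integral>\<omega>. sin (W h \<omega>) * sin (l * W k \<omega>) \<partial>M) = 0"
    "(\<integral>\<omega>. sin (l * W k \<omega>) \<partial>M) = 0"
proof -
  let ?p = "1 *\<^sub>R h + l *\<^sub>R k" and ?m = "1 *\<^sub>R h + (-l) *\<^sub>R k" and ?q = "l *\<^sub>R k"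
  have st: "?p \<in> steps" "?m \<in> steps" "?q \<in> steps" using k h
      by (auto intro!: span_add span_diff span_scale span_neg span_zero)
  have n: "(norm ?p)\<^sup>2 = (norm h)\<^sup>2 + (norm ?q)\<^sup>2" "(norm ?m)\<^sup>2 = (norm h)\<^sup>2 + (norm ?q)\<^sup>2"
    unfolding power2_norm_eq_inner using o
        by (simp_all add: inner_add_left inner_add_right inner_diff_left inner_diff_right inner_commute)
  have "AE \<omega> in M. W (l *\<^sub>R k) \<omega> = l * W k \<omega>" using W_linear[of l k 0 k] by simp
  note ae = W_linear[of 1 h l k] W_linear[of 1 h "-l" k] this
  have q: "(\<integral>\<omega>. g (W h \<omega>) * f (l * W k \<omega>) \<partial>M) = (\<integral>\<omega>. (a (W ?p \<omega>) + s * a (W ?m \<omega>)) / 2 \<partial>M)"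
    if [measurable]: "g \<in> borel_measurable borel" "f \<in> borel_measurable borel" "a \<in> borel_measurable borel"
      and e: "\<And>x y. g x * f y = (a (x + y) + s * a (x - y)) / 2" for g f a :: "real \<Rightarrow> real" and s
  proof (intro integral_cong_AE)
    show "AE \<omega> in M. g (W h \<omega>) * f (l * W k \<omega>) = (a (W ?p \<omega>) + s * a (W ?m \<omega>)) / 2"
      using ae(1,2) by eventually_elim (simp add: e)
  qed auto
  have i: "integrable M (\<lambda>\<omega>. cos (W h \<omega>))" "integrable M (\<lambda>\<omega>. sin (W h \<omega>))" for h
    by (auto intro!: bounded_integrable[where C=1])
  have r: "(\<integral>\<omega>. cos (l * W k \<omega>) \<partial>M) = exp (- (norm ?q)\<^sup>2 / 2)" "(\<integral>\<omega>. sin (l * W k \<omega>) \<partial>M) = 0"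
  proof -
    have "(\<integral>\<omega>. cos (l * W k \<omega>) \<partial>M) = (\<integral>\<omega>. cos (W ?q \<omega>) \<partial>M)" "(\<integral>\<omega>. sin (l * W k \<omega>) \<partial>M) = (\<integral>\<omega>. sin (W ?q \<omega>) \<partial>M)"
      using ae(3) by (auto intro!: integral_cong_AE elim!: eventually_mono)
    then show "(\<integral>\<omega>. cos (l * W k \<omega>) \<partial>M) = exp (- (norm ?q)\<^sup>2 / 2)" "(\<integral>\<omega>. sin (l * W k \<omega>) \<partial>M) = 0"
      using W_char[OF st(3)] by auto
  qed
  show "(\<integral>\<omega>. sin (l * W k \<omega>) \<partial>M) = 0" by (rule r)
  show "(\<integral>\<omega>. cos (W h \<omega>) * cos (l * W k \<omega>) \<partial>M) = (\<integral>\<omega>. cos (W h \<omega>) \<partial>M) * (\<integral>\<omega>. cos (l * W k \<omega>) \<partial>M)"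
    unfolding r W_char[OF h]
    by (subst q[of cos cos cos 1])
      (auto simp: cos_add cos_diff W_char[OF st(1)[simplified]] W_char[OF st(2)[simplified]] i n[simplified]
          add_divide_distrib exp_add[symmetric] simp del: scaleR_zero_left)
  show "(\<integral>\<omega>. cos (W h \<omega>) * sin (l * W k \<omega>) \<partial>M) = 0"
    by (subst q[of cos sin sin "-1"])
        (auto simp: sin_add sin_diff W_char[OF st(1)[simplified]] W_char[OF st(2)[simplified]] i)
  show "(\<integral>\<omega>. sin (W h \<omega>) * cos (l * W k \<omega>) \<partial>M) = 0"
    by (subst q[of sin cos sin 1]) (auto simp: sin_add sin_diff W_char[OF st(1)[simplified]]
        W_char[OF st(2)[simplified]] i)
  show "(\<integral>\<omega>. sin (W h \<omega>) * sin (l * W k \<omega>) \<partial>M) = 0"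
    by (subst q[of sin sin "\<lambda>x. - cos x" "-1"])
        (auto simp: cos_add cos_diff W_char[OF st(1)[simplified]] W_char[OF st(2)[simplified]] i n[simplified]
        simp del: scaleR_zero_left)
qed

lemma W_family_measurable[measurable]: "(\<lambda>\<omega> i. W (h i) \<omega>) \<in> borel_measurable M" for h :: "nat \<Rightarrow> 'h"
  by (rule measurable_coordinatewise_then_product) simp

lemma W_independent:
  fixes h :: "nat \<Rightarrow> 'h"
  assumes k: "k \<in> steps" and h: "\<And>i. h i \<in> steps" and o: "\<And>i. k \<bullet> h i = 0"
  shows "distr M borel (W k) \<Otimes>\<^sub>M distr M borel (\<lambda>\<omega> i. W (h i) \<omega>) =
    distr M (borel \<Otimes>\<^sub>M borel) (\<lambda>\<omega>. (W k \<omega>, \<lambda>i. W (h i) \<omega>))"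
proof (rule pair_measure_eqI)
  let ?V = "\<lambda>\<omega> i. W (h i) \<omega>"
  show "sigma_finite_measure (distr M borel (W k))" "sigma_finite_measure (distr M borel ?V)"
    by (auto intro!: prob_space_imp_sigma_finite prob_space_distr)
  show "sets (distr M borel (W k) \<Otimes>\<^sub>M distr M borel ?V) = sets (distr M (borel \<Otimes>\<^sub>M borel) (\<lambda>\<omega>. (W k \<omega>, ?V \<omega>)))"
    by simp
  fix A :: "real set" and S :: "(nat \<Rightarrow> real) set"
  assume "A \<in> sets (distr M borel (W k))" "S \<in> sets (distr M borel ?V)"
  then have [measurable]: "A \<in> sets borel" "S \<in> sets borel" by auto
  define D where "D \<omega> = indicator A (W k \<omega>) - prob (W k -` A \<inter> space M)" for \<omega>
  have pA: "(\<integral>\<omega>. indicator A (W k \<omega>) \<partial>M) = prob (W k -` A \<inter> space M)"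
  proof -
    have "(\<integral>\<omega>. (indicator A (W k \<omega>) :: real) \<partial>M) = (\<integral>\<omega>. indicator (W k -` A \<inter> space M) \<omega> \<partial>M)"
      by (intro Bochner_Integration.integral_cong) (auto simp: indicator_def)
    then show ?thesis by simp
  qed
  have iA: "integrable M (\<lambda>\<omega>. indicator A (W k \<omega>) :: real)"
      by (rule bounded_integrable[where C=1]) (auto simp: indicator_def)
  have iAf: "integrable M (\<lambda>\<omega>. indicator A (W k \<omega>) * f \<omega> :: real)" if "f \<in> borel_measurable M" "\<And>\<omega>. \<bar>f \<omega>\<bar> \<le> 1"
      for f
    using that by (intro bounded_integrable[where C=1]) (auto simp: indicator_def)
  have Df: "(\<integral>\<omega>. D \<omega> * f \<omega> \<partial>M) = (\<integral>\<omega>. (f \<omega> - (\<integral>\<omega>. f \<omega> \<partial>M)) * indicator A (W k \<omega>) \<partial>M)"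
    if f: "f \<in> borel_measurable M" "\<And>\<omega>. \<bar>f \<omega>\<bar> \<le> 1" for f
  proof -
    have "integrable M f" using f by (rule bounded_integrable)
    then have "(\<integral>\<omega>. D \<omega> * f \<omega> \<partial>M) = (\<integral>\<omega>. indicator A (W k \<omega>) * f \<omega> \<partial>M) - prob (W k -` A \<inter> space M) * (\<integral>\<omega>. f \<omega> \<partial>M)"
      unfolding D_def left_diff_distrib using iAf[OF f] by simp
    also have "\<dots> = (\<integral>\<omega>. indicator A (W k \<omega>) * f \<omega> \<partial>M) - (\<integral>\<omega>. (\<integral>\<omega>. f \<omega> \<partial>M) * indicator A (W k \<omega>) \<partial>M)"
      using pA by simp
    also have "\<dots> = (\<integral>\<omega>. (f \<omega> - (\<integral>\<omega>. f \<omega> \<partial>M)) * indicator A (W k \<omega>) \<partial>M)"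
      unfolding left_diff_distrib using iAf[OF f] iA by (simp add: mult.commute)
    finally show ?thesis .
  qed
  have DW: "(\<integral>\<omega>. D \<omega> * cos (W x \<omega>) \<partial>M) = 0 \<and> (\<integral>\<omega>. D \<omega> * sin (W x \<omega>) \<partial>M) = 0"
    if x: "x \<in> steps" "k \<bullet> x = 0" for x
  proof (intro conjI)
    note pr = W_char_product[OF k x]
    have i: "integrable M (\<lambda>\<omega>. f (W x \<omega>) * g (l * W k \<omega>))" "integrable M (\<lambda>\<omega>. g (l * W k \<omega>))"
        "integrable M (\<lambda>\<omega>. g (W x \<omega>))"
      if "f \<in> {sin, cos}" "g \<in> {sin, cos}" for f g :: "real \<Rightarrow> real" and l
      using that by (auto intro!: bounded_integrable[where C=1] simp: abs_mult intro!: mult_le_one)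
    note i = i[of sin sin, simplified] i[of sin cos, simplified] i[of cos sin, simplified]
        i[of cos cos, simplified]
    show "(\<integral>\<omega>. D \<omega> * cos (W x \<omega>) \<partial>M) = 0"
      by (subst Df, simp, simp, rule char_density_unique)
        (auto simp: left_diff_distrib i pr)
    show "(\<integral>\<omega>. D \<omega> * sin (W x \<omega>) \<partial>M) = 0"
      by (subst Df, simp, simp, rule char_density_unique)
        (auto simp: left_diff_distrib i pr W_char[OF x(1)])
  qed
  have Dc: "(\<integral>\<omega>. D \<omega> * cos (\<Sum>i\<in>J. c i * W (h i) \<omega>) \<partial>M) = 0 \<and> (\<integral>\<omega>. D \<omega> * sin (\<Sum>i\<in>J. c i * W (h i) \<omega>) \<partial>M) = 0"
    if J: "finite J" for J c
  proof -
    let ?x = "\<Sum>i\<in>J. c i *\<^sub>R h i"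
    have x: "?x \<in> steps" "k \<bullet> ?x = 0" using h o by (auto intro!: span_sum span_scale simp: inner_sum_right)
    have [measurable]: "D \<in> borel_measurable M" unfolding D_def by measurable
    have "(\<integral>\<omega>. D \<omega> * cos (\<Sum>i\<in>J. c i * W (h i) \<omega>) \<partial>M) = (\<integral>\<omega>. D \<omega> * cos (W ?x \<omega>) \<partial>M)"
      "(\<integral>\<omega>. D \<omega> * sin (\<Sum>i\<in>J. c i * W (h i) \<omega>) \<partial>M) = (\<integral>\<omega>. D \<omega> * sin (W ?x \<omega>) \<partial>M)"
      using W_sum[OF J, of c h] by (auto intro!: integral_cong_AE elim!: eventually_mono)
    then show ?thesis using DW[OF x] by auto
  qed
  have iD: "integrable M D" unfolding D_def using iA by simp
  have VS: "?V -` S \<inter> space M \<in> sigma_sets (space M) {W (h i) -` A \<inter> space M | i A. i \<in> UNIV \<and> A \<in> sets borel}"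
      (is "_ \<in> sigma_sets _ ?G")
  proof -
    have G: "?G \<subseteq> Pow (space M)" by auto
    have "W (h i) \<in> borel_measurable (sigma (space M) ?G)" for i
      using G by (intro measurableI) (auto simp: space_measure_of sets_measure_of)
    then have "?V \<in> borel_measurable (sigma (space M) ?G)" by (rule measurable_coordinatewise_then_product)
    from measurable_sets[OF this, of S] show ?thesis using G by (simp add: space_measure_of sets_measure_of)
  qed
  have "(\<integral>\<omega>. D \<omega> * indicator (?V -` S \<inter> space M) \<omega> \<partial>M) = 0"
    by (rule char_density_unique_sigma[OF _ iD _ _ VS]) (use Dc in auto)
  moreover have "(\<integral>\<omega>. D \<omega> * indicator (?V -` S \<inter> space M) \<omega> \<partial>M) =
     prob ((\<lambda>\<omega>. (W k \<omega>, ?V \<omega>)) -` (A \<times> S) \<inter> space M) - prob (W k -` A \<inter> space M) * prob (?V -` S \<inter> space M)"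
  proof -
    have "(\<integral>\<omega>. D \<omega> * indicator (?V -` S \<inter> space M) \<omega> \<partial>M) =
      (\<integral>\<omega>. indicator ((\<lambda>\<omega>. (W k \<omega>, ?V \<omega>)) -` (A \<times> S) \<inter> space M) \<omega> - prob (W k -` A \<inter> space M) * indicator
          (?V -` S \<inter> space M) \<omega> \<partial>M)"
      by (intro Bochner_Integration.integral_cong) (auto simp: D_def indicator_def)
    also have "\<dots> = prob ((\<lambda>\<omega>. (W k \<omega>, ?V \<omega>)) -` (A \<times> S) \<inter> space M) -
        prob (W k -` A \<inter> space M) * prob (?V -` S \<inter> space M)"
    proof -
      have "(\<lambda>\<omega>. (W k \<omega>, ?V \<omega>)) -` (A \<times> S) \<inter> space M \<in> sets M"
          by (rule measurable_sets[of _ _ "borel \<Otimes>\<^sub>M borel"]) auto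
      moreover have "?V -` S \<inter> space M \<in> sets M" by (rule measurable_sets[of _ _ borel]) auto
      ultimately show ?thesis
        by (subst Bochner_Integration.integral_diff) (simp_all add: emeasure_eq_measure)
    qed
    finally show ?thesis .
  qed
  ultimately show "emeasure (distr M borel (W k)) A * emeasure (distr M borel ?V) S =
       emeasure (distr M (borel \<Otimes>\<^sub>M borel) (\<lambda>\<omega>. (W k \<omega>, ?V \<omega>))) (A \<times> S)"
    by (simp add: emeasure_distr emeasure_eq_measure ennreal_mult'[symmetric])
qed

end

lemma square_integrable_bounded_mult:
  fixes f g :: "'a \<Rightarrow> real"
  assumes g: "square_integrable M g" and [measurable]: "f \<in> borel_measurable M" and b: "\<And>x. \<bar>f x\<bar> \<le> C"
  shows "square_integrable M (\<lambda>x. f x * g x)"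
proof -
  have [measurable]: "g \<in> borel_measurable M" and i: "integrable M (\<lambda>x. C\<^sup>2 * (g x)\<^sup>2)"
    using g by (auto simp: square_integrable_def)
  have "(f x)\<^sup>2 \<le> C\<^sup>2" for x
    using b[of x] by (simp add: abs_le_square_iff[symmetric] order_trans[OF _ abs_ge_self])
  then have "integrable M (\<lambda>x. (f x * g x)\<^sup>2)"
    by (intro Bochner_Integration.integrable_bound[OF i])
        (auto simp: power_mult_distrib intro!: AE_I2 mult_right_mono)
  then show ?thesis by (simp add: square_integrable_def)
qed

lemma (in finite_measure) square_integrable_linear_growth:
  fixes f :: "'a \<Rightarrow> real"
  assumes f: "square_integrable M f" and [measurable]: "g \<in> borel_measurable borel"
      and b: "\<And>y. \<bar>g y\<bar> \<le> C * (1 + \<bar>y\<bar>)"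
  shows "square_integrable M (\<lambda>x. g (f x))"
proof -
  have [measurable]: "f \<in> borel_measurable M" using f by (simp add: square_integrable_def)
  have "square_integrable M (\<lambda>x. C * (1 + \<bar>f x\<bar>))"
    by (intro square_integrable_cmult square_integrable_add square_integrable_const square_integrable_abs f)
  then have i: "integrable M (\<lambda>x. (C * (1 + \<bar>f x\<bar>))\<^sup>2)" by (simp add: square_integrable_def)
  have "integrable M (\<lambda>x. (g (f x))\<^sup>2)"
    by (rule Bochner_Integration.integrable_bound[OF i])
      (auto intro!: AE_I2 abs_le_square_iff[THEN iffD1] order_trans[OF b abs_ge_self] simp del: power_mult_distrib)
  then show ?thesis by (simp add: square_integrable_def)
qed

lemma Cb_infinity_bound:
  assumes "Cb_infinity n f"
  obtains K where "\<And>x. \<bar>f x\<bar> \<le> K" "\<And>j x. j < n \<Longrightarrow> \<bar>partial_deriv j f x\<bar> \<le> K"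
proof -
  have "\<exists>K. \<forall>x. \<bar>f x\<bar> \<le> K" using Cb_infinity_D(2)[OF assms] by (auto simp: bounded_iff)
  moreover have "\<exists>K. \<forall>x. \<bar>partial_deriv j f x\<bar> \<le> K" if "j < n" for j
    using Cb_infinity_D(5)[OF assms that] by (auto simp: bounded_iff)
  ultimately obtain K0 K where K: "\<And>x. \<bar>f x\<bar> \<le> K0" "\<And>j x. j < n \<Longrightarrow> \<bar>partial_deriv j f x\<bar> \<le> K j" by metis
  have K0: "K j \<ge> 0" if "j < n" for j using K(2)[OF that] abs_ge_zero order_trans by blast
  show ?thesis
  proof (rule that[of "K0 + (\<Sum>j<n. K j)"])
    fix x show "\<bar>f x\<bar> \<le> K0 + (\<Sum>j<n. K j)" using K(1)[of x] K0 sum_nonneg[of "{..<n}" K] by auto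
    fix j assume j: "j < n"
    have "K j \<le> (\<Sum>j<n. K j)" using j K0 by (intro member_le_sum) auto
    moreover have "0 \<le> K0" using K(1) abs_ge_zero order_trans by blast
    ultimately show "\<bar>partial_deriv j f x\<bar> \<le> K0 + (\<Sum>j<n. K j)" using K(2)[OF j, of x] by linarith
  qed
qed

lemma Cb_infinity_measurable:
  assumes "Cb_infinity n f"
  shows "f \<in> borel_measurable borel" "j < n \<Longrightarrow> partial_deriv j f \<in> borel_measurable borel"
  using Cb_infinity_D(1,4)[OF assms] by (auto intro: borel_measurable_continuous_onI)

lemma Cb_infinity_partial_cong:
  assumes f: "Cb_infinity n f" and j: "j < n" and xy: "\<And>i. i < n \<Longrightarrow> x i = y i"
  shows "partial_deriv j f x = partial_deriv j f y"
proof -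
  have "f (x(j := z)) = f (y(j := z))" for z
    by (rule Cb_infinity_D(3)[OF f]) (use xy in auto)
  then show ?thesis using xy[OF j] by (simp add: partial_deriv_def)
qed

context fbm_setting
begin

lemma smooth_measurable:
  assumes "Cb_infinity n f"
  shows "(\<lambda>\<omega>. f (\<lambda>i. W (h i) \<omega>)) \<in> borel_measurable M"
    "j < n \<Longrightarrow> (\<lambda>\<omega>. partial_deriv j f (\<lambda>i. W (h i) \<omega>)) \<in> borel_measurable M"
  using Cb_infinity_measurable[OF assms] W_family_measurable measurable_compose by blast+

text \<open>Subtracting the projections onto \<open>k\<close> from the \<open>h i\<close> and \<open>x\<close> leaves variables independent of \<open>W k\<close>;
  given these, the identity is one-dimensional. The exceptional set \<open>S\<close> admits the kinks of the
  regularised logarithm.\<close>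

lemma W_integration_by_parts:
  fixes h :: "nat \<Rightarrow> 'h" and g g' :: "real \<Rightarrow> real"
  assumes k: "k \<in> steps" and h: "\<And>i. i < n \<Longrightarrow> h i \<in> steps" and x: "x \<in> steps" and f: "Cb_infinity n f"
    and S: "finite S" and g: "continuous_on UNIV g"
    and g': "\<And>y. y \<notin> S \<Longrightarrow> (g has_real_derivative g' y) (at y)"
    and [measurable]: "g' \<in> borel_measurable borel"
    and b: "\<And>y. \<bar>g y\<bar> \<le> C * (1 + \<bar>y\<bar>)" "\<And>y. \<bar>g' y\<bar> \<le> C"
  shows "(\<integral>\<omega>. W k \<omega> * (f (\<lambda>i. W (h i) \<omega>) * g (W x \<omega>)) \<partial>M) =
     (\<Sum>j<n. (k \<bullet> h j) * (\<integral>\<omega>. partial_deriv j f (\<lambda>i. W (h i) \<omega>) * g (W x \<omega>) \<partial>M)) +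
     (k \<bullet> x) * (\<integral>\<omega>. f (\<lambda>i. W (h i) \<omega>) * g' (W x \<omega>) \<partial>M)"
proof (cases "k = 0")
  case True
  have "AE \<omega> in M. W k \<omega> = 0" using W_linear[of 0 0 0 0] True by simp
  then have "(\<integral>\<omega>. W k \<omega> * (f (\<lambda>i. W (h i) \<omega>) * g (W x \<omega>)) \<partial>M) = 0"
    by (intro integral_eq_zero_AE) (auto elim: eventually_mono)
  then show ?thesis using True by simp
next
  case False
  have gm[measurable]: "g \<in> borel_measurable borel" using g by (rule borel_measurable_continuous_onI)
  note fm[measurable] = Cb_infinity_measurable(1)[OF f]
  have pm: "partial_deriv j f \<in> borel_measurable borel" if "j < n" for j
      by (rule Cb_infinity_measurable(2)[OF f that])
  obtain K where K: "\<And>x. \<bar>f x\<bar> \<le> K" "\<And>j x. j < n \<Longrightarrow> \<bar>partial_deriv j f x\<bar> \<le> K"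
    using Cb_infinity_bound[OF f] by blast
  have K0: "K \<ge> 0" using K(1) abs_ge_zero order_trans by blast
  have C0: "C \<ge> 0" using b(2) abs_ge_zero order_trans by blast
  define \<sigma> where "\<sigma> = norm k"
  have \<sigma>: "\<sigma> > 0" using False by (simp add: \<sigma>_def)
  define vec where "vec i = (if i < n then h i else if i = n then x else 0)" for i
  have vec: "vec i \<in> steps" for i using h x by (auto simp: vec_def span_zero)
  define c where "c i = (k \<bullet> vec i) / \<sigma>\<^sup>2" for i
  define h' where "h' i = vec i - c i *\<^sub>R k" for i
  have h': "h' i \<in> steps" for i using vec k by (auto simp: h'_def intro: span_diff span_scale)
  have o: "k \<bullet> h' i = 0" for i
    using \<sigma> by (simp add: h'_def inner_diff_right c_def \<sigma>_def power2_norm_eq_inner)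
  have AE: "AE \<omega> in M. \<forall>i. W (vec i) \<omega> = W (h' i) \<omega> + W k \<omega> * c i"
  proof (subst AE_all_countable, intro allI)
    fix i
    have "AE \<omega> in M. W (1 *\<^sub>R h' i + c i *\<^sub>R k) \<omega> = 1 * W (h' i) \<omega> + c i * W k \<omega>" by (rule W_linear)
    then show "AE \<omega> in M. W (vec i) \<omega> = W (h' i) \<omega> + W k \<omega> * c i"
      by (simp add: h'_def mult.commute)
  qed
  define Xi where "Xi y v = y * (f (\<lambda>i. v i + y * c i) * g (v n + y * c n)) -
     \<sigma>\<^sup>2 * ((\<Sum>j<n. c j * partial_deriv j f (\<lambda>i. v i + y * c i)) * g (v n + y * c n) +
        f (\<lambda>i. v i + y * c i) * (g' (v n + y * c n) * c n))" for y and v :: "nat \<Rightarrow> real"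
  have vm[measurable]: "(\<lambda>p. snd p i) \<in> borel_measurable (borel \<Otimes>\<^sub>M (borel :: (nat \<Rightarrow> real) measure))" for i
    by (rule measurable_compose[OF measurable_snd measurable_product_coordinates])
  have lin[measurable]: "(\<lambda>p. (\<lambda>i. snd p i + fst p * c i)) \<in> borel_measurable (borel \<Otimes>\<^sub>M borel)"
    by (rule measurable_coordinatewise_then_product, rule borel_measurable_add[OF vm]) measurable
  have pm2: "(\<lambda>p. partial_deriv j f (\<lambda>i. snd p i + fst p * c i)) \<in> borel_measurable (borel \<Otimes>\<^sub>M borel)" if "j < n"
      for j
    by (rule measurable_compose[OF lin pm[OF that]])
  have Xi_m[measurable]: "(\<lambda>p. Xi (fst p) (snd p)) \<in> borel_measurable (borel \<Otimes>\<^sub>M borel)"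
    unfolding Xi_def
    by (intro borel_measurable_diff borel_measurable_times borel_measurable_add borel_measurable_sum
        borel_measurable_const pm2)
      measurable
  have inner: "(\<integral>y. Xi y v \<partial>distr M borel (W k)) = 0" for v
  proof -
    have Xv[measurable]: "(\<lambda>y. Xi y v) \<in> borel_measurable borel"
    proof -
      have "(\<lambda>y. (y, v)) \<in> borel \<rightarrow>\<^sub>M borel \<Otimes>\<^sub>M borel" by measurable
      from measurable_compose[OF this Xi_m] show ?thesis by simp
    qed
    have l2: "(\<lambda>y::real. (\<lambda>i. v i + y * c i)) \<in> borel_measurable borel"
      by (rule measurable_coordinatewise_then_product) measurable
    have pl2: "(\<lambda>y. partial_deriv j f (\<lambda>i. v i + y * c i)) \<in> borel_measurable borel" if "j < n" for j
      by (rule measurable_compose[OF l2 pm[OF that]])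
    have fl2: "(\<lambda>y. f (\<lambda>i. v i + y * c i)) \<in> borel_measurable borel"
      by (rule measurable_compose[OF l2 fm])
    have "(\<integral>y. Xi y v \<partial>distr M borel (W k)) = (\<integral>\<omega>. Xi (W k \<omega>) v \<partial>M)"
      by (rule integral_distr) auto
    also have "\<dots> = (\<integral>y. normal_density 0 \<sigma> y * Xi y v \<partial>lborel)"
      using distributed_integral[OF W_normal[OF k False], of "\<lambda>y. Xi y v"] by (simp add: \<sigma>_def)
    also have "\<dots> = (\<integral>y. normal_density 0 \<sigma> y * (y * (f (\<lambda>i. v i + y * c i) * g (v n + y * c n)) -
      \<sigma>\<^sup>2 * ((\<Sum>j<n. c j * partial_deriv j f (\<lambda>i. v i + y * c i)) * g (v n + y * c n) +
        f (\<lambda>i. v i + y * c i) * (g' (v n + y * c n) * c n))) \<partial>lborel)" by (simp add: Xi_def)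
    also have "\<dots> = 0"
    proof (rule gaussian_integration_by_parts[OF \<sigma>])
      let ?Q = "if c n = 0 then {} else (\<lambda>s. (s - v n) / c n) ` S"
      show "finite ?Q" using S by simp
      have gl: "((\<lambda>y. g (v n + y * c n)) has_real_derivative g' (v n + y * c n) * c n) (at y)" if "y \<notin> ?Q" for y
      proof (cases "c n = 0")
        case False
        then have "v n + y * c n \<notin> S" using that by (auto simp: image_iff field_simps)
        then show ?thesis by (intro DERIV_chain2[OF g']) (auto intro!: derivative_eq_intros)
      qed simp
      show "((\<lambda>y. f (\<lambda>i. v i + y * c i) * g (v n + y * c n)) has_real_derivative
         (\<Sum>j<n. c j * partial_deriv j f (\<lambda>i. v i + y * c i)) * g (v n + y * c n) +
        f (\<lambda>i. v i + y * c i) * (g' (v n + y * c n) * c n)) (at y)" if "y \<notin> ?Q" for y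
        using DERIV_mult[OF Cb_infinity_line_derivative[OF f, of v c y] gl[OF that]]
        by (simp add: mult.commute)
      have "continuous_on UNIV (\<lambda>y. f (\<lambda>i. v i + y * c i))"
        using DERIV_isCont[OF Cb_infinity_line_derivative[OF f, of v c]]
            by (simp add: continuous_at_imp_continuous_on)
      moreover have "continuous_on UNIV (\<lambda>y. g (v n + y * c n))"
        by (rule continuous_on_compose2[OF g]) (auto intro!: continuous_intros)
      ultimately show "continuous_on UNIV (\<lambda>y. f (\<lambda>i. v i + y * c i) * g (v n + y * c n))"
        by (intro continuous_intros)
      show "(\<lambda>y. (\<Sum>j<n. c j * partial_deriv j f (\<lambda>i. v i + y * c i)) * g (v n + y * c n) +
        f (\<lambda>i. v i + y * c i) * (g' (v n + y * c n) * c n)) \<in> borel_measurable borel"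
        by (intro borel_measurable_times borel_measurable_add borel_measurable_sum borel_measurable_const pl2 fl2)
            measurable
      let ?L = "C * (1 + \<bar>v n\<bar> + \<bar>c n\<bar>)" and ?s = "\<Sum>j<n. \<bar>c j\<bar> * K"
      let ?E = "K * ?L + ?s * ?L + K * (C * \<bar>c n\<bar>)"
      have s0: "?s \<ge> 0" using K0 by (intro sum_nonneg) auto
      have gb: "\<bar>g (v n + y * c n)\<bar> \<le> ?L * (1 + \<bar>y\<bar>)" for y
      proof -
        have "\<bar>g (v n + y * c n)\<bar> \<le> C * (1 + \<bar>v n + y * c n\<bar>)" by (rule b)
        also have "\<dots> \<le> C * (1 + (\<bar>v n\<bar> + \<bar>y\<bar> * \<bar>c n\<bar>))"
          using C0 abs_triangle_ineq[of "v n" "y * c n"]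
              by (intro mult_left_mono add_left_mono) (auto simp: abs_mult)
        also have "\<dots> \<le> C * ((1 + \<bar>v n\<bar> + \<bar>c n\<bar>) * (1 + \<bar>y\<bar>))"
          using C0 by (intro mult_left_mono) (auto simp: algebra_simps)
        finally show ?thesis by (simp add: mult.assoc)
      qed
      have sb: "\<bar>\<Sum>j<n. c j * partial_deriv j f w\<bar> \<le> ?s" for w
        by (rule order_trans[OF sum_abs sum_mono]) (auto simp: abs_mult intro!: mult_left_mono K)
      have L0: "0 \<le> ?L" using C0 by simp
      fix y
      have "\<bar>f (\<lambda>i. v i + y * c i) * g (v n + y * c n)\<bar> \<le> K * (?L * (1 + \<bar>y\<bar>))"
        unfolding abs_mult using K gb[of y] K0 by (intro mult_mono) auto
      also have "\<dots> \<le> ?E * (1 + \<bar>y\<bar>)"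
        unfolding mult.assoc[symmetric, of K] using s0 L0 K0 C0
        by (intro mult_right_mono) (auto simp: add.assoc)
      finally show "\<bar>f (\<lambda>i. v i + y * c i) * g (v n + y * c n)\<bar> \<le> ?E * (1 + \<bar>y\<bar>)" .
      have "\<bar>(\<Sum>j<n. c j * partial_deriv j f (\<lambda>i. v i + y * c i)) * g (v n + y * c n) +
        f (\<lambda>i. v i + y * c i) * (g' (v n + y * c n) * c n)\<bar> \<le> ?s * (?L * (1 + \<bar>y\<bar>)) + K * (C * \<bar>c n\<bar>)"
        by (rule order_trans[OF abs_triangle_ineq add_mono], unfold abs_mult; intro mult_mono sb gb K b)
          (use s0 K0 C0 in auto)
      also have "\<dots> \<le> ?s * (?L * (1 + \<bar>y\<bar>)) + K * (C * \<bar>c n\<bar>) * (1 + \<bar>y\<bar>) + K * (?L * (1 + \<bar>y\<bar>))"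
        using K0 C0 L0 by (auto simp: distrib_left intro!: add_nonneg_nonneg mult_nonneg_nonneg)
      also have "\<dots> = ?E * (1 + \<bar>y\<bar>)" by (simp add: algebra_simps)
      finally show "\<bar>(\<Sum>j<n. c j * partial_deriv j f (\<lambda>i. v i + y * c i)) * g (v n + y * c n) +
        f (\<lambda>i. v i + y * c i) * (g' (v n + y * c n) * c n)\<bar> \<le> ?E * (1 + \<bar>y\<bar>)" .
    qed
    finally show ?thesis .
  qed
  let ?N1 = "distr M borel (W k)" and ?V = "\<lambda>\<omega> i. W (h' i) \<omega>"
  let ?N2 = "distr M borel ?V"
  let ?G = "\<lambda>\<omega>. f (\<lambda>i. W (h i) \<omega>)" and ?D = "\<lambda>j \<omega>. partial_deriv j f (\<lambda>i. W (h i) \<omega>)"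
  have Gm[measurable]: "?G \<in> borel_measurable M" by (rule smooth_measurable(1)[OF f])
  have Dm: "?D j \<in> borel_measurable M" if "j < n" for j by (rule smooth_measurable(2)[OF f that])
  have XiV: "AE \<omega> in M. Xi (W k \<omega>) (?V \<omega>) = W k \<omega> * (?G \<omega> * g (W x \<omega>)) -
     \<sigma>\<^sup>2 * ((\<Sum>j<n. c j * (?D j \<omega> * g (W x \<omega>))) + c n * (?G \<omega> * g' (W x \<omega>)))"
    using AE
  proof eventually_elim
    case (elim \<omega>)
    have "W (h' n) \<omega> + W k \<omega> * c n = W x \<omega>" using elim[rule_format, of n] by (simp add: vec_def)
    moreover have "f (\<lambda>i. W (h' i) \<omega> + W k \<omega> * c i) = ?G \<omega>"
      using elim by (intro Cb_infinity_D(3)[OF f]) (metis vec_def)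
    moreover have "partial_deriv j f (\<lambda>i. W (h' i) \<omega> + W k \<omega> * c i) = ?D j \<omega>" if "j < n" for j
      using elim by (intro Cb_infinity_partial_cong[OF f that]) (metis vec_def)
    ultimately show ?case unfolding Xi_def
      by (simp add: sum_distrib_right mult.assoc)
  qed
  have sg: "square_integrable M (\<lambda>\<omega>. g (W x \<omega>))"
    by (rule square_integrable_linear_growth[OF W_square_integrable _ b(1)]) simp
  have i1: "integrable M (\<lambda>\<omega>. W k \<omega> * (?G \<omega> * g (W x \<omega>)))"
    by (intro square_integrable_mult W_square_integrable square_integrable_bounded_mult[OF sg _ K(1)] Gm)
  have i2: "integrable M (\<lambda>\<omega>. ?D j \<omega> * g (W x \<omega>))" if "j < n" for j
    by (intro square_integrable_integrable square_integrable_bounded_mult[OF sg _ K(2)[OF that]] Dm that)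
  have i3: "integrable M (\<lambda>\<omega>. ?G \<omega> * g' (W x \<omega>))"
    by (rule bounded_integrable[where C="K * C"]) (auto simp: abs_mult intro!: mult_mono K b K0)
  have iR: "integrable M (\<lambda>\<omega>. W k \<omega> * (?G \<omega> * g (W x \<omega>)) -
     \<sigma>\<^sup>2 * ((\<Sum>j<n. c j * (?D j \<omega> * g (W x \<omega>))) + c n * (?G \<omega> * g' (W x \<omega>))))"
    using i1 i2 i3 by (auto intro!: Bochner_Integration.integrable_diff Bochner_Integration.integrable_add
        Bochner_Integration.integrable_sum integrable_mult_right)
  have XV[measurable]: "(\<lambda>\<omega>. Xi (W k \<omega>) (?V \<omega>)) \<in> borel_measurable M"
  proof -
    have "(\<lambda>\<omega>. (W k \<omega>, ?V \<omega>)) \<in> M \<rightarrow>\<^sub>M borel \<Otimes>\<^sub>M borel" by measurable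
    from measurable_compose[OF this Xi_m] show ?thesis by simp
  qed
  have iXV: "integrable M (\<lambda>\<omega>. Xi (W k \<omega>) (?V \<omega>))"
    using iR XiV by (subst integrable_cong_AE[OF _ _ XiV]) (auto dest: borel_measurable_integrable)
  interpret N: pair_sigma_finite ?N1 ?N2
    by (auto intro!: pair_sigma_finite.intro prob_space_imp_sigma_finite prob_space_distr)
  have ind: "?N1 \<Otimes>\<^sub>M ?N2 = distr M (borel \<Otimes>\<^sub>M borel) (\<lambda>\<omega>. (W k \<omega>, ?V \<omega>))"
    by (rule W_independent[OF k h' o])
  have Xm2: "case_prod Xi \<in> borel_measurable (borel \<Otimes>\<^sub>M borel)" using Xi_m by (simp add: case_prod_beta')
  have iP: "integrable (?N1 \<Otimes>\<^sub>M ?N2) (case_prod Xi)"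
    unfolding ind using iXV Xm2 by (subst integrable_distr_eq) auto
  have "(\<integral>\<omega>. Xi (W k \<omega>) (?V \<omega>) \<partial>M) = integral\<^sup>L (?N1 \<Otimes>\<^sub>M ?N2) (case_prod Xi)"
    unfolding ind using Xm2 by (subst integral_distr) auto
  also have "\<dots> = (\<integral>v. (\<integral>y. Xi y v \<partial>?N1) \<partial>?N2)"
    using N.integral_snd[OF iP] by simp
  also have "\<dots> = 0" by (simp add: inner)
  finally have "(\<integral>\<omega>. W k \<omega> * (?G \<omega> * g (W x \<omega>)) -
     \<sigma>\<^sup>2 * ((\<Sum>j<n. c j * (?D j \<omega> * g (W x \<omega>))) + c n * (?G \<omega> * g' (W x \<omega>))) \<partial>M) = 0"
    using integral_cong_AE[OF XV _ XiV] iR by (auto dest: borel_measurable_integrable)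
  moreover have "(\<integral>\<omega>. W k \<omega> * (?G \<omega> * g (W x \<omega>)) -
     \<sigma>\<^sup>2 * ((\<Sum>j<n. c j * (?D j \<omega> * g (W x \<omega>))) + c n * (?G \<omega> * g' (W x \<omega>))) \<partial>M) =
     (\<integral>\<omega>. W k \<omega> * (?G \<omega> * g (W x \<omega>)) \<partial>M) - \<sigma>\<^sup>2 *
         ((\<Sum>j<n. c j * (\<integral>\<omega>. ?D j \<omega> * g (W x \<omega>) \<partial>M)) + c n * (\<integral>\<omega>. ?G \<omega> * g' (W x \<omega>) \<partial>M))"
  proof -
    have iS: "integrable M (\<lambda>\<omega>. \<Sum>j<n. c j * (?D j \<omega> * g (W x \<omega>)))"
      using i2 by (intro Bochner_Integration.integrable_sum integrable_mult_right) auto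
    have "(\<integral>\<omega>. (\<Sum>j<n. c j * (?D j \<omega> * g (W x \<omega>))) \<partial>M) = (\<Sum>j<n. c j * (\<integral>\<omega>. ?D j \<omega> * g (W x \<omega>) \<partial>M))"
      using i2 by (subst Bochner_Integration.integral_sum) (auto intro: integrable_mult_right)
    then show ?thesis using i1 i3 iS by simp
  qed
  moreover have "\<sigma>\<^sup>2 * c j = k \<bullet> vec j" for j using \<sigma> by (simp add: c_def)
  then have "\<sigma>\<^sup>2 * ((\<Sum>j<n. c j * I j) + c n * J) = (\<Sum>j<n. (k \<bullet> h j) * I j) + (k \<bullet> x) * J" for I J
    by (simp add: distrib_left sum_distrib_left mult.assoc[symmetric] vec_def)
  ultimately show ?thesis by simp
qed

end

section \<open>The regularised logarithm\<close>

definition reg_log :: "real \<Rightarrow> real \<Rightarrow> real" where "reg_log d x = ln (max \<bar>x\<bar> d)"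
definition reg_inv :: "real \<Rightarrow> real \<Rightarrow> real" where "reg_inv d x = (if d \<le> \<bar>x\<bar> then 1 / x else 0)"
definition reg_primitive :: "real \<Rightarrow> real \<Rightarrow> real" where
  "reg_primitive d x = (if d \<le> \<bar>x\<bar> then log_primitive x + d * sgn x else x * ln d)"

lemma reg_log_Lipschitz:
  assumes "d > 0" shows "\<bar>reg_log d x - reg_log d y\<bar> \<le> \<bar>x - y\<bar> / d"
proof -
  have *: "ln u - ln v \<le> \<bar>u - v\<bar> / d" if "u \<ge> d" "v \<ge> d" for u v
  proof -
    have "ln u - ln v \<le> (u - v) / v" using that assms by (intro ln_diff_le) auto
    also have "\<dots> \<le> \<bar>u - v\<bar> / v" using that assms by (intro divide_right_mono) auto
    also have "\<dots> \<le> \<bar>u - v\<bar> / d" using that assms by (intro divide_left_mono) auto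
    finally show ?thesis .
  qed
  have **: "\<bar>ln u - ln v\<bar> \<le> \<bar>u - v\<bar> / d" if "u \<ge> d" "v \<ge> d" for u v
    using *[OF that] *[OF that(2,1)] unfolding abs_minus_commute[of v u] by linarith
  have "\<bar>reg_log d x - reg_log d y\<bar> \<le> \<bar>max \<bar>x\<bar> d - max \<bar>y\<bar> d\<bar> / d"
    unfolding reg_log_def
    by (rule **) auto
  also have "\<dots> \<le> \<bar>x - y\<bar> / d" using assms by (intro divide_right_mono) auto
  finally show ?thesis .
qed

lemma reg_log_continuous: "d > 0 \<Longrightarrow> continuous_on A (reg_log d)"
  unfolding reg_log_def by (intro continuous_intros) (auto simp: max_def)

lemma reg_log_measurable[measurable]: "reg_log d \<in> borel_measurable borel"
  unfolding reg_log_def by measurable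

lemma reg_inv_measurable[measurable]: "reg_inv d \<in> borel_measurable borel"
  unfolding reg_inv_def by measurable

lemma reg_primitive_measurable[measurable]: "reg_primitive d \<in> borel_measurable borel"
  unfolding reg_primitive_def log_primitive_def sgn_real_def by measurable

lemma reg_inv_bound: "d > 0 \<Longrightarrow> \<bar>reg_inv d x\<bar> \<le> 1 / d"
  unfolding reg_inv_def using frac_le[of 1 1 d "\<bar>x\<bar>"] by simp

lemma reg_log_bound: "d > 0 \<Longrightarrow> \<bar>reg_log d x\<bar> \<le> (\<bar>ln d\<bar> + 1 / d) * (1 + \<bar>x\<bar>)"
proof -
  assume d: "d > 0"
  have "\<bar>reg_log d x\<bar> \<le> \<bar>ln d\<bar> + \<bar>x\<bar> / d"
    using reg_log_Lipschitz[OF d, of x 0] d by (simp add: reg_log_def[of d 0] max_def)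
  also have "\<dots> \<le> (\<bar>ln d\<bar> + 1 / d) * (1 + \<bar>x\<bar>)" using d by (simp add: algebra_simps)
  finally show ?thesis .
qed

lemma DERIV_ln_abs: "x \<noteq> 0 \<Longrightarrow> ((\<lambda>x. ln \<bar>x\<bar>) has_real_derivative 1 / x) (at x)"
proof -
  assume "x \<noteq> 0"
  then consider "x > 0" | "x < 0" by linarith
  then show ?thesis
  proof cases
    case 1
    have "(ln has_real_derivative 1 / x) (at x)" using 1 by (auto intro!: derivative_eq_intros)
    then show ?thesis by (rule has_field_derivative_transform_within_open[where S="{0<..}"]) (use 1 in auto)
  next
    case 2
    have "((\<lambda>x. ln (- x)) has_real_derivative 1 / x) (at x)" using 2 by (auto intro!: derivative_eq_intros)
    then show ?thesis by (rule has_field_derivative_transform_within_open[where S="{..<0}"]) (use 2 in auto)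
  qed
qed

lemma reg_log_derivative:
  assumes d: "d > 0" and x: "x \<notin> {d, - d}"
  shows "(reg_log d has_real_derivative reg_inv d x) (at x)"
proof (cases "\<bar>x\<bar> < d")
  case True
  have "((\<lambda>x. ln d) has_real_derivative 0) (at x)" by simp
  then have "(reg_log d has_real_derivative 0) (at x)"
    by (rule has_field_derivative_transform_within_open[where S="{-d<..<d}"])
        (use True in \<open>auto simp: reg_log_def max_def\<close>)
  then show ?thesis using True by (simp add: reg_inv_def)
next
  case False
  then have *: "\<bar>x\<bar> > d" using x by auto
  have "((\<lambda>x. ln \<bar>x\<bar>) has_real_derivative 1 / x) (at x)" using * d by (intro DERIV_ln_abs) auto
  then have "(reg_log d has_real_derivative 1 / x) (at x)"
  proof (rule has_field_derivative_transform_within_open)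
    show "open {x. d < \<bar>x\<bar>}" by (intro open_Collect_less continuous_intros)
  qed (use * in \<open>auto simp: reg_log_def max_def\<close>)
  then show ?thesis using * by (simp add: reg_inv_def)
qed

lemma DERIV_log_primitive: "x \<noteq> 0 \<Longrightarrow> (log_primitive has_real_derivative ln \<bar>x\<bar>) (at x)"
  unfolding log_primitive_def[abs_def]
  by (rule DERIV_cong[OF DERIV_diff[OF DERIV_mult[OF DERIV_ident DERIV_ln_abs] DERIV_ident]]) auto

lemma reg_primitive_derivative:
  assumes d: "d > 0"
  shows "(reg_primitive d has_real_derivative reg_log d x) (at x)"
proof -
  have in': "((\<lambda>x. x * ln d) has_real_derivative ln d) (at y within A)" for y A
    by (auto intro!: derivative_eq_intros)
  have out: "((\<lambda>x. log_primitive x + k) has_real_derivative ln \<bar>y\<bar>) (at y within A)" if "y \<noteq> 0" for y k A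
    using DERIV_add[OF has_field_derivative_at_within[OF DERIV_log_primitive[OF that], of A] DERIV_const[of k]]
        by simp
  consider "\<bar>x\<bar> < d" | "\<bar>x\<bar> > d" | "x = d" | "x = - d" by linarith
  then show ?thesis
  proof cases
    case 1
    from in'[of x UNIV] have "(reg_primitive d has_real_derivative ln d) (at x)"
      by (rule has_field_derivative_transform_within_open[where S="{-d<..<d}"])
          (use 1 in \<open>auto simp: reg_primitive_def\<close>)
    then show ?thesis using 1 by (simp add: reg_log_def max_def)
  next
    case 2
    from out[of x "d * sgn x" UNIV] have "((\<lambda>y. log_primitive y + d * sgn x) has_real_derivative ln \<bar>x\<bar>) (at x)"
        using 2 d by auto
    then have "(reg_primitive d has_real_derivative ln \<bar>x\<bar>) (at x)"
    proof (rule has_field_derivative_transform_within_open)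
      show "open ({x. d < \<bar>x\<bar>} \<inter> {y. 0 < y * x})" by (intro open_Int open_Collect_less continuous_intros)
      show "x \<in> {x. d < \<bar>x\<bar>} \<inter> {y. 0 < y * x}" using 2 d by (auto simp: zero_less_mult_iff)
    qed (use 2 d in \<open>auto simp: reg_primitive_def zero_less_mult_iff\<close>)
    then show ?thesis using 2 by (simp add: reg_log_def max_def)
  next
    case 3
    have "(reg_primitive d has_real_derivative ln d) (at d within {..d})"
      by (rule has_field_derivative_transform_within[OF in', of d])
          (use d in \<open>auto simp: reg_primitive_def log_primitive_def dist_real_def\<close>)
    moreover have "(reg_primitive d has_real_derivative ln d) (at d within {d..})"
    proof (rule has_field_derivative_transform_within[of _ _ _ _ d])
      show "((\<lambda>x. log_primitive x + d) has_real_derivative ln d) (at d within {d..})"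
        using out[of d d "{d..}"] d by simp
    qed (use d in \<open>auto simp: reg_primitive_def\<close>)
    ultimately have "(reg_primitive d has_real_derivative ln d) (at d within {..d} \<union> {d..})"
      unfolding has_field_derivative_iff by (rule Lim_Un)
    moreover have "{..d} \<union> {d..} = UNIV" by auto
    ultimately show ?thesis using 3 d by (simp add: reg_log_def)
  next
    case 4
    have "(reg_primitive d has_real_derivative ln d) (at (-d) within {-d..})"
    proof (rule has_field_derivative_transform_within[OF in', of d])
      fix x assume "x \<in> {-d..}" "dist x (-d) < d"
      then have "x = - d \<or> \<bar>x\<bar> < d" using d by (auto simp: dist_real_def)
      then show "x * ln d = reg_primitive d x" using d by (auto simp: reg_primitive_def log_primitive_def)
    qed (use d in auto)
    moreover have "(reg_primitive d has_real_derivative ln d) (at (-d) within {..-d})"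
    proof (rule has_field_derivative_transform_within[of _ _ _ _ d])
      show "((\<lambda>x. log_primitive x + - d) has_real_derivative ln d) (at (-d) within {..-d})"
        using out[of "-d" "-d" "{..-d}"] d by simp
    qed (use d in \<open>auto simp: reg_primitive_def\<close>)
    ultimately have "(reg_primitive d has_real_derivative ln d) (at (-d) within {-d..} \<union> {..-d})"
      unfolding has_field_derivative_iff by (rule Lim_Un)
    moreover have "{-d..} \<union> {..-d} = UNIV" by auto
    ultimately show ?thesis using 4 d by (simp add: reg_log_def)
  qed
qed

lemma reg_primitive_taylor:
  assumes d: "d > 0"
  shows "\<bar>reg_primitive d x - reg_primitive d y - reg_log d y * (x - y)\<bar> \<le> (x - y)\<^sup>2 / d"
proof (cases "x = y")
  case False
  have "\<exists>z. \<bar>z - y\<bar> \<le> \<bar>x - y\<bar> \<and> reg_primitive d x - reg_primitive d y = (x - y) * reg_log d z"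
  proof (cases "x < y")
    case True
    from MVT2[OF this, of "reg_primitive d" "reg_log d"] reg_primitive_derivative[OF d]
    obtain z where "x < z" "z < y" "reg_primitive d y - reg_primitive d x = (y - x) * reg_log d z" by blast
    then show ?thesis by (intro exI[of _ z]) (auto simp: algebra_simps)
  next
    case F: False
    then have "y < x" using False by simp
    from MVT2[OF this, of "reg_primitive d" "reg_log d"] reg_primitive_derivative[OF d]
    obtain z where "y < z" "z < x" "reg_primitive d x - reg_primitive d y = (x - y) * reg_log d z" by blast
    then show ?thesis by (intro exI[of _ z]) auto
  qed
  then obtain z where z: "\<bar>z - y\<bar> \<le> \<bar>x - y\<bar>" "reg_primitive d x - reg_primitive d y = (x - y) * reg_log d z"
      by blast
  have "\<bar>reg_primitive d x - reg_primitive d y - reg_log d y * (x - y)\<bar> = \<bar>x - y\<bar> * \<bar>reg_log d z - reg_log d y\<bar>"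
    unfolding z(2) abs_mult[symmetric] by (simp add: algebra_simps)
  also have "\<dots> \<le> \<bar>x - y\<bar> * (\<bar>x - y\<bar> / d)"
    using reg_log_Lipschitz[OF d, of z y] z(1) d
        by (intro mult_left_mono order_trans[OF reg_log_Lipschitz[OF d]] divide_right_mono) auto
  finally show ?thesis by (simp add: power2_eq_square flip: abs_mult)
qed simp

lemma reg_primitive_close:
  assumes d: "d > 0"
  shows "\<bar>reg_primitive d x - log_primitive x\<bar> \<le> d"
proof (cases "d \<le> \<bar>x\<bar>")
  case True
  then show ?thesis using d by (auto simp: reg_primitive_def abs_mult sgn_if)
next
  case False
  show ?thesis
  proof (cases "x = 0")
    case True then show ?thesis using d by (simp add: reg_primitive_def log_primitive_def)
  next
    case x: False
    have "reg_primitive d x - log_primitive x = x * (ln (d / \<bar>x\<bar>) + 1)"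
      using False x d by (simp add: reg_primitive_def log_primitive_def ln_div algebra_simps)
    moreover have "ln (d / \<bar>x\<bar>) + 1 \<le> d / \<bar>x\<bar>"
      using ln_le_minus_one[of "d / \<bar>x\<bar>"] x d by simp
    moreover have "ln (d / \<bar>x\<bar>) \<ge> 0" using False x d by (intro ln_ge_zero) (simp add: field_simps)
    ultimately have "\<bar>reg_primitive d x - log_primitive x\<bar> \<le> \<bar>x\<bar> * (d / \<bar>x\<bar>)"
      by (simp only: abs_mult, intro mult_left_mono) (simp_all only: abs_of_nonneg abs_ge_zero)
    then show ?thesis using x by simp
  qed
qed

lemma reg_log_close:
  assumes "0 < d" "d \<le> 1" "x \<noteq> 0"
  shows "\<bar>reg_log d x - ln \<bar>x\<bar>\<bar> \<le> (if \<bar>x\<bar> < d then \<bar>ln \<bar>x\<bar>\<bar> else 0)"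
  using assms by (auto simp: reg_log_def max_def ln_less_cancel_iff abs_if)

lemma reg_primitive_bound: "\<bar>reg_primitive 1 x\<bar> \<le> \<bar>x\<bar> + x\<^sup>2"
proof -
  have "\<bar>reg_primitive 1 x - reg_primitive 1 0 - reg_log 1 0 * (x - 0)\<bar> \<le> (x - 0)\<^sup>2 / 1"
      by (rule reg_primitive_taylor) simp
  then show ?thesis by (simp add: reg_primitive_def[of 1 0] reg_log_def)
qed

section \<open>The Ito formula for the regularised logarithm\<close>

definition cov_slope :: "real \<Rightarrow> real \<Rightarrow> real \<Rightarrow> real" where
  "cov_slope H r s = H * (s powr (2*H-1) + sgn (r - s) * \<bar>r - s\<bar> powr (2*H-1))"

lemma fbm_cov_derivative:
  assumes "1/2 < H" "s > 0"
  shows "((\<lambda>s. fbm_cov H s r) has_real_derivative cov_slope H r s) (at s)"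
proof -
  have "((\<lambda>s. \<bar>r - s\<bar> powr (2*H)) has_real_derivative 2*H * sgn (r - s) * \<bar>r - s\<bar> powr (2*H-1) * (-1)) (at s)"
    by (rule DERIV_chain2[OF has_real_derivative_abs_powr]) (use assms in \<open>auto intro!: derivative_eq_intros\<close>)
  moreover have "((\<lambda>s. s powr (2*H)) has_real_derivative 2*H * s powr (2*H-1)) (at s)"
    using assms by (intro has_real_derivative_powr) auto
  ultimately have "((\<lambda>s. (s powr (2*H) + r powr (2*H) - \<bar>r - s\<bar> powr (2*H)) / 2) has_real_derivative
      (2*H * s powr (2*H-1) + 0 - 2*H * sgn (r - s) * \<bar>r - s\<bar> powr (2*H-1) * (-1)) / 2) (at s)"
    by (intro DERIV_cdivide DERIV_diff DERIV_add DERIV_const)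
  then show ?thesis
    unfolding fbm_cov_def cov_slope_def by (rule DERIV_cong) (simp add: field_simps)
qed

lemma cov_slope_measurable[measurable]: "cov_slope H r \<in> borel_measurable borel"
  unfolding cov_slope_def sgn_real_def by measurable

lemma cov_slope_bound:
  assumes "1/2 < H" "s \<in> {0..T}" "r \<in> {0..T}"
  shows "\<bar>cov_slope H r s\<bar> \<le> 2 * H * T powr (2*H-1)"
proof -
  have "\<bar>s powr (2*H-1) + sgn (r - s) * \<bar>r - s\<bar> powr (2*H-1)\<bar> \<le> s powr (2*H-1) + \<bar>r - s\<bar> powr (2*H-1)"
    by (rule order_trans[OF abs_triangle_ineq]) (auto simp: abs_mult abs_sgn_eq)
  also have "\<dots> \<le> T powr (2*H-1) + T powr (2*H-1)"
    using assms by (intro add_mono powr_mono2) auto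
  finally show ?thesis using assms by (simp add: cov_slope_def abs_mult)
qed

context fbm_setting
begin

lemma e_increment_norm:
  assumes "s \<in> {0..T}" "r \<in> {0..T}"
  shows "(norm (e r - e s))\<^sup>2 = \<bar>r - s\<bar> powr (2*H)"
  using assms by (simp add: power2_norm_eq_inner inner_diff_left inner_diff_right e_inner fbm_cov_def
      abs_minus_commute field_simps)

lemma e_steps: "s \<in> {0..T} \<Longrightarrow> e s \<in> steps"
  by (auto intro: span_base)

text \<open>\<open>\<rho>\<close> is the kernel against which an element represented by a function has to be integrated to
  give its inner product with \<open>\<phi>\<close>.\<close>

definition slope :: "'h \<Rightarrow> (real \<Rightarrow> real) \<Rightarrow> bool" where
  "slope \<phi> \<rho> \<longleftrightarrow> \<rho> \<in> borel_measurable borel \<and> (\<exists>K. \<forall>s. \<bar>\<rho> s\<bar> \<le> K) \<and>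
     (\<forall>s\<in>{0<..<T}. ((\<lambda>r. e r \<bullet> \<phi>) has_real_derivative \<rho> s) (at s))"

lemma slope_e:
  assumes q: "q \<in> {0..T}"
  shows "slope (e q) (\<lambda>s. indicator {0..T} s * cov_slope H q s)"
  unfolding slope_def
proof (intro conjI ballI)
  show "\<exists>K. \<forall>s. \<bar>indicator {0..T} s * cov_slope H q s\<bar> \<le> K"
    using cov_slope_bound[OF H(1) _ q] H(1)
        by (intro exI[of _ "2 * H * T powr (2*H-1)"]) (auto simp: indicator_def)
  fix s assume s: "s \<in> {0<..<T}"
  have "((\<lambda>r. fbm_cov H r q) has_real_derivative cov_slope H q s) (at s)"
    using s H by (intro fbm_cov_derivative) auto
  then have "((\<lambda>r. e r \<bullet> e q) has_real_derivative cov_slope H q s) (at s)"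
    by (rule has_field_derivative_transform_within_open[where S="{0<..<T}"]) (use s q in \<open>auto simp: e_inner\<close>)
  then show "((\<lambda>r. e r \<bullet> e q) has_real_derivative indicator {0..T} s * cov_slope H q s) (at s)"
    using s by simp
qed measurable

lemma steps_slope:
  assumes "\<phi> \<in> steps"
  obtains \<rho> where "slope \<phi> \<rho>"
proof -
  obtain J c where J: "finite J" "J \<subseteq> {0..T}" "\<phi> = (\<Sum>s\<in>J. c s *\<^sub>R e s)"
    using assms by (rule steps_explicit)
  let ?r = "\<lambda>q s. indicator {0..T} s * cov_slope H q s"
  have sl: "slope (e q) (?r q)" if "q \<in> J" for q using slope_e J that by auto
  have "slope \<phi> (\<lambda>s. \<Sum>q\<in>J. c q * ?r q s)"
    unfolding slope_def
  proof (intro conjI ballI)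
    show "(\<lambda>s. \<Sum>q\<in>J. c q * ?r q s) \<in> borel_measurable borel" by measurable
    have "\<forall>q\<in>J. \<exists>K. \<forall>s. \<bar>?r q s\<bar> \<le> K" using sl by (auto simp: slope_def)
    then obtain K where K: "\<And>q s. q \<in> J \<Longrightarrow> \<bar>?r q s\<bar> \<le> K q" by metis
    have "\<bar>\<Sum>q\<in>J. c q * ?r q s\<bar> \<le> (\<Sum>q\<in>J. \<bar>c q\<bar> * K q)" for s
      by (rule order_trans[OF sum_abs sum_mono]) (use K in \<open>auto simp: abs_mult[of "c _"] intro!: mult_left_mono\<close>)
    then show "\<exists>K. \<forall>s. \<bar>\<Sum>q\<in>J. c q * ?r q s\<bar> \<le> K" by blast
    fix s assume s: "s \<in> {0<..<T}"
    have "((\<lambda>r. \<Sum>q\<in>J. c q * (e r \<bullet> e q)) has_real_derivative (\<Sum>q\<in>J. c q * ?r q s)) (at s)"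
      using sl s by (intro DERIV_sum DERIV_cmult) (auto simp: slope_def)
    then show "((\<lambda>r. e r \<bullet> \<phi>) has_real_derivative (\<Sum>q\<in>J. c q * ?r q s)) (at s)"
      by (simp add: J(3) inner_sum_right)
  qed
  then show ?thesis by (rule that)
qed

lemma e_continuous: "continuous_on {0..T} e"
  unfolding continuous_on_def
proof
  fix s assume s: "s \<in> {0..T}"
  have "((\<lambda>r. \<bar>r - s\<bar> powr (2*H)) \<longlongrightarrow> \<bar>s - s\<bar> powr (2*H)) (at s within {0..T})"
    using H by (intro tendsto_powr' tendsto_intros) auto
  then have "((\<lambda>r. sqrt (\<bar>r - s\<bar> powr (2*H))) \<longlongrightarrow> sqrt 0) (at s within {0..T})"
    by (intro tendsto_real_sqrt) simp
  moreover have "\<forall>\<^sub>F r in at s within {0..T}. sqrt (\<bar>r - s\<bar> powr (2*H)) = norm (e r - e s)"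
    unfolding eventually_at_filter
    by (intro always_eventually allI impI) (simp add: e_increment_norm[OF s, symmetric])
  ultimately have "((\<lambda>r. norm (e r - e s)) \<longlongrightarrow> 0) (at s within {0..T})"
    by (auto intro: Lim_transform_eventually)
  then show "(e \<longlongrightarrow> e s) (at s within {0..T})"
    by (simp add: tendsto_norm_zero_iff LIM_zero_iff)
qed

lemma slope_integral:
  assumes sl: "slope \<phi> \<rho>" and pq: "0 \<le> p" "p \<le> q" "q \<le> T"
  shows "(e q - e p) \<bullet> \<phi> = (\<integral>s. indicator {p..q} s * \<rho> s \<partial>lborel)"
proof -
  obtain K where K: "\<And>s. \<bar>\<rho> s\<bar> \<le> K" and [measurable]: "\<rho> \<in> borel_measurable borel"
    using sl by (auto simp: slope_def)
  have "(\<rho> has_integral (e q \<bullet> \<phi> - e p \<bullet> \<phi>)) {p..q}"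
  proof (rule fundamental_theorem_of_calculus_interior)
    show "continuous_on {p..q} (\<lambda>r. e r \<bullet> \<phi>)"
      by (intro continuous_intros continuous_on_subset[OF e_continuous]) (use pq in auto)
    show "((\<lambda>r. e r \<bullet> \<phi>) has_vector_derivative \<rho> s) (at s)" if "s \<in> {p<..<q}" for s
      using sl that pq by (auto simp: slope_def has_real_derivative_iff_has_vector_derivative)
  qed (use pq in auto)
  moreover have "set_integrable lborel {p..q} \<rho>"
    unfolding set_integrable_def
    by (rule integrableI_bounded_set_indicator[where B=K]) (use K in \<open>auto simp: emeasure_lborel_Icc_eq\<close>)
  ultimately show ?thesis
    using set_borel_integral_eq_integral(2)[of "{p..q}" \<rho>]
    by (simp add: set_lebesgue_integral_def integral_unique inner_diff_left)
qed

abbreviation "F \<equiv> generated_sigma M T B"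

lemma F_generators: "{B s -` A \<inter> space M | s A. s \<in> {0..T} \<and> A \<in> sets borel} \<subseteq> Pow (space M)"
  by auto

lemma space_F[simp]: "space F = space M"
  unfolding generated_sigma_def by (rule space_measure_of[OF F_generators])

lemma sets_F: "sets F = sigma_sets (space M) {B s -` A \<inter> space M | s A. s \<in> {0..T} \<and> A \<in> sets borel}"
  unfolding generated_sigma_def by (rule sets_measure_of[OF F_generators])

lemma F_sub: "sets F \<subseteq> sets M"
  unfolding sets_F by (rule sets.sigma_sets_subset) (auto intro!: measurable_sets[OF B_measurable])

lemma F_measurable_imp: "f \<in> measurable F N \<Longrightarrow> f \<in> measurable M N"
  using F_sub by (auto simp: measurable_def)

lemma B_F_measurable: "s \<in> {0..T} \<Longrightarrow> B s \<in> borel_measurable F"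
  by (rule measurableI) (auto simp: sets_F)

text \<open>Nothing is known about \<open>B\<close> outside \<open>[0,T]\<close>; with clipped time it is jointly measurable.\<close>

definition clip :: "real \<Rightarrow> real" where "clip s = max 0 (min s T)"

lemma clip_in: "clip s \<in> {0..T}" and clip_bounds[simp]: "0 \<le> clip s" "clip s \<le> T"
  and clip_id: "s \<in> {0..T} \<Longrightarrow> clip s = s"
  using T by (auto simp: clip_def)

lemma B_path: "\<omega> \<in> space M \<Longrightarrow> continuous_on {0..T} (\<lambda>s. B s \<omega>)"
  using fbm by (auto simp: fractional_brownian_motion_def)

lemma B_clip_F_joint: "(\<lambda>p. B (clip (fst p)) (snd p)) \<in> borel_measurable ((lborel :: real measure) \<Otimes>\<^sub>M F)"
proof (rule borel_measurable_LIMSEQ_real)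
  let ?s = "\<lambda>i s. clip (of_int \<lfloor>s * real (Suc i)\<rfloor> / real (Suc i))"
  fix i
  show "(\<lambda>p. B (?s i (fst p)) (snd p)) \<in> borel_measurable ((lborel :: real measure) \<Otimes>\<^sub>M F)"
  proof (rule measurable_compose_countable[where f="\<lambda>k p. B (clip (of_int k / real (Suc i))) (snd p)" and
      g="\<lambda>p. \<lfloor>fst p * real (Suc i)\<rfloor>"])
    show "(\<lambda>p. B (clip (of_int k / real (Suc i))) (snd p)) \<in> borel_measurable ((lborel :: real measure) \<Otimes>\<^sub>M F)"
        for k
      by (rule measurable_compose[OF measurable_snd B_F_measurable]) simp
  qed measurable
next
  fix p assume "p \<in> space ((lborel :: real measure) \<Otimes>\<^sub>M F)"
  then have p: "snd p \<in> space M" by (auto simp: space_pair_measure)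
  let ?s = "\<lambda>i s. clip (of_int \<lfloor>s * real (Suc i)\<rfloor> / real (Suc i))"
  have "(\<lambda>i. of_int \<lfloor>fst p * real (Suc i)\<rfloor> / real (Suc i)) \<longlonglongrightarrow> fst p"
  proof (rule LIM_zero_cancel, rule Lim_null_comparison)
    show "\<forall>\<^sub>F i in sequentially. norm (of_int \<lfloor>fst p * real (Suc i)\<rfloor> / real (Suc i) - fst p) \<le>
        inverse (real (Suc i))"
    proof (intro always_eventually allI)
      fix i
      have "\<bar>of_int \<lfloor>fst p * real (Suc i)\<rfloor> - fst p * real (Suc i)\<bar> \<le> 1" by linarith
      then have "\<bar>of_int \<lfloor>fst p * real (Suc i)\<rfloor> - fst p * real (Suc i)\<bar> / real (Suc i) \<le> 1 / real (Suc i)"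
        by (intro divide_right_mono) auto
      also have "\<bar>of_int \<lfloor>fst p * real (Suc i)\<rfloor> - fst p * real (Suc i)\<bar> / real (Suc i) =
          \<bar>(of_int \<lfloor>fst p * real (Suc i)\<rfloor> - fst p * real (Suc i)) / real (Suc i)\<bar>"
        by simp
      also have "(of_int \<lfloor>fst p * real (Suc i)\<rfloor> - fst p * real (Suc i)) / real (Suc i) =
          of_int \<lfloor>fst p * real (Suc i)\<rfloor> / real (Suc i) - fst p"
        by (simp add: diff_divide_distrib del: of_nat_Suc)
      finally show "norm (of_int \<lfloor>fst p * real (Suc i)\<rfloor> / real (Suc i) - fst p) \<le> inverse (real (Suc i))"
        by (simp add: inverse_eq_divide)
    qed
    show "(\<lambda>i. inverse (real (Suc i))) \<longlonglongrightarrow> 0" by (rule LIMSEQ_inverse_real_of_nat)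
  qed
  then have "(\<lambda>i. ?s i (fst p)) \<longlonglongrightarrow> clip (fst p)"
    unfolding clip_def by (intro tendsto_intros)
  then show "(\<lambda>i. B (?s i (fst p)) (snd p)) \<longlonglongrightarrow> B (clip (fst p)) (snd p)"
    by (intro continuous_on_tendsto_compose[OF B_path[OF p]] always_eventually) auto
qed

lemma B_clip_joint[measurable]:
    "(\<lambda>p. B (clip (fst p)) (snd p)) \<in> borel_measurable ((lborel :: real measure) \<Otimes>\<^sub>M M)"
proof -
  have "(\<lambda>p. p) \<in> (lborel :: real measure) \<Otimes>\<^sub>M M \<rightarrow>\<^sub>M (lborel :: real measure) \<Otimes>\<^sub>M F"
    by (rule measurable_pair) (auto simp: comp_def intro!: measurable_compose[OF measurable_snd] measurableI dest:
        subsetD[OF F_sub]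
       sets.sets_into_space)
  from measurable_compose[OF this B_clip_F_joint] show ?thesis .
qed

lemma B_square_integrable: "s \<in> {0..T} \<Longrightarrow> square_integrable M (B s)"
  by (rule square_integrable_AE_cong[OF W_square_integrable B_measurable W_e])

lemma B_second_moment: "s \<in> {0..T} \<Longrightarrow> (\<integral>\<omega>. (B s \<omega>)\<^sup>2 \<partial>M) = s powr (2*H)"
proof -
  assume s: "s \<in> {0..T}"
  have "(\<integral>\<omega>. B s \<omega> * B s \<omega> \<partial>M) = fbm_cov H s s" using fbm s unfolding fractional_brownian_motion_def by blast
  then show ?thesis by (simp add: fbm_cov_def power2_eq_square)
qed

lemma B_abs_moment: "s \<in> {0..T} \<Longrightarrow> (\<integral>\<omega>. \<bar>B s \<omega>\<bar> \<partial>M) \<le> T powr H"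
proof -
  assume s: "s \<in> {0..T}"
  have "(\<integral>\<omega>. \<bar>B s \<omega>\<bar> \<partial>M) \<le> sqrt (s powr (2*H))"
    using L1_le_L2[OF B_square_integrable[OF s]] B_second_moment[OF s] by simp
  also have "\<dots> \<le> sqrt (T powr (2*H))" using s H by (intro real_sqrt_le_mono powr_mono2) auto
  also have "\<dots> = T powr H" by (simp add: powr_half_sqrt[symmetric] powr_powr)
  finally show ?thesis .
qed

lemma time_fubini:
  fixes q \<psi> :: "real \<Rightarrow> real"
  assumes X[measurable]: "X \<in> borel_measurable M" and XK: "\<And>\<omega>. \<bar>X \<omega>\<bar> \<le> K"
    and [measurable]: "\<psi> \<in> borel_measurable borel" "q \<in> borel_measurable borel"
    and \<psi>L: "\<And>s. s \<in> {0..T} \<Longrightarrow> \<bar>\<psi> s\<bar> \<le> L" and qC: "\<And>y. \<bar>q y\<bar> \<le> C * (1 + \<bar>y\<bar>)"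
    and t: "t \<in> {0..T}"
  shows "integrable lborel (\<lambda>s. indicator {0..t} s * (\<psi> s * (\<integral>\<omega>. X \<omega> * q (B (clip s) \<omega>) \<partial>M)))"
    "(\<integral>s. indicator {0..t} s * (\<psi> s * (\<integral>\<omega>. X \<omega> * q (B (clip s) \<omega>) \<partial>M)) \<partial>lborel) =
      (\<integral>\<omega>. X \<omega> * (\<integral>s. indicator {0..t} s * (\<psi> s * q (B (clip s) \<omega>)) \<partial>lborel) \<partial>M)"
    "integrable M (\<lambda>\<omega>. X \<omega> * (\<integral>s. indicator {0..t} s * (\<psi> s * q (B (clip s) \<omega>)) \<partial>lborel))"
proof -
  interpret P: pair_sigma_finite lborel M by unfold_locales
  have K0: "K \<ge> 0" using XK abs_ge_zero order_trans by blast
  have C0: "C \<ge> 0" using qC[of 0] by simp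
  have L0: "L \<ge> 0" using \<psi>L[OF t] abs_ge_zero order_trans by blast
  let ?f = "\<lambda>s \<omega>. indicator {0..t} s * (\<psi> s * (X \<omega> * q (B (clip s) \<omega>)))"
  have Bc: "(\<lambda>p. q (B (clip (fst p)) (snd p))) \<in> borel_measurable (lborel \<Otimes>\<^sub>M M)"
    by (rule measurable_compose[OF B_clip_joint]) simp
  have fm[measurable]: "(\<lambda>p. ?f (fst p) (snd p)) \<in> borel_measurable (lborel \<Otimes>\<^sub>M M)"
    by (intro borel_measurable_times Bc) measurable
  then have fm2: "case_prod ?f \<in> borel_measurable (lborel \<Otimes>\<^sub>M M)" by (simp add: case_prod_beta')
  have sq: "square_integrable M (\<lambda>\<omega>. q (B (clip s) \<omega>))" for s
    by (rule square_integrable_linear_growth[OF B_square_integrable _ qC]) auto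
  have iX: "integrable M (\<lambda>\<omega>. X \<omega> * q (B (clip s) \<omega>))" for s
    by (intro square_integrable_integrable square_integrable_bounded_mult[OF sq _ XK]) auto
  have Xb: "(\<integral>\<omega>. \<bar>X \<omega> * q (B (clip s) \<omega>)\<bar> \<partial>M) \<le> K * (C * (1 + T powr H))" for s
  proof -
    have "(\<integral>\<omega>. \<bar>X \<omega> * q (B (clip s) \<omega>)\<bar> \<partial>M) \<le> (\<integral>\<omega>. K * (C * (1 + \<bar>B (clip s) \<omega>\<bar>)) \<partial>M)"
    proof (rule integral_mono)
      show "integrable M (\<lambda>\<omega>. K * (C * (1 + \<bar>B (clip s) \<omega>\<bar>)))"
        using square_integrable_integrable[OF B_square_integrable[OF clip_in]] by auto
      show "\<bar>X \<omega> * q (B (clip s) \<omega>)\<bar> \<le> K * (C * (1 + \<bar>B (clip s) \<omega>\<bar>))" for \<omega>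
        unfolding abs_mult using XK qC K0 by (intro mult_mono) auto
    qed (use iX in auto)
    also have "\<dots> = K * (C * (1 + (\<integral>\<omega>. \<bar>B (clip s) \<omega>\<bar> \<partial>M)))"
      using square_integrable_integrable[OF B_square_integrable[OF clip_in]] by (simp add: prob_space)
    also have "\<dots> \<le> K * (C * (1 + T powr H))"
      using B_abs_moment[OF clip_in] K0 C0 by (intro mult_left_mono add_left_mono) auto
    finally show ?thesis .
  qed
  have int: "integrable (lborel \<Otimes>\<^sub>M M) (case_prod ?f)"
  proof (rule P.Fubini_integrable[OF fm2])
    show "AE s in lborel. integrable M (\<lambda>\<omega>. case_prod ?f (s, \<omega>))" using iX by simp
    have [measurable]: "(\<lambda>s. \<integral>\<omega>. norm (?f s \<omega>) \<partial>M) \<in> borel_measurable lborel"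
      by (rule borel_measurable_lebesgue_integral) (use fm in \<open>simp add: case_prod_beta'\<close>)
    have "integrable lborel (\<lambda>s. indicator {0..t} s * (L * (K * (C * (1 + T powr H)))))"
      using t by (intro integrable_mult_left integrable_real_indicator) auto
    then show "integrable lborel (\<lambda>s. \<integral>\<omega>. norm (case_prod ?f (s, \<omega>)) \<partial>M)"
    proof (rule Bochner_Integration.integrable_bound)
      show "AE s in lborel. norm (\<integral>\<omega>. norm (case_prod ?f (s, \<omega>)) \<partial>M) \<le>
          norm (indicator {0..t} s * (L * (K * (C * (1 + T powr H)))))"
      proof (rule AE_I2)
        fix s
        have "(\<integral>\<omega>. norm (case_prod ?f (s, \<omega>)) \<partial>M) =
            indicator {0..t} s * (\<bar>\<psi> s\<bar> * (\<integral>\<omega>. \<bar>X \<omega> * q (B (clip s) \<omega>)\<bar> \<partial>M))"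
          by (simp add: abs_mult)
        moreover have "indicator {0..t} s * (\<bar>\<psi> s\<bar> * (\<integral>\<omega>. \<bar>X \<omega> * q (B (clip s) \<omega>)\<bar> \<partial>M)) \<le>
            indicator {0..t} s * (L * (K * (C * (1 + T powr H))))"
          using Xb[of s] \<psi>L[of s] t L0 by (auto simp: indicator_def intro!: mult_mono)
        ultimately show "norm (\<integral>\<omega>. norm (case_prod ?f (s, \<omega>)) \<partial>M) \<le>
            norm (indicator {0..t} s * (L * (K * (C * (1 + T powr H)))))"
          by simp
      qed
    qed simp
  qed
  have in1: "(\<integral>\<omega>. ?f s \<omega> \<partial>M) = indicator {0..t} s * (\<psi> s * (\<integral>\<omega>. X \<omega> * q (B (clip s) \<omega>) \<partial>M))" for s
    by simp
  have in2: "(\<integral>s. ?f s \<omega> \<partial>lborel) = X \<omega> * (\<integral>s. indicator {0..t} s * (\<psi> s * q (B (clip s) \<omega>)) \<partial>lborel)" for \<omega>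
    by (subst integral_mult_right_zero[symmetric], rule Bochner_Integration.integral_cong) auto
  show "integrable lborel (\<lambda>s. indicator {0..t} s * (\<psi> s * (\<integral>\<omega>. X \<omega> * q (B (clip s) \<omega>) \<partial>M)))"
    using P.integrable_fst[OF int] unfolding in1 by simp
  show "integrable M (\<lambda>\<omega>. X \<omega> * (\<integral>s. indicator {0..t} s * (\<psi> s * q (B (clip s) \<omega>)) \<partial>lborel))"
    using P.integrable_snd[OF int] unfolding in2 by simp
  show "(\<integral>s. indicator {0..t} s * (\<psi> s * (\<integral>\<omega>. X \<omega> * q (B (clip s) \<omega>) \<partial>M)) \<partial>lborel) =
      (\<integral>\<omega>. X \<omega> * (\<integral>s. indicator {0..t} s * (\<psi> s * q (B (clip s) \<omega>)) \<partial>lborel) \<partial>M)"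
    using P.Fubini_integral[OF int] unfolding in1 in2 by simp
qed

lemma B_zero: "AE \<omega> in M. B 0 \<omega> = 0"
proof -
  have "(\<integral>\<omega>. (B 0 \<omega>)\<^sup>2 \<partial>M) = 0" using B_second_moment[of 0] T by simp
  then have "AE \<omega> in M. (B 0 \<omega>)\<^sup>2 = 0"
    using B_square_integrable[of 0] T
        by (subst (asm) integral_nonneg_eq_0_iff_AE) (auto simp: square_integrable_def)
  then show ?thesis by (auto elim: eventually_mono)
qed

lemma reg_primitive_square_bound: "d > 0 \<Longrightarrow> \<bar>reg_primitive d y\<bar> \<le> \<bar>ln d\<bar> * \<bar>y\<bar> + y\<^sup>2 / d"
  using reg_primitive_taylor[of d y 0] abs_mult[of "ln d" y] abs_triangle_ineq2[of "reg_primitive d y" "ln d * y"]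
  by (simp add: reg_primitive_def[of d 0] reg_log_def[of d 0] max_def)

lemma reg_primitive_B_integrable:
  assumes d: "d > 0" and s: "s \<in> {0..T}"
  shows "integrable M (\<lambda>\<omega>. reg_primitive d (B s \<omega> - a))"
proof -
  note [measurable] = B_measurable[OF s]
  have sq: "square_integrable M (\<lambda>\<omega>. B s \<omega> - a)"
    by (intro square_integrable_diff B_square_integrable s square_integrable_const)
  then have "integrable M (\<lambda>\<omega>. \<bar>ln d\<bar> * \<bar>B s \<omega> - a\<bar> + (B s \<omega> - a)\<^sup>2 / d)"
    using square_integrable_integrable[OF sq]
        by (intro Bochner_Integration.integrable_add integrable_mult_right integrable_divide_zero)
        (auto simp: square_integrable_def)
  then show ?thesis
    by (rule Bochner_Integration.integrable_bound)
        (auto intro!: AE_I2 order_trans[OF reg_primitive_square_bound[OF d] abs_ge_self])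
qed

lemma reg_log_shift_bound: "d > 0 \<Longrightarrow> \<bar>reg_log d (y - a)\<bar> \<le> ((\<bar>ln d\<bar> + 1/d) * (1 + \<bar>a\<bar>)) * (1 + \<bar>y\<bar>)"
proof -
  assume d: "d > 0"
  have "\<bar>reg_log d (y - a)\<bar> \<le> (\<bar>ln d\<bar> + 1/d) * (1 + \<bar>y - a\<bar>)" by (rule reg_log_bound[OF d])
  also have "\<dots> \<le> (\<bar>ln d\<bar> + 1/d) * ((1 + \<bar>a\<bar>) * (1 + \<bar>y\<bar>))"
  proof (rule mult_left_mono)
    have "1 + \<bar>y - a\<bar> \<le> 1 + \<bar>a\<bar> + \<bar>y\<bar> + \<bar>a\<bar> * \<bar>y\<bar>" by (simp add: abs_triangle_ineq4 add.commute add_increasing2)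
    then show "1 + \<bar>y - a\<bar> \<le> (1 + \<bar>a\<bar>) * (1 + \<bar>y\<bar>)" by (simp add: algebra_simps)
  qed (use d in auto)
  finally show ?thesis by (simp add: mult.assoc)
qed

lemma reg_log_B_square_integrable:
  assumes d: "d > 0" and s: "s \<in> {0..T}"
  shows "square_integrable M (\<lambda>\<omega>. reg_log d (B s \<omega> - a))"
  using reg_log_shift_bound[OF d, of _ a]
  by (intro square_integrable_linear_growth[OF B_square_integrable[OF s], where g="\<lambda>y. reg_log d (y - a)"]) auto

lemma B_increment:
  assumes s: "s \<in> {0..T}" and r: "r \<in> {0..T}"
  shows "AE \<omega> in M. W (e r - e s) \<omega> = B r \<omega> - B s \<omega>"
    "(\<integral>\<omega>. (B r \<omega> - B s \<omega>)\<^sup>2 \<partial>M) = \<bar>r - s\<bar> powr (2*H)"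
proof -
  show ae: "AE \<omega> in M. W (e r - e s) \<omega> = B r \<omega> - B s \<omega>"
    using W_linear[of 1 "e r" "-1" "e s"] W_e[OF s] W_e[OF r] by eventually_elim simp
  note [measurable] = B_measurable[OF s] B_measurable[OF r]
  have "(\<integral>\<omega>. (B r \<omega> - B s \<omega>)\<^sup>2 \<partial>M) = (\<integral>\<omega>. (W (e r - e s) \<omega>)\<^sup>2 \<partial>M)"
    using ae by (intro integral_cong_AE) (auto elim: eventually_mono)
  then show "(\<integral>\<omega>. (B r \<omega> - B s \<omega>)\<^sup>2 \<partial>M) = \<bar>r - s\<bar> powr (2*H)"
    by (simp add: W_norm e_increment_norm[OF s r])
qed

text \<open>Since \<open>2H > 1\<close>, the error is negligible after division by \<open>r - s\<close>.\<close>

lemma ito_increment: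
  fixes \<phi> :: "nat \<Rightarrow> 'h"
  assumes f: "Cb_infinity n f" and \<phi>: "\<And>j. j < n \<Longrightarrow> \<phi> j \<in> steps" and d: "d > 0"
    and K: "\<And>x. \<bar>f x\<bar> \<le> K" "\<And>j x. j < n \<Longrightarrow> \<bar>partial_deriv j f x\<bar> \<le> K"
    and s: "s \<in> {0..T}" and r: "r \<in> {0..T}"
  shows "\<bar>(\<integral>\<omega>. f (\<lambda>i. W (\<phi> i) \<omega>) * reg_primitive d (B r \<omega> - a) \<partial>M) -
      (\<integral>\<omega>. f (\<lambda>i. W (\<phi> i) \<omega>) * reg_primitive d (B s \<omega> - a) \<partial>M)
     - ((\<Sum>j<n. ((e r - e s) \<bullet> \<phi> j) * (\<integral>\<omega>. partial_deriv j f (\<lambda>i. W (\<phi> i) \<omega>) * reg_log d (B s \<omega> - a) \<partial>M)) +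
        ((e r - e s) \<bullet> e s) * (\<integral>\<omega>. f (\<lambda>i. W (\<phi> i) \<omega>) * reg_inv d (B s \<omega> - a) \<partial>M))\<bar> \<le> K / d * \<bar>r - s\<bar> powr (2*H)"
proof -
  let ?G = "\<lambda>\<omega>. f (\<lambda>i. W (\<phi> i) \<omega>)" and ?D = "\<lambda>j \<omega>. partial_deriv j f (\<lambda>i. W (\<phi> i) \<omega>)"
  have Gm[measurable]: "?G \<in> borel_measurable M" by (rule smooth_measurable(1)[OF f])
  have Dm[measurable]: "?D j \<in> borel_measurable M" if "j < n" for j by (rule smooth_measurable(2)[OF f that])
  note Bm[measurable] = B_measurable[OF s] B_measurable[OF r]
  let ?g = "\<lambda>z. reg_log d (z - a)" and ?g' = "\<lambda>z. reg_inv d (z - a)"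
  let ?C = "(\<bar>ln d\<bar> + 1/d) * (1 + \<bar>a\<bar>) + 1 / d"
  have ibp: "(\<integral>\<omega>. W (e r - e s) \<omega> * (?G \<omega> * ?g (W (e s) \<omega>)) \<partial>M) =
     (\<Sum>j<n. ((e r - e s) \<bullet> \<phi> j) * (\<integral>\<omega>. ?D j \<omega> * ?g (W (e s) \<omega>) \<partial>M)) +
     ((e r - e s) \<bullet> e s) * (\<integral>\<omega>. ?G \<omega> * ?g' (W (e s) \<omega>) \<partial>M)"
  proof (rule W_integration_by_parts[OF _ \<phi> _ f, where S="{a + d, a - d}" and C="?C"])
    show "e r - e s \<in> steps" "e s \<in> steps" using span_diff[OF e_steps[OF r] e_steps[OF s]] e_steps[OF s] by auto
    show "continuous_on UNIV ?g"
      by (rule continuous_on_compose2[OF reg_log_continuous[OF d, of UNIV]]) (auto intro!: continuous_intros)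
    fix y
    show "(?g has_real_derivative ?g' y) (at y)" if "y \<notin> {a + d, a - d}"
    proof -
      have "(reg_log d has_real_derivative reg_inv d (y - a)) (at (y - a))"
        using that by (intro reg_log_derivative[OF d]) auto
      then have "((\<lambda>z. reg_log d (z - a)) has_real_derivative reg_inv d (y - a) * 1) (at y)"
        by (rule DERIV_chain2) (auto intro!: derivative_eq_intros)
      then show ?thesis by simp
    qed
    show "\<bar>?g y\<bar> \<le> ?C * (1 + \<bar>y\<bar>)"
      by (rule order_trans[OF reg_log_shift_bound[OF d]]) (use d in \<open>simp add: distrib_right\<close>)
    show "\<bar>?g' y\<bar> \<le> ?C"
      using reg_inv_bound[OF d, of "y - a"] d by (auto intro: order_trans)
  qed auto
  note aes = W_e[OF s] and aei = B_increment(1)[OF s r]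
  have c1: "(\<integral>\<omega>. W (e r - e s) \<omega> * (?G \<omega> * ?g (W (e s) \<omega>)) \<partial>M) = (\<integral>\<omega>. ?G \<omega> * (?g (B s \<omega>) * (B r \<omega> - B s \<omega>)) \<partial>M)"
  proof (rule integral_cong_AE)
    show "AE \<omega> in M. W (e r - e s) \<omega> * (?G \<omega> * ?g (W (e s) \<omega>)) = ?G \<omega> * (?g (B s \<omega>) * (B r \<omega> - B s \<omega>))"
      using aes aei by eventually_elim simp
  qed measurable
  have c2: "(\<integral>\<omega>. ?D j \<omega> * ?g (W (e s) \<omega>) \<partial>M) = (\<integral>\<omega>. ?D j \<omega> * ?g (B s \<omega>) \<partial>M)" if "j < n" for j
  proof (rule integral_cong_AE)
    show "AE \<omega> in M. ?D j \<omega> * ?g (W (e s) \<omega>) = ?D j \<omega> * ?g (B s \<omega>)"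
      using aes by eventually_elim simp
  qed (use Dm[OF that] in measurable)
  have c3: "(\<integral>\<omega>. ?G \<omega> * ?g' (W (e s) \<omega>) \<partial>M) = (\<integral>\<omega>. ?G \<omega> * ?g' (B s \<omega>) \<partial>M)"
  proof (rule integral_cong_AE)
    show "AE \<omega> in M. ?G \<omega> * ?g' (W (e s) \<omega>) = ?G \<omega> * ?g' (B s \<omega>)"
      using aes by eventually_elim simp
  qed measurable
  have iP: "integrable M (\<lambda>\<omega>. ?G \<omega> * reg_primitive d (B q \<omega> - a))" if "q \<in> {0..T}" for q
  proof (rule Bochner_Integration.integrable_bound)
    show "integrable M (\<lambda>\<omega>. K * reg_primitive d (B q \<omega> - a))"
        by (intro integrable_mult_right reg_primitive_B_integrable d that)
    show "AE \<omega> in M. norm (?G \<omega> * reg_primitive d (B q \<omega> - a)) \<le> norm (K * reg_primitive d (B q \<omega> - a))"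
      using K(1) by (auto simp: abs_mult intro!: AE_I2 mult_right_mono order_trans[OF K(1) abs_ge_self])
  qed (use B_measurable[OF that] in measurable)
  have sqd: "square_integrable M (\<lambda>\<omega>. B r \<omega> - B s \<omega>)"
    by (intro square_integrable_diff B_square_integrable s r)
  have iL: "integrable M (\<lambda>\<omega>. ?G \<omega> * (?g (B s \<omega>) * (B r \<omega> - B s \<omega>)))"
    unfolding mult.assoc[symmetric]
    by (intro square_integrable_mult sqd
        square_integrable_bounded_mult[OF reg_log_B_square_integrable[OF d s] Gm K(1)])
  have "\<bar>(\<integral>\<omega>. ?G \<omega> * reg_primitive d (B r \<omega> - a) - ?G \<omega> * reg_primitive d (B s \<omega> - a) -
      ?G \<omega> * (?g (B s \<omega>) * (B r \<omega> - B s \<omega>)) \<partial>M)\<bar>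
     \<le> (\<integral>\<omega>. K / d * (B r \<omega> - B s \<omega>)\<^sup>2 \<partial>M)"
  proof (rule order_trans[OF integral_abs_bound integral_mono])
    show "integrable M (\<lambda>\<omega>. \<bar>?G \<omega> * reg_primitive d (B r \<omega> - a) - ?G \<omega> * reg_primitive d (B s \<omega> - a) -
        ?G \<omega> * (?g (B s \<omega>) * (B r \<omega> - B s \<omega>))\<bar>)"
      using iP[OF r] iP[OF s] iL by auto
    show "integrable M (\<lambda>\<omega>. K / d * (B r \<omega> - B s \<omega>)\<^sup>2)" using sqd by (auto simp: square_integrable_def)
    fix \<omega>
    have "\<bar>?G \<omega> * reg_primitive d (B r \<omega> - a) - ?G \<omega> * reg_primitive d (B s \<omega> - a) -
        ?G \<omega> * (?g (B s \<omega>) * (B r \<omega> - B s \<omega>))\<bar>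
      = \<bar>?G \<omega>\<bar> * \<bar>reg_primitive d (B r \<omega> - a) - reg_primitive d (B s \<omega> - a) - reg_log d (B s \<omega> - a) *
          ((B r \<omega> - a) - (B s \<omega> - a))\<bar>"
      unfolding abs_mult[symmetric] by (simp add: algebra_simps)
    also have "\<dots> \<le> K * (((B r \<omega> - a) - (B s \<omega> - a))\<^sup>2 / d)"
      using K(1) abs_ge_zero order_trans[OF abs_ge_zero K(1)] by (intro mult_mono reg_primitive_taylor[OF d]) auto
    finally show "\<bar>?G \<omega> * reg_primitive d (B r \<omega> - a) - ?G \<omega> * reg_primitive d (B s \<omega> - a) -
        ?G \<omega> * (?g (B s \<omega>) * (B r \<omega> - B s \<omega>))\<bar>
      \<le> K / d * (B r \<omega> - B s \<omega>)\<^sup>2" by simp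
  qed
  also have "(\<integral>\<omega>. K / d * (B r \<omega> - B s \<omega>)\<^sup>2 \<partial>M) = K / d * \<bar>r - s\<bar> powr (2*H)"
    by (simp add: B_increment(2)[OF s r])
  also have "(\<integral>\<omega>. ?G \<omega> * reg_primitive d (B r \<omega> - a) - ?G \<omega> * reg_primitive d (B s \<omega> - a) -
      ?G \<omega> * (?g (B s \<omega>) * (B r \<omega> - B s \<omega>)) \<partial>M)
    = (\<integral>\<omega>. ?G \<omega> * reg_primitive d (B r \<omega> - a) \<partial>M) - (\<integral>\<omega>. ?G \<omega> * reg_primitive d (B s \<omega> - a) \<partial>M) -
        (\<integral>\<omega>. ?G \<omega> * (?g (B s \<omega>) * (B r \<omega> - B s \<omega>)) \<partial>M)"
    using iP[OF r] iP[OF s] iL by simp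
  also have "(\<integral>\<omega>. ?G \<omega> * (?g (B s \<omega>) * (B r \<omega> - B s \<omega>)) \<partial>M) =
      (\<Sum>j<n. ((e r - e s) \<bullet> \<phi> j) * (\<integral>\<omega>. ?D j \<omega> * ?g (B s \<omega>) \<partial>M)) +
     ((e r - e s) \<bullet> e s) * (\<integral>\<omega>. ?G \<omega> * ?g' (B s \<omega>) \<partial>M)"
    unfolding c1[symmetric] ibp c3 by (simp add: c2)
  finally show ?thesis .
qed

text \<open>The weight \<open>H * s powr (2*H-1)\<close> is half the derivative of the variance \<open>s powr (2*H)\<close>.\<close>

lemma ito_regularised:
  fixes \<phi> :: "nat \<Rightarrow> 'h"
  assumes f: "Cb_infinity n f" and sl: "\<And>j. j < n \<Longrightarrow> slope (\<phi> j) (\<rho> j)" and \<phi>: "\<And>j. j < n \<Longrightarrow> \<phi> j \<in> steps"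
    and d: "d > 0" and t: "t \<in> {0..T}"
  shows "(\<integral>\<omega>. f (\<lambda>i. W (\<phi> i) \<omega>) * (reg_primitive d (B t \<omega> - a) - reg_primitive d (- a)
        - (\<integral>s. indicator {0..t} s * (H * s powr (2*H-1) * reg_inv d (B (clip s) \<omega> - a)) \<partial>lborel)) \<partial>M) =
     (\<Sum>j<n. \<integral>\<omega>. partial_deriv j f (\<lambda>i. W (\<phi> i) \<omega>) *
         (\<integral>s. indicator {0..t} s * (\<rho> j s * reg_log d (B (clip s) \<omega> - a)) \<partial>lborel) \<partial>M)"
proof -
  let ?G = "\<lambda>\<omega>. f (\<lambda>i. W (\<phi> i) \<omega>)" and ?D = "\<lambda>j \<omega>. partial_deriv j f (\<lambda>i. W (\<phi> i) \<omega>)"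
  have Gm[measurable]: "?G \<in> borel_measurable M" by (rule smooth_measurable(1)[OF f])
  have Dm[measurable]: "?D j \<in> borel_measurable M" if "j < n" for j by (rule smooth_measurable(2)[OF f that])
  obtain K where K: "\<And>x. \<bar>f x\<bar> \<le> K" "\<And>j x. j < n \<Longrightarrow> \<bar>partial_deriv j f x\<bar> \<le> K"
    using Cb_infinity_bound[OF f] by blast
  have \<rho>m[measurable]: "\<rho> j \<in> borel_measurable borel" if "j < n" for j using sl[OF that] by (simp add: slope_def)
  have "\<forall>j\<in>{..<n}. \<exists>L. \<forall>s. \<bar>\<rho> j s\<bar> \<le> L" using sl by (auto simp: slope_def)
  then obtain L where L: "\<And>j s. j < n \<Longrightarrow> \<bar>\<rho> j s\<bar> \<le> L j" by (metis lessThan_iff)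
  define \<Phi> where "\<Phi> s = (\<integral>\<omega>. ?G \<omega> * reg_primitive d (B s \<omega> - a) \<partial>M)" for s
  define \<alpha> where "\<alpha> s = (\<integral>\<omega>. ?G \<omega> * reg_inv d (B (clip s) \<omega> - a) \<partial>M)" for s
  define \<beta> where "\<beta> j s = (\<integral>\<omega>. ?D j \<omega> * reg_log d (B (clip s) \<omega> - a) \<partial>M)" for j s
  define \<Psi> where "\<Psi> s r = (\<Sum>j<n. ((e r - e s) \<bullet> \<phi> j) * \<beta> j s) + ((e r - e s) \<bullet> e s) * \<alpha> s" for s r
  have inc: "\<bar>\<Phi> r - \<Phi> s - \<Psi> s r\<bar> \<le> K / d * \<bar>r - s\<bar> powr (2*H)" if "s \<in> {0..T}" "r \<in> {0..T}" for s r
    using ito_increment[of n f \<phi> d K s r a, OF f \<phi> d K that]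
        unfolding \<Phi>_def \<Psi>_def \<alpha>_def \<beta>_def clip_id[OF that(1)] .
  define \<Phi>' where "\<Phi>' s = (\<Sum>j<n. \<rho> j s * \<beta> j s) + H * s powr (2*H-1) * \<alpha> s" for s
  have contPhi: "continuous_on {0..T} \<Phi>"
    unfolding continuous_on_def
  proof
    fix s assume s: "s \<in> {0..T}"
    have "(\<Psi> s \<longlongrightarrow> (\<Sum>j<n. ((e s - e s) \<bullet> \<phi> j) * \<beta> j s) + ((e s - e s) \<bullet> e s) * \<alpha> s) (at s within {0..T})"
      unfolding \<Psi>_def using e_continuous s by (intro tendsto_intros) (auto simp: continuous_on_def)
    then have 1: "(\<Psi> s \<longlongrightarrow> 0) (at s within {0..T})" by simp
    have "((\<lambda>r. \<bar>r - s\<bar> powr (2*H)) \<longlongrightarrow> \<bar>s - s\<bar> powr (2*H)) (at s within {0..T})"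
      using H by (intro tendsto_powr' tendsto_intros) auto
    then have "((\<lambda>r. K / d * \<bar>r - s\<bar> powr (2*H)) \<longlongrightarrow> K / d * 0) (at s within {0..T})" by (intro tendsto_intros) simp
    then have "((\<lambda>r. K / d * \<bar>r - s\<bar> powr (2*H)) \<longlongrightarrow> 0) (at s within {0..T})" by simp
    then have "((\<lambda>r. \<Phi> r - \<Phi> s - \<Psi> s r) \<longlongrightarrow> 0) (at s within {0..T})"
      by (rule Lim_null_comparison[rotated]) (use inc[OF s] in \<open>auto simp: eventually_at_filter\<close>)
    from tendsto_add[OF tendsto_add[OF this 1] tendsto_const[of "\<Phi> s"]]
    show "(\<Phi> \<longlongrightarrow> \<Phi> s) (at s within {0..T})" by simp
  qed
  have derPhi: "(\<Phi> has_real_derivative \<Phi>' s) (at s)" if s: "s \<in> {0<..<T}" for s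
  proof -
    have s': "s \<in> {0..T}" "s > 0" using s by auto
    have es: "((\<lambda>r. e r \<bullet> e s) has_real_derivative H * s powr (2*H-1)) (at s)"
    proof -
      have "((\<lambda>r. e r \<bullet> e s) has_real_derivative indicator {0..T} s * cov_slope H s s) (at s)"
        using slope_e[OF s'(1)] s unfolding slope_def by blast
      then show ?thesis using s' by (simp add: cov_slope_def)
    qed
    have "(\<Psi> s has_real_derivative \<Phi>' s) (at s)"
      unfolding \<Psi>_def \<Phi>'_def inner_diff_left
      by (rule DERIV_cong[OF DERIV_add[OF DERIV_sum DERIV_cmult_right[OF DERIV_diff[OF es DERIV_const]]]], rule
          DERIV_cmult_right[OF DERIV_diff[OF _ DERIV_const]])
        (use sl s in \<open>auto simp: slope_def\<close>)
    moreover have "\<Psi> s s = 0" by (simp add: \<Psi>_def)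
    ultimately have 1: "((\<lambda>r. \<Psi> s r / (r - s)) \<longlongrightarrow> \<Phi>' s) (at s)" by (simp add: has_field_derivative_iff)
    have "((\<lambda>r. \<bar>r - s\<bar> powr (2*H-1)) \<longlongrightarrow> \<bar>s - s\<bar> powr (2*H-1)) (at s)"
      using H by (intro tendsto_powr' tendsto_intros) auto
    then have "((\<lambda>r. K / d * \<bar>r - s\<bar> powr (2*H-1)) \<longlongrightarrow> K / d * 0) (at s)" by (intro tendsto_intros) simp
    then have 0: "((\<lambda>r. K / d * \<bar>r - s\<bar> powr (2*H-1)) \<longlongrightarrow> 0) (at s)" by simp
    have "((\<lambda>r. (\<Phi> r - \<Phi> s - \<Psi> s r) / (r - s)) \<longlongrightarrow> 0) (at s)"
    proof (rule Lim_null_comparison[OF _ 0])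
      have "\<forall>\<^sub>F r in at s. r \<in> {0<..<T}" using s by (intro eventually_at_in_open') auto
      moreover have "\<forall>\<^sub>F r in at s. r \<noteq> s" by (simp add: eventually_at_filter)
      ultimately show "\<forall>\<^sub>F r in at s. norm ((\<Phi> r - \<Phi> s - \<Psi> s r) / (r - s)) \<le> K / d * \<bar>r - s\<bar> powr (2*H-1)"
      proof eventually_elim
        case (elim r)
        have "\<bar>\<Phi> r - \<Phi> s - \<Psi> s r\<bar> / \<bar>r - s\<bar> \<le> K / d * \<bar>r - s\<bar> powr (2*H) / \<bar>r - s\<bar>"
          using inc[OF s'(1), of r] elim by (intro divide_right_mono) auto
        also have "\<dots> = K / d * \<bar>r - s\<bar> powr (2*H-1)" using elim by (simp add: powr_diff)
        finally show ?case by simp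
      qed
    qed
    from tendsto_add[OF this 1] show ?thesis
      unfolding has_field_derivative_iff by (simp add: add_divide_distrib[symmetric])
  qed
  let ?C = "(\<bar>ln d\<bar> + 1/d) * (1 + \<bar>a\<bar>)"
  have H1: "\<bar>H * s powr (2*H-1)\<bar> \<le> H * T powr (2*H-1)" if "s \<in> {0..T}" for s
    using that H by (simp add: abs_mult) (intro powr_mono2; simp)
  have ib: "\<bar>reg_inv d (y - a)\<bar> \<le> 1 / d * (1 + \<bar>y\<bar>)" for y
    by (rule order_trans[OF reg_inv_bound[OF d]]) (use d in \<open>simp add: field_simps\<close>)
  have pm: "(\<lambda>s. H * s powr (2*H-1)) \<in> borel_measurable borel" "(\<lambda>y. reg_inv d (y - a)) \<in> borel_measurable borel"
    by measurable
  note tf1 = time_fubini[of ?G K "\<lambda>s. H * s powr (2*H-1)" "\<lambda>y. reg_inv d (y - a)" "H * T powr (2*H-1)"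
      "1 / d" t, OF Gm K(1) pm H1 ib t]
  have tf2: "integrable lborel (\<lambda>s. indicator {0..t} s * (\<rho> j s * \<beta> j s))"
      "(\<integral>s. indicator {0..t} s * (\<rho> j s * \<beta> j s) \<partial>lborel) =
          (\<integral>\<omega>. ?D j \<omega> * (\<integral>s. indicator {0..t} s * (\<rho> j s * reg_log d (B (clip s) \<omega> - a)) \<partial>lborel) \<partial>M)"
    if "j < n" for j
    unfolding \<beta>_def
    using time_fubini[OF Dm[OF that] K(2)[OF that] \<rho>m[OF that], of "\<lambda>y. reg_log d (y - a)", OF _ L[OF that]
        reg_log_shift_bound[OF d] t] by auto
  have "(\<Phi>' has_integral (\<Phi> t - \<Phi> 0)) {0..t}"
    using t by (intro fundamental_theorem_of_calculus_interior continuous_on_subset[OF contPhi])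
      (auto simp: has_real_derivative_iff_has_vector_derivative[symmetric] derPhi)
  moreover have "integrable lborel (\<lambda>s. indicator {0..t} s * \<Phi>' s)"
  proof -
    have "integrable lborel (\<lambda>s. (\<Sum>j<n. indicator {0..t} s * (\<rho> j s * \<beta> j s)) +
        indicator {0..t} s * (H * s powr (2*H-1) * \<alpha> s))"
      using tf1(1) tf2(1) unfolding \<alpha>_def
      by (intro Bochner_Integration.integrable_add Bochner_Integration.integrable_sum)
          (simp_all only: lessThan_iff)
    then show ?thesis by (simp add: \<Phi>'_def distrib_left sum_distrib_left mult.assoc)
  qed
  ultimately have "\<Phi> t - \<Phi> 0 = (\<integral>s. indicator {0..t} s * \<Phi>' s \<partial>lborel)"
    using set_borel_integral_eq_integral(2)[of "{0..t}" \<Phi>']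
    by (simp add: set_lebesgue_integral_def set_integrable_def integral_unique)
  also have "\<dots> = (\<integral>s. (\<Sum>j<n. indicator {0..t} s * (\<rho> j s * \<beta> j s)) +
      indicator {0..t} s * (H * s powr (2*H-1) * \<alpha> s) \<partial>lborel)"
    by (simp add: \<Phi>'_def distrib_left sum_distrib_left mult.assoc)
  also have "\<dots> = (\<Sum>j<n. (\<integral>s. indicator {0..t} s * (\<rho> j s * \<beta> j s) \<partial>lborel)) +
      (\<integral>s. indicator {0..t} s * (H * s powr (2*H-1) * \<alpha> s) \<partial>lborel)"
  proof (subst Bochner_Integration.integral_add)
    show "integrable lborel (\<lambda>s. \<Sum>j<n. indicator {0..t} s * (\<rho> j s * \<beta> j s))"
      by (intro Bochner_Integration.integrable_sum tf2(1)) (simp only: lessThan_iff)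
    show "integrable lborel (\<lambda>s. indicator {0..t} s * (H * s powr (2*H-1) * \<alpha> s))"
      using tf1(1) unfolding \<alpha>_def .
    have "(\<integral>s. (\<Sum>j<n. indicator {0..t} s * (\<rho> j s * \<beta> j s)) \<partial>lborel) =
        (\<Sum>j<n. \<integral>s. indicator {0..t} s * (\<rho> j s * \<beta> j s) \<partial>lborel)"
      by (rule Bochner_Integration.integral_sum) (simp only: lessThan_iff tf2(1))
    then show "(\<integral>s. (\<Sum>j<n. indicator {0..t} s * (\<rho> j s * \<beta> j s)) \<partial>lborel) +
        (\<integral>s. indicator {0..t} s * (H * s powr (2*H-1) * \<alpha> s) \<partial>lborel)
       = (\<Sum>j<n. \<integral>s. indicator {0..t} s * (\<rho> j s * \<beta> j s) \<partial>lborel) +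
           (\<integral>s. indicator {0..t} s * (H * s powr (2*H-1) * \<alpha> s) \<partial>lborel)"
      by (simp only:)
  qed
  also have "(\<integral>s. indicator {0..t} s * (H * s powr (2*H-1) * \<alpha> s) \<partial>lborel) =
     (\<integral>\<omega>. ?G \<omega> * (\<integral>s. indicator {0..t} s * (H * s powr (2*H-1) * reg_inv d (B (clip s) \<omega> - a)) \<partial>lborel) \<partial>M)"
    using tf1(2) unfolding \<alpha>_def .
  finally have main: "\<Phi> t - \<Phi> 0 -
      (\<integral>\<omega>. ?G \<omega> * (\<integral>s. indicator {0..t} s * (H * s powr (2*H-1) * reg_inv d (B (clip s) \<omega> - a)) \<partial>lborel) \<partial>M)
     = (\<Sum>j<n. \<integral>\<omega>. ?D j \<omega> * (\<integral>s. indicator {0..t} s * (\<rho> j s * reg_log d (B (clip s) \<omega> - a)) \<partial>lborel) \<partial>M)"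
    using tf2(2) by simp
  have iP: "integrable M (\<lambda>\<omega>. ?G \<omega> * reg_primitive d (B q \<omega> - a))" if "q \<in> {0..T}" for q
  proof (rule Bochner_Integration.integrable_bound)
    show "integrable M (\<lambda>\<omega>. K * reg_primitive d (B q \<omega> - a))"
        by (intro integrable_mult_right reg_primitive_B_integrable d that)
    show "AE \<omega> in M. norm (?G \<omega> * reg_primitive d (B q \<omega> - a)) \<le> norm (K * reg_primitive d (B q \<omega> - a))"
      using K(1) by (auto simp: abs_mult intro!: AE_I2 mult_right_mono order_trans[OF K(1) abs_ge_self])
  qed (use B_measurable[OF that] in measurable)
  have iG: "integrable M (\<lambda>\<omega>. ?G \<omega> * reg_primitive d (- a))"
    by (intro integrable_mult_left bounded_integrable[where C=K] K) measurable
  have "0 \<in> {0..T}" using T by auto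
  note [measurable] = B_measurable[OF this]
  have P0: "\<Phi> 0 = (\<integral>\<omega>. ?G \<omega> * reg_primitive d (- a) \<partial>M)"
    unfolding \<Phi>_def using B_zero by (intro integral_cong_AE) (auto elim!: eventually_mono)
  have "(\<integral>\<omega>. ?G \<omega> * (reg_primitive d (B t \<omega> - a) - reg_primitive d (- a)
        - (\<integral>s. indicator {0..t} s * (H * s powr (2*H-1) * reg_inv d (B (clip s) \<omega> - a)) \<partial>lborel)) \<partial>M) =
     \<Phi> t - \<Phi> 0 - (\<integral>\<omega>. ?G \<omega> * (\<integral>s. indicator {0..t} s * (H * s powr (2*H-1) * reg_inv d (B (clip s) \<omega> - a))
         \<partial>lborel) \<partial>M)"
    unfolding P0 right_diff_distrib \<Phi>_def[of t]
    using iP[OF t] iG tf1(3) by simp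
  then show ?thesis using main by simp
qed

end

section \<open>Continuous functions as elements of the Hilbert space\<close>

lemma signed_powr_mono:
  fixes x y p :: real
  assumes "p > 0" "x \<le> y"
  shows "sgn x * \<bar>x\<bar> powr p \<le> sgn y * \<bar>y\<bar> powr p"
proof -
  consider "x \<ge> 0" | "y \<le> 0" | "x < 0" "y > 0" using assms by linarith
  then show ?thesis
  proof cases
    case 1
    then have "x powr p \<le> y powr p" using assms by (intro powr_mono2) auto
    then show ?thesis using 1 assms by (auto simp: sgn_if)
  next
    case 2
    then have "(-y) powr p \<le> (-x) powr p" using assms by (intro powr_mono2) auto
    then show ?thesis using 2 assms by (auto simp: sgn_if)
  next
    case 3
    then have "- (\<bar>x\<bar> powr p) \<le> \<bar>y\<bar> powr p" by (meson neg_le_0_iff_le order_trans powr_ge_zero)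
    then show ?thesis using 3 by simp
  qed
qed

lemma integral_square_diff_triangle:
  fixes f g h :: "'a \<Rightarrow> real"
  assumes "square_integrable M f" "square_integrable M g" "square_integrable M h"
  shows "(\<integral>x. (f x - g x)\<^sup>2 \<partial>M) \<le> 2 * (\<integral>x. (f x - h x)\<^sup>2 \<partial>M) + 2 * (\<integral>x. (g x - h x)\<^sup>2 \<partial>M)"
proof -
  have i: "integrable M (\<lambda>x. (f x - g x)\<^sup>2)" "integrable M (\<lambda>x. (f x - h x)\<^sup>2)" "integrable M (\<lambda>x. (g x - h x)\<^sup>2)"
    using square_integrable_diff[OF assms(1,2)] square_integrable_diff[OF assms(1,3)]
        square_integrable_diff[OF assms(2,3)]
    by (auto simp: square_integrable_def)
  have "(\<integral>x. (f x - g x)\<^sup>2 \<partial>M) \<le> (\<integral>x. 2 * (f x - h x)\<^sup>2 + 2 * (g x - h x)\<^sup>2 \<partial>M)"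
  proof (rule integral_mono)
    fix x
    have "0 \<le> ((f x - h x) + (g x - h x))\<^sup>2" by simp
    then show "(f x - g x)\<^sup>2 \<le> 2 * (f x - h x)\<^sup>2 + 2 * (g x - h x)\<^sup>2"
      by (simp add: power2_eq_square algebra_simps)
  qed (use i in auto)
  also have "\<dots> = 2 * (\<integral>x. (f x - h x)\<^sup>2 \<partial>M) + 2 * (\<integral>x. (g x - h x)\<^sup>2 \<partial>M)" using i by simp
  finally show ?thesis .
qed

lemma integral_norm_bound_nn:
  fixes f :: "'a \<Rightarrow> real"
  shows "ennreal (norm (integral\<^sup>L M f)) \<le> (\<integral>\<^sup>+x. ennreal (norm (f x)) \<partial>M)"
  by (cases "integrable M f") (auto simp: integral_norm_bound_ennreal[of M f, unfolded real_norm_def]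
      not_integrable_integral_eq)

context fbm_setting
begin

lemma kernel_nn_integral:
  assumes "0 \<le> c" "c \<le> d" "d \<le> T"
  shows "(\<integral>\<^sup>+v\<in>{c..d}. ennreal (\<bar>s - v\<bar> powr (2*H-2)) \<partial>lborel) =
      ennreal ((cov_slope H d s - cov_slope H c s) / (H * (2*H-1)))"
    "0 \<le> (cov_slope H d s - cov_slope H c s) / (H * (2*H-1))"
proof -
  have eq: "(cov_slope H d s - cov_slope H c s) / (H * (2*H-1)) =
      (sgn (d - s) * \<bar>d - s\<bar> powr (2*H-1) - sgn (c - s) * \<bar>c - s\<bar> powr (2*H-1)) / (2*H-1)"
    using H by (simp add: cov_slope_def flip: right_diff_distrib)
  show "(\<integral>\<^sup>+v\<in>{c..d}. ennreal (\<bar>s - v\<bar> powr (2*H-2)) \<partial>lborel) =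
      ennreal ((cov_slope H d s - cov_slope H c s) / (H * (2*H-1)))"
    unfolding eq using nn_integral_abs_powr_Icc[of "2*H-1" c d s] H assms by simp
  show "0 \<le> (cov_slope H d s - cov_slope H c s) / (H * (2*H-1))"
    unfolding eq using signed_powr_mono[of "2*H-1" "c - s" "d - s"] H assms by simp
qed

lemma kernel_integral:
  assumes "0 \<le> c" "c \<le> d" "d \<le> T"
  shows "has_bochner_integral lborel (\<lambda>v. indicator {c..d} v * \<bar>s - v\<bar> powr (2*H-2))
      ((cov_slope H d s - cov_slope H c s) / (H * (2*H-1)))"
proof (rule has_bochner_integral_nn_integral)
  show "(\<integral>\<^sup>+v. ennreal (indicator {c..d} v * \<bar>s - v\<bar> powr (2*H-2)) \<partial>lborel) =
      ennreal ((cov_slope H d s - cov_slope H c s) / (H * (2*H-1)))"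
    unfolding kernel_nn_integral(1)[OF assms, symmetric]
    by (intro nn_integral_cong) (auto simp: indicator_def)
qed (use kernel_nn_integral(2)[OF assms] in auto)

definition schur :: real where "schur = 2 * T powr (2*H-1) / (2*H-1)"

lemma schur_nonneg: "schur \<ge> 0" using H by (simp add: schur_def)

lemma kernel_row:
  assumes "s \<in> {0..T}"
  shows "(\<integral>\<^sup>+v\<in>{0..T}. ennreal (\<bar>s - v\<bar> powr (2*H-2)) \<partial>lborel) \<le> ennreal schur"
proof -
  have "(cov_slope H T s - cov_slope H 0 s) / (H * (2*H-1)) = ((T - s) powr (2*H-1) + s powr (2*H-1)) / (2*H-1)"
    using H assms by (auto simp: cov_slope_def sgn_if right_diff_distrib[symmetric] simp del: right_diff_distrib)
  also have "\<dots> \<le> (T powr (2*H-1) + T powr (2*H-1)) / (2*H-1)"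
    using H assms by (intro divide_right_mono add_mono powr_mono2) auto
  finally show ?thesis
    using kernel_nn_integral(1)[of 0 T s] T by (simp add: schur_def ennreal_leI)
qed

lemma schur_bound:
  fixes g :: "real \<Rightarrow> real"
  assumes [measurable]: "g \<in> borel_measurable borel" and g: "\<And>s. g s \<ge> 0"
  shows "(\<integral>\<^sup>+s\<in>{0..T}. (\<integral>\<^sup>+v\<in>{0..T}. ennreal (g s * g v * \<bar>s - v\<bar> powr (2*H-2)) \<partial>lborel) \<partial>lborel)
     \<le> ennreal schur * (\<integral>\<^sup>+s\<in>{0..T}. ennreal ((g s)\<^sup>2) \<partial>lborel)"
proof -
  let ?k = "\<lambda>s v. ennreal (\<bar>s - v\<bar> powr (2*H-2))"
  let ?h = "\<lambda>s. ennreal ((g s)\<^sup>2 / 2)"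
  have A: "(\<integral>\<^sup>+s\<in>{0..T}. (\<integral>\<^sup>+v\<in>{0..T}. ?h s * ?k s v \<partial>lborel) \<partial>lborel) \<le>
      ennreal schur * (\<integral>\<^sup>+s\<in>{0..T}. ?h s \<partial>lborel)"
  proof -
    have "(\<integral>\<^sup>+s\<in>{0..T}. (\<integral>\<^sup>+v\<in>{0..T}. ?h s * ?k s v \<partial>lborel) \<partial>lborel) =
        (\<integral>\<^sup>+s\<in>{0..T}. ?h s * (\<integral>\<^sup>+v\<in>{0..T}. ?k s v \<partial>lborel) \<partial>lborel)"
      by (simp add: mult.assoc nn_integral_cmult)
    also have "\<dots> \<le> (\<integral>\<^sup>+s\<in>{0..T}. ?h s * ennreal schur \<partial>lborel)"
      using kernel_row by (intro nn_integral_mono) (auto simp: indicator_def intro!: mult_left_mono)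
    also have "\<dots> = ennreal schur * (\<integral>\<^sup>+s\<in>{0..T}. ?h s \<partial>lborel)"
      by (subst nn_integral_cmult[symmetric]) (auto simp: mult_ac)
    finally show ?thesis .
  qed
  have B: "(\<integral>\<^sup>+s\<in>{0..T}. (\<integral>\<^sup>+v\<in>{0..T}. ?h v * ?k s v \<partial>lborel) \<partial>lborel) =
      (\<integral>\<^sup>+s\<in>{0..T}. (\<integral>\<^sup>+v\<in>{0..T}. ?h s * ?k s v \<partial>lborel) \<partial>lborel)"
  proof -
    have "(\<integral>\<^sup>+s\<in>{0..T}. (\<integral>\<^sup>+v\<in>{0..T}. ?h v * ?k s v \<partial>lborel) \<partial>lborel) =
        (\<integral>\<^sup>+s. \<integral>\<^sup>+v. ?h v * ?k s v * indicator {0..T} v * indicator {0..T} s \<partial>lborel \<partial>lborel)"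
      by (intro nn_integral_cong, subst nn_integral_multc[symmetric]) auto
    also have "\<dots> = (\<integral>\<^sup>+v. \<integral>\<^sup>+s. ?h v * ?k s v * indicator {0..T} v * indicator {0..T} s \<partial>lborel \<partial>lborel)"
      by (rule lborel_pair.Fubini'[symmetric]) measurable
    also have "\<dots> = (\<integral>\<^sup>+v\<in>{0..T}. (\<integral>\<^sup>+s\<in>{0..T}. ?h v * ?k v s \<partial>lborel) \<partial>lborel)"
      by (intro nn_integral_cong, subst nn_integral_multc[symmetric]) (auto simp: mult_ac abs_minus_commute)
    finally show ?thesis .
  qed
  have "(\<integral>\<^sup>+s\<in>{0..T}. (\<integral>\<^sup>+v\<in>{0..T}. ennreal (g s * g v * \<bar>s - v\<bar> powr (2*H-2)) \<partial>lborel) \<partial>lborel)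
    \<le> (\<integral>\<^sup>+s. (\<integral>\<^sup>+v. ?h s * ?k s v * indicator {0..T} v + ?h v * ?k s v * indicator {0..T} v \<partial>lborel) * indicator
        {0..T} s \<partial>lborel)"
  proof (intro nn_integral_mono mult_right_mono)
    fix s v
    have "g s * g v \<le> (g s)\<^sup>2 / 2 + (g v)\<^sup>2 / 2" using sum_squares_bound[of "g s" "g v"] by simp
    then have "g s * g v * \<bar>s - v\<bar> powr (2*H-2) \<le> ((g s)\<^sup>2 / 2) * \<bar>s - v\<bar> powr (2*H-2) + ((g v)\<^sup>2 / 2) * \<bar>s -
        v\<bar> powr (2*H-2)"
      unfolding distrib_right[symmetric] by (intro mult_right_mono) auto
    then have "ennreal (g s * g v * \<bar>s - v\<bar> powr (2*H-2)) \<le> ?h s * ?k s v + ?h v * ?k s v"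
      by (subst (1 2) ennreal_mult[symmetric]) (auto simp flip: ennreal_plus intro: ennreal_leI)
    then show "ennreal (g s * g v * \<bar>s - v\<bar> powr (2*H-2)) * indicator {0..T} v \<le>
        ?h s * ?k s v * indicator {0..T} v + ?h v * ?k s v * indicator {0..T} v"
      by (auto simp: indicator_def)
  qed auto
  also have "\<dots> = (\<integral>\<^sup>+s\<in>{0..T}. (\<integral>\<^sup>+v\<in>{0..T}. ?h s * ?k s v \<partial>lborel) \<partial>lborel) +
      (\<integral>\<^sup>+s\<in>{0..T}. (\<integral>\<^sup>+v\<in>{0..T}. ?h v * ?k s v \<partial>lborel) \<partial>lborel)"
    by (subst nn_integral_add[symmetric]) (auto simp: nn_integral_add distrib_right)
  also have "\<dots> \<le> ennreal schur * (\<integral>\<^sup>+s\<in>{0..T}. ?h s \<partial>lborel) + ennreal schur * (\<integral>\<^sup>+s\<in>{0..T}. ?h s \<partial>lborel)"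
    unfolding B by (intro add_mono A)
  also have "\<dots> = ennreal schur * (\<integral>\<^sup>+s\<in>{0..T}. ennreal ((g s)\<^sup>2) \<partial>lborel)"
    unfolding distrib_left[symmetric]
    by (subst nn_integral_add[symmetric]) (auto simp: distrib_right[symmetric] simp flip: ennreal_plus)
  finally show ?thesis .
qed

lemma slope_linear:
  assumes "slope x \<rho>" "slope y \<rho>'"
  shows "slope (b *\<^sub>R x + c *\<^sub>R y) (\<lambda>s. b * \<rho> s + c * \<rho>' s)"
  unfolding slope_def
proof (intro conjI ballI)
  show "(\<lambda>s. b * \<rho> s + c * \<rho>' s) \<in> borel_measurable borel" using assms by (auto simp: slope_def)
  obtain K K' where "\<And>s. \<bar>\<rho> s\<bar> \<le> K" "\<And>s. \<bar>\<rho>' s\<bar> \<le> K'" using assms by (auto simp: slope_def)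
  then have "\<bar>b * \<rho> s + c * \<rho>' s\<bar> \<le> \<bar>b\<bar> * K + \<bar>c\<bar> * K'" for s
    by (intro order_trans[OF abs_triangle_ineq add_mono]) (auto simp: abs_mult intro: mult_left_mono)
  then show "\<exists>K. \<forall>s. \<bar>b * \<rho> s + c * \<rho>' s\<bar> \<le> K" by blast
  fix s assume "s \<in> {0<..<T}"
  then show "((\<lambda>r. e r \<bullet> (b *\<^sub>R x + c *\<^sub>R y)) has_real_derivative b * \<rho> s + c * \<rho>' s) (at s)"
    using assms unfolding inner_add_right inner_scaleR_right
    by (intro DERIV_add DERIV_cmult) (auto simp: slope_def)
qed

text \<open>\<open>x\<close> is the element that a bounded \<open>\<eta>\<close> represents; the last conjunct is the double integral formula
  for its covariance function, in differentiated form.\<close>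

definition smooth_rep :: "(real \<Rightarrow> real) \<Rightarrow> 'h \<Rightarrow> bool" where
  "smooth_rep \<eta> x \<longleftrightarrow> \<eta> \<in> borel_measurable borel \<and> (\<exists>K. \<forall>s. \<bar>\<eta> s\<bar> \<le> K) \<and>
     (\<forall>\<phi> \<rho>. slope \<phi> \<rho> \<longrightarrow> x \<bullet> \<phi> = (\<integral>s. indicator {0..T} s * (\<eta> s * \<rho> s) \<partial>lborel)) \<and>
     slope x (\<lambda>s. indicator {0..T} s *
         (H * (2*H-1) * (\<integral>v. indicator {0..T} v * (\<eta> v * \<bar>s - v\<bar> powr (2*H-2)) \<partial>lborel)))"

lemma bounded_mult_kernel_integrable:
  assumes [measurable]: "\<eta> \<in> borel_measurable borel" and K: "\<And>s. \<bar>\<eta> s\<bar> \<le> K"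
  shows "integrable lborel (\<lambda>v. indicator {0..T} v * (\<eta> v * \<bar>s - v\<bar> powr (2*H-2)))"
proof -
  have "integrable lborel (\<lambda>v. K * (indicator {0..T} v * \<bar>s - v\<bar> powr (2*H-2)))"
    using kernel_integral[of 0 T s] T by (intro integrable_mult_right) (auto simp: has_bochner_integral_iff)
  then show ?thesis
    by (rule Bochner_Integration.integrable_bound)
       (auto intro!: AE_I2 simp: abs_mult indicator_def mult_right_mono order_trans[OF K abs_ge_self])
qed

lemma bounded_integrable_Icc:
  fixes f :: "real \<Rightarrow> real"
  assumes [measurable]: "f \<in> borel_measurable borel" and K: "\<And>s. s \<in> {b..c} \<Longrightarrow> \<bar>f s\<bar> \<le> K"
  shows "integrable lborel (\<lambda>s. indicator {b..c} s * f s)"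
  using integrableI_bounded_set_indicator[of "{b..c}" lborel f K] K by (auto simp: emeasure_lborel_Icc_eq)

lemma smooth_rep_indicator:
  assumes ab: "0 \<le> a" "a \<le> b" "b \<le> T"
  shows "smooth_rep (indicator {a<..b}) (e b - e a)"
  unfolding smooth_rep_def
proof (intro conjI allI impI)
  show "\<exists>K. \<forall>s. \<bar>indicator {a<..b} s :: real\<bar> \<le> K" by (intro exI[of _ 1]) (auto simp: indicator_def)
  fix \<phi> \<rho> assume sl: "slope \<phi> \<rho>"
  then have [measurable]: "\<rho> \<in> borel_measurable borel" by (simp add: slope_def)
  show "(e b - e a) \<bullet> \<phi> = (\<integral>s. indicator {0..T} s * (indicator {a<..b} s * \<rho> s) \<partial>lborel)"
    unfolding slope_integral[OF sl ab] using ab AE_lborel_singleton[of a]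
    by (intro integral_cong_AE) (auto elim!: eventually_mono simp: indicator_def)
next
  have sb: "slope (1 *\<^sub>R e b + (-1) *\<^sub>R e a)
      (\<lambda>s. 1 * (indicator {0..T} s * cov_slope H b s) + (-1) * (indicator {0..T} s * cov_slope H a s))"
    using ab by (intro slope_linear slope_e) auto
  have eq: "(\<integral>v. indicator {0..T} v * (indicator {a<..b} v * \<bar>s - v\<bar> powr (2*H-2)) \<partial>lborel) =
      (cov_slope H b s - cov_slope H a s) / (H * (2*H-1))" for s
  proof -
    have "(\<integral>v. indicator {0..T} v * (indicator {a<..b} v * \<bar>s - v\<bar> powr (2*H-2)) \<partial>lborel) =
        (\<integral>v. indicator {a..b} v * \<bar>s - v\<bar> powr (2*H-2) \<partial>lborel)"
      using ab AE_lborel_singleton[of a]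
      by (intro integral_cong_AE) (auto elim!: eventually_mono simp: indicator_def)
    then show ?thesis using kernel_integral[OF ab, of s] by (simp add: has_bochner_integral_iff)
  qed
  have c: "H * (2*H-1) * (y / (H * (2*H-1))) = y" for y using H by auto
  have "(\<lambda>s. indicator {0..T} s *
      (H * (2*H-1) * (\<integral>v. indicator {0..T} v * (indicator {a<..b} v * \<bar>s - v\<bar> powr (2*H-2)) \<partial>lborel)))
     = (\<lambda>s. 1 * (indicator {0..T} s * cov_slope H b s) + (-1) * (indicator {0..T} s * cov_slope H a s))"
    unfolding eq c by (auto simp: fun_eq_iff right_diff_distrib)
  with sb show "slope (e b - e a)
      (\<lambda>s. indicator {0..T} s * (H * (2*H-1) *
      (\<integral>v. indicator {0..T} v * (indicator {a<..b} v * \<bar>s - v\<bar> powr (2*H-2)) \<partial>lborel)))"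
    by simp
qed measurable

lemma smooth_rep_linear:
  assumes "smooth_rep \<eta> x" "smooth_rep \<eta>' y"
  shows "smooth_rep (\<lambda>s. b * \<eta> s + c * \<eta>' s) (b *\<^sub>R x + c *\<^sub>R y)"
  unfolding smooth_rep_def
proof (intro conjI allI impI)
  obtain K K' where K: "\<And>s. \<bar>\<eta> s\<bar> \<le> K" "\<And>s. \<bar>\<eta>' s\<bar> \<le> K'"
      and [measurable]: "\<eta> \<in> borel_measurable borel" "\<eta>' \<in> borel_measurable borel"
    using assms by (auto simp: smooth_rep_def)
  show "(\<lambda>s. b * \<eta> s + c * \<eta>' s) \<in> borel_measurable borel" by measurable
  have "\<bar>b * \<eta> s + c * \<eta>' s\<bar> \<le> \<bar>b\<bar> * K + \<bar>c\<bar> * K'" for s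
    using K by (intro order_trans[OF abs_triangle_ineq add_mono]) (auto simp: abs_mult intro: mult_left_mono)
  then show "\<exists>K. \<forall>s. \<bar>b * \<eta> s + c * \<eta>' s\<bar> \<le> K" by blast
  fix \<phi> \<rho> assume sl: "slope \<phi> \<rho>"
  then obtain L where L: "\<And>s. \<bar>\<rho> s\<bar> \<le> L" and [measurable]: "\<rho> \<in> borel_measurable borel" by (auto simp: slope_def)
  have i: "integrable lborel (\<lambda>s. indicator {0..T} s * (\<xi> s * \<rho> s))"
    if [measurable]: "\<xi> \<in> borel_measurable borel" and "\<And>s. \<bar>\<xi> s\<bar> \<le> K" for \<xi> K
    by (rule bounded_integrable_Icc[where K="K * L"])
      (use that L order_trans[OF abs_ge_zero that(2)] in \<open>auto simp: abs_mult intro!: mult_mono\<close>)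
  have "(b *\<^sub>R x + c *\<^sub>R y) \<bullet> \<phi> = b * (\<integral>s. indicator {0..T} s * (\<eta> s * \<rho> s) \<partial>lborel) +
      c * (\<integral>s. indicator {0..T} s * (\<eta>' s * \<rho> s) \<partial>lborel)"
    using assms sl by (auto simp: smooth_rep_def inner_add_left)
  also have "\<dots> = (\<integral>s. b * (indicator {0..T} s * (\<eta> s * \<rho> s)) + c * (indicator {0..T} s * (\<eta>' s * \<rho> s)) \<partial>lborel)"
    using i[OF _ K(1)] i[OF _ K(2)] by simp
  also have "\<dots> = (\<integral>s. indicator {0..T} s * ((b * \<eta> s + c * \<eta>' s) * \<rho> s) \<partial>lborel)"
    by (intro Bochner_Integration.integral_cong) (auto simp: algebra_simps)
  finally show "(b *\<^sub>R x + c *\<^sub>R y) \<bullet> \<phi> = (\<integral>s. indicator {0..T} s * ((b * \<eta> s + c * \<eta>' s) * \<rho> s) \<partial>lborel)" .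
next
  obtain K K' where K: "\<And>s. \<bar>\<eta> s\<bar> \<le> K" "\<And>s. \<bar>\<eta>' s\<bar> \<le> K'"
      and m[measurable]: "\<eta> \<in> borel_measurable borel" "\<eta>' \<in> borel_measurable borel"
    using assms by (auto simp: smooth_rep_def)
  let ?k = "\<lambda>\<eta> s. \<integral>v. indicator {0..T} v * (\<eta> v * \<bar>s - v\<bar> powr (2*H-2)) \<partial>lborel"
  have "?k (\<lambda>s. b * \<eta> s + c * \<eta>' s) s = b * ?k \<eta> s + c * ?k \<eta>' s" for s
  proof -
    have "?k (\<lambda>s. b * \<eta> s + c * \<eta>' s) s =
        (\<integral>v. b * (indicator {0..T} v * (\<eta> v * \<bar>s - v\<bar> powr (2*H-2))) + c *
        (indicator {0..T} v * (\<eta>' v * \<bar>s - v\<bar> powr (2*H-2))) \<partial>lborel)"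
      by (intro Bochner_Integration.integral_cong) (auto simp: algebra_simps)
    then show ?thesis using bounded_mult_kernel_integrable[OF m(1) K(1)]
        bounded_mult_kernel_integrable[OF m(2) K(2)] by simp
  qed
  then have eq: "(\<lambda>s. indicator {0..T} s * (H * (2*H-1) * ?k (\<lambda>s. b * \<eta> s + c * \<eta>' s) s)) =
    (\<lambda>s. b * (indicator {0..T} s * (H * (2*H-1) * ?k \<eta> s)) + c * (indicator {0..T} s * (H * (2*H-1) * ?k \<eta>' s)))"
    by (auto simp: fun_eq_iff algebra_simps)
  show "slope (b *\<^sub>R x + c *\<^sub>R y) (\<lambda>s. indicator {0..T} s * (H * (2*H-1) * ?k (\<lambda>s. b * \<eta> s + c * \<eta>' s) s))"
    unfolding eq using assms by (intro slope_linear) (auto simp: smooth_rep_def)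
qed

lemma smooth_rep_0: "smooth_rep (\<lambda>_. 0) 0"
  unfolding smooth_rep_def slope_def by auto

lemma smooth_rep_sum:
  assumes "finite I" "\<And>i. i \<in> I \<Longrightarrow> smooth_rep (\<eta> i) (x i)"
  shows "smooth_rep (\<lambda>s. \<Sum>i\<in>I. c i * \<eta> i s) (\<Sum>i\<in>I. c i *\<^sub>R x i)"
  using assms
proof (induction I)
  case empty
  show ?case by (simp add: smooth_rep_0)
next
  case (insert j I)
  have "smooth_rep (\<lambda>s. c j * \<eta> j s + 1 * (\<Sum>i\<in>I. c i * \<eta> i s)) (c j *\<^sub>R x j + 1 *\<^sub>R (\<Sum>i\<in>I. c i *\<^sub>R x i))"
    using insert by (intro smooth_rep_linear) auto
  then show ?case using insert.hyps by simp
qed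

lemma smooth_rep_norm:
  assumes "smooth_rep \<eta> x"
  shows "(norm x)\<^sup>2 \<le> (H * (2*H-1) * schur) * (\<integral>s. indicator {0..T} s * (\<eta> s)\<^sup>2 \<partial>lborel)"
proof -
  let ?k = "\<lambda>s v. \<bar>s - v\<bar> powr (2*H-2)"
  let ?\<rho> = "\<lambda>s. indicator {0..T} s * (H * (2*H-1) * (\<integral>v. indicator {0..T} v * (\<eta> v * ?k s v) \<partial>lborel))"
  obtain K where K: "\<And>s. \<bar>\<eta> s\<bar> \<le> K" and m[measurable]: "\<eta> \<in> borel_measurable borel"
    using assms by (auto simp: smooth_rep_def)
  have sl: "slope x ?\<rho>" using assms by (simp add: smooth_rep_def)
  have Hp: "H * (2*H-1) \<ge> 0" using H by simp
  have "(norm x)\<^sup>2 = (\<integral>s. indicator {0..T} s * (\<eta> s * ?\<rho> s) \<partial>lborel)"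
    using assms sl unfolding smooth_rep_def power2_norm_eq_inner by blast
  then have "ennreal ((norm x)\<^sup>2) \<le> ennreal (norm (\<integral>s. indicator {0..T} s * (\<eta> s * ?\<rho> s) \<partial>lborel))"
    by (simp add: ennreal_leI)
  also have "\<dots> \<le> (\<integral>\<^sup>+s. ennreal (norm (indicator {0..T} s * (\<eta> s * ?\<rho> s))) \<partial>lborel)"
    by (rule integral_norm_bound_nn)
  also have "\<dots> \<le> (\<integral>\<^sup>+s. ennreal (H * (2*H-1)) *
      ((\<integral>\<^sup>+v\<in>{0..T}. ennreal (\<bar>\<eta> s\<bar> * \<bar>\<eta> v\<bar> * ?k s v) \<partial>lborel) * indicator {0..T} s) \<partial>lborel)"
  proof (rule nn_integral_mono)
    fix s
    have "ennreal (norm (\<integral>v. indicator {0..T} v * (\<eta> v * ?k s v) \<partial>lborel)) \<le>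
        (\<integral>\<^sup>+v. ennreal (norm (indicator {0..T} v * (\<eta> v * ?k s v))) \<partial>lborel)"
      by (rule integral_norm_bound_nn)
    then have "ennreal \<bar>\<eta> s\<bar> * ennreal (norm (\<integral>v. indicator {0..T} v * (\<eta> v * ?k s v) \<partial>lborel)) \<le>
        ennreal \<bar>\<eta> s\<bar> * (\<integral>\<^sup>+v. ennreal (norm (indicator {0..T} v * (\<eta> v * ?k s v))) \<partial>lborel)"
      by (rule mult_left_mono) auto
    also have "\<dots> = (\<integral>\<^sup>+v\<in>{0..T}. ennreal (\<bar>\<eta> s\<bar> * \<bar>\<eta> v\<bar> * ?k s v) \<partial>lborel)"
      by (subst nn_integral_cmult[symmetric], measurable)
          (intro nn_integral_cong, auto simp: indicator_def abs_mult ennreal_mult mult.assoc)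
    finally have *: "ennreal \<bar>\<eta> s\<bar> * ennreal (norm (\<integral>v. indicator {0..T} v * (\<eta> v * ?k s v) \<partial>lborel)) \<le>
        (\<integral>\<^sup>+v\<in>{0..T}. ennreal (\<bar>\<eta> s\<bar> * \<bar>\<eta> v\<bar> * ?k s v) \<partial>lborel)" .
    have "ennreal (norm (indicator {0..T} s * (\<eta> s * ?\<rho> s))) =
        ennreal (H * (2*H-1)) * (ennreal \<bar>\<eta> s\<bar> * ennreal (norm (\<integral>v. indicator {0..T} v * (\<eta> v * ?k s v) \<partial>lborel))
        * indicator {0..T} s)"
      using H by (auto simp: indicator_def abs_mult abs_of_nonneg ennreal_mult[symmetric] mult_ac)
    also have "\<dots> \<le> ennreal (H * (2*H-1)) *
        ((\<integral>\<^sup>+v\<in>{0..T}. ennreal (\<bar>\<eta> s\<bar> * \<bar>\<eta> v\<bar> * ?k s v) \<partial>lborel) * indicator {0..T} s)"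
      using * by (intro mult_left_mono mult_right_mono) auto
    finally show "ennreal (norm (indicator {0..T} s * (\<eta> s * ?\<rho> s))) \<le>
        ennreal (H * (2*H-1)) * ((\<integral>\<^sup>+v\<in>{0..T}. ennreal (\<bar>\<eta> s\<bar> * \<bar>\<eta> v\<bar> * ?k s v) \<partial>lborel) * indicator {0..T} s)" .
  qed
  also have "\<dots> = ennreal (H * (2*H-1)) *
      (\<integral>\<^sup>+s\<in>{0..T}. (\<integral>\<^sup>+v\<in>{0..T}. ennreal (\<bar>\<eta> s\<bar> * \<bar>\<eta> v\<bar> * ?k s v) \<partial>lborel) \<partial>lborel)"
    by (rule nn_integral_cmult) measurable
  also have "\<dots> \<le> ennreal (H * (2*H-1)) * (ennreal schur * (\<integral>\<^sup>+s\<in>{0..T}. ennreal (\<bar>\<eta> s\<bar>\<^sup>2) \<partial>lborel))"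
    by (intro mult_left_mono schur_bound) auto
  also have "(\<integral>\<^sup>+s\<in>{0..T}. ennreal (\<bar>\<eta> s\<bar>\<^sup>2) \<partial>lborel) = (\<integral>\<^sup>+s. ennreal (indicator {0..T} s * (\<eta> s)\<^sup>2) \<partial>lborel)"
    by (intro nn_integral_cong) (auto simp: indicator_def)
  also have "\<dots> = ennreal (\<integral>s. indicator {0..T} s * (\<eta> s)\<^sup>2 \<partial>lborel)"
  proof (rule nn_integral_eq_integral)
    show "integrable lborel (\<lambda>s. indicator {0..T} s * (\<eta> s)\<^sup>2)"
      by (rule bounded_integrable_Icc[where K="K\<^sup>2"])
          (use K in \<open>auto intro!: abs_le_square_iff[THEN iffD1] order_trans[OF K abs_ge_self]\<close>)
  qed (auto simp: indicator_def)
  also have "ennreal (H * (2*H-1)) * (ennreal schur * ennreal (\<integral>s. indicator {0..T} s * (\<eta> s)\<^sup>2 \<partial>lborel)) =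
      ennreal ((H * (2*H-1) * schur) * (\<integral>s. indicator {0..T} s * (\<eta> s)\<^sup>2 \<partial>lborel))"
    using Hp schur_nonneg by (simp add: ennreal_mult[symmetric] mult.assoc)
  finally show ?thesis using Hp schur_nonneg
    by (subst (asm) ennreal_le_iff) (auto intro!: mult_nonneg_nonneg integral_nonneg_AE)
qed

definition riemann :: "real \<Rightarrow> (real \<Rightarrow> real) \<Rightarrow> nat \<Rightarrow> 'h" where
  "riemann t \<phi> N = (\<Sum>i<N. \<phi> (t * real i / real N) *\<^sub>R (e (t * real (Suc i) / real N) - e (t * real i / real N)))"

definition riemann_step :: "real \<Rightarrow> (real \<Rightarrow> real) \<Rightarrow> nat \<Rightarrow> real \<Rightarrow> real" where
  "riemann_step t \<phi> N s = (\<Sum>i<N. \<phi> (t * real i / real N) *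
      indicator {t * real i / real N<..t * real (Suc i) / real N} s)"

lemma riemann_rep:
  assumes t: "t \<in> {0..T}"
  shows "smooth_rep (riemann_step t \<phi> N) (riemann t \<phi> N)"
  unfolding riemann_def[abs_def] riemann_step_def[abs_def]
proof (rule smooth_rep_sum)
  fix i assume i: "i \<in> {..<N}"
  have "t * real (Suc i) / real N \<le> t * real N / real N"
    using t i by (intro divide_right_mono mult_left_mono) auto
  also have "\<dots> = t" using i by simp
  finally show "smooth_rep (indicator {t * real i / real N<..t * real (Suc i) / real N})
      (e (t * real (Suc i) / real N) - e (t * real i / real N))"
    using t by (intro smooth_rep_indicator divide_right_mono mult_left_mono) auto
qed simp

lemma riemann_step_outside:
  assumes t: "t \<ge> 0" and s: "s \<notin> {0<..t}"
  shows "riemann_step t \<phi> N s = 0"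
  unfolding riemann_step_def
proof (rule sum.neutral, rule ballI)
  fix i assume i: "i \<in> {..<N}"
  have "t * real (Suc i) / real N \<le> t * real N / real N"
    using t i by (intro divide_right_mono mult_left_mono) auto
  also have "\<dots> = t" using i by simp
  finally have 1: "t * real (Suc i) / real N \<le> t" .
  have 2: "0 \<le> t * real i / real N" using t by simp
  from s 1 2 have "s \<notin> {t * real i / real N<..t * real (Suc i) / real N}" by auto
  then show "\<phi> (t * real i / real N) * indicator {t * real i / real N<..t * real (Suc i) / real N} s = 0" by simp
qed

lemma riemann_step_inside:
  assumes s: "s \<in> {0<..t}" and N: "N > 0"
  shows "\<exists>p\<in>{0..t}. \<bar>p - s\<bar> \<le> t / real N \<and> riemann_step t \<phi> N s = \<phi> p"
proof -
  have t: "t > 0" using s by auto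
  define x where "x = s * real N / t"
  have x: "0 < x" "x \<le> real N" using s t N by (auto simp: x_def field_simps)
  define j where "j = nat (\<lceil>x\<rceil> - 1)"
  have c: "\<lceil>x\<rceil> \<ge> 1" using x by (simp add: le_ceiling_iff)
  then have jr: "real j = of_int \<lceil>x\<rceil> - 1" by (simp add: j_def)
  have jx: "real j < x" "x \<le> real j + 1" unfolding jr by linarith+
  have jN: "j < N" using jx x by linarith
  have iff: "s \<in> {t * real i / real N<..t * real (Suc i) / real N} \<longleftrightarrow> i = j" for i
  proof -
    have "s \<in> {t * real i / real N<..t * real (Suc i) / real N} \<longleftrightarrow> real i < x \<and> x \<le> real i + 1"
      using t N by (auto simp: x_def field_simps)
    also have "\<dots> \<longleftrightarrow> i = j" using jx by auto
    finally show ?thesis .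
  qed
  have "riemann_step t \<phi> N s = (\<Sum>i<N. if i = j then \<phi> (t * real i / real N) else 0)"
    unfolding riemann_step_def using iff by (intro sum.cong) (auto simp: indicator_def)
  also have "\<dots> = \<phi> (t * real j / real N)" using jN by simp
  finally have v: "riemann_step t \<phi> N s = \<phi> (t * real j / real N)" .
  have sj: "t * real j / real N < s" "s \<le> t * real (Suc j) / real N" using iff[of j] by auto
  have "t * real (Suc j) / real N = t * real j / real N + t / real N"
      by (simp add: add_divide_distrib distrib_left)
  then have "\<bar>t * real j / real N - s\<bar> \<le> t / real N" using sj by linarith
  moreover have "t * real j / real N \<in> {0..t}" using sj s t by auto
  ultimately show ?thesis using v by blast
qed

lemma riemann_step_bound:
  assumes t: "t \<ge> 0" and K: "\<And>p. p \<in> {0..t} \<Longrightarrow> \<bar>\<phi> p\<bar> \<le> K"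
  shows "\<bar>riemann_step t \<phi> N s\<bar> \<le> K"
proof -
  have K0: "0 \<le> K" using K[of 0] t abs_ge_zero[of "\<phi> 0"] by auto
  show ?thesis
  proof (cases "s \<in> {0<..t} \<and> N > 0")
    case True
    then show ?thesis using riemann_step_inside[of s t N \<phi>] K by auto
  next
    case False
    then have "riemann_step t \<phi> N s = 0"
      using riemann_step_outside[OF t, of s] by (auto simp: riemann_step_def)
    then show ?thesis using K0 by simp
  qed
qed

lemma riemann_step_tendsto:
  assumes t: "t \<ge> 0" and c: "continuous_on {0..t} \<phi>"
  shows "(\<lambda>N. riemann_step t \<phi> N s) \<longlonglongrightarrow> indicator {0<..t} s * \<phi> s"
proof (cases "s \<in> {0<..t}")
  case True
  have "\<forall>N. \<exists>p. N > 0 \<longrightarrow> p \<in> {0..t} \<and> \<bar>p - s\<bar> \<le> t / real N \<and> riemann_step t \<phi> N s = \<phi> p"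
    using riemann_step_inside[OF True] by blast
  then obtain p where p: "\<And>N. N > 0 \<Longrightarrow> p N \<in> {0..t}" "\<And>N. N > 0 \<Longrightarrow> \<bar>p N - s\<bar> \<le> t / real N"
      "\<And>N. N > 0 \<Longrightarrow> riemann_step t \<phi> N s = \<phi> (p N)" by metis
  have "(\<lambda>N. t * inverse (real N)) \<longlonglongrightarrow> t * 0" by (intro tendsto_intros lim_inverse_n)
  then have z: "(\<lambda>N. t / real N) \<longlonglongrightarrow> 0" by (simp add: divide_inverse)
  have "(\<lambda>N. p N - s) \<longlonglongrightarrow> 0"
  proof (rule Lim_null_comparison[OF _ z])
    show "\<forall>\<^sub>F N in sequentially. norm (p N - s) \<le> t / real N"
      using eventually_gt_at_top[of 0] by eventually_elim (simp add: p(2))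
  qed
  then have "p \<longlonglongrightarrow> s" by (simp add: LIM_zero_iff)
  then have "(\<lambda>N. \<phi> (p N)) \<longlonglongrightarrow> \<phi> s"
  proof (rule continuous_on_tendsto_compose[OF c])
    show "\<forall>\<^sub>F N in sequentially. p N \<in> {0..t}"
      using eventually_gt_at_top[of 0] by eventually_elim (rule p(1))
  qed (use True in auto)
  moreover have "\<forall>\<^sub>F N in sequentially. \<phi> (p N) = riemann_step t \<phi> N s"
    using eventually_gt_at_top[of 0] by eventually_elim (simp add: p(3))
  ultimately have "(\<lambda>N. riemann_step t \<phi> N s) \<longlonglongrightarrow> \<phi> s" by (rule Lim_transform_eventually)
  then show ?thesis using True by simp
next
  case False
  then show ?thesis using riemann_step_outside[OF t False] by simp
qed

lemma riemann_step_measurable[measurable]: "riemann_step t \<phi> N \<in> borel_measurable borel"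
  unfolding riemann_step_def[abs_def] by measurable

lemma continuous_cutoff_measurable:
  fixes \<phi> :: "real \<Rightarrow> real"
  assumes t: "t \<ge> 0" and c: "continuous_on {0..t} \<phi>"
  shows "(\<lambda>s. indicator {0<..t} s * \<phi> s) \<in> borel_measurable borel"
  by (rule borel_measurable_LIMSEQ_real[OF riemann_step_tendsto[OF assms]]) measurable

lemma continuous_Icc_bound:
  fixes \<phi> :: "real \<Rightarrow> real"
  assumes "continuous_on {0..t} \<phi>"
  obtains K where "\<And>p. p \<in> {0..t} \<Longrightarrow> \<bar>\<phi> p\<bar> \<le> K" "K \<ge> 0"
proof -
  have "bounded (\<phi> ` {0..t})" using assms by (intro compact_imp_bounded compact_continuous_image) auto
  then have "\<exists>K. \<forall>p\<in>{0..t}. \<bar>\<phi> p\<bar> \<le> K" by (auto simp: bounded_iff)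
  then obtain K where "\<And>p. p \<in> {0..t} \<Longrightarrow> \<bar>\<phi> p\<bar> \<le> K" by blast
  then show ?thesis using that[of "max K 0"] by (meson max.coboundedI1 max.cobounded2)
qed

abbreviation "CH \<equiv> H * (2*H-1) * schur"

lemma CH_nonneg: "0 \<le> CH"
  using H schur_nonneg by (intro mult_nonneg_nonneg) auto

lemma riemann_step_L2:
  assumes t: "t \<in> {0..T}" and c: "continuous_on {0..t} \<phi>"
  shows "(\<lambda>N. \<integral>s. indicator {0..T} s * (riemann_step t \<phi> N s - indicator {0<..t} s * \<phi> s)\<^sup>2 \<partial>lborel) \<longlonglongrightarrow> 0"
proof -
  have t0: "t \<ge> 0" using t by auto
  note [measurable] = continuous_cutoff_measurable[OF t0 c]
  obtain K where K: "\<And>p. p \<in> {0..t} \<Longrightarrow> \<bar>\<phi> p\<bar> \<le> K" "K \<ge> 0" using continuous_Icc_bound[OF c] by blast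
  have b: "\<bar>riemann_step t \<phi> N s - indicator {0<..t} s * \<phi> s\<bar> \<le> \<bar>2 * K\<bar>" for N s
  proof -
    have "\<bar>indicator {0<..t} s * \<phi> s\<bar> \<le> K" using K by (auto simp: indicator_def)
    then show ?thesis using riemann_step_bound[of t \<phi> K N s, OF t0 K(1)] K(2) by linarith
  qed
  have "(\<lambda>N. \<integral>s. indicator {0..T} s * (riemann_step t \<phi> N s - indicator {0<..t} s * \<phi> s)\<^sup>2 \<partial>lborel) \<longlonglongrightarrow>
      (\<integral>s. indicator {0..T} s * (indicator {0<..t} s * \<phi> s - indicator {0<..t} s * \<phi> s)\<^sup>2 \<partial>lborel)"
  proof (rule integral_dominated_convergence[where w="\<lambda>s. indicator {0..T} s * (2 * K)\<^sup>2"])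
    show "integrable lborel (\<lambda>s. indicator {0..T} s * (2 * K)\<^sup>2)"
        by (intro integrable_mult_left integrable_real_indicator) (auto simp: emeasure_lborel_Icc_eq)
    show "AE s in lborel. (\<lambda>N. indicator {0..T} s * (riemann_step t \<phi> N s - indicator {0<..t} s * \<phi> s)\<^sup>2) \<longlonglongrightarrow>
        indicator {0..T} s * (indicator {0<..t} s * \<phi> s - indicator {0<..t} s * \<phi> s)\<^sup>2"
      by (intro AE_I2 tendsto_intros riemann_step_tendsto t0 c)
    show "AE s in lborel. norm (indicator {0..T} s * (riemann_step t \<phi> N s - indicator {0<..t} s * \<phi> s)\<^sup>2) \<le>
        indicator {0..T} s * (2 * K)\<^sup>2" for N
    proof (rule AE_I2)
      fix s
      have "(riemann_step t \<phi> N s - indicator {0<..t} s * \<phi> s)\<^sup>2 \<le> (2*K)\<^sup>2"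
        using b[of N s] by (simp only: abs_le_square_iff)
      then show "norm (indicator {0..T} s * (riemann_step t \<phi> N s - indicator {0<..t} s * \<phi> s)\<^sup>2) \<le>
          indicator {0..T} s * (2 * K)\<^sup>2"
        by (auto simp: abs_mult intro!: mult_left_mono)
    qed
  qed measurable
  then show ?thesis by simp
qed

lemma riemann_diff: "riemann t \<phi> N - riemann t \<psi> N = riemann t (\<lambda>s. \<phi> s - \<psi> s) N"
  by (simp add: riemann_def sum_subtractf[symmetric] scaleR_left_diff_distrib[symmetric])

lemma square_integrable_cutoff:
  fixes f :: "real \<Rightarrow> real"
  assumes "f \<in> borel_measurable borel" "\<And>s. \<bar>f s\<bar> \<le> K"
  shows "square_integrable lborel (\<lambda>s. indicator {0..T} s * f s)"
proof -
  have "integrable lborel (\<lambda>s. indicator {0..T} s * (f s)\<^sup>2)"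
    by (rule bounded_integrable_Icc[where K="K\<^sup>2"])
        (use assms in \<open>auto intro!: abs_le_square_iff[THEN iffD1] order_trans[OF assms(2) abs_ge_self]\<close>)
  moreover have "(indicator {0..T} s * f s)\<^sup>2 = indicator {0..T} s * (f s)\<^sup>2" for s by (auto simp: indicator_def)
  ultimately show ?thesis using assms by (simp add: square_integrable_def)
qed

lemma riemann_convergent:
  assumes t: "t \<in> {0..T}" and c: "continuous_on {0..t} \<phi>"
  shows "convergent (riemann t \<phi>)"
proof -
  have t0: "t \<ge> 0" using t by auto
  note [measurable] = continuous_cutoff_measurable[OF t0 c]
  obtain K where K: "\<And>p. p \<in> {0..t} \<Longrightarrow> \<bar>\<phi> p\<bar> \<le> K" "K \<ge> 0" using continuous_Icc_bound[OF c] by blast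
  define A where "A N = (\<integral>s. indicator {0..T} s * (riemann_step t \<phi> N s - indicator {0<..t} s * \<phi> s)\<^sup>2 \<partial>lborel)"
      for N
  have A: "A \<longlonglongrightarrow> 0" unfolding A_def by (rule riemann_step_L2[OF t c])
  have sq: "square_integrable lborel (\<lambda>s. indicator {0..T} s * riemann_step t \<phi> N s)" for N
    by (rule square_integrable_cutoff[OF riemann_step_measurable riemann_step_bound[of t \<phi> K, OF t0 K(1)]])
  have sq2: "square_integrable lborel (\<lambda>s. indicator {0..T} s * (indicator {0<..t} s * \<phi> s))"
    by (rule square_integrable_cutoff[OF continuous_cutoff_measurable[OF t0 c], where K=K])
        (use K in \<open>auto simp: indicator_def\<close>)
  have ind: "(indicator {0..T} s * x - indicator {0..T} s * y)\<^sup>2 = indicator {0..T} s * (x - y)\<^sup>2"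
      for s x y :: real
    by (auto simp: indicator_def)
  have n: "(norm (riemann t \<phi> N - riemann t \<phi> N'))\<^sup>2 \<le> CH * (2 * A N + 2 * A N')" for N N'
  proof -
    have "smooth_rep (\<lambda>s. 1 * riemann_step t \<phi> N s + (-1) * riemann_step t \<phi> N' s)
        (1 *\<^sub>R riemann t \<phi> N + (-1) *\<^sub>R riemann t \<phi> N')"
      by (intro smooth_rep_linear riemann_rep t)
    from smooth_rep_norm[OF this]
    have "(norm (riemann t \<phi> N - riemann t \<phi> N'))\<^sup>2 \<le>
        CH * (\<integral>s. indicator {0..T} s * (riemann_step t \<phi> N s - riemann_step t \<phi> N' s)\<^sup>2 \<partial>lborel)"
      by simp
    also have "\<dots> \<le> CH * (2 * A N + 2 * A N')"
      using integral_square_diff_triangle[OF sq sq sq2, of N N'] CH_nonneg unfolding ind A_def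
      by (intro mult_left_mono) auto
    finally show ?thesis .
  qed
  have "Cauchy (riemann t \<phi>)"
  proof (rule metric_CauchyI)
    fix r :: real assume r: "r > 0"
    have "(\<lambda>N. 4 * CH * A N) \<longlonglongrightarrow> 4 * CH * 0" by (intro tendsto_intros A)
    then have "\<forall>\<^sub>F N in sequentially. 4 * CH * A N < r\<^sup>2"
      using r by (intro order_tendstoD(2)) (auto)
    then obtain N0 where N0: "\<And>N. N \<ge> N0 \<Longrightarrow> 4 * CH * A N < r\<^sup>2" by (auto simp: eventually_sequentially)
    have "dist (riemann t \<phi> N) (riemann t \<phi> N') < r" if "N \<ge> N0" "N' \<ge> N0" for N N'
    proof -
      have "(norm (riemann t \<phi> N - riemann t \<phi> N'))\<^sup>2 \<le> (4 * CH * A N) / 2 + (4 * CH * A N') / 2"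
      proof -
        have "c * (2 * x + 2 * y) = (4 * c * x) / 2 + (4 * c * y) / 2" for c x y :: real
            by (simp add: algebra_simps)
        then show ?thesis using n[of N N'] by (simp only:)
      qed
      also have "\<dots> < r\<^sup>2" using N0[OF that(1)] N0[OF that(2)] by linarith
      finally show ?thesis using r by (simp add: dist_norm power2_less_imp_less)
    qed
    then show "\<exists>N0. \<forall>N\<ge>N0. \<forall>N'\<ge>N0. dist (riemann t \<phi> N) (riemann t \<phi> N') < r" by blast
  qed
  then show ?thesis by (simp add: Cauchy_convergent_iff)
qed

definition wiener_elem :: "real \<Rightarrow> (real \<Rightarrow> real) \<Rightarrow> 'h" where "wiener_elem t \<phi> = lim (riemann t \<phi>)"

lemma riemann_tendsto:
  "t \<in> {0..T} \<Longrightarrow> continuous_on {0..t} \<phi> \<Longrightarrow> riemann t \<phi> \<longlonglongrightarrow> wiener_elem t \<phi>"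
  using riemann_convergent by (simp add: wiener_elem_def convergent_LIMSEQ_iff)

lemma wiener_elem_slope:
  assumes t: "t \<in> {0..T}" and c: "continuous_on {0..t} \<phi>" and sl: "slope x \<rho>"
  shows "wiener_elem t \<phi> \<bullet> x = (\<integral>s. indicator {0..t} s * (\<phi> s * \<rho> s) \<partial>lborel)"
proof (rule LIMSEQ_unique)
  have t0: "t \<ge> 0" using t by auto
  note cm[measurable] = continuous_cutoff_measurable[OF t0 c]
  obtain K where K: "\<And>p. p \<in> {0..t} \<Longrightarrow> \<bar>\<phi> p\<bar> \<le> K" "K \<ge> 0" using continuous_Icc_bound[OF c] by blast
  obtain L where L: "\<And>s. \<bar>\<rho> s\<bar> \<le> L" and [measurable]: "\<rho> \<in> borel_measurable borel" using sl
      by (auto simp: slope_def)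
  show "(\<lambda>N. riemann t \<phi> N \<bullet> x) \<longlonglongrightarrow> wiener_elem t \<phi> \<bullet> x"
    by (intro tendsto_intros riemann_tendsto t c)
  have eq: "riemann t \<phi> N \<bullet> x = (\<integral>s. indicator {0..T} s * (riemann_step t \<phi> N s * \<rho> s) \<partial>lborel)" for N
    using riemann_rep[OF t] sl unfolding smooth_rep_def by blast
  have "(\<lambda>N. riemann t \<phi> N \<bullet> x) \<longlonglongrightarrow> (\<integral>s. indicator {0..T} s * ((indicator {0<..t} s * \<phi> s) * \<rho> s) \<partial>lborel)"
    unfolding eq
  proof (rule integral_dominated_convergence[where w="\<lambda>s. indicator {0..T} s * (K * L)"])
    show "integrable lborel (\<lambda>s. indicator {0..T} s * (K * L))"
        by (intro integrable_mult_left integrable_real_indicator) (auto simp: emeasure_lborel_Icc_eq)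
    show "AE s in lborel. (\<lambda>N. indicator {0..T} s * (riemann_step t \<phi> N s * \<rho> s)) \<longlonglongrightarrow>
        indicator {0..T} s * ((indicator {0<..t} s * \<phi> s) * \<rho> s)"
      by (intro AE_I2 tendsto_intros riemann_step_tendsto t0 c)
    show "AE s in lborel. norm (indicator {0..T} s * (riemann_step t \<phi> N s * \<rho> s)) \<le> indicator {0..T} s * (K * L)"
        for N
      using K L riemann_step_bound[of t \<phi> K, OF t0 K(1)]
      by (intro AE_I2) (auto simp: abs_mult intro!: mult_left_mono mult_mono)
  qed measurable
  also have "(\<integral>s. indicator {0..T} s * ((indicator {0<..t} s * \<phi> s) * \<rho> s) \<partial>lborel) =
      (\<integral>s. indicator {0..t} s * (\<phi> s * \<rho> s) \<partial>lborel)"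
  proof (rule integral_cong_AE)
    show "AE s in lborel. indicator {0..T} s * ((indicator {0<..t} s * \<phi> s) * \<rho> s) =
        indicator {0..t} s * (\<phi> s * \<rho> s)"
      using AE_lborel_singleton[of 0] by eventually_elim (use t in \<open>auto simp: indicator_def\<close>)
    have "(\<lambda>s. (indicator {0<..t} s * \<phi> s) * \<rho> s + indicator {0} s * (\<phi> 0 * \<rho> 0)) \<in> borel_measurable lborel"
        by measurable
    also have "(\<lambda>s. (indicator {0<..t} s * \<phi> s) * \<rho> s + indicator {0} s * (\<phi> 0 * \<rho> 0)) =
        (\<lambda>s. indicator {0..t} s * (\<phi> s * \<rho> s))"
      using t0 by (auto simp: fun_eq_iff indicator_def)
    finally show "(\<lambda>s. indicator {0..t} s * (\<phi> s * \<rho> s)) \<in> borel_measurable lborel" .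
  qed measurable
  finally show "(\<lambda>N. riemann t \<phi> N \<bullet> x) \<longlonglongrightarrow> (\<integral>s. indicator {0..t} s * (\<phi> s * \<rho> s) \<partial>lborel)" .
qed

lemma wiener_elem_norm:
  assumes t: "t \<in> {0..T}" and c: "continuous_on {0..t} \<phi>" "continuous_on {0..t} \<psi>"
  shows "(norm (wiener_elem t \<phi> - wiener_elem t \<psi>))\<^sup>2 \<le> CH * (\<integral>s. indicator {0..t} s * (\<phi> s - \<psi> s)\<^sup>2 \<partial>lborel)"
proof (rule LIMSEQ_le)
  have t0: "t \<ge> 0" using t by auto
  let ?d = "\<lambda>s. \<phi> s - \<psi> s"
  have cd: "continuous_on {0..t} ?d" using c by (intro continuous_intros)
  note cm[measurable] = continuous_cutoff_measurable[OF t0 cd]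
  obtain K where K: "\<And>p. p \<in> {0..t} \<Longrightarrow> \<bar>?d p\<bar> \<le> K" "K \<ge> 0" using continuous_Icc_bound[OF cd] by blast
  show "(\<lambda>N. (norm (riemann t \<phi> N - riemann t \<psi> N))\<^sup>2) \<longlonglongrightarrow> (norm (wiener_elem t \<phi> - wiener_elem t \<psi>))\<^sup>2"
    by (intro tendsto_intros riemann_tendsto t c)
  have "(\<lambda>N. \<integral>s. indicator {0..T} s * (riemann_step t ?d N s)\<^sup>2 \<partial>lborel) \<longlonglongrightarrow>
      (\<integral>s. indicator {0..T} s * (indicator {0<..t} s * ?d s)\<^sup>2 \<partial>lborel)"
  proof (rule integral_dominated_convergence[where w="\<lambda>s. indicator {0..T} s * K\<^sup>2"])
    show "integrable lborel (\<lambda>s. indicator {0..T} s * K\<^sup>2)"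
        by (intro integrable_mult_left integrable_real_indicator) (auto simp: emeasure_lborel_Icc_eq)
    show "AE s in lborel. (\<lambda>N. indicator {0..T} s * (riemann_step t ?d N s)\<^sup>2) \<longlonglongrightarrow>
        indicator {0..T} s * (indicator {0<..t} s * ?d s)\<^sup>2"
      by (intro AE_I2 tendsto_intros riemann_step_tendsto t0 cd)
    show "AE s in lborel. norm (indicator {0..T} s * (riemann_step t ?d N s)\<^sup>2) \<le> indicator {0..T} s * K\<^sup>2" for N
    proof (rule AE_I2)
      fix s
      have "(riemann_step t ?d N s)\<^sup>2 \<le> K\<^sup>2"
        using riemann_step_bound[of t ?d K N s, OF t0 K(1)] K(2)
            by (simp only: abs_le_square_iff[symmetric] abs_of_nonneg)
      then show "norm (indicator {0..T} s * (riemann_step t ?d N s)\<^sup>2) \<le> indicator {0..T} s * K\<^sup>2"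
        by (auto simp: abs_mult intro!: mult_left_mono)
    qed
  qed measurable
  also have "(\<integral>s. indicator {0..T} s * (indicator {0<..t} s * ?d s)\<^sup>2 \<partial>lborel) =
      (\<integral>s. indicator {0..t} s * (?d s)\<^sup>2 \<partial>lborel)"
  proof (rule integral_cong_AE)
    show "AE s in lborel. indicator {0..T} s * (indicator {0<..t} s * ?d s)\<^sup>2 = indicator {0..t} s * (?d s)\<^sup>2"
      using AE_lborel_singleton[of 0] by eventually_elim (use t in \<open>auto simp: indicator_def\<close>)
    have "(\<lambda>s. (indicator {0<..t} s * ?d s)\<^sup>2 + indicator {0} s * (?d 0)\<^sup>2) \<in> borel_measurable lborel"
        by measurable
    also have "(\<lambda>s. (indicator {0<..t} s * ?d s)\<^sup>2 + indicator {0} s * (?d 0)\<^sup>2) =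
        (\<lambda>s. indicator {0..t} s * (?d s)\<^sup>2)"
      using t0 by (auto simp: fun_eq_iff indicator_def)
    finally show "(\<lambda>s. indicator {0..t} s * (?d s)\<^sup>2) \<in> borel_measurable lborel" .
  qed measurable
  finally show "(\<lambda>N. CH * (\<integral>s. indicator {0..T} s * (riemann_step t ?d N s)\<^sup>2 \<partial>lborel)) \<longlonglongrightarrow>
      CH * (\<integral>s. indicator {0..t} s * (?d s)\<^sup>2 \<partial>lborel)"
    by (intro tendsto_intros)
  show "\<exists>N0. \<forall>N\<ge>N0. (norm (riemann t \<phi> N - riemann t \<psi> N))\<^sup>2 \<le>
      CH * (\<integral>s. indicator {0..T} s * (riemann_step t ?d N s)\<^sup>2 \<partial>lborel)"
    unfolding riemann_diff using smooth_rep_norm[OF riemann_rep[OF t]] by blast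
qed

end

section \<open>The logarithm along a path as an element of the Hilbert space\<close>

lemma ln_square_near_zero:
  fixes y :: real
  assumes "\<bar>y\<bar> \<le> 1"
  shows "(ln \<bar>y\<bar>)\<^sup>2 \<le> 16 * \<bar>y\<bar> powr (1/2 - 1)"
proof (cases "y = 0")
  case False
  define z where "z = \<bar>y\<bar> powr (-1/4)"
  have z: "z > 0" using False by (simp add: z_def)
  have lz: "ln z = - ln \<bar>y\<bar> / 4" using False by (simp add: z_def ln_powr)
  have "ln \<bar>y\<bar> \<le> 0" using assms False by simp
  then have "0 \<le> - ln \<bar>y\<bar>" "- ln \<bar>y\<bar> \<le> 4 * z" using lz ln_le_minus_one[OF z] by auto
  then have "(- ln \<bar>y\<bar>)\<^sup>2 \<le> (4 * z)\<^sup>2" by (intro power_mono) auto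
  also have "(4 * z)\<^sup>2 = 16 * \<bar>y\<bar> powr (1/2 - 1)"
    by (simp add: z_def power2_eq_square powr_add[symmetric])
  finally show ?thesis by simp
qed simp

lemma ln_square_le:
  fixes y :: real
  shows "(ln \<bar>y\<bar>)\<^sup>2 \<le> indicator {-1..1} y * (16 * \<bar>y\<bar> powr (1/2 - 1)) + y\<^sup>2"
proof (cases "\<bar>y\<bar> \<le> 1")
  case True
  then have "y \<in> {-1..1}" by auto
  then show ?thesis using ln_square_near_zero[OF True] by (simp add: add_increasing2)
next
  case False
  then have "ln \<bar>y\<bar> \<le> \<bar>y\<bar> - 1" by (intro ln_le_minus_one) auto
  then have "0 \<le> ln \<bar>y\<bar>" "ln \<bar>y\<bar> \<le> \<bar>y\<bar>" using False by auto
  then have "(ln \<bar>y\<bar>)\<^sup>2 \<le> \<bar>y\<bar>\<^sup>2" by (intro power_mono)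
  then show ?thesis by (simp add: add_increasing indicator_def)
qed

lemma normal_density_le: "\<sigma> > 0 \<Longrightarrow> normal_density m \<sigma> x \<le> 1 / \<sigma>"
proof -
  assume s: "\<sigma> > 0"
  have p1: "1 \<le> sqrt (2 * pi)" using pi_ge_two by simp
  have e: "exp (- (x - m)\<^sup>2 / (2 * \<sigma>\<^sup>2)) \<le> 1" by simp
  have "normal_density m \<sigma> x \<le> 1 / sqrt (2 * pi * \<sigma>\<^sup>2) * 1"
    unfolding normal_density_def using e by (intro mult_left_mono) auto
  also have "\<dots> = 1 / (sqrt (2 * pi) * \<sigma>)" using s by (simp add: real_sqrt_mult)
  also have "\<dots> \<le> 1 / \<sigma>" using s p1 by (intro divide_left_mono) auto
  finally show ?thesis .
qed

context fbm_setting
begin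

lemma norm_e: "s \<in> {0..T} \<Longrightarrow> norm (e s) = s powr H"
proof -
  assume s: "s \<in> {0..T}"
  have "(norm (e s))\<^sup>2 = (s powr H)\<^sup>2"
    unfolding power2_norm_eq_inner e_inner[OF s s] by (simp add: fbm_cov_def power2_eq_square powr_add[symmetric])
  then show ?thesis by (simp add: power2_eq_iff_nonneg)
qed

lemma B_nn_integral:
  assumes s: "s \<in> {0<..T}" and [measurable]: "g \<in> borel_measurable borel"
  shows "(\<integral>\<^sup>+\<omega>. g (B s \<omega>) \<partial>M) = (\<integral>\<^sup>+x. ennreal (normal_density 0 (s powr H) x) * g x \<partial>lborel)"
proof -
  have s': "s \<in> {0..T}" using s by auto
  have "e s \<noteq> 0" using norm_e[OF s'] s by auto
  from W_normal[OF e_steps[OF s'] this]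
  have d: "distributed M lborel (W (e s)) (\<lambda>x. ennreal (normal_density 0 (s powr H) x))"
      by (simp add: norm_e[OF s'])
  have "(\<integral>\<^sup>+\<omega>. g (B s \<omega>) \<partial>M) = (\<integral>\<^sup>+\<omega>. g (W (e s) \<omega>) \<partial>M)"
    using W_e[OF s'] by (intro nn_integral_cong_AE) (auto elim: eventually_mono)
  also have "\<dots> = (\<integral>\<^sup>+x. ennreal (normal_density 0 (s powr H) x) * g x \<partial>lborel)"
    by (rule distributed_nn_integral[OF d, symmetric]) simp
  finally show ?thesis .
qed

lemma B_not_eq: "s \<in> {0<..T} \<Longrightarrow> AE \<omega> in M. B s \<omega> \<noteq> a"
proof -
  assume s: "s \<in> {0<..T}"
  then have [measurable]: "B s \<in> borel_measurable M" by (intro B_measurable) auto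
  have "(\<integral>\<^sup>+\<omega>. indicator {a} (B s \<omega>) \<partial>M) =
      (\<integral>\<^sup>+x. ennreal (normal_density 0 (s powr H) x) * indicator {a} x \<partial>lborel)"
    by (rule B_nn_integral[OF s]) simp
  also have "\<dots> = (\<integral>\<^sup>+x. 0 \<partial>(lborel :: real measure))"
    using AE_lborel_singleton[of a]
        by (intro nn_integral_cong_AE) (auto elim!: eventually_mono simp: indicator_def)
  finally have "(\<integral>\<^sup>+\<omega>. indicator {a} (B s \<omega>) \<partial>M) = 0" by simp
  then have "AE \<omega> in M. indicator {a} (B s \<omega>) = (0 :: ennreal)"
    by (subst (asm) nn_integral_0_iff_AE) auto
  then show ?thesis by eventually_elim (auto simp: indicator_def split: if_splits)
qed

lemma ln_B_nn_integral:
  assumes s: "s \<in> {0<..T}"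
  shows "(\<integral>\<^sup>+\<omega>. ennreal ((ln \<bar>B s \<omega> - a\<bar>)\<^sup>2) \<partial>M) \<le> ennreal (64 * s powr (- H) + (2 * T powr (2*H) + 2 * a\<^sup>2))"
proof -
  have s': "s \<in> {0..T}" using s by auto
  note [measurable] = B_measurable[OF s']
  have "(\<integral>\<^sup>+\<omega>. ennreal ((ln \<bar>B s \<omega> - a\<bar>)\<^sup>2) \<partial>M) \<le>
     (\<integral>\<^sup>+\<omega>. ennreal (16 * \<bar>B s \<omega> - a\<bar> powr (1/2-1)) * indicator {-1..1} (B s \<omega> - a) + ennreal ((B s \<omega> - a)\<^sup>2) \<partial>M)"
  proof (rule nn_integral_mono)
    fix \<omega>
    have "ennreal ((ln \<bar>B s \<omega> - a\<bar>)\<^sup>2) \<le>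
        ennreal (indicator {-1..1} (B s \<omega> - a) * (16 * \<bar>B s \<omega> - a\<bar> powr (1/2 - 1)) + (B s \<omega> - a)\<^sup>2)"
      by (intro ennreal_leI ln_square_le)
    also have "\<dots> = ennreal (16 * \<bar>B s \<omega> - a\<bar> powr (1/2-1)) * indicator {-1..1} (B s \<omega> - a) +
        ennreal ((B s \<omega> - a)\<^sup>2)"
      by (subst ennreal_plus) (auto simp: indicator_def)
    finally show "ennreal ((ln \<bar>B s \<omega> - a\<bar>)\<^sup>2) \<le>
        ennreal (16 * \<bar>B s \<omega> - a\<bar> powr (1/2-1)) * indicator {-1..1} (B s \<omega> - a) + ennreal ((B s \<omega> - a)\<^sup>2)" .
  qed
  also have "\<dots> = (\<integral>\<^sup>+\<omega>. ennreal (16 * \<bar>B s \<omega> - a\<bar> powr (1/2-1)) * indicator {-1..1} (B s \<omega> - a) \<partial>M) +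
      (\<integral>\<^sup>+\<omega>. ennreal ((B s \<omega> - a)\<^sup>2) \<partial>M)"
    by (rule nn_integral_add) measurable
  also have "\<dots> \<le> ennreal (64 * s powr (-H)) + ennreal (2 * T powr (2*H) + 2 * a\<^sup>2)"
  proof (rule add_mono)
    have "(\<integral>\<^sup>+\<omega>. ennreal (16 * \<bar>B s \<omega> - a\<bar> powr (1/2-1)) * indicator {-1..1} (B s \<omega> - a) \<partial>M) =
      (\<integral>\<^sup>+x. ennreal (normal_density 0 (s powr H) x) *
          (ennreal (16 * \<bar>x - a\<bar> powr (1/2-1)) * indicator {-1..1} (x - a)) \<partial>lborel)"
      by (rule B_nn_integral[OF s, of "\<lambda>x. ennreal (16 * \<bar>x - a\<bar> powr (1/2-1)) * indicator {-1..1} (x - a)"])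
          measurable
    also have "\<dots> \<le> (\<integral>\<^sup>+x. ennreal (16 * s powr (-H)) * (ennreal (\<bar>a - x\<bar> powr (1/2-1)) * indicator {a-1..a+1} x)
        \<partial>lborel)"
    proof (rule nn_integral_mono)
      fix x
      have "normal_density 0 (s powr H) x \<le> s powr (-H)"
        using normal_density_le[of "s powr H" 0 x] s by (simp add: powr_minus_divide)
      then have "ennreal (normal_density 0 (s powr H) x) * ennreal (16 * \<bar>x - a\<bar> powr (1/2-1)) \<le>
          ennreal (s powr (-H)) * ennreal (16 * \<bar>x - a\<bar> powr (1/2-1))"
        by (intro mult_right_mono ennreal_leI) auto
      also have "\<dots> = ennreal (16 * s powr (-H)) * ennreal (\<bar>a - x\<bar> powr (1/2-1))"
        by (simp add: ennreal_mult[symmetric] abs_minus_commute mult_ac)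
      finally show "ennreal (normal_density 0 (s powr H) x) *
          (ennreal (16 * \<bar>x - a\<bar> powr (1/2-1)) * indicator {-1..1} (x - a)) \<le> ennreal (16 * s powr (-H)) *
          (ennreal (\<bar>a - x\<bar> powr (1/2-1)) * indicator {a-1..a+1} x)"
        by (auto simp: indicator_def)
    qed
    also have "\<dots> = ennreal (16 * s powr (-H)) * ennreal 4"
      by (subst nn_integral_cmult) (use nn_integral_abs_powr_Icc[of "1/2" "a-1" "a+1" a] in auto)
    also have "\<dots> = ennreal (64 * s powr (-H))" by (simp add: ennreal_mult'[symmetric] del: ennreal_numeral)
    finally show "(\<integral>\<^sup>+\<omega>. ennreal (16 * \<bar>B s \<omega> - a\<bar> powr (1/2-1)) * indicator {-1..1} (B s \<omega> - a) \<partial>M) \<le>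
        ennreal (64 * s powr (-H))" .
    have sq: "square_integrable M (\<lambda>\<omega>. B s \<omega> - a)" "integrable M (\<lambda>\<omega>. (B s \<omega>)\<^sup>2)"
      using square_integrable_diff[OF B_square_integrable[OF s'] square_integrable_const]
          B_square_integrable[OF s'] by (simp_all add: square_integrable_def)
    have "(\<integral>\<omega>. (B s \<omega> - a)\<^sup>2 \<partial>M) \<le> (\<integral>\<omega>. 2 * (B s \<omega>)\<^sup>2 + 2 * a\<^sup>2 \<partial>M)"
    proof (rule integral_mono)
      show "(B s \<omega> - a)\<^sup>2 \<le> 2 * (B s \<omega>)\<^sup>2 + 2 * a\<^sup>2" for \<omega>
        using zero_le_power2[of "B s \<omega> + a"] by (simp add: power2_eq_square algebra_simps)
    qed (use sq in \<open>auto simp: square_integrable_def\<close>)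
    also have "\<dots> = 2 * s powr (2*H) + 2 * a\<^sup>2" using sq B_second_moment[OF s'] by (simp add: prob_space)
    also have "\<dots> \<le> 2 * T powr (2*H) + 2 * a\<^sup>2" using s H by (auto intro!: powr_mono2)
    finally have "(\<integral>\<omega>. (B s \<omega> - a)\<^sup>2 \<partial>M) \<le> 2 * T powr (2*H) + 2 * a\<^sup>2" .
    then show "(\<integral>\<^sup>+\<omega>. ennreal ((B s \<omega> - a)\<^sup>2) \<partial>M) \<le> ennreal (2 * T powr (2*H) + 2 * a\<^sup>2)"
      using sq by (subst nn_integral_eq_integral)
          (auto simp: square_integrable_def simp del: ennreal_plus intro!: ennreal_leI)
  qed
  also have "\<dots> = ennreal (64 * s powr (- H) + (2 * T powr (2*H) + 2 * a\<^sup>2))" by simp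
  finally show ?thesis .
qed

end

locale fbm_level = fbm_setting M B e W H T
  for M :: "'a measure" and B :: "real \<Rightarrow> 'a \<Rightarrow> real"
    and e :: "real \<Rightarrow> 'h::{real_inner,banach,second_countable_topology}"
    and W :: "'h \<Rightarrow> 'a \<Rightarrow> real" and H T :: real +
  fixes a t :: real
  assumes t: "t \<in> {0..T}"
begin

abbreviation "X s \<omega> \<equiv> B (clip s) \<omega> - a"

lemma X_joint: "(\<lambda>p. X (fst p) (snd p)) \<in> borel_measurable (lborel \<Otimes>\<^sub>M M)"
  using B_clip_joint by simp

lemma compose_X_joint: "g \<in> borel_measurable borel \<Longrightarrow>
    (\<lambda>p. g (X (fst p) (snd p)) :: real) \<in> borel_measurable (lborel \<Otimes>\<^sub>M M)"
  by (rule measurable_compose[OF X_joint])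

lemma X_path_measurable: "\<omega> \<in> space M \<Longrightarrow> (\<lambda>s. X s \<omega>) \<in> borel_measurable borel"
  using measurable_compose[OF measurable_Pair2' X_joint, of \<omega>] by simp

lemma compose_X_path: "g \<in> borel_measurable borel \<Longrightarrow> \<omega> \<in> space M \<Longrightarrow> (\<lambda>s. g (X s \<omega>) :: real) \<in> borel_measurable borel"
  using measurable_compose[OF X_path_measurable] by blast

lemma ln_abs_measurable: "(\<lambda>y::real. ln \<bar>y\<bar>) \<in> borel_measurable borel" by measurable

sublocale P: pair_sigma_finite lborel M by unfold_locales

lemma log_double_finite: "(\<integral>\<^sup>+\<omega>. (\<integral>\<^sup>+s. ennreal (indicator {0..T} s * (ln \<bar>X s \<omega>\<bar>)\<^sup>2) \<partial>lborel) \<partial>M) < \<infinity>"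
proof -
  let ?D = "2 * T powr (2*H) + 2 * a\<^sup>2"
  have m: "(\<lambda>p. ennreal (indicator {0..T} (fst p) * (ln \<bar>X (fst p) (snd p)\<bar>)\<^sup>2)) \<in> borel_measurable (lborel \<Otimes>\<^sub>M M)"
    using compose_X_joint[OF ln_abs_measurable] by measurable
  have "(\<integral>\<^sup>+\<omega>. (\<integral>\<^sup>+s. ennreal (indicator {0..T} s * (ln \<bar>X s \<omega>\<bar>)\<^sup>2) \<partial>lborel) \<partial>M) =
    (\<integral>\<^sup>+s. (\<integral>\<^sup>+\<omega>. ennreal (indicator {0..T} s * (ln \<bar>X s \<omega>\<bar>)\<^sup>2) \<partial>M) \<partial>lborel)"
    by (rule P.Fubini') (use m in \<open>simp add: case_prod_beta'\<close>)
  also have "\<dots> \<le> (\<integral>\<^sup>+s. ennreal 64 * (ennreal (\<bar>0 - s\<bar> powr ((1 - H) - 1)) * indicator {0..T} s) +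
      ennreal ?D * indicator {0..T} s \<partial>lborel)"
  proof (rule nn_integral_mono_AE)
    show "AE s in lborel. (\<integral>\<^sup>+\<omega>. ennreal (indicator {0..T} s * (ln \<bar>X s \<omega>\<bar>)\<^sup>2) \<partial>M) \<le>
        ennreal 64 * (ennreal (\<bar>0 - s\<bar> powr ((1 - H) - 1)) * indicator {0..T} s) + ennreal ?D * indicator {0..T} s"
      using AE_lborel_singleton[of 0]
    proof eventually_elim
      case (elim s)
      show ?case
      proof (cases "s \<in> {0..T}")
        case True
        then have "s \<in> {0<..T}" using elim by auto
        have "ennreal (64 * s powr (- H) + ?D) = ennreal 64 * ennreal (s powr (- H)) + ennreal ?D"
          by (subst ennreal_plus) (auto simp: ennreal_mult simp del: ennreal_numeral)
        with ln_B_nn_integral[OF \<open>s \<in> {0<..T}\<close>, of a] show ?thesis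
          using True by (simp add: clip_id del: ennreal_numeral ennreal_plus)
      qed simp
    qed
  qed
  also have "\<dots> = ennreal 64 * (\<integral>\<^sup>+s\<in>{0..T}. ennreal (\<bar>0 - s\<bar> powr ((1 - H) - 1)) \<partial>lborel) +
      ennreal ?D * (\<integral>\<^sup>+s. indicator {0..T} s \<partial>lborel)"
    by (subst nn_integral_add) (auto simp: nn_integral_cmult)
  also have "\<dots> < \<infinity>"
    using nn_integral_abs_powr_Icc[of "1 - H" 0 T 0] H T
        by (simp add: ennreal_mult_less_top emeasure_lborel_Icc_eq)
  finally show ?thesis .
qed

definition good :: "'a \<Rightarrow> bool" where
  "good \<omega> \<longleftrightarrow> \<omega> \<in> space M \<and> integrable lborel (\<lambda>s. indicator {0..T} s * (ln \<bar>X s \<omega>\<bar>)\<^sup>2) \<and>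
     (AE s in lborel. s \<in> {0<..T} \<longrightarrow> X s \<omega> \<noteq> 0)"

lemma AE_good: "AE \<omega> in M. good \<omega>"
proof -
  have "AE \<omega> in M. (\<integral>\<^sup>+s. ennreal (indicator {0..T} s * (ln \<bar>X s \<omega>\<bar>)\<^sup>2) \<partial>lborel) \<noteq> \<infinity>"
  proof (rule nn_integral_noteq_infinite)
    have "(\<lambda>p. ennreal (indicator {0..T} (fst p) * (ln \<bar>X (fst p) (snd p)\<bar>)\<^sup>2)) \<in> borel_measurable (lborel \<Otimes>\<^sub>M M)"
      using compose_X_joint[OF ln_abs_measurable] by measurable
    from measurable_compose[OF measurable_pair_swap' this]
    have "(\<lambda>p. ennreal (indicator {0..T} (snd p) * (ln \<bar>X (snd p) (fst p)\<bar>)\<^sup>2)) \<in> borel_measurable (M \<Otimes>\<^sub>M lborel)"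
      by (simp add: case_prod_beta')
    then show "(\<lambda>\<omega>. \<integral>\<^sup>+s. ennreal (indicator {0..T} s * (ln \<bar>X s \<omega>\<bar>)\<^sup>2) \<partial>lborel) \<in> borel_measurable M"
      by (intro lborel.borel_measurable_nn_integral) (simp add: case_prod_beta')
  qed (use log_double_finite in auto)
  moreover have "AE \<omega> in M. AE s in lborel. s \<in> {0<..T} \<longrightarrow> X s \<omega> \<noteq> 0"
  proof -
    have [measurable]: "(\<lambda>p. X (fst p) (snd p)) \<in> borel_measurable (lborel \<Otimes>\<^sub>M M)" by (rule X_joint)
    have "{p \<in> space (lborel \<Otimes>\<^sub>M M). fst p \<in> {0<..T} \<longrightarrow> X (fst p) (snd p) \<noteq> 0} \<in> sets (lborel \<Otimes>\<^sub>M M)"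
      by measurable
    note * = P.AE_commute[of "\<lambda>s \<omega>. s \<in> {0<..T} \<longrightarrow> X s \<omega> \<noteq> 0", OF this]
    have "AE s in lborel. AE \<omega> in M. s \<in> {0<..T} \<longrightarrow> X s \<omega> \<noteq> 0"
    proof (rule AE_I2)
      fix s
      show "AE \<omega> in M. s \<in> {0<..T} \<longrightarrow> X s \<omega> \<noteq> 0"
        using B_not_eq[of s a] by (cases "s \<in> {0<..T}") (auto simp: clip_id elim: eventually_mono)
    qed
    with * show ?thesis by simp
  qed
  moreover have "AE \<omega> in M. \<omega> \<in> space M" by simp
  ultimately show ?thesis
  proof eventually_elim
    case (elim \<omega>)
    have "integrable lborel (\<lambda>s. indicator {0..T} s * (ln \<bar>X s \<omega>\<bar>)\<^sup>2)"
    proof (rule integrableI_bounded)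
      show "(\<lambda>s. indicator {0..T} s * (ln \<bar>X s \<omega>\<bar>)\<^sup>2) \<in> borel_measurable lborel"
        using compose_X_path[OF ln_abs_measurable elim(3)] by measurable
      show "(\<integral>\<^sup>+s. ennreal (norm (indicator {0..T} s * (ln \<bar>X s \<omega>\<bar>)\<^sup>2)) \<partial>lborel) < \<infinity>"
        using elim(1) by (simp add: abs_mult less_top[symmetric])
    qed
    then show ?case using elim by (simp add: good_def)
  qed
qed

definition "log_energy \<omega> = (\<integral>s. indicator {0..t} s * (ln \<bar>X s \<omega>\<bar>)\<^sup>2 \<partial>lborel)"

definition "log_error d \<omega> = (\<integral>s. indicator {0..t} s * (reg_log d (X s \<omega>) - ln \<bar>X s \<omega>\<bar>)\<^sup>2 \<partial>lborel)"

lemma good_integrable: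
  assumes "good \<omega>"
  shows "integrable lborel (\<lambda>s. indicator {0..t} s * (ln \<bar>X s \<omega>\<bar>)\<^sup>2)"
proof (rule Bochner_Integration.integrable_bound)
  show "integrable lborel (\<lambda>s. indicator {0..T} s * (ln \<bar>X s \<omega>\<bar>)\<^sup>2)" using assms by (simp add: good_def)
  show "(\<lambda>s. indicator {0..t} s * (ln \<bar>X s \<omega>\<bar>)\<^sup>2) \<in> borel_measurable lborel"
    using compose_X_path[OF ln_abs_measurable, of \<omega>] assms
        by (auto simp: good_def intro!: borel_measurable_times borel_measurable_power)
qed (use t in \<open>auto simp: indicator_def\<close>)

lemma good_AE:
  assumes "good \<omega>"
  shows "AE s in lborel. s \<in> {0..t} \<longrightarrow> X s \<omega> \<noteq> 0"
proof -
  have "AE s in lborel. s \<in> {0<..T} \<longrightarrow> X s \<omega> \<noteq> 0" using assms by (simp add: good_def)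
  then show ?thesis using AE_lborel_singleton[of 0] by eventually_elim (use t in auto)
qed

lemma reg_log_error_bound: "0 < d \<Longrightarrow> d \<le> 1 \<Longrightarrow> x \<noteq> 0 \<Longrightarrow> (reg_log d x - ln \<bar>x\<bar>)\<^sup>2 \<le> (ln \<bar>x\<bar>)\<^sup>2"
  using reg_log_close[of d x] by (subst abs_le_square_iff[symmetric]) (auto split: if_splits)

lemma log_error_integrable:
  assumes g: "good \<omega>" and d: "0 < d" "d \<le> 1"
  shows "integrable lborel (\<lambda>s. indicator {0..t} s * (reg_log d (X s \<omega>) - ln \<bar>X s \<omega>\<bar>)\<^sup>2)"
      "log_error d \<omega> \<le> log_energy \<omega>"
proof -
  have \<omega>: "\<omega> \<in> space M" using g by (simp add: good_def)
  have b: "AE s in lborel. indicator {0..t} s * (reg_log d (X s \<omega>) - ln \<bar>X s \<omega>\<bar>)\<^sup>2 \<le>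
      indicator {0..t} s * (ln \<bar>X s \<omega>\<bar>)\<^sup>2"
    using good_AE[OF g] by eventually_elim (auto simp: indicator_def intro!: reg_log_error_bound d)
  show i: "integrable lborel (\<lambda>s. indicator {0..t} s * (reg_log d (X s \<omega>) - ln \<bar>X s \<omega>\<bar>)\<^sup>2)"
  proof (rule Bochner_Integration.integrable_bound[OF good_integrable[OF g]])
    show "(\<lambda>s. indicator {0..t} s * (reg_log d (X s \<omega>) - ln \<bar>X s \<omega>\<bar>)\<^sup>2) \<in> borel_measurable lborel"
      using compose_X_path[OF ln_abs_measurable \<omega>] compose_X_path[OF reg_log_measurable \<omega>] by measurable
    show "AE s in lborel. norm (indicator {0..t} s * (reg_log d (X s \<omega>) - ln \<bar>X s \<omega>\<bar>)\<^sup>2) \<le>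
        norm (indicator {0..t} s * (ln \<bar>X s \<omega>\<bar>)\<^sup>2)"
      using b by eventually_elim simp
  qed
  show "log_error d \<omega> \<le> log_energy \<omega>"
    unfolding log_error_def log_energy_def by (rule integral_mono_AE[OF i good_integrable[OF g] b])
qed

definition dseq :: "nat \<Rightarrow> real" where "dseq n = inverse (real (Suc n))"

lemma dseq: "dseq n > 0" "dseq n \<le> 1" "dseq \<longlonglongrightarrow> 0"
  using LIMSEQ_inverse_real_of_nat by (auto simp: dseq_def[abs_def] inverse_le_1_iff)

lemma log_error_tendsto:
  assumes g: "good \<omega>"
  shows "(\<lambda>n. log_error (dseq n) \<omega>) \<longlonglongrightarrow> 0"
proof -
  have \<omega>: "\<omega> \<in> space M" using g by (simp add: good_def)
  have "(\<lambda>n. log_error (dseq n) \<omega>) \<longlonglongrightarrow> (\<integral>s. 0 \<partial>(lborel :: real measure))"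
    unfolding log_error_def
  proof (rule integral_dominated_convergence[OF _ _ good_integrable[OF g]])
    show "(\<lambda>s. indicator {0..t} s * (reg_log (dseq n) (X s \<omega>) - ln \<bar>X s \<omega>\<bar>)\<^sup>2) \<in> borel_measurable lborel" for n
      using log_error_integrable(1)[OF g dseq(1,2)] by auto
    show "AE s in lborel. (\<lambda>n. indicator {0..t} s * (reg_log (dseq n) (X s \<omega>) - ln \<bar>X s \<omega>\<bar>)\<^sup>2) \<longlonglongrightarrow> 0"
      using good_AE[OF g]
    proof eventually_elim
      case (elim s)
      show ?case
      proof (cases "s \<in> {0..t}")
        case True
        then have "\<bar>X s \<omega>\<bar> > 0" using elim by auto
        then have "\<forall>\<^sub>F n in sequentially. dseq n < \<bar>X s \<omega>\<bar>" by (rule order_tendstoD(2)[OF dseq(3)])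
        then have "\<forall>\<^sub>F n in sequentially. indicator {0..t} s * (reg_log (dseq n) (X s \<omega>) - ln \<bar>X s \<omega>\<bar>)\<^sup>2 = 0"
          by eventually_elim (simp add: reg_log_def max_def)
        then show ?thesis by (rule tendsto_eventually)
      qed simp
    qed
    show "AE s in lborel. norm (indicator {0..t} s * (reg_log (dseq n) (X s \<omega>) - ln \<bar>X s \<omega>\<bar>)\<^sup>2) \<le>
        indicator {0..t} s * (ln \<bar>X s \<omega>\<bar>)\<^sup>2" for n
      using good_AE[OF g] by eventually_elim (auto simp: indicator_def intro!: reg_log_error_bound dseq)
  qed simp
  then show ?thesis by simp
qed

definition Ureg :: "real \<Rightarrow> 'a \<Rightarrow> 'h" where "Ureg d \<omega> = wiener_elem t (\<lambda>s. reg_log d (B s \<omega> - a))"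

text \<open>The limit is taken along a sequence and pathwise, so that \<open>U\<close> is measurable; it exists for good
  \<open>\<omega>\<close>.\<close>

definition U :: "'a \<Rightarrow> 'h" where "U \<omega> = lim (\<lambda>n. Ureg (dseq n) \<omega>)"

lemma reg_log_path_continuous:
  assumes "\<omega> \<in> space M" "d > 0"
  shows "continuous_on {0..t} (\<lambda>s. reg_log d (B s \<omega> - a))"
proof -
  have "continuous_on {0..t} (\<lambda>s. B s \<omega> - a)"
    using t by (intro continuous_intros continuous_on_subset[OF B_path[OF assms(1)]]) auto
  then show ?thesis by (rule continuous_on_compose2[OF reg_log_continuous[OF assms(2), of UNIV]]) auto
qed

lemma Ureg_F_measurable: "Ureg d \<in> borel_measurable F"
  unfolding Ureg_def[abs_def] wiener_elem_def
proof (rule borel_measurable_lim_metric)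
  fix N
  have "B (t * real i / real N) \<in> borel_measurable F" if "i < N" for i
  proof (rule B_F_measurable)
    have "t * real i / real N \<le> t * real N / real N" using that t by (intro divide_right_mono mult_left_mono) auto
    then show "t * real i / real N \<in> {0..T}" using that t by auto
  qed
  then show "(\<lambda>\<omega>. riemann t (\<lambda>s. reg_log d (B s \<omega> - a)) N) \<in> borel_measurable F"
    unfolding riemann_def by (intro borel_measurable_sum borel_measurable_scaleR borel_measurable_const
        measurable_compose[OF _ reg_log_measurable] borel_measurable_diff) auto
qed

lemma U_F_measurable: "U \<in> borel_measurable F"
  unfolding U_def[abs_def] by (rule borel_measurable_lim_metric) (rule Ureg_F_measurable)

lemma clip_eq: "s \<in> {0..t} \<Longrightarrow> clip s = s" using t by (intro clip_id) auto

lemma indicator_clip: "indicator {0..t} s * f (B s \<omega> - a) = (indicator {0..t} s * f (X s \<omega>) :: real)"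
  by (auto simp: indicator_def clip_eq)

lemma Ureg_diff:
  assumes g: "good \<omega>" and d: "0 < d" "d \<le> 1" and d': "0 < d'" "d' \<le> 1"
  shows "(norm (Ureg d \<omega> - Ureg d' \<omega>))\<^sup>2 \<le> CH * (2 * log_error d \<omega> + 2 * log_error d' \<omega>)"
proof -
  have \<omega>: "\<omega> \<in> space M" using g by (simp add: good_def)
  let ?i = "\<lambda>s. indicator {0..t} s :: real"
  note mm = compose_X_path[OF ln_abs_measurable \<omega>] compose_X_path[OF reg_log_measurable \<omega>, of d]
      compose_X_path[OF reg_log_measurable \<omega>, of d']
  have ind: "(?i s * x - ?i s * y)\<^sup>2 = ?i s * (x - y)\<^sup>2" "(?i s * x)\<^sup>2 = ?i s * x\<^sup>2" for s x y
    by (auto simp: indicator_def)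
  have sl: "square_integrable lborel (\<lambda>s. ?i s * ln \<bar>X s \<omega>\<bar>)"
    unfolding square_integrable_def ind using good_integrable[OF g] mm(1) by auto
  have se: "square_integrable lborel (\<lambda>s. ?i s * reg_log d (X s \<omega>))" if "0 < d" "d \<le> 1" for d
  proof -
    have "square_integrable lborel (\<lambda>s. ?i s * (reg_log d (X s \<omega>) - ln \<bar>X s \<omega>\<bar>))"
      unfolding square_integrable_def ind
          using log_error_integrable(1)[OF g that] mm(1) compose_X_path[OF reg_log_measurable \<omega>, of d] by auto
    from square_integrable_add[OF this sl] show ?thesis by (simp add: algebra_simps)
  qed
  have "(norm (Ureg d \<omega> - Ureg d' \<omega>))\<^sup>2 \<le>
      CH * (\<integral>s. ?i s * (reg_log d (B s \<omega> - a) - reg_log d' (B s \<omega> - a))\<^sup>2 \<partial>lborel)"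
    unfolding Ureg_def using wiener_elem_norm[OF t reg_log_path_continuous[OF \<omega> d(1)]
        reg_log_path_continuous[OF \<omega> d'(1)]] .
  also have "(\<integral>s. ?i s * (reg_log d (B s \<omega> - a) - reg_log d' (B s \<omega> - a))\<^sup>2 \<partial>lborel) =
      (\<integral>s. (?i s * reg_log d (X s \<omega>) - ?i s * reg_log d' (X s \<omega>))\<^sup>2 \<partial>lborel)"
    unfolding ind by (simp only: indicator_clip[of _ "\<lambda>y. (reg_log d y - reg_log d' y)\<^sup>2"])
  also have "CH * \<dots> \<le> CH * (2 * log_error d \<omega> + 2 * log_error d' \<omega>)"
    using integral_square_diff_triangle[OF se[OF d] se[OF d'] sl] unfolding ind log_error_def[symmetric]
    by (intro mult_left_mono CH_nonneg) auto
  finally show ?thesis .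
qed

lemma Ureg_tendsto:
  assumes g: "good \<omega>"
  shows "(\<lambda>n. Ureg (dseq n) \<omega>) \<longlonglongrightarrow> U \<omega>"
proof -
  have "Cauchy (\<lambda>n. Ureg (dseq n) \<omega>)"
  proof (rule metric_CauchyI)
    fix r :: real assume r: "r > 0"
    have "(\<lambda>N. 4 * CH * log_error (dseq N) \<omega>) \<longlonglongrightarrow> 4 * CH * 0" by (intro tendsto_intros log_error_tendsto g)
    then have "\<forall>\<^sub>F N in sequentially. 4 * CH * log_error (dseq N) \<omega> < r\<^sup>2"
      using r by (intro order_tendstoD(2)) auto
    then obtain N0 where N0: "\<And>N. N \<ge> N0 \<Longrightarrow> 4 * CH * log_error (dseq N) \<omega> < r\<^sup>2"
        by (auto simp: eventually_sequentially)
    have "dist (Ureg (dseq N) \<omega>) (Ureg (dseq N') \<omega>) < r" if "N \<ge> N0" "N' \<ge> N0" for N N'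
    proof -
      have "(norm (Ureg (dseq N) \<omega> - Ureg (dseq N') \<omega>))\<^sup>2 \<le>
          (4 * CH * log_error (dseq N) \<omega>) / 2 + (4 * CH * log_error (dseq N') \<omega>) / 2"
      proof -
        have "c * (2 * x + 2 * y) = (4 * c * x) / 2 + (4 * c * y) / 2" for c x y :: real
            by (simp add: algebra_simps)
        then show ?thesis using Ureg_diff[OF g dseq(1,2) dseq(1,2), of N N'] by (simp only:)
      qed
      also have "\<dots> < r\<^sup>2" using N0[OF that(1)] N0[OF that(2)] by linarith
      finally show ?thesis using r by (simp add: dist_norm power2_less_imp_less)
    qed
    then show "\<exists>N0. \<forall>N\<ge>N0. \<forall>N'\<ge>N0. dist (Ureg (dseq N) \<omega>) (Ureg (dseq N') \<omega>) < r" by blast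
  qed
  then show ?thesis unfolding U_def by (simp add: Cauchy_convergent_iff convergent_LIMSEQ_iff)
qed

lemma Ureg_U_diff:
  assumes g: "good \<omega>" and d: "0 < d" "d \<le> 1"
  shows "(norm (Ureg d \<omega> - U \<omega>))\<^sup>2 \<le> CH * (2 * log_error d \<omega>)"
proof (rule LIMSEQ_le)
  show "(\<lambda>n. (norm (Ureg d \<omega> - Ureg (dseq n) \<omega>))\<^sup>2) \<longlonglongrightarrow> (norm (Ureg d \<omega> - U \<omega>))\<^sup>2"
    by (intro tendsto_intros Ureg_tendsto g)
  have "(\<lambda>n. CH * (2 * log_error d \<omega> + 2 * log_error (dseq n) \<omega>)) \<longlonglongrightarrow> CH * (2 * log_error d \<omega> + 2 * 0)"
    by (intro tendsto_intros log_error_tendsto g)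
  then show "(\<lambda>n. CH * (2 * log_error d \<omega> + 2 * log_error (dseq n) \<omega>)) \<longlonglongrightarrow> CH * (2 * log_error d \<omega>)" by simp
  show "\<exists>N. \<forall>n\<ge>N. (norm (Ureg d \<omega> - Ureg (dseq n) \<omega>))\<^sup>2 \<le> CH * (2 * log_error d \<omega> + 2 * log_error (dseq n) \<omega>)"
    using Ureg_diff[OF g d dseq(1,2)] by blast
qed

lemma log_energy_integrable: "integrable M log_energy"
proof (rule integrableI_bounded)
  have "(\<lambda>p. indicator {0..t} (fst p) * (ln \<bar>X (fst p) (snd p)\<bar>)\<^sup>2) \<in> borel_measurable (lborel \<Otimes>\<^sub>M M)"
    using compose_X_joint[OF ln_abs_measurable] by measurable
  from measurable_compose[OF measurable_pair_swap' this]
  show m: "log_energy \<in> borel_measurable M"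
    unfolding log_energy_def[abs_def]
        by (intro lborel.borel_measurable_lebesgue_integral) (simp add: case_prod_beta')
  have "(\<integral>\<^sup>+\<omega>. ennreal (norm (log_energy \<omega>)) \<partial>M) \<le>
      (\<integral>\<^sup>+\<omega>. (\<integral>\<^sup>+s. ennreal (indicator {0..T} s * (ln \<bar>X s \<omega>\<bar>)\<^sup>2) \<partial>lborel) \<partial>M)"
  proof (rule nn_integral_mono)
    fix \<omega>
    have "ennreal (norm (log_energy \<omega>)) \<le> (\<integral>\<^sup>+s. ennreal (norm (indicator {0..t} s * (ln \<bar>X s \<omega>\<bar>)\<^sup>2)) \<partial>lborel)"
      unfolding log_energy_def by (rule integral_norm_bound_nn)
    also have "\<dots> \<le> (\<integral>\<^sup>+s. ennreal (indicator {0..T} s * (ln \<bar>X s \<omega>\<bar>)\<^sup>2) \<partial>lborel)"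
      using t by (intro nn_integral_mono ennreal_leI) (auto simp: indicator_def)
    finally show "ennreal (norm (log_energy \<omega>)) \<le> (\<integral>\<^sup>+s. ennreal (indicator {0..T} s * (ln \<bar>X s \<omega>\<bar>)\<^sup>2) \<partial>lborel)" .
  qed
  also have "\<dots> < \<infinity>" by (rule log_double_finite)
  finally show "(\<integral>\<^sup>+\<omega>. ennreal (norm (log_energy \<omega>)) \<partial>M) < \<infinity>" .
qed

lemma log_error_measurable: "log_error d \<in> borel_measurable M"
proof -
  have "(\<lambda>p. indicator {0..t} (fst p) * (reg_log d (X (fst p) (snd p)) - ln \<bar>X (fst p) (snd p)\<bar>)\<^sup>2) \<in>
      borel_measurable (lborel \<Otimes>\<^sub>M M)"
    using compose_X_joint[OF ln_abs_measurable] compose_X_joint[OF reg_log_measurable] by measurable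
  from measurable_compose[OF measurable_pair_swap' this]
  show ?thesis
    unfolding log_error_def[abs_def]
        by (intro lborel.borel_measurable_lebesgue_integral) (simp add: case_prod_beta')
qed

lemma log_error_nonneg: "0 \<le> log_error d \<omega>"
  unfolding log_error_def by (intro integral_nonneg_AE) (auto simp: indicator_def)

lemma log_error_mean_tendsto: "(\<lambda>n. \<integral>\<omega>. log_error (dseq n) \<omega> \<partial>M) \<longlonglongrightarrow> 0"
proof -
  have "(\<lambda>n. \<integral>\<omega>. log_error (dseq n) \<omega> \<partial>M) \<longlonglongrightarrow> (\<integral>\<omega>. 0 \<partial>M)"
  proof (rule integral_dominated_convergence[OF _ _ log_energy_integrable])
    show "AE \<omega> in M. (\<lambda>n. log_error (dseq n) \<omega>) \<longlonglongrightarrow> 0" using AE_good by eventually_elim (rule log_error_tendsto)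
    show "AE \<omega> in M. norm (log_error (dseq n) \<omega>) \<le> log_energy \<omega>" for n
      using AE_good by eventually_elim (simp add: log_error_nonneg log_error_integrable(2) dseq)
  qed (auto intro: log_error_measurable)
  then show ?thesis by simp
qed

lemma log_error_mean_integrable: "0 < d \<Longrightarrow> d \<le> 1 \<Longrightarrow> integrable M (log_error d)"
proof (rule Bochner_Integration.integrable_bound[OF log_energy_integrable log_error_measurable])
  assume d: "0 < d" "d \<le> 1"
  show "AE \<omega> in M. norm (log_error d \<omega>) \<le> norm (log_energy \<omega>)"
    using AE_good by eventually_elim
        (use log_error_integrable(2)[OF _ d] log_error_nonneg[of d] in \<open>auto intro: order_trans[OF _ abs_ge_self]\<close>)
qed

lemma Ureg_measurable[measurable]: "Ureg d \<in> borel_measurable M"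
    and U_measurable[measurable]: "U \<in> borel_measurable M"
  using Ureg_F_measurable U_F_measurable by (auto intro: F_measurable_imp)

lemma Ureg_U_square_integrable:
  assumes "0 < d" "d \<le> 1"
  shows "square_integrable M (\<lambda>\<omega>. norm (Ureg d \<omega> - U \<omega>))"
    "(\<integral>\<omega>. (norm (Ureg d \<omega> - U \<omega>))\<^sup>2 \<partial>M) \<le> CH * (2 * (\<integral>\<omega>. log_error d \<omega> \<partial>M))"
proof -
  have i: "integrable M (\<lambda>\<omega>. CH * (2 * log_error d \<omega>))" using log_error_mean_integrable[OF assms] by simp
  have b: "AE \<omega> in M. (norm (Ureg d \<omega> - U \<omega>))\<^sup>2 \<le> CH * (2 * log_error d \<omega>)"
    using AE_good by eventually_elim (rule Ureg_U_diff[OF _ assms])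
  have j: "integrable M (\<lambda>\<omega>. (norm (Ureg d \<omega> - U \<omega>))\<^sup>2)"
    by (rule Bochner_Integration.integrable_bound[OF i]) (use b in \<open>auto elim!: eventually_mono\<close>)
  then show "square_integrable M (\<lambda>\<omega>. norm (Ureg d \<omega> - U \<omega>))" by (auto simp: square_integrable_def)
  show "(\<integral>\<omega>. (norm (Ureg d \<omega> - U \<omega>))\<^sup>2 \<partial>M) \<le> CH * (2 * (\<integral>\<omega>. log_error d \<omega> \<partial>M))"
    using integral_mono_AE[OF j i b] by simp
qed

lemma wiener_elem_0: "wiener_elem t (\<lambda>_. 0) = 0"
  by (simp add: wiener_elem_def riemann_def[abs_def])

lemma Ureg_bound:
  assumes g: "good \<omega>" and d: "0 < d" "d \<le> 1"
  shows "(norm (Ureg d \<omega>))\<^sup>2 \<le> CH * log_energy \<omega>"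
proof -
  have \<omega>: "\<omega> \<in> space M" using g by (simp add: good_def)
  have "(norm (Ureg d \<omega> - wiener_elem t (\<lambda>_. 0)))\<^sup>2 \<le>
      CH * (\<integral>s. indicator {0..t} s * (reg_log d (B s \<omega> - a) - 0)\<^sup>2 \<partial>lborel)"
    unfolding Ureg_def by (rule wiener_elem_norm[OF t reg_log_path_continuous[OF \<omega> d(1)]]) simp
  also have "\<dots> = CH * (\<integral>s. indicator {0..t} s * (reg_log d (X s \<omega>))\<^sup>2 \<partial>lborel)"
    by (simp only: indicator_clip[of _ "\<lambda>y. (reg_log d y)\<^sup>2"] diff_0_right)
  also have "\<dots> \<le> CH * log_energy \<omega>"
  proof (rule mult_left_mono[OF _ CH_nonneg])
    have b: "AE s in lborel. indicator {0..t} s * (reg_log d (X s \<omega>))\<^sup>2 \<le> indicator {0..t} s * (ln \<bar>X s \<omega>\<bar>)\<^sup>2"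
      using good_AE[OF g]
    proof eventually_elim
      case (elim s)
      have "\<bar>reg_log d y\<bar> \<le> \<bar>ln \<bar>y\<bar>\<bar>" if "y \<noteq> 0" for y
        using d that by (cases "\<bar>y\<bar> < d") (auto simp: reg_log_def max_def ln_less_cancel_iff abs_of_nonpos)
      then show ?case using elim by (auto simp: indicator_def abs_le_square_iff)
    qed
    have m: "(\<lambda>s. indicator {0..t} s * (reg_log d (X s \<omega>))\<^sup>2) \<in> borel_measurable lborel"
      using compose_X_path[OF reg_log_measurable \<omega>] by measurable
    have i: "integrable lborel (\<lambda>s. indicator {0..t} s * (reg_log d (X s \<omega>))\<^sup>2)"
      by (rule Bochner_Integration.integrable_bound[OF good_integrable[OF g] m])
          (use b in \<open>auto elim!: eventually_mono\<close>)
    show "(\<integral>s. indicator {0..t} s * (reg_log d (X s \<omega>))\<^sup>2 \<partial>lborel) \<le> log_energy \<omega>"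
      unfolding log_energy_def by (rule integral_mono_AE[OF i good_integrable[OF g] b])
  qed
  finally show ?thesis by (simp add: wiener_elem_0)
qed

lemma U_norm_integrable: "integrable M (\<lambda>\<omega>. (norm (U \<omega>))\<^sup>2)"
proof (rule Bochner_Integration.integrable_bound)
  show "integrable M (\<lambda>\<omega>. CH * log_energy \<omega>)" using log_energy_integrable by simp
  show "AE \<omega> in M. norm ((norm (U \<omega>))\<^sup>2) \<le> norm (CH * log_energy \<omega>)"
    using AE_good
  proof eventually_elim
    case (elim \<omega>)
    have "(\<lambda>n. (norm (Ureg (dseq n) \<omega>))\<^sup>2) \<longlonglongrightarrow> (norm (U \<omega>))\<^sup>2" by (intro tendsto_intros Ureg_tendsto elim)
    then have "(norm (U \<omega>))\<^sup>2 \<le> CH * log_energy \<omega>"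
      by (rule LIMSEQ_le_const2) (use Ureg_bound[OF elim dseq(1,2)] in blast)
    then show ?case by simp
  qed
qed measurable

lemma good_log_integrable:
  assumes g: "good \<omega>"
  shows "integrable lborel (\<lambda>s. indicator {0..t} s * ln \<bar>X s \<omega>\<bar>)"
proof (rule Bochner_Integration.integrable_bound)
  have \<omega>: "\<omega> \<in> space M" using g by (simp add: good_def)
  show "integrable lborel (\<lambda>s. indicator {0..t} s * 1 + indicator {0..t} s * (ln \<bar>X s \<omega>\<bar>)\<^sup>2)"
    using good_integrable[OF g] by (intro Bochner_Integration.integrable_add integrable_mult_left
        integrable_real_indicator) (auto simp: emeasure_lborel_Icc_eq)
  show "(\<lambda>s. indicator {0..t} s * ln \<bar>X s \<omega>\<bar>) \<in> borel_measurable lborel"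
    using compose_X_path[OF ln_abs_measurable \<omega>] by measurable
  have "\<bar>y\<bar> \<le> 1 + y\<^sup>2" for y :: real using zero_le_power2[of "\<bar>y\<bar> - 1"] by (simp add: power2_diff)
  then show "AE s in lborel. norm (indicator {0..t} s * ln \<bar>X s \<omega>\<bar>) \<le>
      norm (indicator {0..t} s * 1 + indicator {0..t} s * (ln \<bar>X s \<omega>\<bar>)\<^sup>2)"
    by (auto simp: indicator_def)
qed

lemma U_slope:
  assumes g: "good \<omega>" and sl: "slope x \<rho>"
  shows "U \<omega> \<bullet> x = (\<integral>s. indicator {0..t} s * (ln \<bar>X s \<omega>\<bar> * \<rho> s) \<partial>lborel)"
proof (rule LIMSEQ_unique)
  have \<omega>: "\<omega> \<in> space M" using g by (simp add: good_def)
  obtain L where L: "\<And>s. \<bar>\<rho> s\<bar> \<le> L" and [measurable]: "\<rho> \<in> borel_measurable borel" using sl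
      by (auto simp: slope_def)
  have L0: "L \<ge> 0" using L abs_ge_zero order_trans by blast
  show "(\<lambda>n. Ureg (dseq n) \<omega> \<bullet> x) \<longlonglongrightarrow> U \<omega> \<bullet> x" by (intro tendsto_intros Ureg_tendsto g)
  have eq: "Ureg (dseq n) \<omega> \<bullet> x = (\<integral>s. indicator {0..t} s * (reg_log (dseq n) (X s \<omega>) * \<rho> s) \<partial>lborel)" for n
    unfolding Ureg_def wiener_elem_slope[OF t reg_log_path_continuous[OF \<omega> dseq(1)] sl]
    by (intro Bochner_Integration.integral_cong) (auto simp: indicator_def clip_eq)
  show "(\<lambda>n. Ureg (dseq n) \<omega> \<bullet> x) \<longlonglongrightarrow> (\<integral>s. indicator {0..t} s * (ln \<bar>X s \<omega>\<bar> * \<rho> s) \<partial>lborel)"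
    unfolding eq
  proof (rule integral_dominated_convergence[where w="\<lambda>s. 2 * L * \<bar>indicator {0..t} s * ln \<bar>X s \<omega>\<bar>\<bar>"])
    show "integrable lborel (\<lambda>s. 2 * L * \<bar>indicator {0..t} s * ln \<bar>X s \<omega>\<bar>\<bar>)"
      by (intro integrable_mult_right integrable_abs good_log_integrable g)
    show "AE s in lborel. (\<lambda>n. indicator {0..t} s * (reg_log (dseq n) (X s \<omega>) * \<rho> s)) \<longlonglongrightarrow>
        indicator {0..t} s * (ln \<bar>X s \<omega>\<bar> * \<rho> s)"
      using good_AE[OF g]
    proof eventually_elim
      case (elim s)
      show ?case
      proof (cases "s \<in> {0..t}")
        case True
        then have "\<bar>X s \<omega>\<bar> > 0" using elim by auto
        then have "\<forall>\<^sub>F n in sequentially. dseq n < \<bar>X s \<omega>\<bar>" by (rule order_tendstoD(2)[OF dseq(3)])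
        then have "\<forall>\<^sub>F n in sequentially. indicator {0..t} s * (reg_log (dseq n) (X s \<omega>) * \<rho> s) =
            indicator {0..t} s * (ln \<bar>X s \<omega>\<bar> * \<rho> s)"
          by eventually_elim (simp add: reg_log_def max_def)
        then show ?thesis by (rule tendsto_eventually)
      qed simp
    qed
    show "AE s in lborel. norm (indicator {0..t} s * (reg_log (dseq n) (X s \<omega>) * \<rho> s)) \<le>
        2 * L * \<bar>indicator {0..t} s * ln \<bar>X s \<omega>\<bar>\<bar>" for n
      using good_AE[OF g]
    proof eventually_elim
      case (elim s)
      show ?case
      proof (cases "s \<in> {0..t}")
        case True
        then have "\<bar>reg_log (dseq n) (X s \<omega>)\<bar> \<le> 2 * \<bar>ln \<bar>X s \<omega>\<bar>\<bar>"
          using reg_log_close[OF dseq(1,2), of "X s \<omega>" n] elim by (auto split: if_splits)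
        then have "\<bar>reg_log (dseq n) (X s \<omega>)\<bar> * \<bar>\<rho> s\<bar> \<le> (2 * \<bar>ln \<bar>X s \<omega>\<bar>\<bar>) * L"
          using L by (intro mult_mono) auto
        then show ?thesis using True by (simp add: abs_mult mult_ac)
      qed simp
    qed
    show "(\<lambda>s. indicator {0..t} s * (ln \<bar>X s \<omega>\<bar> * \<rho> s)) \<in> borel_measurable lborel"
      using compose_X_path[OF ln_abs_measurable \<omega>] by measurable
    show "(\<lambda>s. indicator {0..t} s * (reg_log (dseq n) (X s \<omega>) * \<rho> s)) \<in> borel_measurable lborel" for n
      using compose_X_path[OF reg_log_measurable \<omega>, of "dseq n"] by measurable
  qed
qed

lemma U_represents:
  assumes g: "good \<omega>"
  shows "represents H T e (\<lambda>s. ln \<bar>B s \<omega> - a\<bar> * indicator {0..t} s) (U \<omega>)"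
  unfolding represents_def
proof (intro conjI ballI)
  have \<omega>: "\<omega> \<in> space M" using g by (simp add: good_def)
  let ?\<phi> = "\<lambda>s. ln \<bar>B s \<omega> - a\<bar> * indicator {0..t} s"
  define l where "l s = ln \<bar>X s \<omega>\<bar> * indicator {0..t} s" for s
  have l: "?\<phi> s = l s" for s by (auto simp: l_def indicator_def clip_eq)
  have lm[measurable]: "l \<in> borel_measurable borel"
    unfolding l_def[abs_def] using compose_X_path[OF ln_abs_measurable \<omega>] by measurable
  show "set_borel_measurable lborel {0..T} ?\<phi>" unfolding l set_borel_measurable_def by measurable
  have "(\<integral>\<^sup>+s\<in>{0..T}. (\<integral>\<^sup>+v\<in>{0..T}. ennreal (\<bar>l s\<bar> * \<bar>l v\<bar> * \<bar>s - v\<bar> powr (2*H - 2)) \<partial>lborel) \<partial>lborel)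
    \<le> ennreal schur * (\<integral>\<^sup>+s\<in>{0..T}. ennreal (\<bar>l s\<bar>\<^sup>2) \<partial>lborel)"
    by (rule schur_bound) auto
  also have "(\<integral>\<^sup>+s\<in>{0..T}. ennreal (\<bar>l s\<bar>\<^sup>2) \<partial>lborel) =
      (\<integral>\<^sup>+s. ennreal (indicator {0..t} s * (ln \<bar>X s \<omega>\<bar>)\<^sup>2) \<partial>lborel)"
    using t by (intro nn_integral_cong) (auto simp: indicator_def l_def)
  also have "\<dots> = ennreal (log_energy \<omega>)"
    unfolding log_energy_def by (rule nn_integral_eq_integral[OF good_integrable[OF g]]) (auto simp: indicator_def)
  also have "ennreal schur * \<dots> < \<infinity>" by (simp add: ennreal_mult_less_top)
  finally show "(\<integral>\<^sup>+s\<in>{0..T}. (\<integral>\<^sup>+v\<in>{0..T}. ennreal (\<bar>?\<phi> s\<bar> * \<bar>?\<phi> v\<bar> * \<bar>s - v\<bar> powr (2*H - 2)) \<partial>lborel) \<partial>lborel) <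
      \<infinity>"
    unfolding l .
  fix r assume r: "r \<in> {0..T}"
  have c: "H * (2*H-1) * (y / (H * (2*H-1))) = y" for y using H by auto
  have in1: "(LINT v:{0..r}|lborel. l s * \<bar>s - v\<bar> powr (2*H - 2)) =
      l s * ((cov_slope H r s - cov_slope H 0 s) / (H * (2*H-1)))" for s
  proof -
    have "(LINT v:{0..r}|lborel. l s * \<bar>s - v\<bar> powr (2*H - 2)) =
        l s * (\<integral>v. indicator {0..r} v * \<bar>s - v\<bar> powr (2*H - 2) \<partial>lborel)"
      unfolding set_lebesgue_integral_def real_scaleR_def mult.left_commute[of "indicator _ _"]
          by (rule integral_mult_right_zero)
    then show ?thesis using kernel_integral[of 0 r s] r by (auto simp: has_bochner_integral_iff)
  qed
  have z: "cov_slope H 0 s = 0" if "s \<in> {0..T}" for s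
    using that by (auto simp: cov_slope_def sgn_if)
  have "U \<omega> \<bullet> e r = (\<integral>s. indicator {0..t} s * (ln \<bar>X s \<omega>\<bar> * (indicator {0..T} s * cov_slope H r s)) \<partial>lborel)"
    by (rule U_slope[OF g slope_e[OF r]])
  also have "\<dots> = (\<integral>s. H * (2*H-1) *
      (indicator {0..T} s *\<^sub>R (l s * ((cov_slope H r s - cov_slope H 0 s) / (H * (2*H-1))))) \<partial>lborel)"
  proof (intro Bochner_Integration.integral_cong refl)
    fix s
    have "H * (2*H-1) * (indicator {0..T} s *\<^sub>R (l s * ((cov_slope H r s - cov_slope H 0 s) / (H * (2*H-1))))) =
        indicator {0..T} s * l s * (H * (2*H-1) * ((cov_slope H r s - cov_slope H 0 s) / (H * (2*H-1))))"
      by (simp only: real_scaleR_def mult_ac)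
    also have "\<dots> = indicator {0..t} s * (ln \<bar>X s \<omega>\<bar> * (indicator {0..T} s * cov_slope H r s))"
      unfolding c using z t by (auto simp: indicator_def l_def)
    finally show "indicator {0..t} s * (ln \<bar>X s \<omega>\<bar> * (indicator {0..T} s * cov_slope H r s)) =
        H * (2*H-1) * (indicator {0..T} s *\<^sub>R (l s * ((cov_slope H r s - cov_slope H 0 s) / (H * (2*H-1)))))"
        by simp
  qed
  also have "\<dots> = H * (2*H - 1) * (LINT s:{0..T}|lborel. (LINT v:{0..r}|lborel. l s * \<bar>s - v\<bar> powr (2*H - 2)))"
    unfolding in1 by (simp only: set_lebesgue_integral_def integral_mult_right_zero)
  finally show "U \<omega> \<bullet> e r = H * (2*H - 1) *
      (LINT s:{0..T}|lborel. (LINT v:{0..r}|lborel. ?\<phi> s * \<bar>s - v\<bar> powr (2*H - 2)))"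
    unfolding l .
qed

end

section \<open>The two-point estimate\<close>

definition reg_gap :: "real \<Rightarrow> real \<Rightarrow> real \<Rightarrow> real" where
  "reg_gap \<epsilon> \<delta> x = reg_inv \<epsilon> x - reg_inv \<delta> x"

lemma reg_gap_measurable[measurable]: "reg_gap \<epsilon> \<delta> \<in> borel_measurable borel"
  unfolding reg_gap_def[abs_def] by measurable

lemma reg_gap_eq: "\<epsilon> < \<delta> \<Longrightarrow> reg_gap \<epsilon> \<delta> x = (if \<epsilon> \<le> \<bar>x\<bar> \<and> \<bar>x\<bar> < \<delta> then 1 / x else 0)"
  by (auto simp: reg_gap_def reg_inv_def)

lemma reg_gap_odd: "reg_gap \<epsilon> \<delta> (- x) = - reg_gap \<epsilon> \<delta> x"
  by (simp add: reg_gap_def reg_inv_def)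

lemma reg_gap_bound:
  assumes "0 < \<epsilon>" "\<epsilon> < \<delta>"
  shows "\<bar>reg_gap \<epsilon> \<delta> x\<bar> \<le> 1 / \<epsilon> * indicator {-\<delta>..\<delta>} x"
proof (cases "\<epsilon> \<le> \<bar>x\<bar> \<and> \<bar>x\<bar> < \<delta>")
  case True
  then have "1 / \<bar>x\<bar> \<le> 1 / \<epsilon>" using assms by (intro divide_left_mono) auto
  moreover have "x \<in> {-\<delta>..\<delta>}" using True by auto
  ultimately show ?thesis using True assms by (simp add: reg_gap_eq)
next
  case False
  then show ?thesis using assms by (auto simp: reg_gap_eq)
qed

lemma reg_gap_integrable:
  assumes "0 < \<epsilon>" "\<epsilon> < \<delta>" and [measurable]: "f \<in> borel_measurable borel" and f: "\<And>x. \<bar>f x\<bar> \<le> 1"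
  shows "integrable lborel (\<lambda>x. f x * reg_gap \<epsilon> \<delta> x)"
proof (rule Bochner_Integration.integrable_bound)
  show "integrable lborel (\<lambda>x. 1 / \<epsilon> * indicator {-\<delta>..\<delta>} x)"
    by (intro integrable_mult_right integrable_real_indicator) (auto simp: emeasure_lborel_Icc_eq)
  show "AE x in lborel. norm (f x * reg_gap \<epsilon> \<delta> x) \<le> norm (1 / \<epsilon> * indicator {-\<delta>..\<delta>} x)"
  proof (rule AE_I2)
    fix x
    have "\<bar>f x\<bar> * \<bar>reg_gap \<epsilon> \<delta> x\<bar> \<le> 1 * (1 / \<epsilon> * indicator {-\<delta>..\<delta>} x)"
      by (intro mult_mono f reg_gap_bound assms) auto
    then show "norm (f x * reg_gap \<epsilon> \<delta> x) \<le> norm (1 / \<epsilon> * indicator {-\<delta>..\<delta>} x)"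
      using assms by (simp add: abs_mult)
  qed
qed measurable

definition sine_transform :: "real \<Rightarrow> real \<Rightarrow> real \<Rightarrow> real" where
  "sine_transform \<epsilon> \<delta> \<kappa> = (\<integral>u. sin (\<kappa> * u) * reg_gap \<epsilon> \<delta> u \<partial>lborel)"

lemma cosine_transform_zero: "(\<integral>u. cos (\<kappa> * u) * reg_gap \<epsilon> \<delta> u \<partial>lborel) = 0"
proof -
  have "(\<integral>u. cos (\<kappa> * u) * reg_gap \<epsilon> \<delta> u \<partial>lborel) =
      (\<integral>u. cos (\<kappa> * (0 + (-1) * u)) * reg_gap \<epsilon> \<delta> (0 + (-1) * u) \<partial>lborel)"
    by (subst lborel_integral_real_affine[of "-1" _ 0]) auto
  also have "\<dots> = - (\<integral>u. cos (\<kappa> * u) * reg_gap \<epsilon> \<delta> u \<partial>lborel)"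
    by (simp add: reg_gap_odd)
  finally show ?thesis by simp
qed

lemma shifted_transforms:
  assumes \<epsilon>: "0 < \<epsilon>" "\<epsilon> < \<delta>"
  shows "(\<integral>u. sin (\<kappa> * u + \<theta>) * reg_gap \<epsilon> \<delta> u \<partial>lborel) = cos \<theta> * sine_transform \<epsilon> \<delta> \<kappa>"
    "(\<integral>u. cos (\<kappa> * u + \<theta>) * reg_gap \<epsilon> \<delta> u \<partial>lborel) = - sin \<theta> * sine_transform \<epsilon> \<delta> \<kappa>"
proof -
  have i: "integrable lborel (\<lambda>u. sin (\<kappa> * u) * reg_gap \<epsilon> \<delta> u)"
      "integrable lborel (\<lambda>u. cos (\<kappa> * u) * reg_gap \<epsilon> \<delta> u)"
    by (auto intro!: reg_gap_integrable[OF \<epsilon>])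
  have "(\<integral>u. sin (\<kappa> * u + \<theta>) * reg_gap \<epsilon> \<delta> u \<partial>lborel) =
      (\<integral>u. cos \<theta> * (sin (\<kappa> * u) * reg_gap \<epsilon> \<delta> u) + sin \<theta> * (cos (\<kappa> * u) * reg_gap \<epsilon> \<delta> u) \<partial>lborel)"
    by (intro Bochner_Integration.integral_cong) (auto simp: sin_add algebra_simps)
  also have "\<dots> = cos \<theta> * (\<integral>u. sin (\<kappa> * u) * reg_gap \<epsilon> \<delta> u \<partial>lborel) +
      sin \<theta> * (\<integral>u. cos (\<kappa> * u) * reg_gap \<epsilon> \<delta> u \<partial>lborel)"
    using i by simp
  finally show "(\<integral>u. sin (\<kappa> * u + \<theta>) * reg_gap \<epsilon> \<delta> u \<partial>lborel) = cos \<theta> * sine_transform \<epsilon> \<delta> \<kappa>"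
    unfolding cosine_transform_zero by (simp add: sine_transform_def)
  have "(\<integral>u. cos (\<kappa> * u + \<theta>) * reg_gap \<epsilon> \<delta> u \<partial>lborel) =
      (\<integral>u. cos \<theta> * (cos (\<kappa> * u) * reg_gap \<epsilon> \<delta> u) + (- sin \<theta>) * (sin (\<kappa> * u) * reg_gap \<epsilon> \<delta> u) \<partial>lborel)"
    by (intro Bochner_Integration.integral_cong) (auto simp: cos_add algebra_simps)
  also have "\<dots> = cos \<theta> * (\<integral>u. cos (\<kappa> * u) * reg_gap \<epsilon> \<delta> u \<partial>lborel) +
      (- sin \<theta>) * (\<integral>u. sin (\<kappa> * u) * reg_gap \<epsilon> \<delta> u \<partial>lborel)"
    using i by simp
  finally show "(\<integral>u. cos (\<kappa> * u + \<theta>) * reg_gap \<epsilon> \<delta> u \<partial>lborel) = - sin \<theta> * sine_transform \<epsilon> \<delta> \<kappa>"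
    unfolding cosine_transform_zero by (simp add: sine_transform_def)
qed

lemma sine_transform_linear_bound:
  assumes \<epsilon>: "0 < \<epsilon>" "\<epsilon> < \<delta>"
  shows "\<bar>sine_transform \<epsilon> \<delta> \<kappa>\<bar> \<le> 2 * \<delta> * \<bar>\<kappa>\<bar>"
proof -
  have "\<bar>sine_transform \<epsilon> \<delta> \<kappa>\<bar> \<le> (\<integral>u. \<bar>sin (\<kappa> * u) * reg_gap \<epsilon> \<delta> u\<bar> \<partial>lborel)"
    unfolding sine_transform_def by (rule integral_abs_bound)
  also have "\<dots> \<le> (\<integral>u. \<bar>\<kappa>\<bar> * indicator {-\<delta>..\<delta>} u \<partial>lborel)"
  proof (rule integral_mono)
    show "integrable lborel (\<lambda>u. \<bar>sin (\<kappa> * u) * reg_gap \<epsilon> \<delta> u\<bar>)"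
      by (intro integrable_abs reg_gap_integrable \<epsilon>) auto
    show "integrable lborel (\<lambda>u. \<bar>\<kappa>\<bar> * indicator {-\<delta>..\<delta>} u)"
      by (intro integrable_mult_right integrable_real_indicator) (auto simp: emeasure_lborel_Icc_eq)
    fix u
    show "\<bar>sin (\<kappa> * u) * reg_gap \<epsilon> \<delta> u\<bar> \<le> \<bar>\<kappa>\<bar> * indicator {-\<delta>..\<delta>} u"
    proof (cases "\<epsilon> \<le> \<bar>u\<bar> \<and> \<bar>u\<bar> < \<delta>")
      case True
      then have u: "u \<noteq> 0" "u \<in> {-\<delta>..\<delta>}" using \<epsilon> by auto
      have "\<bar>sin (\<kappa> * u)\<bar> * (1 / \<bar>u\<bar>) \<le> \<bar>\<kappa> * u\<bar> * (1 / \<bar>u\<bar>)" by (intro mult_right_mono abs_sin_x_le_abs_x) auto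
      also have "\<dots> = \<bar>\<kappa>\<bar>" using u by (simp add: abs_mult)
      finally show ?thesis using True u \<epsilon> by (simp add: reg_gap_eq abs_mult)
    qed (use \<epsilon> in \<open>auto simp: reg_gap_eq\<close>)
  qed
  also have "\<dots> = 2 * \<delta> * \<bar>\<kappa>\<bar>" using \<epsilon> by simp
  finally show ?thesis .
qed

lemma sine_transform_bounded:
  obtains K where "K > 0" "\<And>\<epsilon> \<delta> \<kappa>. 0 < \<epsilon> \<Longrightarrow> \<epsilon> < \<delta> \<Longrightarrow> \<bar>sine_transform \<epsilon> \<delta> \<kappa>\<bar> \<le> K"
proof -
  obtain C where C: "\<And>x. \<bar>Si x\<bar> \<le> C" using bounded_Si by auto
  have "\<bar>sine_transform \<epsilon> \<delta> \<kappa>\<bar> \<le> 4 * C + 1" if \<epsilon>: "0 < \<epsilon>" "\<epsilon> < \<delta>" for \<epsilon> \<delta> \<kappa>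
  proof -
    have der: "((\<lambda>u. Si (\<kappa> * u)) has_real_derivative sin (\<kappa> * u) / u) (at u)" if "u \<noteq> 0" for u
    proof -
      have "((\<lambda>u. Si (\<kappa> * u)) has_real_derivative sinc (\<kappa> * u) * \<kappa>) (at u)"
        by (rule DERIV_chain2[OF DERIV_Si]) (auto intro!: derivative_eq_intros)
      then show ?thesis using that by (cases "\<kappa> = 0") auto
    qed
    have piece: "(\<integral>u. indicator {b..c} u * (sin (\<kappa> * u) / u) \<partial>lborel) = Si (\<kappa> * c) - Si (\<kappa> * b)"
      and pieceI: "integrable lborel (\<lambda>u. indicator {b..c} u * (sin (\<kappa> * u) / u))"
      if "b \<le> c" "0 \<notin> {b..c}" for b c
    proof -
      have co: "continuous_on {b..c} (\<lambda>u. sin (\<kappa> * u) / u)" using that by (intro continuous_intros) auto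
      have "((\<lambda>u. sin (\<kappa> * u) / u) has_integral (Si (\<kappa> * c) - Si (\<kappa> * b))) {b..c}"
      proof (rule fundamental_theorem_of_calculus[OF that(1)])
        fix u assume "u \<in> {b..c}"
        then have "u \<noteq> 0" using that by auto
        from der[OF this] show "((\<lambda>u. Si (\<kappa> * u)) has_vector_derivative sin (\<kappa> * u) / u) (at u within {b..c})"
          by (simp add: has_real_derivative_iff_has_vector_derivative has_vector_derivative_at_within)
      qed
      moreover have si: "set_integrable lborel {b..c} (\<lambda>u. sin (\<kappa> * u) / u)"
        by (rule borel_integrable_atLeastAtMost'[OF co])
      ultimately show "(\<integral>u. indicator {b..c} u * (sin (\<kappa> * u) / u) \<partial>lborel) = Si (\<kappa> * c) - Si (\<kappa> * b)"
        using set_borel_integral_eq_integral(2)[OF si] by (simp add: set_lebesgue_integral_def integral_unique)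
      show "integrable lborel (\<lambda>u. indicator {b..c} u * (sin (\<kappa> * u) / u))"
        using si by (simp add: set_integrable_def)
    qed
    have "sine_transform \<epsilon> \<delta> \<kappa> = (\<integral>u. indicator {\<epsilon>..\<delta>} u * (sin (\<kappa> * u) / u) +
        indicator {-\<delta>..-\<epsilon>} u * (sin (\<kappa> * u) / u) \<partial>lborel)"
      unfolding sine_transform_def
    proof (rule integral_cong_AE)
      show "AE u in lborel. sin (\<kappa> * u) * reg_gap \<epsilon> \<delta> u = indicator {\<epsilon>..\<delta>} u * (sin (\<kappa> * u) / u) +
          indicator {-\<delta>..-\<epsilon>} u * (sin (\<kappa> * u) / u)"
        using AE_lborel_singleton[of \<delta>] AE_lborel_singleton[of "-\<delta>"]
        by eventually_elim (use \<epsilon> in \<open>auto simp: reg_gap_eq indicator_def abs_if\<close>)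
    qed measurable
    also have "\<dots> = (Si (\<kappa> * \<delta>) - Si (\<kappa> * \<epsilon>)) + (Si (\<kappa> * - \<epsilon>) - Si (\<kappa> * - \<delta>))"
      using pieceI[of \<epsilon> \<delta>] pieceI[of "-\<delta>" "-\<epsilon>"] piece[of \<epsilon> \<delta>] piece[of "-\<delta>" "-\<epsilon>"] \<epsilon>
      by (subst Bochner_Integration.integral_add) auto
    finally show ?thesis
      using C[of "\<kappa> * \<delta>"] C[of "\<kappa> * \<epsilon>"] C[of "\<kappa> * - \<epsilon>"] C[of "\<kappa> * - \<delta>"] by linarith
  qed
  moreover have "4 * C + 1 > 0" using C[of 0] by linarith
  ultimately show ?thesis using that by blast
qed

lemma normal_density_fourier:
  assumes "\<sigma> > 0"
  shows "normal_density 0 \<sigma> z = 1 / (sqrt (2 * pi) * \<sigma>) * (\<integral>\<eta>. normal_density 0 (1/\<sigma>) \<eta> * cos (z * \<eta>) \<partial>lborel)"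
  using fourier_normal_density(3)[of "1/\<sigma>" z] assms
  by (simp add: normal_density_def real_sqrt_mult power_divide)

lemma gaussian_fourier_swap:
  fixes g :: "real \<Rightarrow> real"
  assumes \<sigma>: "\<sigma> > 0" and g: "integrable lborel g"
  shows "(\<integral>z. normal_density 0 \<sigma> (z - c) * g z \<partial>lborel) =
     1 / (sqrt (2 * pi) * \<sigma>) * (\<integral>\<eta>. normal_density 0 (1/\<sigma>) \<eta> * (\<integral>z. cos ((z - c) * \<eta>) * g z \<partial>lborel) \<partial>lborel)"
    "(\<lambda>\<eta>. \<integral>z. cos ((z - c) * \<eta>) * g z \<partial>lborel) \<in> borel_measurable lborel"
proof -
  have [measurable]: "g \<in> borel_measurable borel" using g by auto
  let ?n = "normal_density 0 (1/\<sigma>)"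
  let ?f = "\<lambda>z \<eta>. ?n \<eta> * cos ((z - c) * \<eta>) * g z"
  have int: "integrable (lborel \<Otimes>\<^sub>M lborel) (case_prod ?f)"
  proof (rule lborel_pair.Fubini_integrable)
    show "integrable lborel (\<lambda>z. \<integral>\<eta>. norm (case_prod ?f (z, \<eta>)) \<partial>lborel)"
    proof (rule Bochner_Integration.integrable_bound[OF integrable_abs[OF g]])
      show "AE z in lborel. norm (\<integral>\<eta>. norm (case_prod ?f (z, \<eta>)) \<partial>lborel) \<le> norm \<bar>g z\<bar>"
      proof (rule AE_I2)
        fix z
        have "(\<integral>\<eta>. norm (case_prod ?f (z, \<eta>)) \<partial>lborel) \<le> (\<integral>\<eta>. ?n \<eta> * \<bar>g z\<bar> \<partial>lborel)"
        proof (rule integral_mono')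
          show "integrable lborel (\<lambda>\<eta>. ?n \<eta> * \<bar>g z\<bar>)" using \<sigma> by simp
          show "norm (case_prod ?f (z, \<eta>)) \<le> ?n \<eta> * \<bar>g z\<bar>" for \<eta>
            by (simp add: abs_mult mult_right_mono mult_left_le)
        qed simp
        also have "\<dots> = \<bar>g z\<bar>" using \<sigma> by simp
        finally show "norm (\<integral>\<eta>. norm (case_prod ?f (z, \<eta>)) \<partial>lborel) \<le> norm \<bar>g z\<bar>" by simp
      qed
    qed measurable
    show "AE z in lborel. integrable lborel (\<lambda>\<eta>. case_prod ?f (z, \<eta>))"
      using fourier_normal_density(1)[of "1/\<sigma>"] \<sigma> by (auto intro!: integrable_mult_left)
  qed measurable
  have "(\<integral>z. normal_density 0 \<sigma> (z - c) * g z \<partial>lborel) =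
      (\<integral>z. 1 / (sqrt (2 * pi) * \<sigma>) * (\<integral>\<eta>. ?f z \<eta> \<partial>lborel) \<partial>lborel)"
    by (subst normal_density_fourier[OF \<sigma>]) simp
  also have "\<dots> = 1 / (sqrt (2 * pi) * \<sigma>) * (\<integral>z. (\<integral>\<eta>. ?f z \<eta> \<partial>lborel) \<partial>lborel)" by (rule integral_mult_right_zero)
  also have "(\<integral>z. (\<integral>\<eta>. ?f z \<eta> \<partial>lborel) \<partial>lborel) = (\<integral>\<eta>. (\<integral>z. ?f z \<eta> \<partial>lborel) \<partial>lborel)"
    by (rule lborel_pair.Fubini_integral[OF int, symmetric])
  finally show "(\<integral>z. normal_density 0 \<sigma> (z - c) * g z \<partial>lborel) =
     1 / (sqrt (2 * pi) * \<sigma>) * (\<integral>\<eta>. normal_density 0 (1/\<sigma>) \<eta> * (\<integral>z. cos ((z - c) * \<eta>) * g z \<partial>lborel) \<partial>lborel)"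
    by (simp add: mult.assoc)
  show "(\<lambda>\<eta>. \<integral>z. cos ((z - c) * \<eta>) * g z \<partial>lborel) \<in> borel_measurable lborel"
    by (rule lborel.borel_measurable_lebesgue_integral) measurable
qed

lemma weighted_average_bound:
  fixes f :: "real \<Rightarrow> real"
  assumes \<sigma>: "\<sigma> > 0" and f: "\<And>x. \<bar>f x\<bar> \<le> K" "\<And>x. \<bar>f x\<bar> \<le> L * \<bar>x\<bar>"
  shows "\<bar>\<integral>\<eta>. normal_density 0 \<sigma> \<eta> * f \<eta> \<partial>lborel\<bar> \<le> K" "\<bar>\<integral>\<eta>. normal_density 0 \<sigma> \<eta> * f \<eta> \<partial>lborel\<bar> \<le> L * \<sigma>"
proof -
  let ?n = "normal_density 0 \<sigma>"
  have K0: "K \<ge> 0" using f(1)[of 0] by simp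
  have L0: "L \<ge> 0" using f(2)[of 1] by simp
  have "\<bar>\<integral>\<eta>. ?n \<eta> * f \<eta> \<partial>lborel\<bar> \<le> (\<integral>\<eta>. \<bar>?n \<eta> * f \<eta>\<bar> \<partial>lborel)" by (rule integral_abs_bound)
  also have "\<dots> \<le> (\<integral>\<eta>. ?n \<eta> * K \<partial>lborel)"
    by (rule integral_mono') (use \<sigma> f K0 in \<open>auto simp: abs_mult intro!: mult_left_mono\<close>)
  also have "\<dots> = K" using \<sigma> by simp
  finally show "\<bar>\<integral>\<eta>. ?n \<eta> * f \<eta> \<partial>lborel\<bar> \<le> K" .
  have "\<bar>\<integral>\<eta>. ?n \<eta> * f \<eta> \<partial>lborel\<bar> \<le> (\<integral>\<eta>. \<bar>?n \<eta> * f \<eta>\<bar> \<partial>lborel)" by (rule integral_abs_bound)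
  also have "\<dots> \<le> (\<integral>\<eta>. L * (?n \<eta> * \<bar>\<eta> - 0\<bar> ^ (2 * 0 + 1)) \<partial>lborel)"
  proof (rule integral_mono')
    show "integrable lborel (\<lambda>\<eta>. L * (?n \<eta> * \<bar>\<eta> - 0\<bar> ^ (2 * 0 + 1)))"
      by (intro integrable_mult_right integrable_normal_moment_abs \<sigma>)
    fix \<eta>
    have "?n \<eta> * \<bar>f \<eta>\<bar> \<le> ?n \<eta> * (L * \<bar>\<eta>\<bar>)" by (intro mult_left_mono f) auto
    then show "\<bar>?n \<eta> * f \<eta>\<bar> \<le> L * (?n \<eta> * \<bar>\<eta> - 0\<bar> ^ (2 * 0 + 1))" by (simp add: abs_mult mult.left_commute)
  qed (use L0 in auto)
  also have "\<dots> = L * (sqrt (2 / pi) * \<sigma>)"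
    using integral_normal_moment_abs_odd[OF \<sigma>, of 0 0] by simp
  also have "\<dots> \<le> L * \<sigma>"
    using L0 \<sigma> pi_ge_two by (intro mult_left_mono) auto
  finally show "\<bar>\<integral>\<eta>. ?n \<eta> * f \<eta> \<partial>lborel\<bar> \<le> L * \<sigma>" .
qed

text \<open>Write both normal densities as Fourier integrals. Oddness of the gap leaves only sine transforms:
  the integral over \<open>x\<close> is at most \<open>K / A\<close>, and the remaining frequency has standard deviation
  \<open>1 / \<sigma>\<close>, where the transform is bounded by \<open>K\<close> and by \<open>2 * \<delta>\<close> times the frequency.\<close>

lemma two_point_estimate:
  assumes \<epsilon>: "0 < \<epsilon>" "\<epsilon> < \<delta>" and A: "A > 0" and \<sigma>: "\<sigma> > 0"
    and S: "\<And>\<kappa>. \<bar>sine_transform \<epsilon> \<delta> \<kappa>\<bar> \<le> K"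
  shows "\<bar>\<integral>x. normal_density 0 A x *
      (reg_gap \<epsilon> \<delta> (x - a) * (\<integral>z. normal_density 0 \<sigma> z * reg_gap \<epsilon> \<delta> (\<rho> * x + z - a) \<partial>lborel)) \<partial>lborel\<bar>
     \<le> K / (A * \<sigma>) * min K (2 * \<delta> / \<sigma>)"
proof -
  let ?g = "reg_gap \<epsilon> \<delta>" and ?S = "sine_transform \<epsilon> \<delta>"
  let ?c = "\<lambda>\<sigma>. 1 / (sqrt (2 * pi) * \<sigma>)"
  have K0: "K \<ge> 0" using S abs_ge_zero order_trans by blast
  have g0: "integrable lborel ?g" using reg_gap_integrable[OF \<epsilon>, of "\<lambda>_. 1"] by simp
  have cb: "0 < ?c s" "?c s \<le> 1 / s" if "s > 0" for s
  proof -
    have "1 \<le> sqrt (2 * pi)" using pi_ge_two by simp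
    then show "?c s \<le> 1 / s" using that by (intro divide_left_mono) auto
  qed (use that in simp)
  have Sm[measurable]: "?S \<in> borel_measurable borel"
    unfolding sine_transform_def[abs_def] by measurable
  have lam: "(\<integral>z. normal_density 0 \<sigma> z * ?g (\<rho> * x + z - a) \<partial>lborel) =
      ?c \<sigma> * (\<integral>\<eta>. normal_density 0 (1/\<sigma>) \<eta> * (sin ((\<rho> * x - a) * \<eta>) * ?S \<eta>) \<partial>lborel)" for x
  proof -
    have "(\<integral>z. normal_density 0 \<sigma> z * ?g (\<rho> * x + z - a) \<partial>lborel) =
        (\<integral>u. normal_density 0 \<sigma> (u - (\<rho> * x - a)) * ?g u \<partial>lborel)"
      by (subst lborel_integral_real_affine[of 1 _ "- (\<rho> * x - a)"]) (auto simp: algebra_simps)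
    also have "\<dots> = ?c \<sigma> * (\<integral>\<eta>. normal_density 0 (1/\<sigma>) \<eta> * (\<integral>u. cos ((u - (\<rho> * x - a)) * \<eta>) * ?g u \<partial>lborel)
        \<partial>lborel)"
      by (rule gaussian_fourier_swap(1)[OF \<sigma> g0])
    also have "(\<lambda>\<eta>. \<integral>u. cos ((u - (\<rho> * x - a)) * \<eta>) * ?g u \<partial>lborel) = (\<lambda>\<eta>. sin ((\<rho> * x - a) * \<eta>) * ?S \<eta>)"
    proof
      fix \<eta>
      have "(\<integral>u. cos ((u - (\<rho> * x - a)) * \<eta>) * ?g u \<partial>lborel) =
          (\<integral>u. cos (\<eta> * u + (- ((\<rho> * x - a) * \<eta>))) * ?g u \<partial>lborel)"
        by (simp add: algebra_simps)
      then show "(\<integral>u. cos ((u - (\<rho> * x - a)) * \<eta>) * ?g u \<partial>lborel) = sin ((\<rho> * x - a) * \<eta>) * ?S \<eta>"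
        unfolding shifted_transforms(2)[OF \<epsilon>] by simp
    qed
    finally show ?thesis .
  qed
  define I where "I \<eta> = (\<integral>x. normal_density 0 A x * (?g (x - a) * sin ((\<rho> * x - a) * \<eta>)) \<partial>lborel)" for \<eta>
  have Ib: "\<bar>I \<eta>\<bar> \<le> K / A" for \<eta>
  proof -
    let ?\<theta> = "(\<rho> * a - a) * \<eta>"
    let ?h = "\<lambda>u. sin ((\<rho> * \<eta>) * u + ?\<theta>) * ?g u"
    have h: "integrable lborel ?h" by (intro reg_gap_integrable \<epsilon>) auto
    have "I \<eta> = (\<integral>u. normal_density 0 A (u - (-a)) * ?h u \<partial>lborel)"
      unfolding I_def by (subst lborel_integral_real_affine[of 1 _ a]) (auto simp: algebra_simps)
    also have "\<dots> = ?c A * (\<integral>\<xi>. normal_density 0 (1/A) \<xi> * (\<integral>u. cos ((u - (-a)) * \<xi>) * ?h u \<partial>lborel) \<partial>lborel)"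
      by (rule gaussian_fourier_swap(1)[OF A h])
    finally have eq: "I \<eta> = ?c A * (\<integral>\<xi>. normal_density 0 (1/A) \<xi> * (\<integral>u. cos ((u - (-a)) * \<xi>) * ?h u \<partial>lborel)
        \<partial>lborel)" .
    have inner: "\<bar>\<integral>u. cos ((u - (-a)) * \<xi>) * ?h u \<partial>lborel\<bar> \<le> K" for \<xi>
    proof -
      have i: "integrable lborel (\<lambda>u. sin (\<kappa> * u + \<theta>) * ?g u)" for \<kappa> \<theta> by (intro reg_gap_integrable \<epsilon>) auto
      have "(\<integral>u. cos ((u - (-a)) * \<xi>) * ?h u \<partial>lborel) =
        (\<integral>u. (1/2) * (sin ((\<rho> * \<eta> + \<xi>) * u + (?\<theta> + a * \<xi>)) * ?g u) + (1/2) *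
            (sin ((\<rho> * \<eta> - \<xi>) * u + (?\<theta> - a * \<xi>)) * ?g u) \<partial>lborel)"
      proof (intro Bochner_Integration.integral_cong refl)
        fix u
        have "cos y * sin x = (1/2) * sin (x + y) + (1/2) * sin (x - y)" for x y :: real
          by (simp add: sin_add sin_diff field_simps)
        from this[of "(u - (-a)) * \<xi>" "(\<rho> * \<eta>) * u + ?\<theta>"]
        have "cos ((u - (-a)) * \<xi>) * sin ((\<rho> * \<eta>) * u + ?\<theta>) = (1/2) * sin ((\<rho> * \<eta> + \<xi>) * u + (?\<theta> + a * \<xi>)) +
            (1/2) * sin ((\<rho> * \<eta> - \<xi>) * u + (?\<theta> - a * \<xi>))"
          by (simp add: algebra_simps)
        then show "cos ((u - (-a)) * \<xi>) * ?h u = (1/2) * (sin ((\<rho> * \<eta> + \<xi>) * u + (?\<theta> + a * \<xi>)) * ?g u) +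
            (1/2) * (sin ((\<rho> * \<eta> - \<xi>) * u + (?\<theta> - a * \<xi>)) * ?g u)"
          by (simp only: mult.assoc[symmetric] distrib_right)
      qed
      also have "\<dots> = (1/2) * (cos (?\<theta> + a * \<xi>) * ?S (\<rho> * \<eta> + \<xi>)) + (1/2) * (cos (?\<theta> - a * \<xi>) * ?S (\<rho> * \<eta> - \<xi>))"
        using i by (simp add: shifted_transforms(1)[OF \<epsilon>])
      finally have e: "(\<integral>u. cos ((u - (-a)) * \<xi>) * ?h u \<partial>lborel) = \<dots>" .
      have "\<bar>cos p * ?S q\<bar> \<le> K" for p q
        using S[of q] by (auto simp: abs_mult intro!:
            order_trans[OF mult_right_mono[OF abs_cos_le_one[of p]], of "\<bar>?S q\<bar>"])
      from this[of "?\<theta> + a * \<xi>" "\<rho> * \<eta> + \<xi>"] this[of "?\<theta> - a * \<xi>" "\<rho> * \<eta> - \<xi>"] show ?thesis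
        unfolding e by linarith
    qed
    have "\<bar>\<integral>\<xi>. normal_density 0 (1/A) \<xi> * (\<integral>u. cos ((u - (-a)) * \<xi>) * ?h u \<partial>lborel) \<partial>lborel\<bar> \<le>
        (\<integral>\<xi>. normal_density 0 (1/A) \<xi> * K \<partial>lborel)"
      by (rule order_trans[OF integral_abs_bound integral_mono'])
          (use A inner K0 in \<open>auto simp: abs_mult intro!: mult_left_mono\<close>)
    also have "\<dots> = K" using A by simp
    finally have "\<bar>I \<eta>\<bar> \<le> ?c A * K" unfolding eq abs_mult using cb(1)[OF A]
        by (simp add: mult_left_mono divide_right_mono)
    also have "\<dots> \<le> 1 / A * K" using cb(2)[OF A] K0 by (rule mult_right_mono)
    finally show ?thesis by simp
  qed
  let ?f = "\<lambda>x \<eta>. normal_density 0 A x *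
      (?g (x - a) * (normal_density 0 (1/\<sigma>) \<eta> * (sin ((\<rho> * x - a) * \<eta>) * ?S \<eta>)))"
  have int: "integrable (lborel \<Otimes>\<^sub>M lborel) (case_prod ?f)"
  proof (rule lborel_pair.Fubini_integrable)
    have i1: "integrable lborel (\<lambda>\<eta>. normal_density 0 (1/\<sigma>) \<eta> * (sin ((\<rho> * x - a) * \<eta>) * ?S \<eta>))" for x
      by (rule Bochner_Integration.integrable_bound[OF
          integrable_mult_left[OF integrable_normal_density[of "1/\<sigma>" 0], of K]])
        (use \<sigma> S K0 in \<open>auto simp: abs_mult intro!: AE_I2 mult_left_mono mult_le_one
            order_trans[OF mult_left_le_one_le] \<close>)
    show "AE x in lborel. integrable lborel (\<lambda>\<eta>. case_prod ?f (x, \<eta>))" using i1 by simp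
    show "integrable lborel (\<lambda>x. \<integral>\<eta>. norm (case_prod ?f (x, \<eta>)) \<partial>lborel)"
    proof (rule Bochner_Integration.integrable_bound[where f="\<lambda>x. normal_density 0 A x * (1/\<epsilon> * K)"])
      show "integrable lborel (\<lambda>x. normal_density 0 A x * (1/\<epsilon> * K))" using A by simp
      show "AE x in lborel. norm (\<integral>\<eta>. norm (case_prod ?f (x, \<eta>)) \<partial>lborel) \<le>
          norm (normal_density 0 A x * (1/\<epsilon> * K))"
      proof (rule AE_I2)
        fix x
        have gb: "\<bar>?g y\<bar> \<le> 1 / \<epsilon>" for y
          by (rule order_trans[OF reg_gap_bound[OF \<epsilon>]]) (use \<epsilon> in \<open>auto simp: indicator_def\<close>)
        have "(\<integral>\<eta>. norm (case_prod ?f (x, \<eta>)) \<partial>lborel) \<le>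
            (\<integral>\<eta>. normal_density 0 (1/\<sigma>) \<eta> * (normal_density 0 A x * (1/\<epsilon> * K)) \<partial>lborel)"
        proof (rule integral_mono')
          show "integrable lborel (\<lambda>\<eta>. normal_density 0 (1/\<sigma>) \<eta> * (normal_density 0 A x * (1/\<epsilon> * K)))" using \<sigma>
              by (intro integrable_mult_left integrable_normal_density) auto
          fix \<eta>
          have "\<bar>?g (x - a)\<bar> * (normal_density 0 (1/\<sigma>) \<eta> * (\<bar>sin ((\<rho> * x - a) * \<eta>)\<bar> * \<bar>?S \<eta>\<bar>)) \<le>
              1 / \<epsilon> * (normal_density 0 (1/\<sigma>) \<eta> * (1 * K))"
            using gb S K0 \<epsilon> by (intro mult_mono) auto
          then have "normal_density 0 A x *
              (\<bar>?g (x - a)\<bar> * (normal_density 0 (1/\<sigma>) \<eta> * (\<bar>sin ((\<rho> * x - a) * \<eta>)\<bar> * \<bar>?S \<eta>\<bar>))) \<le> normal_density 0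
              A x * (1 / \<epsilon> * (normal_density 0 (1/\<sigma>) \<eta> * (1 * K)))"
            by (rule mult_left_mono) simp
          then show "norm (case_prod ?f (x, \<eta>)) \<le> normal_density 0 (1/\<sigma>) \<eta> * (normal_density 0 A x * (1/\<epsilon> * K))"
            by (simp add: abs_mult mult_ac)
          show "0 \<le> normal_density 0 (1/\<sigma>) \<eta> * (normal_density 0 A x * (1/\<epsilon> * K))" using \<epsilon> K0 by simp
        qed
        also have "\<dots> = normal_density 0 A x * (1/\<epsilon> * K)" using \<sigma> by simp
        finally show "norm (\<integral>\<eta>. norm (case_prod ?f (x, \<eta>)) \<partial>lborel) \<le> norm (normal_density 0 A x * (1/\<epsilon> * K))"
            using \<epsilon> K0 by simp
      qed
    qed measurable
  qed measurable
  have "(\<integral>x. normal_density 0 A x * (?g (x - a) * (\<integral>z. normal_density 0 \<sigma> z * ?g (\<rho> * x + z - a) \<partial>lborel))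
      \<partial>lborel) = (\<integral>x. ?c \<sigma> * (\<integral>\<eta>. ?f x \<eta> \<partial>lborel) \<partial>lborel)"
    unfolding lam by (intro Bochner_Integration.integral_cong refl)
        (unfold integral_mult_right_zero, simp only: mult_ac)
  also have "\<dots> = ?c \<sigma> * (\<integral>x. (\<integral>\<eta>. ?f x \<eta> \<partial>lborel) \<partial>lborel)" by (rule integral_mult_right_zero)
  also have "(\<integral>x. (\<integral>\<eta>. ?f x \<eta> \<partial>lborel) \<partial>lborel) = (\<integral>\<eta>. (\<integral>x. ?f x \<eta> \<partial>lborel) \<partial>lborel)"
    by (rule lborel_pair.Fubini_integral[OF int, symmetric])
  also have "\<dots> = (\<integral>\<eta>. normal_density 0 (1/\<sigma>) \<eta> * (?S \<eta> * I \<eta>) \<partial>lborel)"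
  proof (intro Bochner_Integration.integral_cong refl)
    fix \<eta>
    have "(\<integral>x. ?f x \<eta> \<partial>lborel) = (\<integral>x. (normal_density 0 (1/\<sigma>) \<eta> * ?S \<eta>) *
        (normal_density 0 A x * (?g (x - a) * sin ((\<rho> * x - a) * \<eta>))) \<partial>lborel)"
      by (intro Bochner_Integration.integral_cong refl) (simp add: mult_ac)
    then show "(\<integral>x. ?f x \<eta> \<partial>lborel) = normal_density 0 (1/\<sigma>) \<eta> * (?S \<eta> * I \<eta>)" by (simp add: I_def)
  qed
  finally have main: "(\<integral>x. normal_density 0 A x *
      (?g (x - a) * (\<integral>z. normal_density 0 \<sigma> z * ?g (\<rho> * x + z - a) \<partial>lborel)) \<partial>lborel)
     = ?c \<sigma> * (\<integral>\<eta>. normal_density 0 (1/\<sigma>) \<eta> * (?S \<eta> * I \<eta>) \<partial>lborel)" .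
  have f1: "\<bar>?S \<eta> * I \<eta>\<bar> \<le> K * (K / A)" for \<eta>
    unfolding abs_mult using S Ib K0 by (intro mult_mono) auto
  have f2: "\<bar>?S \<eta> * I \<eta>\<bar> \<le> (2 * \<delta> * (K / A)) * \<bar>\<eta>\<bar>" for \<eta>
  proof -
    have "\<bar>?S \<eta>\<bar> * \<bar>I \<eta>\<bar> \<le> (2 * \<delta> * \<bar>\<eta>\<bar>) * (K / A)"
      using sine_transform_linear_bound[OF \<epsilon>] Ib \<epsilon> by (intro mult_mono) auto
    then show ?thesis by (simp add: abs_mult mult_ac)
  qed
  have s1: "1 / \<sigma> > 0" using \<sigma> by simp
  have "\<bar>\<integral>\<eta>. normal_density 0 (1/\<sigma>) \<eta> * (?S \<eta> * I \<eta>) \<partial>lborel\<bar> \<le> (K / A) * min K (2 * \<delta> / \<sigma>)"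
    using weighted_average_bound[OF s1 f1 f2] A K0 by (auto simp: min_def mult_ac)
  then have "?c \<sigma> * \<bar>\<integral>\<eta>. normal_density 0 (1/\<sigma>) \<eta> * (?S \<eta> * I \<eta>) \<partial>lborel\<bar> \<le> 1 / \<sigma> * ((K / A) * min K (2 * \<delta> / \<sigma>))"
    using cb[OF \<sigma>] \<sigma> by (intro mult_mono) auto
  then show ?thesis unfolding main abs_mult using cb(1)[OF \<sigma>] by (simp add: mult_ac)
qed

lemma powr_subadditive_gap:
  fixes H :: real
  assumes H: "0 < H" "H < 1" and m: "0 < m" "m \<le> n"
  shows "(2 - 2 powr H) * m powr H \<le> m powr H + n powr H - (m + n) powr H"
proof -
  have "m powr H - (m + m) powr H \<le> n powr H - (m + n) powr H"
  proof (rule DERIV_nonneg_imp_nondecreasing[OF m(2)])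
    fix x assume x: "m \<le> x" "x \<le> n"
    have "((\<lambda>x. x powr H - (m + x) powr H) has_real_derivative H * x powr (H - 1) - H * (m + x) powr (H - 1))
        (at x)"
      using x m by (auto intro!: derivative_eq_intros)
    moreover have "(m + x) powr (H - 1) \<le> x powr (H - 1)"
      using x m H by (intro powr_mono2') auto
    ultimately show "\<exists>y. ((\<lambda>x. x powr H - (m + x) powr H) has_real_derivative y) (at x) \<and> 0 \<le> y"
      using H by (intro exI[of _ "H * x powr (H - 1) - H * (m + x) powr (H - 1)"]) (simp add: mult_left_mono)
  qed
  moreover have "(m + m) powr H = 2 powr H * m powr H" using m powr_mult[of 2 m H] by (simp add: mult_2[symmetric])
  ultimately show ?thesis by (simp add: algebra_simps)
qed

text \<open>By Heron's formula the right-hand side is a product of four linear factors.\<close>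

lemma fbm_determinant_lower:
  fixes H :: real
  assumes H: "0 < H" "H < 1" and s: "0 < s" "s < r"
  shows "(2 - 2 powr H) * ((r - s) powr H)\<^sup>2 * (s powr H)\<^sup>2 \<le>
      4 * (s powr H)\<^sup>2 * (r powr H)\<^sup>2 - ((s powr H)\<^sup>2 + (r powr H)\<^sup>2 - ((r - s) powr H)\<^sup>2)\<^sup>2"
proof -
  define x y z where "x = s powr H" and "y = r powr H" and "z = (r - s) powr H"
  have p: "x > 0" "y > 0" "z > 0" using s by (auto simp: x_def y_def z_def)
  have yx: "x \<le> y" "z \<le> y" using s H by (auto simp: x_def y_def z_def intro!: powr_mono2)
  have c0: "0 \<le> 2 - 2 powr H"
    using powr_mono[of H 1 2] H by simp
  have gap: "(2 - 2 powr H) * min x z \<le> z - y + x"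
  proof (cases "s \<le> r - s")
    case True
    then have "x \<le> z" unfolding x_def z_def using s H by (intro powr_mono2) auto
    then show ?thesis using powr_subadditive_gap[OF H s(1) True] by (simp add: x_def y_def z_def)
  next
    case False
    then have "z \<le> x" unfolding x_def z_def using s H by (intro powr_mono2) auto
    then show ?thesis using powr_subadditive_gap[OF H, of "r - s" s] False s
        by (simp add: x_def y_def z_def min_def)
  qed
  have "(2 - 2 powr H) * z\<^sup>2 * x\<^sup>2 = ((2 - 2 powr H) * min x z) * z * x * max x z"
    by (auto simp: min_def max_def power2_eq_square)
  also have "\<dots> \<le> (z - y + x) * (z + y - x) * (x + y - z) * (x + y + z)"
    using gap p yx c0 by (intro mult_mono) (auto intro!: mult_nonneg_nonneg order_trans[OF _ gap])
  also have "\<dots> = 4 * x\<^sup>2 * y\<^sup>2 - (x\<^sup>2 + y\<^sup>2 - z\<^sup>2)\<^sup>2"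
    by (simp add: power2_eq_square algebra_simps)
  finally show ?thesis unfolding x_def y_def z_def by simp
qed

lemma min_le_geometric:
  fixes p q g :: real
  assumes "0 < p" "0 \<le> q" "0 < g" "g < 1"
  shows "min p q \<le> p powr (1 - g) * q powr g"
proof (cases "q = 0")
  case False
  then have q: "q > 0" using assms by simp
  have m: "min p q > 0" using assms q by simp
  have "min p q = min p q powr (1 - g) * min p q powr g" using m by (simp add: powr_add[symmetric])
  also have "\<dots> \<le> p powr (1 - g) * q powr g"
    using assms m by (intro mult_mono powr_mono2) auto
  finally show ?thesis .
qed (use assms in auto)

context fbm_setting
begin

abbreviation "gap_const \<equiv> sqrt (2 - 2 powr H) / 2"

lemma gap_const_pos: "gap_const > 0"
proof -
  have "2 powr H < 2 powr (1::real)" using H by (intro powr_less_mono) auto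
  then show ?thesis by simp
qed

lemma residual_norm_lower:
  assumes s: "0 < s" "s < r" "r \<le> T"
  defines "\<rho> \<equiv> (e r \<bullet> e s) / (norm (e s))\<^sup>2"
  shows "gap_const * (r - s) powr H \<le> norm (e r - \<rho> *\<^sub>R e s)" "(e r - \<rho> *\<^sub>R e s) \<bullet> e s = 0"
proof -
  have sr: "s \<in> {0..T}" "r \<in> {0..T}" using s by auto
  define x y z where "x = s powr H" and "y = r powr H" and "z = (r - s) powr H"
  have x: "x > 0" using s by (simp add: x_def)
  have n: "norm (e s) = x" "norm (e r) = y" using norm_e sr by (auto simp: x_def y_def)
  have sq: "u powr (2*H) = (u powr H)\<^sup>2" for u by (simp add: power2_eq_square powr_add[symmetric])
  have R: "2 * (e r \<bullet> e s) = x\<^sup>2 + y\<^sup>2 - z\<^sup>2"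
    using e_inner[OF sr(2,1)] s by (simp add: fbm_cov_def sq x_def y_def z_def abs_minus_commute)
  have es: "e s \<bullet> e s = x\<^sup>2" "e r \<bullet> e r = y\<^sup>2" using n by (simp_all flip: power2_norm_eq_inner)
  show "(e r - \<rho> *\<^sub>R e s) \<bullet> e s = 0"
    using x by (simp add: inner_diff_left \<rho>_def es n)
  have "(norm (e r - \<rho> *\<^sub>R e s))\<^sup>2 = y\<^sup>2 - (e r \<bullet> e s)\<^sup>2 / x\<^sup>2"
    using x unfolding power2_norm_eq_inner
    by (simp add: inner_diff_left inner_diff_right es \<rho>_def n inner_commute[of "e s" "e r"] power2_eq_square
        field_simps)
  then have "4 * x\<^sup>2 * (norm (e r - \<rho> *\<^sub>R e s))\<^sup>2 = 4 * x\<^sup>2 * y\<^sup>2 - (2 * (e r \<bullet> e s))\<^sup>2"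
    using x by (simp add: field_simps)
  also have "\<dots> \<ge> (2 - 2 powr H) * z\<^sup>2 * x\<^sup>2"
    unfolding R using fbm_determinant_lower[of H s r] H s by (simp add: x_def y_def z_def)
  finally have "(2 - 2 powr H) * z\<^sup>2 \<le> 4 * (norm (e r - \<rho> *\<^sub>R e s))\<^sup>2"
    using x by (simp add: mult.commute[of _ "x\<^sup>2"] mult.left_commute[of _ "x\<^sup>2"])
  then have "(gap_const * z)\<^sup>2 \<le> (norm (e r - \<rho> *\<^sub>R e s))\<^sup>2"
    using gap_const_pos by (simp add: power_mult_distrib power_divide)
  then show "gap_const * (r - s) powr H \<le> norm (e r - \<rho> *\<^sub>R e s)"
    unfolding z_def by (rule power2_le_imp_le) simp
qed

lemma gap_covariance:
  assumes s: "0 < s" "s < r" "r \<le> T" and \<epsilon>: "0 < \<epsilon>" "\<epsilon> < \<delta>" and S: "\<And>\<kappa>. \<bar>sine_transform \<epsilon> \<delta> \<kappa>\<bar> \<le> K"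
  shows "\<bar>\<integral>\<omega>. reg_gap \<epsilon> \<delta> (B s \<omega> - a) * reg_gap \<epsilon> \<delta> (B r \<omega> - a) \<partial>M\<bar> \<le>
    K / (s powr H * (gap_const * (r - s) powr H)) * min K (2 * \<delta> / (gap_const * (r - s) powr H))"
proof -
  let ?g = "reg_gap \<epsilon> \<delta>"
  have K0: "K \<ge> 0" using S abs_ge_zero order_trans by blast
  have sr: "s \<in> {0..T}" "r \<in> {0..T}" using s by auto
  note [measurable] = B_measurable[OF sr(1)] B_measurable[OF sr(2)]
  define \<rho> where "\<rho> = (e r \<bullet> e s) / (norm (e s))\<^sup>2"
  define k where "k = e r - \<rho> *\<^sub>R e s"
  define \<sigma> where "\<sigma> = norm k"
  define l where "l = gap_const * (r - s) powr H"
  have l: "l > 0" using s gap_const_pos by (simp add: l_def)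
  have \<sigma>l: "l \<le> \<sigma>" and o: "k \<bullet> e s = 0"
    using residual_norm_lower[OF s] by (auto simp: \<sigma>_def k_def \<rho>_def l_def)
  have \<sigma>: "\<sigma> > 0" using l \<sigma>l by linarith
  have k: "k \<in> steps" using sr by (auto simp: k_def intro!: span_diff span_scale e_steps)
  have k0: "k \<noteq> 0" using \<sigma> by (auto simp: \<sigma>_def)
  have es0: "e s \<noteq> 0" using norm_e[OF sr(1)] s by auto
  let ?V = "\<lambda>\<omega> (i::nat). W (e s) \<omega>"
  let ?N1 = "distr M borel (W k)" and ?N2 = "distr M borel ?V"
  have Vm[measurable]: "?V \<in> borel_measurable M" by (rule W_family_measurable)
  define f where "f z v = ?g (v 0 - a) * ?g (\<rho> * v 0 + z - a)" for z and v :: "nat \<Rightarrow> real"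
  have v0[measurable]: "(\<lambda>p. snd p 0) \<in> borel_measurable (borel \<Otimes>\<^sub>M (borel :: (nat \<Rightarrow> real) measure))"
    by (rule measurable_compose[OF measurable_snd measurable_product_coordinates])
  have fm[measurable]: "case_prod f \<in> borel_measurable (borel \<Otimes>\<^sub>M borel)"
    unfolding f_def case_prod_beta' by measurable
  have gb: "\<bar>?g y\<bar> \<le> 1 / \<epsilon>" for y
    by (rule order_trans[OF reg_gap_bound[OF \<epsilon>]]) (use \<epsilon> in \<open>auto simp: indicator_def\<close>)
  interpret N: pair_sigma_finite ?N1 ?N2
    by (auto intro!: pair_sigma_finite.intro prob_space_imp_sigma_finite prob_space_distr)
  have ind: "?N1 \<Otimes>\<^sub>M ?N2 = distr M (borel \<Otimes>\<^sub>M borel) (\<lambda>\<omega>. (W k \<omega>, ?V \<omega>))"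
    by (rule W_independent[OF k e_steps[OF sr(1)] o])
  have WV: "(\<lambda>\<omega>. (W k \<omega>, ?V \<omega>)) \<in> M \<rightarrow>\<^sub>M borel \<Otimes>\<^sub>M borel" by measurable
  have iP: "integrable (?N1 \<Otimes>\<^sub>M ?N2) (case_prod f)"
    unfolding ind
  proof (subst integrable_distr_eq[OF WV fm])
    show "integrable M (\<lambda>\<omega>. case_prod f (W k \<omega>, ?V \<omega>))"
    proof (rule bounded_integrable[where C="1 / \<epsilon> * (1 / \<epsilon>)"])
      show "(\<lambda>\<omega>. case_prod f (W k \<omega>, ?V \<omega>)) \<in> borel_measurable M" by (rule measurable_compose[OF WV fm])
      show "\<bar>case_prod f (W k \<omega>, ?V \<omega>)\<bar> \<le> 1 / \<epsilon> * (1 / \<epsilon>)" for \<omega>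
        unfolding f_def case_prod_conv abs_mult using \<epsilon> by (intro mult_mono gb) auto
    qed
  qed
  have ae: "AE \<omega> in M. W k \<omega> = B r \<omega> - \<rho> * B s \<omega> \<and> W (e s) \<omega> = B s \<omega>"
    using W_linear[of 1 "e r" "-\<rho>" "e s"] W_e[OF sr(1)] W_e[OF sr(2)]
    by eventually_elim (simp add: k_def)
  have "(\<integral>\<omega>. ?g (B s \<omega> - a) * ?g (B r \<omega> - a) \<partial>M) = (\<integral>\<omega>. case_prod f (W k \<omega>, ?V \<omega>) \<partial>M)"
  proof (rule integral_cong_AE)
    show "AE \<omega> in M. ?g (B s \<omega> - a) * ?g (B r \<omega> - a) = case_prod f (W k \<omega>, ?V \<omega>)"
      using ae by eventually_elim (simp add: f_def)
    show "(\<lambda>\<omega>. case_prod f (W k \<omega>, ?V \<omega>)) \<in> borel_measurable M" by (rule measurable_compose[OF WV fm])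
  qed measurable
  also have "\<dots> = integral\<^sup>L (?N1 \<Otimes>\<^sub>M ?N2) (case_prod f)"
    unfolding ind by (rule integral_distr[OF WV fm, symmetric])
  also have "\<dots> = (\<integral>v. (\<integral>z. f z v \<partial>?N1) \<partial>?N2)"
    using N.integral_snd[OF iP] by simp
  also have "\<dots> = (\<integral>v. ?g (v 0 - a) * (\<integral>z. normal_density 0 \<sigma> z * ?g (\<rho> * v 0 + z - a) \<partial>lborel) \<partial>?N2)"
  proof (intro Bochner_Integration.integral_cong refl)
    fix v :: "nat \<Rightarrow> real"
    have "(\<integral>z. ?g (\<rho> * v 0 + z - a) \<partial>?N1) = (\<integral>\<omega>. ?g (\<rho> * v 0 + W k \<omega> - a) \<partial>M)"
      by (rule integral_distr) measurable
    also have "\<dots> = (\<integral>z. normal_density 0 \<sigma> z * ?g (\<rho> * v 0 + z - a) \<partial>lborel)"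
      using distributed_integral[OF W_normal[OF k k0], of "\<lambda>z. ?g (\<rho> * v 0 + z - a)"] by (simp add: \<sigma>_def)
    finally show "(\<integral>z. f z v \<partial>?N1) = ?g (v 0 - a) * (\<integral>z. normal_density 0 \<sigma> z * ?g (\<rho> * v 0 + z - a) \<partial>lborel)"
      by (simp add: f_def)
  qed
  also have "\<dots> = (\<integral>\<omega>. ?g (W (e s) \<omega> - a) * (\<integral>z. normal_density 0 \<sigma> z * ?g (\<rho> * W (e s) \<omega> + z - a) \<partial>lborel) \<partial>M)"
  proof -
    have "(\<lambda>x. \<integral>z. normal_density 0 \<sigma> z * ?g (\<rho> * x + z - a) \<partial>lborel) \<in> borel_measurable borel"
      by (rule lborel.borel_measurable_lebesgue_integral) measurable
    from measurable_compose[OF measurable_product_coordinates this]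
    have "(\<lambda>v :: nat \<Rightarrow> real. \<integral>z. normal_density 0 \<sigma> z * ?g (\<rho> * v 0 + z - a) \<partial>lborel) \<in> borel_measurable borel" .
    moreover have "(\<lambda>v :: nat \<Rightarrow> real. ?g (v 0 - a)) \<in> borel_measurable borel"
      by (rule measurable_compose[OF measurable_product_coordinates, of "\<lambda>y. ?g (y - a)"]) measurable
    ultimately show ?thesis by (subst integral_distr) auto
  qed
  also have "\<dots> = (\<integral>x. normal_density 0 (s powr H) x *
      (?g (x - a) * (\<integral>z. normal_density 0 \<sigma> z * ?g (\<rho> * x + z - a) \<partial>lborel)) \<partial>lborel)"
  proof -
    have "(\<lambda>x. \<integral>z. normal_density 0 \<sigma> z * ?g (\<rho> * x + z - a) \<partial>lborel) \<in> borel_measurable borel"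
      by (rule lborel.borel_measurable_lebesgue_integral) measurable
    then have "(\<lambda>x. ?g (x - a) * (\<integral>z. normal_density 0 \<sigma> z * ?g (\<rho> * x + z - a) \<partial>lborel)) \<in>
        borel_measurable borel" by measurable
    then show ?thesis
      using distributed_integral[OF W_normal[OF e_steps[OF sr(1)] es0], of
          "\<lambda>x. ?g (x - a) * (\<integral>z. normal_density 0 \<sigma> z * ?g (\<rho> * x + z - a) \<partial>lborel)"]
      by (simp add: norm_e[OF sr(1)])
  qed
  finally have "\<bar>\<integral>\<omega>. ?g (B s \<omega> - a) * ?g (B r \<omega> - a) \<partial>M\<bar> \<le> K / (s powr H * \<sigma>) * min K (2 * \<delta> / \<sigma>)"
    using two_point_estimate[OF \<epsilon> _ \<sigma> S, of "s powr H" a \<rho>] s by simp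
  also have "\<dots> \<le> K / (s powr H * l) * min K (2 * \<delta> / l)"
  proof (rule mult_mono)
    show "K / (s powr H * \<sigma>) \<le> K / (s powr H * l)"
      using K0 s l \<sigma>l by (intro divide_left_mono mult_left_mono) auto
    have "2 * \<delta> / \<sigma> \<le> 2 * \<delta> / l" using \<epsilon> l \<sigma>l by (intro divide_left_mono) auto
    then show "min K (2 * \<delta> / \<sigma>) \<le> min K (2 * \<delta> / l)" by auto
    show "0 \<le> K / (s powr H * l)" using K0 l by simp
    show "0 \<le> min K (2 * \<delta> / \<sigma>)" using K0 \<epsilon> \<sigma> by simp
  qed
  finally show ?thesis by (simp add: l_def)
qed

text \<open>Any exponent \<open>\<gamma> > 0\<close> with \<open>H * (1 + \<gamma>) < 1\<close> would do: it keeps the singularity integrable.\<close>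

abbreviation "gap_rate \<equiv> (1 - H) / (2 * H)"

lemma gap_rate: "0 < gap_rate" "gap_rate < 1" "H * (1 + gap_rate) = (1 + H) / 2"
  using H by (auto simp: field_simps)

lemma gap_covariance_rate:
  assumes K: "K > 0" "\<And>\<epsilon> \<delta> \<kappa>. 0 < \<epsilon> \<Longrightarrow> \<epsilon> < \<delta> \<Longrightarrow> \<bar>sine_transform \<epsilon> \<delta> \<kappa>\<bar> \<le> K"
    and \<epsilon>: "0 < \<epsilon>" "\<epsilon> < \<delta>" and s: "s \<in> {0<..T}" "r \<in> {0<..T}" "s \<noteq> r"
  shows "\<bar>\<integral>\<omega>. reg_gap \<epsilon> \<delta> (B s \<omega> - a) * reg_gap \<epsilon> \<delta> (B r \<omega> - a) \<partial>M\<bar> \<le>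
    (K / gap_const * (K powr (1 - gap_rate) * (2 / gap_const) powr gap_rate) * \<delta> powr gap_rate) *
       ((s powr (-H) + r powr (-H)) * \<bar>s - r\<bar> powr ((1-H)/2 - 1))"
proof -
  let ?g = gap_rate
  have main: "\<bar>\<integral>\<omega>. reg_gap \<epsilon> \<delta> (B s \<omega> - a) * reg_gap \<epsilon> \<delta> (B r \<omega> - a) \<partial>M\<bar> \<le>
    (K / gap_const * (K powr (1 - ?g) * (2 / gap_const) powr ?g) * \<delta> powr ?g) *
       ((s powr (-H) + r powr (-H)) * (r - s) powr ((1-H)/2 - 1))"
    if s: "0 < s" "s < r" "r \<le> T" for s r
  proof -
    define d where "d = r - s"
    have d: "d > 0" using s by (simp add: d_def)
    have c: "gap_const > 0" by (rule gap_const_pos)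
    have "\<bar>\<integral>\<omega>. reg_gap \<epsilon> \<delta> (B s \<omega> - a) * reg_gap \<epsilon> \<delta> (B r \<omega> - a) \<partial>M\<bar> \<le>
      K / (s powr H * (gap_const * d powr H)) * min K (2 * \<delta> / (gap_const * d powr H))"
      unfolding d_def by (rule gap_covariance[OF s \<epsilon> K(2)[OF \<epsilon>]])
    also have "\<dots> \<le> K / (s powr H * (gap_const * d powr H)) *
        (K powr (1 - ?g) * (2 * \<delta> / (gap_const * d powr H)) powr ?g)"
      using K(1) c d \<epsilon> s gap_rate by (intro mult_left_mono min_le_geometric) auto
    also have "(2 * \<delta> / (gap_const * d powr H)) powr ?g =
        (2 / gap_const) powr ?g * \<delta> powr ?g * d powr (- (H * ?g))"
    proof -
      have "(p * q * d powr (-H)) powr g = p powr g * q powr g * d powr (- (H * g))" if "p > 0" "q > 0"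
          for p q g :: real
        using that by (simp add: powr_mult powr_powr)
      moreover have "2 * \<delta> / (gap_const * d powr H) = (2 / gap_const) * \<delta> * d powr (-H)"
          by (simp add: powr_minus_divide)
      moreover have "2 / gap_const > 0" "\<delta> > 0" using c \<epsilon> by auto
      ultimately show ?thesis by (simp only:)
    qed
    also have "K / (s powr H * (gap_const * d powr H)) = K / gap_const * (s powr (-H) * d powr (-H))"
      by (simp add: powr_minus_divide)
    also have "K / gap_const * (s powr (-H) * d powr (-H)) *
        (K powr (1 - ?g) * ((2 / gap_const) powr ?g * \<delta> powr ?g * d powr (- (H * ?g))))
       = (K / gap_const * (K powr (1 - ?g) * (2 / gap_const) powr ?g) * \<delta> powr ?g) *
           (s powr (-H) * (d powr (-H) * d powr (- (H * ?g))))"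
      by (simp only: mult_ac)
    also have "d powr (-H) * d powr (- (H * ?g)) = d powr ((1-H)/2 - 1)"
    proof -
      have "- H + - (H * ?g) = (1-H)/2 - 1" using gap_rate(3) by (simp add: algebra_simps)
      then show ?thesis by (simp add: powr_add[symmetric])
    qed
    also have "(K / gap_const * (K powr (1 - ?g) * (2 / gap_const) powr ?g) * \<delta> powr ?g) *
        (s powr (-H) * d powr ((1-H)/2 - 1))
      \<le> (K / gap_const * (K powr (1 - ?g) * (2 / gap_const) powr ?g) * \<delta> powr ?g) *
          ((s powr (-H) + r powr (-H)) * d powr ((1-H)/2 - 1))"
      using K(1) c by (intro mult_left_mono mult_right_mono) auto
    finally show ?thesis by (simp add: d_def)
  qed
  show ?thesis
  proof (cases "s < r")
    case True
    then show ?thesis using main[of s r] s by simp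
  next
    case False
    then show ?thesis using main[of r s] s by (simp add: mult.commute[of "reg_gap \<epsilon> \<delta> (B r _ - a)"] add.commute)
  qed
qed

lemma singular_double_integral:
  obtains J where "J \<ge> 0" "(\<integral>\<^sup>+s\<in>{0..T}.
      (\<integral>\<^sup>+r\<in>{0..T}. ennreal ((s powr (-H) + r powr (-H)) * \<bar>s - r\<bar> powr ((1-H)/2 - 1)) \<partial>lborel) \<partial>lborel) \<le> ennreal
      J"
proof -
  let ?q = "(1-H)/2"
  let ?k = "\<lambda>s r. ennreal (\<bar>s - r\<bar> powr (?q - 1))" and ?h = "\<lambda>s. ennreal (s powr (-H))"
  define R where "R = 2 * T powr ?q / ?q"
  have q: "?q > 0" using H by simp
  have R0: "R \<ge> 0" using q by (simp add: R_def)
  have row: "(\<integral>\<^sup>+r\<in>{0..T}. ?k s r \<partial>lborel) \<le> ennreal R" if "s \<in> {0..T}" for s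
  proof -
    have "(sgn (T - s) * \<bar>T - s\<bar> powr ?q - sgn (0 - s) * \<bar>0 - s\<bar> powr ?q) / ?q =
        ((T - s) powr ?q + s powr ?q) / ?q"
      using that by (auto simp: sgn_if)
    also have "\<dots> \<le> (T powr ?q + T powr ?q) / ?q"
      using that q by (intro divide_right_mono add_mono powr_mono2) auto
    finally show ?thesis using nn_integral_abs_powr_Icc[OF q, of 0 T s] T by (simp add: R_def ennreal_leI)
  qed
  have one: "(\<integral>\<^sup>+s\<in>{0..T}. ?h s \<partial>lborel) = ennreal (T powr (1-H) / (1-H))"
  proof -
    have "(\<integral>\<^sup>+s\<in>{0..T}. ?h s \<partial>lborel) = (\<integral>\<^sup>+v\<in>{0..T}. ennreal (\<bar>0 - v\<bar> powr ((1-H) - 1)) \<partial>lborel)"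
      by (intro nn_integral_cong) (auto simp: indicator_def)
    then show ?thesis using nn_integral_abs_powr_Icc[of "1-H" 0 T 0] H T by simp
  qed
  define I where "I = (\<integral>\<^sup>+s\<in>{0..T}. (\<integral>\<^sup>+r\<in>{0..T}. ?h s * ?k s r \<partial>lborel) \<partial>lborel)"
  have "I = (\<integral>\<^sup>+s\<in>{0..T}. ?h s * (\<integral>\<^sup>+r\<in>{0..T}. ?k s r \<partial>lborel) \<partial>lborel)"
    unfolding I_def by (simp add: mult.assoc nn_integral_cmult)
  also have "\<dots> \<le> (\<integral>\<^sup>+s. (?h s * indicator {0..T} s) * ennreal R \<partial>lborel)"
    using row by (intro nn_integral_mono) (auto simp: indicator_def intro!: mult_left_mono)
  also have "\<dots> = ennreal (T powr (1-H) / (1-H)) * ennreal R"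
    unfolding one[symmetric] by (rule nn_integral_multc) measurable
  finally have I: "I \<le> ennreal (T powr (1-H) / (1-H) * R)" using H R0 by (subst ennreal_mult) auto
  have sw: "(\<integral>\<^sup>+s\<in>{0..T}. (\<integral>\<^sup>+r\<in>{0..T}. ?h r * ?k s r \<partial>lborel) \<partial>lborel) = I"
  proof -
    have "(\<integral>\<^sup>+s\<in>{0..T}. (\<integral>\<^sup>+r\<in>{0..T}. ?h r * ?k s r \<partial>lborel) \<partial>lborel) =
        (\<integral>\<^sup>+s. \<integral>\<^sup>+r. ?h r * ?k s r * indicator {0..T} r * indicator {0..T} s \<partial>lborel \<partial>lborel)"
      by (intro nn_integral_cong, subst nn_integral_multc[symmetric]) auto
    also have "\<dots> = (\<integral>\<^sup>+r. \<integral>\<^sup>+s. ?h r * ?k s r * indicator {0..T} r * indicator {0..T} s \<partial>lborel \<partial>lborel)"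
      by (rule lborel_pair.Fubini'[symmetric]) measurable
    also have "\<dots> = I"
      unfolding I_def by (intro nn_integral_cong, subst nn_integral_multc[symmetric])
          (auto simp: mult_ac abs_minus_commute)
    finally show ?thesis .
  qed
  have "(\<integral>\<^sup>+s\<in>{0..T}. (\<integral>\<^sup>+r\<in>{0..T}. ennreal ((s powr (-H) + r powr (-H)) * \<bar>s - r\<bar> powr (?q - 1)) \<partial>lborel) \<partial>lborel)
    = (\<integral>\<^sup>+s. (\<integral>\<^sup>+r. ?h s * ?k s r * indicator {0..T} r + ?h r * ?k s r * indicator {0..T} r \<partial>lborel) * indicator
        {0..T} s \<partial>lborel)"
    by (intro nn_integral_cong arg_cong2[where f="(*)"] refl) (auto simp: distrib_right ennreal_mult indicator_def)
  also have "\<dots> = I + (\<integral>\<^sup>+s\<in>{0..T}. (\<integral>\<^sup>+r\<in>{0..T}. ?h r * ?k s r \<partial>lborel) \<partial>lborel)"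
    unfolding I_def by (subst nn_integral_add[symmetric]) (auto simp: nn_integral_add distrib_right)
  also have "\<dots> \<le> ennreal (2 * (T powr (1-H) / (1-H) * R))"
  proof -
    have "0 \<le> T powr (1-H) / (1-H) * R" using H R0 by simp
    then show ?thesis unfolding sw using add_mono[OF I I] by (simp add: mult.commute flip: ennreal_plus)
  qed
  finally show ?thesis using H R0 by (intro that[of "2 * (T powr (1-H) / (1-H) * R)"]) auto
qed

end

context fbm_level
begin

definition Creg :: "real \<Rightarrow> 'a \<Rightarrow> real" where
  "Creg d \<omega> = (\<integral>s. indicator {0..t} s * (H * s powr (2*H-1) * reg_inv d (X s \<omega>)) \<partial>lborel)"

lemma weight_bound: "s \<in> {0..T} \<Longrightarrow> \<bar>H * s powr (2*H-1)\<bar> \<le> H * T powr (2*H-1)"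
  using H by (simp add: abs_mult) (intro powr_mono2; simp)

lemma Creg_integrand_integrable:
  assumes d: "d > 0" and \<omega>: "\<omega> \<in> space M"
  shows "integrable lborel (\<lambda>s. indicator {0..t} s * (H * s powr (2*H-1) * reg_inv d (X s \<omega>)))"
proof (rule bounded_integrable_Icc[where K="H * T powr (2*H-1) * (1 / d)"])
  show "(\<lambda>s. H * s powr (2*H-1) * reg_inv d (X s \<omega>)) \<in> borel_measurable borel"
    using compose_X_path[OF reg_inv_measurable \<omega>] by measurable
  fix s assume "s \<in> {0..t}"
  then have "s \<in> {0..T}" using t by auto
  then show "\<bar>H * s powr (2*H-1) * reg_inv d (X s \<omega>)\<bar> \<le> H * T powr (2*H-1) * (1 / d)"
    unfolding abs_mult[of "H * s powr (2*H-1)"] using weight_bound reg_inv_bound[OF d] H by (intro mult_mono) auto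
qed

lemma Creg_bound:
  assumes d: "d > 0" and \<omega>: "\<omega> \<in> space M"
  shows "\<bar>Creg d \<omega>\<bar> \<le> T * (H * T powr (2*H-1) * (1 / d))"
proof -
  have "\<bar>Creg d \<omega>\<bar> \<le> (\<integral>s. \<bar>indicator {0..t} s * (H * s powr (2*H-1) * reg_inv d (X s \<omega>))\<bar> \<partial>lborel)"
    unfolding Creg_def by (rule integral_abs_bound)
  also have "\<dots> \<le> (\<integral>s. indicator {0..T} s * (H * T powr (2*H-1) * (1 / d)) \<partial>lborel)"
  proof (rule integral_mono')
    show "integrable lborel (\<lambda>s. indicator {0..T} s * (H * T powr (2*H-1) * (1 / d)))"
      by (intro integrable_mult_left integrable_real_indicator) (auto simp: emeasure_lborel_Icc_eq)
    fix s
    show "\<bar>indicator {0..t} s * (H * s powr (2*H-1) * reg_inv d (X s \<omega>))\<bar> \<le>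
        indicator {0..T} s * (H * T powr (2*H-1) * (1 / d))"
    proof (cases "s \<in> {0..t}")
      case True
      then have s: "s \<in> {0..T}" using t by auto
      have "\<bar>H * s powr (2*H-1)\<bar> * \<bar>reg_inv d (X s \<omega>)\<bar> \<le> (H * T powr (2*H-1)) * (1 / d)"
        using weight_bound[OF s] reg_inv_bound[OF d] H by (intro mult_mono) auto
      then show ?thesis using True s by (simp add: abs_mult)
    qed (use H d in \<open>auto simp: indicator_def\<close>)
    show "0 \<le> indicator {0..T} s * (H * T powr (2*H-1) * (1 / d))" using H d by (simp add: indicator_def)
  qed
  also have "\<dots> = T * (H * T powr (2*H-1) * (1 / d))" using T by simp
  finally show ?thesis .
qed

lemma Creg_F_measurable: "Creg d \<in> borel_measurable F"
proof -
  have "(\<lambda>p. X (fst p) (snd p)) \<in> borel_measurable (lborel \<Otimes>\<^sub>M F)" using B_clip_F_joint by simp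
  from measurable_compose[OF this reg_inv_measurable]
  have "(\<lambda>p. indicator {0..t} (fst p) * (H * fst p powr (2*H-1) * reg_inv d (X (fst p) (snd p)))) \<in>
      borel_measurable (lborel \<Otimes>\<^sub>M F)"
    by measurable
  from measurable_compose[OF measurable_pair_swap' this]
  show ?thesis
    unfolding Creg_def[abs_def] by (intro lborel.borel_measurable_lebesgue_integral) (simp add: case_prod_beta')
qed

lemma Creg_measurable[measurable]: "Creg d \<in> borel_measurable M"
  by (rule F_measurable_imp[OF Creg_F_measurable])

lemma Creg_square_integrable: "d > 0 \<Longrightarrow> square_integrable M (Creg d)"
  by (rule square_integrable_bounded[OF Creg_measurable Creg_bound])

lemma Creg_cauchy:
  obtains K where "K \<ge> 0" "\<And>\<epsilon> \<delta>. 0 < \<epsilon> \<Longrightarrow> \<epsilon> < \<delta> \<Longrightarrow> (\<integral>\<omega>. (Creg \<epsilon> \<omega> - Creg \<delta> \<omega>)\<^sup>2 \<partial>M) \<le> K * \<delta> powr gap_rate"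
proof -
  obtain K where K: "K > 0" "\<And>\<epsilon> \<delta> \<kappa>. 0 < \<epsilon> \<Longrightarrow> \<epsilon> < \<delta> \<Longrightarrow> \<bar>sine_transform \<epsilon> \<delta> \<kappa>\<bar> \<le> K"
    using sine_transform_bounded by blast
  obtain J where J: "J \<ge> 0" "(\<integral>\<^sup>+s\<in>{0..T}.
      (\<integral>\<^sup>+r\<in>{0..T}. ennreal ((s powr (-H) + r powr (-H)) * \<bar>s - r\<bar> powr ((1-H)/2 - 1)) \<partial>lborel) \<partial>lborel) \<le> ennreal
      J"
    using singular_double_integral by blast
  define w where "w s = H * s powr (2*H-1)" for s
  define w0 where "w0 = H * T powr (2*H-1)"
  have w0: "w0 \<ge> 0" using H by (simp add: w0_def)
  have w: "\<bar>w s\<bar> \<le> w0" if "s \<in> {0..T}" for s using weight_bound[OF that] by (simp add: w_def w0_def)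
  have wm[measurable]: "w \<in> borel_measurable borel" unfolding w_def by measurable
  define L where "L = K / gap_const * (K powr (1 - gap_rate) * (2 / gap_const) powr gap_rate)"
  have L: "L \<ge> 0" using K gap_const_pos by (simp add: L_def)
  have est: "(\<integral>\<omega>. (Creg \<epsilon> \<omega> - Creg \<delta> \<omega>)\<^sup>2 \<partial>M) \<le> (w0\<^sup>2 * L * J) * \<delta> powr gap_rate" if \<epsilon>: "0 < \<epsilon>" "\<epsilon> < \<delta>" for \<epsilon> \<delta>
  proof -
    let ?q = "\<lambda>y. reg_gap \<epsilon> \<delta> (y - a)"
    define A where "A \<omega> = (if \<omega> \<in> space M then Creg \<epsilon> \<omega> - Creg \<delta> \<omega> else 0)" for \<omega>
    define c where "c s r = (\<integral>\<omega>. ?q (B (clip s) \<omega>) * ?q (B (clip r) \<omega>) \<partial>M)" for s r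
    have qm[measurable]: "?q \<in> borel_measurable borel" by measurable
    have gb: "\<bar>?q y\<bar> \<le> 1 / \<epsilon>" for y
      by (rule order_trans[OF reg_gap_bound[OF \<epsilon>]]) (use \<epsilon> in \<open>auto simp: indicator_def\<close>)
    have gb2: "\<bar>?q y\<bar> \<le> 1 / \<epsilon> * (1 + \<bar>y\<bar>)" for y
      by (rule order_trans[OF gb]) (use \<epsilon> in \<open>simp add: field_simps\<close>)
    have Am[measurable]: "A \<in> borel_measurable M" unfolding A_def[abs_def] by measurable
    have Ab: "\<bar>A \<omega>\<bar> \<le> T * (H * T powr (2*H-1) * (1 / \<epsilon>)) + T * (H * T powr (2*H-1) * (1 / \<delta>))" for \<omega>
    proof (cases "\<omega> \<in> space M")
      case True
      show ?thesis using Creg_bound[OF \<epsilon>(1) True] Creg_bound[of \<delta>, OF _ True] \<epsilon> True by (simp add: A_def)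
    next
      case False
      have "0 \<le> T * (H * T powr (2*H-1) * (1 / \<epsilon>)) + T * (H * T powr (2*H-1) * (1 / \<delta>))"
        using T H \<epsilon> by (intro add_nonneg_nonneg mult_nonneg_nonneg) auto
      with False show ?thesis unfolding A_def by simp
    qed
    have Aeq: "A \<omega> = (\<integral>s. indicator {0..t} s * (w s * ?q (B (clip s) \<omega>)) \<partial>lborel)" if "\<omega> \<in> space M" for \<omega>
    proof -
      have "A \<omega> = (\<integral>s. indicator {0..t} s * (H * s powr (2*H-1) * reg_inv \<epsilon> (X s \<omega>)) -
          indicator {0..t} s * (H * s powr (2*H-1) * reg_inv \<delta> (X s \<omega>)) \<partial>lborel)"
        unfolding A_def Creg_def using Creg_integrand_integrable[OF _ that] \<epsilon> that by simp
      also have "\<dots> = (\<integral>s. indicator {0..t} s * (w s * ?q (B (clip s) \<omega>)) \<partial>lborel)"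
        by (intro Bochner_Integration.integral_cong) (auto simp: w_def reg_gap_def algebra_simps)
      finally show ?thesis .
    qed
    have qB[measurable]: "(\<lambda>\<omega>. ?q (B (clip s) \<omega>)) \<in> borel_measurable M" for s
      by (rule measurable_compose[OF B_measurable[OF clip_in] qm])
    have "(\<integral>\<omega>. (Creg \<epsilon> \<omega> - Creg \<delta> \<omega>)\<^sup>2 \<partial>M) =
        (\<integral>\<omega>. A \<omega> * (\<integral>s. indicator {0..t} s * (w s * ?q (B (clip s) \<omega>)) \<partial>lborel) \<partial>M)"
      by (intro Bochner_Integration.integral_cong refl, subst Aeq[symmetric]) (auto simp: A_def power2_eq_square)
    also have "\<dots> = (\<integral>s. indicator {0..t} s * (w s * (\<integral>\<omega>. A \<omega> * ?q (B (clip s) \<omega>) \<partial>M)) \<partial>lborel)"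
      using time_fubini(2)[OF Am Ab wm qm w gb2 t] by simp
    also have "(\<lambda>s. \<integral>\<omega>. A \<omega> * ?q (B (clip s) \<omega>) \<partial>M) = (\<lambda>s. \<integral>r. indicator {0..t} r * (w r * c s r) \<partial>lborel)"
    proof
      fix s
      have "(\<integral>\<omega>. A \<omega> * ?q (B (clip s) \<omega>) \<partial>M) =
          (\<integral>\<omega>. ?q (B (clip s) \<omega>) * (\<integral>r. indicator {0..t} r * (w r * ?q (B (clip r) \<omega>)) \<partial>lborel) \<partial>M)"
        by (intro Bochner_Integration.integral_cong refl, subst Aeq[symmetric]) auto
      also have "\<dots> = (\<integral>r. indicator {0..t} r * (w r * c s r) \<partial>lborel)"
        unfolding c_def by (rule time_fubini(2)[OF qB gb wm qm w gb2 t, symmetric])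
      finally show "(\<integral>\<omega>. A \<omega> * ?q (B (clip s) \<omega>) \<partial>M) = (\<integral>r. indicator {0..t} r * (w r * c s r) \<partial>lborel)" .
    qed
    finally have eq: "(\<integral>\<omega>. (Creg \<epsilon> \<omega> - Creg \<delta> \<omega>)\<^sup>2 \<partial>M) =
        (\<integral>s. indicator {0..t} s * (w s * (\<integral>r. indicator {0..t} r * (w r * c s r) \<partial>lborel)) \<partial>lborel)" .
    let ?b = "\<lambda>s r. (s powr (-H) + r powr (-H)) * \<bar>s - r\<bar> powr ((1-H)/2 - 1)"
    let ?C = "w0\<^sup>2 * L * \<delta> powr gap_rate"
    have C0: "?C \<ge> 0" using L by simp
    have cb: "\<bar>c s r\<bar> \<le> L * \<delta> powr gap_rate * ?b s r" if "s \<in> {0<..T}" "r \<in> {0<..T}" "s \<noteq> r" for s r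
      using gap_covariance_rate[OF K \<epsilon> that, of a] that by (simp add: c_def clip_id L_def)
    have inner: "ennreal (norm (indicator {0..t} s * (w s * (\<integral>r. indicator {0..t} r * (w r * c s r) \<partial>lborel)))) \<le>
       ennreal ?C * ((\<integral>\<^sup>+r\<in>{0..T}. ennreal (?b s r) \<partial>lborel) * indicator {0..T} s)" if s0: "s \<noteq> 0" for s
    proof (cases "s \<in> {0..t}")
      case True
      then have s: "s \<in> {0<..T}" using s0 t by auto
      have "ennreal (norm (indicator {0..t} s * (w s * (\<integral>r. indicator {0..t} r * (w r * c s r) \<partial>lborel)))) =
          ennreal \<bar>w s\<bar> * ennreal (norm (\<integral>r. indicator {0..t} r * (w r * c s r) \<partial>lborel))"
        using True by (simp add: abs_mult ennreal_mult)
      also have "\<dots> \<le> ennreal w0 * (\<integral>\<^sup>+r. ennreal (norm (indicator {0..t} r * (w r * c s r))) \<partial>lborel)"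
        using w[of s] s by (intro mult_mono ennreal_leI integral_norm_bound_nn) auto
      also have "\<dots> \<le> ennreal w0 * (\<integral>\<^sup>+r. ennreal (w0 * (L * \<delta> powr gap_rate)) *
          (ennreal (?b s r) * indicator {0..T} r) \<partial>lborel)"
      proof (intro mult_left_mono nn_integral_mono_AE)
        show "AE r in lborel. ennreal (norm (indicator {0..t} r * (w r * c s r))) \<le>
            ennreal (w0 * (L * \<delta> powr gap_rate)) * (ennreal (?b s r) * indicator {0..T} r)"
          using AE_lborel_singleton[of 0] AE_lborel_singleton[of s]
        proof eventually_elim
          case (elim r)
          show ?case
          proof (cases "r \<in> {0..t}")
            case True
            then have r: "r \<in> {0<..T}" "r \<in> {0..T}" using elim t by auto
            have "\<bar>w r\<bar> * \<bar>c s r\<bar> \<le> w0 * (L * \<delta> powr gap_rate * ?b s r)"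
              using w[OF r(2)] cb[OF s r(1)] elim w0 by (intro mult_mono) auto
            then have "ennreal (\<bar>w r\<bar> * \<bar>c s r\<bar>) \<le> ennreal (w0 * (L * \<delta> powr gap_rate)) * ennreal (?b s r)"
              using L w0 by (subst ennreal_mult[symmetric]) (auto intro!: ennreal_leI simp: mult.assoc)
            then show ?thesis using True r by (simp add: abs_mult)
          qed simp
        qed
      qed simp
      also have "\<dots> = ennreal w0 * (ennreal (w0 * (L * \<delta> powr gap_rate)) * (\<integral>\<^sup>+r\<in>{0..T}. ennreal (?b s r) \<partial>lborel))"
        by (subst nn_integral_cmult) auto
      also have "\<dots> = ennreal ?C * (\<integral>\<^sup>+r\<in>{0..T}. ennreal (?b s r) \<partial>lborel)"
        using w0 L by (simp add: mult.assoc[symmetric] ennreal_mult[symmetric] power2_eq_square)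
      finally show ?thesis using s by simp
    qed simp
    have "ennreal (\<integral>\<omega>. (Creg \<epsilon> \<omega> - Creg \<delta> \<omega>)\<^sup>2 \<partial>M) \<le>
        ennreal (norm (\<integral>s. indicator {0..t} s * (w s * (\<integral>r. indicator {0..t} r * (w r * c s r) \<partial>lborel)) \<partial>lborel))"
      unfolding eq by (intro ennreal_leI) simp
    also have "\<dots> \<le> (\<integral>\<^sup>+s. ennreal (norm
        (indicator {0..t} s * (w s * (\<integral>r. indicator {0..t} r * (w r * c s r) \<partial>lborel)))) \<partial>lborel)"
      by (rule integral_norm_bound_nn)
    also have "\<dots> \<le> (\<integral>\<^sup>+s. ennreal ?C * ((\<integral>\<^sup>+r\<in>{0..T}. ennreal (?b s r) \<partial>lborel) * indicator {0..T} s) \<partial>lborel)"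
      using AE_lborel_singleton[of 0] inner by (intro nn_integral_mono_AE) (auto elim!: eventually_mono)
    also have "\<dots> = ennreal ?C * (\<integral>\<^sup>+s\<in>{0..T}. (\<integral>\<^sup>+r\<in>{0..T}. ennreal (?b s r) \<partial>lborel) \<partial>lborel)"
      by (rule nn_integral_cmult) measurable
    also have "\<dots> \<le> ennreal ?C * ennreal J" by (intro mult_left_mono J) simp
    also have "\<dots> = ennreal ((w0\<^sup>2 * L * J) * \<delta> powr gap_rate)"
      using C0 J(1) by (simp add: ennreal_mult[symmetric] mult_ac)
    finally show ?thesis using L J(1) by (simp add: ennreal_le_iff)
  qed
  show ?thesis by (rule that[of "w0\<^sup>2 * L * J"]) (use est L J in auto)
qed

end

context fbm_setting
begin

section \<open>The Skorohod integral of the logarithm\<close>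

lemma steps_dense: "r > 0 \<Longrightarrow> \<exists>y\<in>steps. norm (y - x) < r"
proof -
  assume r: "r > 0"
  have "x \<in> closure steps" using hilbert by (simp add: fbm_hilbert_space_def)
  then show ?thesis using r unfolding closure_approachable dist_norm by blast
qed

lemma represents_unique:
  assumes "represents H T e \<phi> h" "represents H T e \<phi> k"
  shows "h = k"
proof -
  have base: "(h - k) \<bullet> x = 0" if "x \<in> e ` {0..T}" for x
    using assms that by (auto simp: represents_def inner_diff_left)
  have s: "(h - k) \<bullet> x = 0" if "x \<in> steps" for x
    using that by (induction rule: span_induct_alt) (auto simp: inner_add_right base)
  have "closed {x. (h - k) \<bullet> x = 0}" by (intro closed_Collect_eq continuous_intros)
  then have "closure steps \<subseteq> {x. (h - k) \<bullet> x = 0}" using s by (intro closure_minimal) auto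
  then have "h - k \<in> {x. (h - k) \<bullet> x = 0}" using hilbert by (simp only: fbm_hilbert_space_def) blast
  then have "(h - k) \<bullet> (h - k) = 0" by simp
  then show ?thesis by simp
qed

lemma B_square_square_integrable:
  assumes s: "s \<in> {0..T}"
  shows "square_integrable M (\<lambda>\<omega>. (B s \<omega>)\<^sup>2)"
proof -
  note [measurable] = B_measurable[OF s]
  have "square_integrable M (\<lambda>\<omega>. (W (e s) \<omega>)\<^sup>2)"
  proof (cases "e s = 0")
    case True
    have "AE \<omega> in M. 0 = (W (e s) \<omega>)\<^sup>2" using W_linear[of 0 0 0 0] True by simp
    then show ?thesis by (intro square_integrable_AE_cong[OF square_integrable_const[of 0]]) auto
  next
    case False
    have "integrable lborel (\<lambda>x. normal_density 0 (norm (e s)) x * (x - 0) ^ 4)"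
      using False by (intro integrable_normal_moment) simp
    then have "integrable M (\<lambda>\<omega>. W (e s) \<omega> ^ 4)"
      using distributed_integrable[OF W_normal[OF e_steps[OF s] False], of "\<lambda>x. x ^ 4"] by simp
    then show ?thesis by (simp add: square_integrable_def flip: power_mult)
  qed
  then show ?thesis
  proof (rule square_integrable_AE_cong)
    show "AE \<omega> in M. (W (e s) \<omega>)\<^sup>2 = (B s \<omega>)\<^sup>2" using W_e[OF s] by (auto elim: eventually_mono)
  qed measurable
qed

lemma log_primitive_measurable[measurable]: "log_primitive \<in> borel_measurable borel"
  unfolding log_primitive_def[abs_def] by measurable

lemma log_primitive_square_integrable:
  assumes s: "s \<in> {0..T}"
  shows "square_integrable M (\<lambda>\<omega>. log_primitive (B s \<omega> - a))"
proof -
  note [measurable] = B_measurable[OF s]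
  have "square_integrable M (\<lambda>\<omega>. (1 + \<bar>a\<bar> + 2 * a\<^sup>2) + (\<bar>B s \<omega>\<bar> + 2 * (B s \<omega>)\<^sup>2))"
    by (intro square_integrable_add square_integrable_const square_integrable_abs square_integrable_cmult
        B_square_integrable B_square_square_integrable s)
  then have i: "integrable M (\<lambda>\<omega>. ((1 + \<bar>a\<bar> + 2 * a\<^sup>2) + (\<bar>B s \<omega>\<bar> + 2 * (B s \<omega>)\<^sup>2))\<^sup>2)"
      by (simp add: square_integrable_def)
  have b: "\<bar>log_primitive (y - a)\<bar> \<le> \<bar>(1 + \<bar>a\<bar> + 2 * a\<^sup>2) + (\<bar>y\<bar> + 2 * y\<^sup>2)\<bar>" for y
  proof -
    have "\<bar>log_primitive (y - a)\<bar> \<le> 1 + \<bar>reg_primitive 1 (y - a)\<bar>"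
      using reg_primitive_close[of 1 "y - a"] by linarith
    also have "\<dots> \<le> 1 + (\<bar>y - a\<bar> + (y - a)\<^sup>2)" using reg_primitive_bound[of "y - a"] by linarith
    also have "(y - a)\<^sup>2 \<le> 2 * y\<^sup>2 + 2 * a\<^sup>2"
      using zero_le_power2[of "y + a"] by (simp add: power2_eq_square algebra_simps)
    finally show ?thesis by (simp add: abs_triangle_ineq4)
  qed
  have "integrable M (\<lambda>\<omega>. (log_primitive (B s \<omega> - a))\<^sup>2)"
  proof (rule Bochner_Integration.integrable_bound[OF i])
    have "(log_primitive (B s \<omega> - a))\<^sup>2 \<le> ((1 + \<bar>a\<bar> + 2 * a\<^sup>2) + (\<bar>B s \<omega>\<bar> + 2 * (B s \<omega>)\<^sup>2))\<^sup>2" for \<omega>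
      using b[of "B s \<omega>"] unfolding abs_le_square_iff .
    then show "AE \<omega> in M. norm ((log_primitive (B s \<omega> - a))\<^sup>2) \<le>
        norm (((1 + \<bar>a\<bar> + 2 * a\<^sup>2) + (\<bar>B s \<omega>\<bar> + 2 * (B s \<omega>)\<^sup>2))\<^sup>2)"
      by (intro AE_I2) simp
  qed measurable
  then show ?thesis by (simp add: square_integrable_def)
qed

lemma F_density_unique:
  assumes D: "integrable M D" "D \<in> borel_measurable F"
    and null: "\<And>n \<theta> (k :: nat \<Rightarrow> real) r. (\<And>i. i < n \<Longrightarrow> r i \<in> {0..T}) \<Longrightarrow>
        (\<integral>\<omega>. D \<omega> * cos (\<theta> + (\<Sum>i<n. k i * B (r i) \<omega>)) \<partial>M) = 0"
  shows "AE \<omega> in M. D \<omega> = 0"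
proof -
  have Dm[measurable]: "D \<in> borel_measurable M" using D by auto
  have enum: "(\<integral>\<omega>. D \<omega> * cos (\<theta> + (\<Sum>s\<in>J. c s * B s \<omega>)) \<partial>M) = 0" if J: "finite J" "J \<subseteq> {0..T}" for J c \<theta>
  proof -
    obtain g where g: "bij_betw g {..<card J} J" using ex_bij_betw_nat_finite[OF J(1)]
        by (auto simp: atLeast0LessThan)
    have gJ: "g i \<in> {0..T}" if "i < card J" for i using bij_betwE[OF g] J(2) that by blast
    have "(\<Sum>s\<in>J. c s * B s \<omega>) = (\<Sum>i<card J. c (g i) * B (g i) \<omega>)" for \<omega>
      by (rule sum.reindex_bij_betw[OF g, symmetric])
    moreover have "(\<integral>\<omega>. D \<omega> * cos (\<theta> + (\<Sum>i<card J. c (g i) * B (g i) \<omega>)) \<partial>M) = 0"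
      by (rule null[OF gJ])
    ultimately show ?thesis by simp
  qed
  have z: "(\<integral>\<omega>. D \<omega> * indicator S \<omega> \<partial>M) = 0" if "S \<in> sets F" for S
  proof (rule char_density_unique_sigma[of "{0..T}" B])
    show "S \<in> sigma_sets (space M) {B i -` A \<inter> space M |i A. i \<in> {0..T} \<and> A \<in> sets borel}" using that
        by (simp add: sets_F)
    fix J c assume J: "finite J" "J \<subseteq> {0..T}"
    show "(\<integral>\<omega>. D \<omega> * cos (\<Sum>i\<in>J. c i * B i \<omega>) \<partial>M) = 0" using enum[OF J, of 0] by simp
    have "cos (- pi / 2 + x) = sin x" for x by (simp add: cos_add cos_diff)
    then show "(\<integral>\<omega>. D \<omega> * sin (\<Sum>i\<in>J. c i * B i \<omega>) \<partial>M) = 0" using enum[OF J, of "- pi / 2"] by simp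
  qed (auto intro: B_measurable D)
  have pos: "AE \<omega> in M. D' \<omega> \<le> 0" if m[measurable]: "D' \<in> borel_measurable F" "integrable M D'"
      and z: "\<And>S. S \<in> sets F \<Longrightarrow> (\<integral>\<omega>. D' \<omega> * indicator S \<omega> \<partial>M) = 0" for D' :: "'a \<Rightarrow> real"
  proof -
    let ?S = "{\<omega> \<in> space F. 0 < D' \<omega>}"
    have S: "?S \<in> sets F" by measurable
    then have SM: "?S \<in> sets M" using F_sub by blast
    have i: "integrable M (\<lambda>\<omega>. D' \<omega> * indicator ?S \<omega>)"
      using integrable_mult_indicator[OF SM m(2)] by (simp add: mult.commute)
    have "AE \<omega> in M. D' \<omega> * indicator ?S \<omega> = 0"
      using z[OF S] i by (subst (asm) integral_nonneg_eq_0_iff_AE) (auto simp: indicator_def)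
    moreover have "AE \<omega> in M. \<omega> \<in> space M" by simp
    ultimately show ?thesis by eventually_elim (auto simp: indicator_def split: if_splits)
  qed
  have "AE \<omega> in M. D \<omega> \<le> 0" by (rule pos[OF D(2,1) z])
  moreover have "AE \<omega> in M. - D \<omega> \<le> 0"
    by (rule pos) (use D z in auto)
  ultimately show ?thesis by eventually_elim simp
qed

end

context fbm_level
begin

lemma Creg_limit:
  obtains Y where "Y \<in> borel_measurable F" "square_integrable M Y"
      "((\<lambda>\<epsilon>. \<integral>\<omega>. (Creg \<epsilon> \<omega> - Y \<omega>)\<^sup>2 \<partial>M) \<longlongrightarrow> 0) (at_right 0)"
proof -
  obtain K where K: "K \<ge> 0" "\<And>\<epsilon> \<delta>. 0 < \<epsilon> \<Longrightarrow> \<epsilon> < \<delta> \<Longrightarrow> (\<integral>\<omega>. (Creg \<epsilon> \<omega> - Creg \<delta> \<omega>)\<^sup>2 \<partial>M) \<le> K * \<delta> powr gap_rate"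
    using Creg_cauchy by blast
  have pw: "((\<lambda>x. K * f x powr gap_rate) \<longlongrightarrow> 0) G" if "(f \<longlongrightarrow> 0) G" "\<forall>\<^sub>F x in G. 0 \<le> f x" for f :: "'c \<Rightarrow> real" and G
    using tendsto_mult[OF tendsto_const[of K] tendsto_zero_powrI[OF that(1) tendsto_const that(2) gap_rate(1)]]
        by simp
  have sym: "(\<integral>\<omega>. (Creg \<epsilon> \<omega> - Creg \<delta> \<omega>)\<^sup>2 \<partial>M) = (\<integral>\<omega>. (Creg \<delta> \<omega> - Creg \<epsilon> \<omega>)\<^sup>2 \<partial>M)" for \<epsilon> \<delta>
    by (simp add: power2_commute)
  have K2: "(\<integral>\<omega>. (Creg \<epsilon> \<omega> - Creg \<delta> \<omega>)\<^sup>2 \<partial>M) \<le> K * \<eta> powr gap_rate" if "0 < \<epsilon>" "0 < \<delta>" "\<epsilon> \<le> \<eta>" "\<delta> \<le> \<eta>" for \<epsilon> \<delta> \<eta>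
  proof -
    have m: "K * x powr gap_rate \<le> K * \<eta> powr gap_rate" if "0 < x" "x \<le> \<eta>" for x
      using that K(1) gap_rate by (intro mult_left_mono powr_mono2) auto
    consider "\<epsilon> < \<delta>" | "\<delta> < \<epsilon>" | "\<epsilon> = \<delta>" by linarith
    then show ?thesis
    proof cases
      case 1 then show ?thesis using K(2)[of \<epsilon> \<delta>] m[of \<delta>] that by simp
    next
      case 2 then show ?thesis using K(2)[of \<delta> \<epsilon>] m[of \<epsilon>] that sym[of \<epsilon> \<delta>] by simp
    next
      case 3 then show ?thesis using K(1) by simp
    qed
  qed
  have "\<exists>Y\<in>borel_measurable F. square_integrable M Y \<and> (\<lambda>n. \<integral>\<omega>. (Creg (dseq n) \<omega> - Y \<omega>)\<^sup>2 \<partial>M) \<longlonglongrightarrow> 0"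
  proof (rule L2_complete[OF F_sub space_F Creg_F_measurable Creg_square_integrable[OF dseq(1)]])
    fix r :: real assume r: "r > 0"
    have "\<forall>\<^sub>F n in sequentially. K * dseq n powr gap_rate < r"
      using order_tendstoD(2)[OF pw[OF dseq(3)] r] dseq(1) by (simp add: less_imp_le)
    then obtain n0 where n0: "K * dseq n0 powr gap_rate < r" by (auto simp: eventually_sequentially)
    have mono: "dseq n \<le> dseq n0" if "n \<ge> n0" for n unfolding dseq_def using that by (intro le_imp_inverse_le) auto
    have "(\<integral>\<omega>. (Creg (dseq m) \<omega> - Creg (dseq n) \<omega>)\<^sup>2 \<partial>M) < r" if "m \<ge> n0" "n \<ge> n0" for m n
      using K2[OF dseq(1) dseq(1) mono[OF that(1)] mono[OF that(2)]] n0 by linarith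
    then show "\<exists>n0. \<forall>m\<ge>n0. \<forall>n\<ge>n0. (\<integral>\<omega>. (Creg (dseq m) \<omega> - Creg (dseq n) \<omega>)\<^sup>2 \<partial>M) < r" by blast
  qed
  then obtain Y where Y: "Y \<in> borel_measurable F" "square_integrable M Y"
      "(\<lambda>n. \<integral>\<omega>. (Creg (dseq n) \<omega> - Y \<omega>)\<^sup>2 \<partial>M) \<longlonglongrightarrow> 0" by blast
  have est: "(\<integral>\<omega>. (Creg \<epsilon> \<omega> - Y \<omega>)\<^sup>2 \<partial>M) \<le> 2 * (K * \<epsilon> powr gap_rate)" if \<epsilon>: "\<epsilon> > 0" for \<epsilon>
  proof (rule tendsto_lowerbound)
    have "(\<lambda>n. 2 * (K * \<epsilon> powr gap_rate) + 2 * (\<integral>\<omega>. (Creg (dseq n) \<omega> - Y \<omega>)\<^sup>2 \<partial>M)) \<longlonglongrightarrow>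
        2 * (K * \<epsilon> powr gap_rate) + 2 * 0"
      by (intro tendsto_intros Y)
    then show "(\<lambda>n. 2 * (K * \<epsilon> powr gap_rate) + 2 * (\<integral>\<omega>. (Creg (dseq n) \<omega> - Y \<omega>)\<^sup>2 \<partial>M)) \<longlonglongrightarrow>
        2 * (K * \<epsilon> powr gap_rate)" by simp
    show "\<forall>\<^sub>F n in sequentially. (\<integral>\<omega>. (Creg \<epsilon> \<omega> - Y \<omega>)\<^sup>2 \<partial>M) \<le>
        2 * (K * \<epsilon> powr gap_rate) + 2 * (\<integral>\<omega>. (Creg (dseq n) \<omega> - Y \<omega>)\<^sup>2 \<partial>M)"
      using order_tendstoD(2)[OF dseq(3) \<epsilon>]
    proof eventually_elim
      case (elim n)
      have "(\<integral>\<omega>. (Creg \<epsilon> \<omega> - Y \<omega>)\<^sup>2 \<partial>M) \<le> 2 * (\<integral>\<omega>. (Creg \<epsilon> \<omega> - Creg (dseq n) \<omega>)\<^sup>2 \<partial>M) +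
          2 * (\<integral>\<omega>. (Y \<omega> - Creg (dseq n) \<omega>)\<^sup>2 \<partial>M)"
        by (rule integral_square_diff_triangle) (auto intro: Creg_square_integrable \<epsilon> dseq Y)
      also have "(\<integral>\<omega>. (Y \<omega> - Creg (dseq n) \<omega>)\<^sup>2 \<partial>M) = (\<integral>\<omega>. (Creg (dseq n) \<omega> - Y \<omega>)\<^sup>2 \<partial>M)"
          by (simp add: power2_commute)
      finally show ?case using K2[OF \<epsilon> dseq(1) order_refl, of n] elim by linarith
    qed
  qed simp
  have "((\<lambda>\<epsilon>. \<integral>\<omega>. (Creg \<epsilon> \<omega> - Y \<omega>)\<^sup>2 \<partial>M) \<longlongrightarrow> 0) (at_right 0)"
  proof (rule Lim_null_comparison)
    have "((\<lambda>\<epsilon>. 2 * (K * \<epsilon> powr gap_rate)) \<longlongrightarrow> 2 * 0) (at_right 0)"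
      by (intro tendsto_mult tendsto_const pw tendsto_ident_at) (auto simp: eventually_at_filter)
    then show "((\<lambda>\<epsilon>. 2 * (K * \<epsilon> powr gap_rate)) \<longlongrightarrow> 0) (at_right 0)" by simp
    show "\<forall>\<^sub>F \<epsilon> in at_right 0. norm (\<integral>\<omega>. (Creg \<epsilon> \<omega> - Y \<omega>)\<^sup>2 \<partial>M) \<le> 2 * (K * \<epsilon> powr gap_rate)"
      using est by (auto simp: eventually_at_filter)
  qed
  with Y show ?thesis using that by blast
qed

definition skorohod_candidate :: "('a \<Rightarrow> real) \<Rightarrow> 'a \<Rightarrow> real" where
  "skorohod_candidate Y \<omega> = log_primitive (B t \<omega> - a) - log_primitive (- a) - Y \<omega>"

lemma candidate_F_measurable: "Y \<in> borel_measurable F \<Longrightarrow> skorohod_candidate Y \<in> borel_measurable F"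
  unfolding skorohod_candidate_def[abs_def]
  by (intro borel_measurable_diff borel_measurable_const
      measurable_compose[OF borel_measurable_diff[OF B_F_measurable[OF t] borel_measurable_const]
      log_primitive_measurable])

lemma candidate_square_integrable: "square_integrable M Y \<Longrightarrow> square_integrable M (skorohod_candidate Y)"
  unfolding skorohod_candidate_def[abs_def]
  by (intro square_integrable_diff square_integrable_const log_primitive_square_integrable t)

lemma duality_steps:
  assumes Y: "square_integrable M Y" "((\<lambda>\<epsilon>. \<integral>\<omega>. (Creg \<epsilon> \<omega> - Y \<omega>)\<^sup>2 \<partial>M) \<longlongrightarrow> 0) (at_right 0)"
    and f: "Cb_infinity n f" and \<phi>: "\<And>j. j < n \<Longrightarrow> \<phi> j \<in> steps"
  shows "(\<integral>\<omega>. f (\<lambda>i. W (\<phi> i) \<omega>) * skorohod_candidate Y \<omega> \<partial>M) =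
    (\<Sum>j<n. \<integral>\<omega>. partial_deriv j f (\<lambda>i. W (\<phi> i) \<omega>) * (U \<omega> \<bullet> \<phi> j) \<partial>M)"
proof (rule LIMSEQ_unique)
  let ?G = "\<lambda>\<omega>. f (\<lambda>i. W (\<phi> i) \<omega>)" and ?D = "\<lambda>j \<omega>. partial_deriv j f (\<lambda>i. W (\<phi> i) \<omega>)"
  have Gm[measurable]: "?G \<in> borel_measurable M" by (rule smooth_measurable(1)[OF f])
  have Dm[measurable]: "?D j \<in> borel_measurable M" if "j < n" for j by (rule smooth_measurable(2)[OF f that])
  obtain K where K: "\<And>x. \<bar>f x\<bar> \<le> K" "\<And>j x. j < n \<Longrightarrow> \<bar>partial_deriv j f x\<bar> \<le> K"
    using Cb_infinity_bound[OF f] by blast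
  have K0: "K \<ge> 0" using K(1) abs_ge_zero order_trans by blast
  have "\<forall>j\<in>{..<n}. \<exists>\<rho>. slope (\<phi> j) \<rho>" using \<phi> steps_slope by (metis lessThan_iff)
  then obtain \<rho> where \<rho>: "\<And>j. j < n \<Longrightarrow> slope (\<phi> j) (\<rho> j)" by (metis lessThan_iff)
  note [measurable] = B_measurable[OF t]
  have Ym[measurable]: "Y \<in> borel_measurable M" using Y(1) by (simp add: square_integrable_def)
  define Zr where "Zr k \<omega> = reg_primitive (dseq k) (B t \<omega> - a) - reg_primitive (dseq k) (- a) - Creg (dseq k) \<omega>"
      for k \<omega>
  have Zm[measurable]: "Zr k \<in> borel_measurable M" for k unfolding Zr_def by measurable
  have sc: "square_integrable M (skorohod_candidate Y)" by (rule candidate_square_integrable[OF Y(1)])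
  then have [measurable]: "skorohod_candidate Y \<in> borel_measurable M" by (simp add: square_integrable_def)
  have CY: "square_integrable M (\<lambda>\<omega>. Creg (dseq k) \<omega> - Y \<omega>)" for k
    by (intro square_integrable_diff Creg_square_integrable dseq Y)
  have zb: "\<bar>Zr k \<omega> - skorohod_candidate Y \<omega>\<bar> \<le> 2 * dseq k + \<bar>Creg (dseq k) \<omega> - Y \<omega>\<bar>" for k \<omega>
    using reg_primitive_close[OF dseq(1), of k "B t \<omega> - a"] reg_primitive_close[OF dseq(1), of k "- a"]
    unfolding Zr_def skorohod_candidate_def by linarith
  have iCY: "integrable M (\<lambda>\<omega>. 2 * dseq k + \<bar>Creg (dseq k) \<omega> - Y \<omega>\<bar>)" for k
    using square_integrable_integrable[OF CY] by auto
  have iZ: "integrable M (\<lambda>\<omega>. Zr k \<omega> - skorohod_candidate Y \<omega>)" for k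
    by (rule Bochner_Integration.integrable_bound[OF iCY]) (auto intro!: AE_I2 order_trans[OF zb abs_ge_self])
  have iGc: "integrable M (\<lambda>\<omega>. ?G \<omega> * skorohod_candidate Y \<omega>)"
    by (intro square_integrable_integrable square_integrable_bounded_mult[OF sc Gm K(1)])
  have iGd: "integrable M (\<lambda>\<omega>. ?G \<omega> * (Zr k \<omega> - skorohod_candidate Y \<omega>))" for k
    by (rule Bochner_Integration.integrable_bound[OF integrable_mult_right[OF iZ, of K]])
      (auto simp: abs_mult intro!: AE_I2 mult_right_mono order_trans[OF K(1) abs_ge_self])
  have "(\<lambda>k. (\<integral>\<omega>. ?G \<omega> * Zr k \<omega> \<partial>M) - (\<integral>\<omega>. ?G \<omega> * skorohod_candidate Y \<omega> \<partial>M)) \<longlonglongrightarrow> 0"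
  proof (rule Lim_null_comparison)
    have "filterlim dseq (at_right 0) sequentially"
      using dseq(3) by (simp add: filterlim_at dseq(1) less_imp_neq[OF dseq(1), symmetric])
    from filterlim_compose[OF Y(2) this]
    have "(\<lambda>k. K * (2 * dseq k + sqrt (\<integral>\<omega>. (Creg (dseq k) \<omega> - Y \<omega>)\<^sup>2 \<partial>M))) \<longlonglongrightarrow> K * (2 * 0 + sqrt 0)"
      by (intro tendsto_intros dseq(3))
    then show "(\<lambda>k. K * (2 * dseq k + sqrt (\<integral>\<omega>. (Creg (dseq k) \<omega> - Y \<omega>)\<^sup>2 \<partial>M))) \<longlonglongrightarrow> 0" by simp
    have "\<bar>(\<integral>\<omega>. ?G \<omega> * Zr k \<omega> \<partial>M) - (\<integral>\<omega>. ?G \<omega> * skorohod_candidate Y \<omega> \<partial>M)\<bar> \<le>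
        K * (2 * dseq k + sqrt (\<integral>\<omega>. (Creg (dseq k) \<omega> - Y \<omega>)\<^sup>2 \<partial>M))" for k
    proof -
      have "(\<integral>\<omega>. ?G \<omega> * Zr k \<omega> \<partial>M) = (\<integral>\<omega>. ?G \<omega> * (Zr k \<omega> - skorohod_candidate Y \<omega>) +
          ?G \<omega> * skorohod_candidate Y \<omega> \<partial>M)"
        by (simp add: algebra_simps)
      then have "(\<integral>\<omega>. ?G \<omega> * Zr k \<omega> \<partial>M) - (\<integral>\<omega>. ?G \<omega> * skorohod_candidate Y \<omega> \<partial>M) =
          (\<integral>\<omega>. ?G \<omega> * (Zr k \<omega> - skorohod_candidate Y \<omega>) \<partial>M)"
        using iGd iGc by simp
      also have "\<bar>\<dots>\<bar> \<le> (\<integral>\<omega>. K * (2 * dseq k + \<bar>Creg (dseq k) \<omega> - Y \<omega>\<bar>) \<partial>M)"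
      proof (rule order_trans[OF integral_abs_bound integral_mono])
        show "integrable M (\<lambda>\<omega>. \<bar>?G \<omega> * (Zr k \<omega> - skorohod_candidate Y \<omega>)\<bar>)" using iGd by simp
        show "integrable M (\<lambda>\<omega>. K * (2 * dseq k + \<bar>Creg (dseq k) \<omega> - Y \<omega>\<bar>))" using iCY by simp
        show "\<bar>?G \<omega> * (Zr k \<omega> - skorohod_candidate Y \<omega>)\<bar> \<le> K * (2 * dseq k + \<bar>Creg (dseq k) \<omega> - Y \<omega>\<bar>)" for \<omega>
          unfolding abs_mult by (intro mult_mono K zb K0) auto
      qed
      also have "\<dots> = K * (2 * dseq k + (\<integral>\<omega>. \<bar>Creg (dseq k) \<omega> - Y \<omega>\<bar> \<partial>M))"
        using square_integrable_integrable[OF CY] by (simp add: prob_space)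
      also have "\<dots> \<le> K * (2 * dseq k + sqrt (\<integral>\<omega>. (Creg (dseq k) \<omega> - Y \<omega>)\<^sup>2 \<partial>M))"
        using L1_le_L2[OF CY] K0 by (intro mult_left_mono add_left_mono) auto
      finally show ?thesis .
    qed
    then show "\<forall>\<^sub>F k in sequentially. norm ((\<integral>\<omega>. ?G \<omega> * Zr k \<omega> \<partial>M) - (\<integral>\<omega>. ?G \<omega> * skorohod_candidate Y \<omega> \<partial>M)) \<le>
        K * (2 * dseq k + sqrt (\<integral>\<omega>. (Creg (dseq k) \<omega> - Y \<omega>)\<^sup>2 \<partial>M))"
      by (intro always_eventually) simp
  qed
  then show "(\<lambda>k. \<integral>\<omega>. ?G \<omega> * Zr k \<omega> \<partial>M) \<longlonglongrightarrow> (\<integral>\<omega>. ?G \<omega> * skorohod_candidate Y \<omega> \<partial>M)" by (rule LIM_zero_cancel)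
  have eq: "(\<integral>\<omega>. ?G \<omega> * Zr k \<omega> \<partial>M) = (\<Sum>j<n. \<integral>\<omega>. ?D j \<omega> * (Ureg (dseq k) \<omega> \<bullet> \<phi> j) \<partial>M)" for k
  proof -
    have "(\<integral>\<omega>. ?G \<omega> * Zr k \<omega> \<partial>M) = (\<Sum>j<n. \<integral>\<omega>. ?D j \<omega> *
        (\<integral>s. indicator {0..t} s * (\<rho> j s * reg_log (dseq k) (X s \<omega>)) \<partial>lborel) \<partial>M)"
      unfolding Zr_def Creg_def by (rule ito_regularised[OF f \<rho> \<phi> dseq(1) t])
    also have "\<dots> = (\<Sum>j<n. \<integral>\<omega>. ?D j \<omega> * (Ureg (dseq k) \<omega> \<bullet> \<phi> j) \<partial>M)"
    proof (intro sum.cong refl Bochner_Integration.integral_cong)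
      fix j \<omega> assume j: "j \<in> {..<n}" and \<omega>: "\<omega> \<in> space M"
      have "Ureg (dseq k) \<omega> \<bullet> \<phi> j = (\<integral>s. indicator {0..t} s * (reg_log (dseq k) (B s \<omega> - a) * \<rho> j s) \<partial>lborel)"
        unfolding Ureg_def using j by (intro wiener_elem_slope[OF t reg_log_path_continuous[OF \<omega> dseq(1)] \<rho>]) auto
      also have "\<dots> = (\<integral>s. indicator {0..t} s * (\<rho> j s * reg_log (dseq k) (X s \<omega>)) \<partial>lborel)"
        by (intro Bochner_Integration.integral_cong) (auto simp: indicator_def clip_eq)
      finally show "?D j \<omega> * (\<integral>s. indicator {0..t} s * (\<rho> j s * reg_log (dseq k) (X s \<omega>)) \<partial>lborel) =
          ?D j \<omega> * (Ureg (dseq k) \<omega> \<bullet> \<phi> j)" by simp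
    qed
    finally show ?thesis .
  qed
  have sU: "square_integrable M (\<lambda>\<omega>. norm (U \<omega>))" using U_norm_integrable by (simp add: square_integrable_def)
  show "(\<lambda>k. \<integral>\<omega>. ?G \<omega> * Zr k \<omega> \<partial>M) \<longlonglongrightarrow> (\<Sum>j<n. \<integral>\<omega>. ?D j \<omega> * (U \<omega> \<bullet> \<phi> j) \<partial>M)"
    unfolding eq
  proof (intro tendsto_sum)
    fix j assume "j \<in> {..<n}"
    then have j: "j < n" by simp
    note [measurable] = Dm[OF j]
    have iU: "integrable M (\<lambda>\<omega>. ?D j \<omega> * (U \<omega> \<bullet> \<phi> j))"
    proof (rule Bochner_Integration.integrable_bound)
      show "integrable M (\<lambda>\<omega>. K * (norm (U \<omega>) * norm (\<phi> j)))" using square_integrable_integrable[OF sU] by simp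
      show "AE \<omega> in M. norm (?D j \<omega> * (U \<omega> \<bullet> \<phi> j)) \<le> norm (K * (norm (U \<omega>) * norm (\<phi> j)))"
        using K0 by (auto simp: abs_mult intro!: AE_I2 mult_mono K j Cauchy_Schwarz_ineq2)
    qed measurable
    have iUd: "integrable M (\<lambda>\<omega>. ?D j \<omega> * ((Ureg (dseq k) \<omega> - U \<omega>) \<bullet> \<phi> j))" for k
    proof (rule Bochner_Integration.integrable_bound)
      show "integrable M (\<lambda>\<omega>. K * (norm (Ureg (dseq k) \<omega> - U \<omega>) * norm (\<phi> j)))"
        using square_integrable_integrable[OF Ureg_U_square_integrable(1)[OF dseq(1,2)]] by simp
      show "AE \<omega> in M. norm (?D j \<omega> * ((Ureg (dseq k) \<omega> - U \<omega>) \<bullet> \<phi> j)) \<le>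
          norm (K * (norm (Ureg (dseq k) \<omega> - U \<omega>) * norm (\<phi> j)))"
        using K0 by (auto simp: abs_mult intro!: AE_I2 mult_mono K j Cauchy_Schwarz_ineq2)
    qed measurable
    have "(\<lambda>k. (\<integral>\<omega>. ?D j \<omega> * (Ureg (dseq k) \<omega> \<bullet> \<phi> j) \<partial>M) - (\<integral>\<omega>. ?D j \<omega> * (U \<omega> \<bullet> \<phi> j) \<partial>M)) \<longlonglongrightarrow> 0"
    proof (rule Lim_null_comparison)
      have "(\<lambda>k. K * norm (\<phi> j) * sqrt (CH * (2 * (\<integral>\<omega>. log_error (dseq k) \<omega> \<partial>M)))) \<longlonglongrightarrow>
          K * norm (\<phi> j) * sqrt (CH * (2 * 0))"
        by (intro tendsto_intros log_error_mean_tendsto)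
      then show "(\<lambda>k. K * norm (\<phi> j) * sqrt (CH * (2 * (\<integral>\<omega>. log_error (dseq k) \<omega> \<partial>M)))) \<longlonglongrightarrow> 0" by simp
      have "\<bar>(\<integral>\<omega>. ?D j \<omega> * (Ureg (dseq k) \<omega> \<bullet> \<phi> j) \<partial>M) - (\<integral>\<omega>. ?D j \<omega> * (U \<omega> \<bullet> \<phi> j) \<partial>M)\<bar> \<le>
          K * norm (\<phi> j) * sqrt (CH * (2 * (\<integral>\<omega>. log_error (dseq k) \<omega> \<partial>M)))" for k
      proof -
        note sq = Ureg_U_square_integrable[OF dseq(1,2), of k]
        have "(\<integral>\<omega>. ?D j \<omega> * (Ureg (dseq k) \<omega> \<bullet> \<phi> j) \<partial>M) =
            (\<integral>\<omega>. ?D j \<omega> * ((Ureg (dseq k) \<omega> - U \<omega>) \<bullet> \<phi> j) + ?D j \<omega> * (U \<omega> \<bullet> \<phi> j) \<partial>M)"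
          by (intro Bochner_Integration.integral_cong) (auto simp: inner_diff_left algebra_simps)
        then have "(\<integral>\<omega>. ?D j \<omega> * (Ureg (dseq k) \<omega> \<bullet> \<phi> j) \<partial>M) - (\<integral>\<omega>. ?D j \<omega> * (U \<omega> \<bullet> \<phi> j) \<partial>M) =
            (\<integral>\<omega>. ?D j \<omega> * ((Ureg (dseq k) \<omega> - U \<omega>) \<bullet> \<phi> j) \<partial>M)"
          using iU iUd by simp
        moreover have "\<bar>\<integral>\<omega>. ?D j \<omega> * ((Ureg (dseq k) \<omega> - U \<omega>) \<bullet> \<phi> j) \<partial>M\<bar> \<le>
            (\<integral>\<omega>. K * norm (\<phi> j) * norm (Ureg (dseq k) \<omega> - U \<omega>) \<partial>M)"
        proof (rule order_trans[OF integral_abs_bound integral_mono])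
          show "integrable M (\<lambda>\<omega>. \<bar>?D j \<omega> * ((Ureg (dseq k) \<omega> - U \<omega>) \<bullet> \<phi> j)\<bar>)" using iUd by simp
          show "integrable M (\<lambda>\<omega>. K * norm (\<phi> j) * norm (Ureg (dseq k) \<omega> - U \<omega>))"
            using square_integrable_integrable[OF sq(1)] by simp
          fix \<omega>
          have "\<bar>?D j \<omega>\<bar> * \<bar>(Ureg (dseq k) \<omega> - U \<omega>) \<bullet> \<phi> j\<bar> \<le> K * (norm (Ureg (dseq k) \<omega> - U \<omega>) * norm (\<phi> j))"
            using K0 by (intro mult_mono K j Cauchy_Schwarz_ineq2) auto
          then show "\<bar>?D j \<omega> * ((Ureg (dseq k) \<omega> - U \<omega>) \<bullet> \<phi> j)\<bar> \<le> K * norm (\<phi> j) * norm (Ureg (dseq k) \<omega> - U \<omega>)"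
            by (simp add: abs_mult mult_ac)
        qed
        moreover have "(\<integral>\<omega>. K * norm (\<phi> j) * norm (Ureg (dseq k) \<omega> - U \<omega>) \<partial>M) =
            K * norm (\<phi> j) * (\<integral>\<omega>. norm (Ureg (dseq k) \<omega> - U \<omega>) \<partial>M)" by simp
        moreover have "K * norm (\<phi> j) * (\<integral>\<omega>. norm (Ureg (dseq k) \<omega> - U \<omega>) \<partial>M) \<le>
            K * norm (\<phi> j) * sqrt (CH * (2 * (\<integral>\<omega>. log_error (dseq k) \<omega> \<partial>M)))"
        proof (rule mult_left_mono)
          have "(\<integral>\<omega>. norm (Ureg (dseq k) \<omega> - U \<omega>) \<partial>M) \<le> sqrt (\<integral>\<omega>. (norm (Ureg (dseq k) \<omega> - U \<omega>))\<^sup>2 \<partial>M)"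
            using L1_le_L2[OF sq(1)] by simp
          moreover have "sqrt (\<integral>\<omega>. (norm (Ureg (dseq k) \<omega> - U \<omega>))\<^sup>2 \<partial>M) \<le>
              sqrt (CH * (2 * (\<integral>\<omega>. log_error (dseq k) \<omega> \<partial>M)))"
            using sq(2) by (rule real_sqrt_le_mono)
          ultimately show "(\<integral>\<omega>. norm (Ureg (dseq k) \<omega> - U \<omega>) \<partial>M) \<le>
              sqrt (CH * (2 * (\<integral>\<omega>. log_error (dseq k) \<omega> \<partial>M)))" by (rule order_trans)
          show "0 \<le> K * norm (\<phi> j)" using K0 by simp
        qed
        ultimately show ?thesis by (simp only:)
      qed
      then show "\<forall>\<^sub>F k in sequentially. norm
          ((\<integral>\<omega>. ?D j \<omega> * (Ureg (dseq k) \<omega> \<bullet> \<phi> j) \<partial>M) - (\<integral>\<omega>. ?D j \<omega> * (U \<omega> \<bullet> \<phi> j) \<partial>M)) \<le> K * norm (\<phi> j) * sqrt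
          (CH * (2 * (\<integral>\<omega>. log_error (dseq k) \<omega> \<partial>M)))"
        by (intro always_eventually) simp
    qed
    then show "(\<lambda>k. \<integral>\<omega>. ?D j \<omega> * (Ureg (dseq k) \<omega> \<bullet> \<phi> j) \<partial>M) \<longlonglongrightarrow> (\<integral>\<omega>. ?D j \<omega> * (U \<omega> \<bullet> \<phi> j) \<partial>M)"
      by (rule LIM_zero_cancel)
  qed
qed

lemma duality:
  assumes Y: "square_integrable M Y" "((\<lambda>\<epsilon>. \<integral>\<omega>. (Creg \<epsilon> \<omega> - Y \<omega>)\<^sup>2 \<partial>M) \<longlongrightarrow> 0) (at_right 0)"
    and f: "Cb_infinity n f"
  shows "(\<integral>\<omega>. smooth_functional W f \<phi> \<omega> * skorohod_candidate Y \<omega> \<partial>M) =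
    (\<integral>\<omega>. malliavin_derivative W n f \<phi> \<omega> \<bullet> U \<omega> \<partial>M)"
proof -
  obtain K where K: "\<And>x. \<bar>f x\<bar> \<le> K" "\<And>j x. j < n \<Longrightarrow> \<bar>partial_deriv j f x\<bar> \<le> K"
    using Cb_infinity_bound[OF f] by blast
  have K0: "K \<ge> 0" using K(1) abs_ge_zero order_trans by blast
  have sc: "square_integrable M (skorohod_candidate Y)" by (rule candidate_square_integrable[OF Y(1)])
  then have [measurable]: "skorohod_candidate Y \<in> borel_measurable M" by (simp add: square_integrable_def)
  have sU: "square_integrable M (\<lambda>\<omega>. norm (U \<omega>))" using U_norm_integrable by (simp add: square_integrable_def)
  have "\<forall>k i. \<exists>y. y \<in> steps \<and> norm (y - \<phi> i) < (1/2)^k" using steps_dense[of "(1/2)^_"]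
      by (meson zero_less_power half_gt_zero zero_less_one)
  then obtain y where y: "\<And>k i. y k i \<in> steps" "\<And>k i. norm (y k i - \<phi> i) < (1/2)^k" by metis
  define \<psi> where "\<psi> k i = (if i < n then y k i else \<phi> i)" for k i
  have \<psi>: "\<psi> k j \<in> steps" if "j < n" for k j using y that by (simp add: \<psi>_def)
  have \<psi>n: "norm (\<psi> k i - \<phi> i) \<le> (1/2)^k" for k i using y(2)[of k i] by (auto simp: \<psi>_def)
  have \<psi>lim: "(\<lambda>k. \<psi> k i) \<longlonglongrightarrow> \<phi> i" for i
  proof (rule LIM_zero_cancel, rule Lim_null_comparison)
    show "\<forall>\<^sub>F k in sequentially. norm (\<psi> k i - \<phi> i) \<le> (1/2)^k" using \<psi>n by simp
    show "(\<lambda>k. (1/2::real)^k) \<longlonglongrightarrow> 0" by (rule LIMSEQ_power_zero) simp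
  qed
  have Wlim: "AE \<omega> in M. \<forall>i. (\<lambda>k. W (\<psi> k i) \<omega>) \<longlonglongrightarrow> W (\<phi> i) \<omega>"
  proof (subst AE_all_countable, intro allI)
    fix i
    have "AE \<omega> in M. summable (\<lambda>k. \<bar>W (\<psi> k i - \<phi> i) \<omega>\<bar>)"
    proof (rule AE_tendsto_of_summable_L1)
      fix k
      show "integrable M (W (\<psi> k i - \<phi> i))" by (rule square_integrable_integrable[OF W_square_integrable])
      have "(\<integral>\<omega>. \<bar>W (\<psi> k i - \<phi> i) \<omega>\<bar> \<partial>M) \<le> sqrt ((norm (\<psi> k i - \<phi> i))\<^sup>2)"
        using L1_le_L2[OF W_square_integrable, of "\<psi> k i - \<phi> i"] by (simp only: W_norm)
      then show "(\<integral>\<omega>. \<bar>W (\<psi> k i - \<phi> i) \<omega>\<bar> \<partial>M) \<le> (1/2)^k" using \<psi>n[of k i] by simp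
    qed
    moreover have "AE \<omega> in M. \<forall>k. W (\<psi> k i - \<phi> i) \<omega> = W (\<psi> k i) \<omega> - W (\<phi> i) \<omega>"
      by (subst AE_all_countable, intro allI) (use W_linear[of 1 _ "-1" "\<phi> i"] in simp)
    ultimately show "AE \<omega> in M. (\<lambda>k. W (\<psi> k i) \<omega>) \<longlonglongrightarrow> W (\<phi> i) \<omega>"
    proof eventually_elim
      case (elim \<omega>)
      have "(\<lambda>k. \<bar>W (\<psi> k i - \<phi> i) \<omega>\<bar>) \<longlonglongrightarrow> 0" using elim(1) by (rule summable_LIMSEQ_zero)
      then have "(\<lambda>k. W (\<psi> k i) \<omega> - W (\<phi> i) \<omega>) \<longlonglongrightarrow> 0" using elim(2) by (simp add: tendsto_rabs_zero_iff)
      then show ?case by (rule LIM_zero_cancel)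
    qed
  qed
  have flim: "AE \<omega> in M. (\<lambda>k. f (\<lambda>i. W (\<psi> k i) \<omega>)) \<longlonglongrightarrow> f (\<lambda>i. W (\<phi> i) \<omega>)"
    using Wlim by eventually_elim (intro continuous_fun_tendsto[OF Cb_infinity_D(1)[OF f]], blast)
  have dlim: "AE \<omega> in M. (\<lambda>k. partial_deriv j f (\<lambda>i. W (\<psi> k i) \<omega>)) \<longlonglongrightarrow> partial_deriv j f (\<lambda>i. W (\<phi> i) \<omega>)" if "j < n"
      for j
    using Wlim by eventually_elim (intro continuous_fun_tendsto[OF Cb_infinity_D(4)[OF f that]], blast)
  have L: "(\<lambda>k. \<integral>\<omega>. f (\<lambda>i. W (\<psi> k i) \<omega>) * skorohod_candidate Y \<omega> \<partial>M) \<longlonglongrightarrow>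
      (\<integral>\<omega>. f (\<lambda>i. W (\<phi> i) \<omega>) * skorohod_candidate Y \<omega> \<partial>M)"
  proof (rule integral_dominated_convergence[where w="\<lambda>\<omega>. K * \<bar>skorohod_candidate Y \<omega>\<bar>"])
    show "integrable M (\<lambda>\<omega>. K * \<bar>skorohod_candidate Y \<omega>\<bar>)" using square_integrable_integrable[OF sc] by simp
    show "AE \<omega> in M. (\<lambda>k. f (\<lambda>i. W (\<psi> k i) \<omega>) * skorohod_candidate Y \<omega>) \<longlonglongrightarrow>
        f (\<lambda>i. W (\<phi> i) \<omega>) * skorohod_candidate Y \<omega>"
      using flim by eventually_elim (intro tendsto_intros)
    show "AE \<omega> in M. norm (f (\<lambda>i. W (\<psi> k i) \<omega>) * skorohod_candidate Y \<omega>) \<le> K * \<bar>skorohod_candidate Y \<omega>\<bar>" for k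
      by (auto simp: abs_mult intro!: AE_I2 mult_right_mono K)
  qed (use smooth_measurable(1)[OF f] in \<open>auto intro!: borel_measurable_times\<close>)
  have iD: "integrable M (\<lambda>\<omega>. partial_deriv j f (\<lambda>i. W (h i) \<omega>) * (U \<omega> \<bullet> x))" if "j < n" for j and x
      and h :: "nat \<Rightarrow> 'h"
  proof (rule Bochner_Integration.integrable_bound)
    show "integrable M (\<lambda>\<omega>. K * (norm (U \<omega>) * norm x))" using square_integrable_integrable[OF sU] by simp
    show "AE \<omega> in M. norm (partial_deriv j f (\<lambda>i. W (h i) \<omega>) * (U \<omega> \<bullet> x)) \<le> norm (K * (norm (U \<omega>) * norm x))"
      using K0 by (auto simp: abs_mult intro!: AE_I2 mult_mono K that Cauchy_Schwarz_ineq2)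
  qed (use smooth_measurable(2)[OF f that] in \<open>auto intro!: borel_measurable_times\<close>)
  have step: "(\<integral>\<omega>. f (\<lambda>i. W (\<psi> k i) \<omega>) * skorohod_candidate Y \<omega> \<partial>M) =
      (\<Sum>j<n. \<integral>\<omega>. partial_deriv j f (\<lambda>i. W (\<psi> k i) \<omega>) * (U \<omega> \<bullet> \<psi> k j) \<partial>M)" for k
    by (rule duality_steps[OF Y f \<psi>])
  have R: "(\<lambda>k. \<Sum>j<n. \<integral>\<omega>. partial_deriv j f (\<lambda>i. W (\<psi> k i) \<omega>) * (U \<omega> \<bullet> \<psi> k j) \<partial>M) \<longlonglongrightarrow>
      (\<Sum>j<n. \<integral>\<omega>. partial_deriv j f (\<lambda>i. W (\<phi> i) \<omega>) * (U \<omega> \<bullet> \<phi> j) \<partial>M)"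
  proof (intro tendsto_sum)
    fix j assume "j \<in> {..<n}"
    then have j: "j < n" by simp
    show "(\<lambda>k. \<integral>\<omega>. partial_deriv j f (\<lambda>i. W (\<psi> k i) \<omega>) * (U \<omega> \<bullet> \<psi> k j) \<partial>M) \<longlonglongrightarrow>
        (\<integral>\<omega>. partial_deriv j f (\<lambda>i. W (\<phi> i) \<omega>) * (U \<omega> \<bullet> \<phi> j) \<partial>M)"
    proof (rule integral_dominated_convergence[where w="\<lambda>\<omega>. K * (norm (U \<omega>) * (norm (\<phi> j) + 1))"])
      show "integrable M (\<lambda>\<omega>. K * (norm (U \<omega>) * (norm (\<phi> j) + 1)))" using square_integrable_integrable[OF sU]
          by simp
      show "AE \<omega> in M. (\<lambda>k. partial_deriv j f (\<lambda>i. W (\<psi> k i) \<omega>) * (U \<omega> \<bullet> \<psi> k j)) \<longlonglongrightarrow>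
          partial_deriv j f (\<lambda>i. W (\<phi> i) \<omega>) * (U \<omega> \<bullet> \<phi> j)"
        using dlim[OF j] by eventually_elim (intro tendsto_intros \<psi>lim)
      show "AE \<omega> in M. norm (partial_deriv j f (\<lambda>i. W (\<psi> k i) \<omega>) * (U \<omega> \<bullet> \<psi> k j)) \<le>
          K * (norm (U \<omega>) * (norm (\<phi> j) + 1))" for k
      proof (rule AE_I2)
        fix \<omega>
        have "norm (\<psi> k j) \<le> norm (\<phi> j) + norm (\<psi> k j - \<phi> j)"
            by (metis add.commute diff_add_cancel norm_triangle_ineq)
        also have "\<dots> \<le> norm (\<phi> j) + 1" using \<psi>n[of k j] power_le_one[of "1/2::real" k] by simp
        finally have "\<bar>U \<omega> \<bullet> \<psi> k j\<bar> \<le> norm (U \<omega>) * (norm (\<phi> j) + 1)"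
          by (intro order_trans[OF Cauchy_Schwarz_ineq2] mult_left_mono) auto
        then show "norm (partial_deriv j f (\<lambda>i. W (\<psi> k i) \<omega>) * (U \<omega> \<bullet> \<psi> k j)) \<le>
            K * (norm (U \<omega>) * (norm (\<phi> j) + 1))"
          using K0 by (auto simp: abs_mult intro!: mult_mono K j)
      qed
    qed (use iD[OF j] in \<open>auto dest: borel_measurable_integrable\<close>)
  qed
  have "(\<integral>\<omega>. f (\<lambda>i. W (\<phi> i) \<omega>) * skorohod_candidate Y \<omega> \<partial>M) =
      (\<Sum>j<n. \<integral>\<omega>. partial_deriv j f (\<lambda>i. W (\<phi> i) \<omega>) * (U \<omega> \<bullet> \<phi> j) \<partial>M)"
    using LIMSEQ_unique[OF L[unfolded step] R] by simp
  also have "\<dots> = (\<integral>\<omega>. (\<Sum>j<n. partial_deriv j f (\<lambda>i. W (\<phi> i) \<omega>) * (U \<omega> \<bullet> \<phi> j)) \<partial>M)"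
    by (rule Bochner_Integration.integral_sum[symmetric]) (use iD in auto)
  also have "\<dots> = (\<integral>\<omega>. malliavin_derivative W n f \<phi> \<omega> \<bullet> U \<omega> \<partial>M)"
    unfolding malliavin_derivative_def inner_sum_left inner_scaleR_left by (simp only: inner_commute)
  finally show ?thesis by (simp add: smooth_functional_def)
qed

lemma candidate_has_divergence:
  assumes Y: "Y \<in> borel_measurable F" "square_integrable M Y" "((\<lambda>\<epsilon>. \<integral>\<omega>. (Creg \<epsilon> \<omega> - Y \<omega>)\<^sup>2 \<partial>M) \<longlongrightarrow> 0) (at_right 0)"
  shows "has_divergence M T B W U (skorohod_candidate Y)"
proof -
  note sc = candidate_square_integrable[OF Y(2)] and dual = duality[OF Y(2,3)]
  have "\<bar>\<integral>\<omega>. malliavin_derivative W n f \<phi> \<omega> \<bullet> U \<omega> \<partial>M\<bar> \<le>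
      sqrt (\<integral>\<omega>. (skorohod_candidate Y \<omega>)\<^sup>2 \<partial>M) * sqrt (\<integral>\<omega>. (smooth_functional W f \<phi> \<omega>)\<^sup>2 \<partial>M)"
    if f: "Cb_infinity n f" for n f \<phi>
  proof -
    obtain K where K: "\<And>x. \<bar>f x\<bar> \<le> K" "\<And>j x. j < n \<Longrightarrow> \<bar>partial_deriv j f x\<bar> \<le> K"
      using Cb_infinity_bound[OF f] by blast
    have "square_integrable M (smooth_functional W f \<phi>)"
      unfolding smooth_functional_def[abs_def]
          by (rule square_integrable_bounded[OF smooth_measurable(1)[OF f] K(1)])
    from L2_Cauchy_Schwarz[OF this sc] show ?thesis unfolding dual[OF f] by (simp add: mult.commute)
  qed
  then show ?thesis
    unfolding has_divergence_def div_domain_def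
    using U_F_measurable U_norm_integrable candidate_F_measurable[OF Y(1)] sc dual by blast
qed

lemma candidate_skorohod:
  assumes Y: "Y \<in> borel_measurable F" "square_integrable M Y" "((\<lambda>\<epsilon>. \<integral>\<omega>. (Creg \<epsilon> \<omega> - Y \<omega>)\<^sup>2 \<partial>M) \<longlongrightarrow> 0) (at_right 0)"
  shows "has_skorohod_integral M H T B e W (\<lambda>s \<omega>. ln \<bar>B s \<omega> - a\<bar>) t (skorohod_candidate Y)"
  unfolding has_skorohod_integral_def
proof (intro exI conjI)
  show "AE \<omega> in M. represents H T e (\<lambda>s. ln \<bar>B s \<omega> - a\<bar> * indicator {0..t} s) (U \<omega>)"
    using AE_good by eventually_elim (rule U_represents)
  show "has_divergence M T B W U (skorohod_candidate Y)" by (rule candidate_has_divergence[OF Y])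
qed

lemma skorohod_unique:
  assumes Y: "Y \<in> borel_measurable F" "square_integrable M Y" "((\<lambda>\<epsilon>. \<integral>\<omega>. (Creg \<epsilon> \<omega> - Y \<omega>)\<^sup>2 \<partial>M) \<longlongrightarrow> 0) (at_right 0)"
    and Z: "has_skorohod_integral M H T B e W (\<lambda>s \<omega>. ln \<bar>B s \<omega> - a\<bar>) t Z"
  shows "AE \<omega> in M. Z \<omega> = skorohod_candidate Y \<omega>"
proof -
  obtain V where V: "AE \<omega> in M. represents H T e (\<lambda>s. ln \<bar>B s \<omega> - a\<bar> * indicator {0..t} s) (V \<omega>)"
      "has_divergence M T B W V Z"
    using Z by (auto simp: has_skorohod_integral_def)
  have VU: "AE \<omega> in M. V \<omega> = U \<omega>"
    using V(1) AE_good by eventually_elim (rule represents_unique[OF _ U_represents])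
  have VF: "V \<in> borel_measurable F" and ZF: "Z \<in> borel_measurable F" and Zs: "square_integrable M Z"
    and Zd: "\<And>n f \<phi>. Cb_infinity n f \<Longrightarrow> (\<integral>\<omega>. smooth_functional W f \<phi> \<omega> * Z \<omega> \<partial>M) =
        (\<integral>\<omega>. malliavin_derivative W n f \<phi> \<omega> \<bullet> V \<omega> \<partial>M)"
    using V(2) by (auto simp: has_divergence_def div_domain_def)
  have [measurable]: "V \<in> borel_measurable M" by (rule F_measurable_imp[OF VF])
  let ?C = "skorohod_candidate Y"
  note sc = candidate_square_integrable[OF Y(2)]
  have same: "(\<integral>\<omega>. smooth_functional W f \<phi> \<omega> * (Z \<omega> - ?C \<omega>) \<partial>M) = 0" if f: "Cb_infinity n f" for n f \<phi>
  proof -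
    obtain K where K: "\<And>x. \<bar>f x\<bar> \<le> K" "\<And>j x. j < n \<Longrightarrow> \<bar>partial_deriv j f x\<bar> \<le> K"
      using Cb_infinity_bound[OF f] by blast
    have sm: "smooth_functional W f \<phi> \<in> borel_measurable M" unfolding smooth_functional_def[abs_def]
        by (rule smooth_measurable(1)[OF f])
    have sb: "\<bar>smooth_functional W f \<phi> \<omega>\<bar> \<le> K" for \<omega> by (simp add: smooth_functional_def K(1))
    have i: "integrable M (\<lambda>\<omega>. smooth_functional W f \<phi> \<omega> * Q \<omega>)" if "square_integrable M Q" for Q
      by (intro square_integrable_integrable square_integrable_bounded_mult[OF that sm sb])
    have mm: "malliavin_derivative W n f \<phi> \<in> borel_measurable M"
      unfolding malliavin_derivative_def[abs_def] using smooth_measurable(2)[OF f]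
          by (intro borel_measurable_sum borel_measurable_scaleR) auto
    have "(\<integral>\<omega>. malliavin_derivative W n f \<phi> \<omega> \<bullet> V \<omega> \<partial>M) = (\<integral>\<omega>. malliavin_derivative W n f \<phi> \<omega> \<bullet> U \<omega> \<partial>M)"
      using VU mm by (intro integral_cong_AE borel_measurable_inner) (auto elim: eventually_mono)
    then have "(\<integral>\<omega>. smooth_functional W f \<phi> \<omega> * Z \<omega> \<partial>M) = (\<integral>\<omega>. smooth_functional W f \<phi> \<omega> * ?C \<omega> \<partial>M)"
      using Zd[OF f] duality[OF Y(2,3) f] by simp
    then show ?thesis using i[OF Zs] i[OF sc] by (simp add: right_diff_distrib)
  qed
  have dm: "(\<lambda>\<omega>. Z \<omega> - ?C \<omega>) \<in> borel_measurable F"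
    using ZF candidate_F_measurable[OF Y(1)] by (rule borel_measurable_diff)
  have [measurable]: "Z \<in> borel_measurable M" "?C \<in> borel_measurable M" using Zs sc
      by (auto simp: square_integrable_def)
  have "AE \<omega> in M. Z \<omega> - ?C \<omega> = 0"
  proof (rule F_density_unique[OF _ dm])
    show "integrable M (\<lambda>\<omega>. Z \<omega> - ?C \<omega>)" by (intro square_integrable_integrable square_integrable_diff Zs sc)
    fix n \<theta> and c r :: "nat \<Rightarrow> real" assume r: "\<And>i. i < n \<Longrightarrow> r i \<in> {0..T}"
    have rm: "B (r i) \<in> borel_measurable M" if "i < n" for i by (rule B_measurable[OF r[OF that]])
    let ?f = "\<lambda>x. 1 * cos (\<theta> + (\<Sum>i<n. c i * x i))"
    have "AE \<omega> in M. \<forall>i\<in>{..<n}. W (e (r i)) \<omega> = B (r i) \<omega>"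
      using r by (intro AE_finite_allI W_e) auto
    then have "(\<integral>\<omega>. (Z \<omega> - ?C \<omega>) * cos (\<theta> + (\<Sum>i<n. c i * B (r i) \<omega>)) \<partial>M) =
        (\<integral>\<omega>. smooth_functional W ?f (\<lambda>i. e (r i)) \<omega> * (Z \<omega> - ?C \<omega>) \<partial>M)"
    proof (intro integral_cong_AE)
      assume "AE \<omega> in M. \<forall>i\<in>{..<n}. W (e (r i)) \<omega> = B (r i) \<omega>"
      then show "AE \<omega> in M. (Z \<omega> - ?C \<omega>) * cos (\<theta> + (\<Sum>i<n. c i * B (r i) \<omega>)) =
          smooth_functional W ?f (\<lambda>i. e (r i)) \<omega> * (Z \<omega> - ?C \<omega>)"
        by eventually_elim (simp add: smooth_functional_def mult.commute)
      have "(\<lambda>\<omega>. \<Sum>i<n. c i * B (r i) \<omega>) \<in> borel_measurable M" using rm by (intro borel_measurable_sum) auto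
      then show "(\<lambda>\<omega>. (Z \<omega> - ?C \<omega>) * cos (\<theta> + (\<Sum>i<n. c i * B (r i) \<omega>))) \<in> borel_measurable M" by measurable
      show "(\<lambda>\<omega>. smooth_functional W ?f (\<lambda>i. e (r i)) \<omega> * (Z \<omega> - ?C \<omega>)) \<in> borel_measurable M"
        unfolding smooth_functional_def by measurable
    qed
    also have "\<dots> = 0" by (rule same[OF Cb_infinity_cos])
    finally show "(\<integral>\<omega>. (Z \<omega> - ?C \<omega>) * cos (\<theta> + (\<Sum>i<n. c i * B (r i) \<omega>)) \<partial>M) = 0" .
  qed
  then show ?thesis by eventually_elim simp
qed

lemma truncated_integral_eq:
  "(LINT s:{0..t}|lborel. indicator {x. \<bar>x - a\<bar> \<ge> \<epsilon>} (B s \<omega>) * (2 * H * s powr (2*H - 1) / (B s \<omega> - a))) =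
      2 * Creg \<epsilon> \<omega>"
proof -
  have "(LINT s:{0..t}|lborel. indicator {x. \<bar>x - a\<bar> \<ge> \<epsilon>} (B s \<omega>) * (2 * H * s powr (2*H - 1) / (B s \<omega> - a)))
    = (\<integral>s. 2 * (indicator {0..t} s * (H * s powr (2*H-1) * reg_inv \<epsilon> (X s \<omega>))) \<partial>lborel)"
    unfolding set_lebesgue_integral_def
    by (intro Bochner_Integration.integral_cong) (auto simp: indicator_def reg_inv_def clip_eq)
  then show ?thesis by (simp add: Creg_def)
qed

lemma truncated_integral_tendsto:
  "skorohod_integrable M H T B e W (\<lambda>s \<omega>. ln \<bar>B s \<omega> - a\<bar>) t \<and>
    L2_tendsto M
      (\<lambda>\<epsilon> \<omega>. LINT s:{0..t}|lborel.
         indicator {x. \<bar>x - a\<bar> \<ge> \<epsilon>} (B s \<omega>) * (2 * H * s powr (2*H - 1) / (B s \<omega> - a)))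
      (C_process M H T B e W t a) (at_right 0)"
proof -
  obtain Y where Y: "Y \<in> borel_measurable F" "square_integrable M Y"
      "((\<lambda>\<epsilon>. \<integral>\<omega>. (Creg \<epsilon> \<omega> - Y \<omega>)\<^sup>2 \<partial>M) \<longlongrightarrow> 0) (at_right 0)"
    using Creg_limit by blast
  note cs = candidate_skorohod[OF Y]
  define Z where "Z = skorohod_integral M H T B e W (\<lambda>s \<omega>. ln \<bar>B s \<omega> - a\<bar>) t"
  have Z: "has_skorohod_integral M H T B e W (\<lambda>s \<omega>. ln \<bar>B s \<omega> - a\<bar>) t Z"
    unfolding Z_def skorohod_integral_def
        by (rule someI[of "has_skorohod_integral M H T B e W (\<lambda>s \<omega>. ln \<bar>B s \<omega> - a\<bar>) t", OF cs])
  have Zm[measurable]: "Z \<in> borel_measurable M"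
    using Z by (auto simp: has_skorohod_integral_def has_divergence_def square_integrable_def)
  note [measurable] = B_measurable[OF t]
  have [measurable]: "Y \<in> borel_measurable M" using Y by (simp add: square_integrable_def)
  let ?C = "C_process M H T B e W t a"
  have Cm[measurable]: "?C \<in> borel_measurable M"
    unfolding C_process_def[abs_def] Z_def[symmetric] by measurable
  have ae: "AE \<omega> in M. 2 * Y \<omega> = ?C \<omega>"
    using skorohod_unique[OF Y Z] by eventually_elim
        (simp add: C_process_def Z_def[symmetric] skorohod_candidate_def)
  have sC: "square_integrable M ?C"
    by (rule square_integrable_AE_cong[OF square_integrable_cmult[OF Y(2)] Cm ae])
  have "\<forall>\<^sub>F \<epsilon> in at_right 0. square_integrable M (\<lambda>\<omega>. 2 * Creg \<epsilon> \<omega>)"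
    unfolding eventually_at_filter by (intro always_eventually)
        (auto intro: square_integrable_cmult Creg_square_integrable)
  moreover have "(\<integral>\<omega>. (2 * Creg \<epsilon> \<omega> - ?C \<omega>)\<^sup>2 \<partial>M) = 4 * (\<integral>\<omega>. (Creg \<epsilon> \<omega> - Y \<omega>)\<^sup>2 \<partial>M)" for \<epsilon>
  proof -
    have "(\<integral>\<omega>. (2 * Creg \<epsilon> \<omega> - ?C \<omega>)\<^sup>2 \<partial>M) = (\<integral>\<omega>. 4 * (Creg \<epsilon> \<omega> - Y \<omega>)\<^sup>2 \<partial>M)"
    proof (rule integral_cong_AE)
      show "AE \<omega> in M. (2 * Creg \<epsilon> \<omega> - ?C \<omega>)\<^sup>2 = 4 * (Creg \<epsilon> \<omega> - Y \<omega>)\<^sup>2"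
        using ae
      proof eventually_elim
        case (elim \<omega>)
        show ?case unfolding elim[symmetric] by (simp add: power2_eq_square algebra_simps)
      qed
    qed measurable
    then show ?thesis by simp
  qed
  then have "((\<lambda>\<epsilon>. \<integral>\<omega>. (2 * Creg \<epsilon> \<omega> - ?C \<omega>)\<^sup>2 \<partial>M) \<longlongrightarrow> 0) (at_right 0)"
    using tendsto_mult[OF tendsto_const[of 4] Y(3)] by simp
  ultimately show ?thesis
    unfolding L2_tendsto_def truncated_integral_eq skorohod_integrable_def using cs sC by blast
qed

end

theorem theorem4p2:
  fixes M :: "'a measure" and B :: "real \<Rightarrow> 'a \<Rightarrow> real"
    and e :: "real \<Rightarrow> 'h::{real_inner,banach,second_countable_topology}"
    and W :: "'h \<Rightarrow> 'a \<Rightarrow> real"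
    and H T t a :: real
  assumes "1/2 < H" and "H < 1"
    and "0 < T"
    and "fractional_brownian_motion M H T B"
    and "fbm_hilbert_space H T e"
    and "wiener_map M T B e W"
    and "t \<in> {0..T}"
  shows "skorohod_integrable M H T B e W (\<lambda>s \<omega>. ln \<bar>B s \<omega> - a\<bar>) t \<and>
    L2_tendsto M
      (\<lambda>\<epsilon> \<omega>. LINT s:{0..t}|lborel.
         indicator {x. \<bar>x - a\<bar> \<ge> \<epsilon>} (B s \<omega>) * (2 * H * s powr (2*H - 1) / (B s \<omega> - a)))
      (C_process M H T B e W t a) (at_right 0)"
proof -
  interpret fbm_level M B e W H T a t
    using assms by (intro fbm_level.intro fbm_setting.intro fbm_level_axioms.intro)
  show ?thesis by (rule truncated_integral_tendsto)
qed

end
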